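(* Let $m\in\mathbb{N}$ and let $(\tau_1,\tau_2,\ldots,\tau_{2m})\in\mathbb{R}^{2m-1}\times(0,+\infty)$ be any fixed vector. For $2m+2\le p\le 4m+2$ set $$\tilde\tau_p=\sum_{k=p-2m-1}^{2m+1}(k-1)(p-k-1)\,\tau_{k-1}\tau_{p-k-1}.$$ Then there exist solutions $b_1(s),\ldots,b_{2m+1}(s)$, pole-free for real values of $s$, of the system of $2m+1$ ordinary differential equations indexed by $p=2m+2,2m+3,\ldots,4m+2$, $$\sum_{k=p-2m-1}^{2m+1}\Big(b_{p-k}b_k''-\tfrac12 b_k'b_{p-k}'-2(2b_1+s)b_{p-k}b_k-2b_{p-k}b_{k+1}\Big)+2\tilde\tau_p=0,$$ where $b_k=0$ for $k>2m+1$. Moreover, for these solutions, as $s\to+\infty$, $$b_1(s)=-\frac{\tau_1}{2s^{3/2}}+O(s^{-5/2}).$$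
   Context: Here $'=\frac{d}{ds}$. In the definition of $\tilde\tau_p$, terms with $k-1=0$ or $p-k-1=0$ are zero (the symbol $\tau_0$ only appears multiplied by $0$). The displayed system is called the coupled Painlevé XXXIV system; for $m=0$ it reduces to the Painlevé XXXIV equation. *)

theory Defs
  imports "HOL-Complex_Analysis.Complex_Analysis" "HOL-Library.Landau_Symbols"
begin

text \<open>
  A solution that is real on the real axis and pole-free there is represented by its
  restriction to the real axis: the function extends holomorphically to an open
  neighbourhood of every real point. The set \<open>\<real>\<close> below is the real axis in the complex plane.
\<close>

definition pole_free_on_reals :: "(real \<Rightarrow> real) \<Rightarrow> bool" where
  "pole_free_on_reals f \<longleftrightarrow>
     (\<exists>F :: complex \<Rightarrow> complex. F analytic_on \<real> \<and> (\<forall>s :: real. F (of_real s) = of_real (f s)))"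

text \<open>
  For \<open>2 * m + 2 \<le> p \<le> 4 * m + 2\<close> every \<open>k\<close> in the range of summation satisfies
  \<open>1 \<le> k\<close> and \<open>k + 1 \<le> p\<close>, so no subtraction of natural numbers truncates.
  The value \<open>\<tau> 0\<close> occurs only with the factor \<open>0\<close>.
\<close>

definition tau_tilde :: "nat \<Rightarrow> (nat \<Rightarrow> real) \<Rightarrow> nat \<Rightarrow> real" where
  "tau_tilde m \<tau> p =
     (\<Sum>k = p - 2 * m - 1..2 * m + 1.
        real (k - 1) * real (p - k - 1) * \<tau> (k - 1) * \<tau> (p - k - 1))"

text \<open>
  The unknowns are \<open>b 1, \<dots>, b (2 * m + 1)\<close>; \<open>b 0\<close> never occurs in the system.
\<close>

definition coupled_PXXXIV ::
    "nat \<Rightarrow> (nat \<Rightarrow> real) \<Rightarrow> (nat \<Rightarrow> real \<Rightarrow> real) \<Rightarrow> bool" where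
  "coupled_PXXXIV m \<tau> b \<longleftrightarrow>
     (\<forall>k > 2 * m + 1. \<forall>s. b k s = 0) \<and>
     (\<forall>p \<in> {2 * m + 2..4 * m + 2}. \<forall>s.
        (\<Sum>k = p - 2 * m - 1..2 * m + 1.
            b (p - k) s * deriv (deriv (b k)) s
            - 1 / 2 * deriv (b k) s * deriv (b (p - k)) s
            - 2 * (2 * b 1 s + s) * b (p - k) s * b k s
            - 2 * b (p - k) s * b (k + 1) s)
        + 2 * tau_tilde m \<tau> p = 0)"

end

theory Submission
 imports Defs "HOL-Probability.Probability"
begin

text \<open>
  The weight \<open>h(x) = exp (- 2 \<Sum>\<^sub>j \<tau>\<^sub>j x\<^sup>-\<^sup>j)\<close> vanishes to infinite order at \<open>0\<close> because \<open>\<tau>\<^sub>2\<^sub>m > 0\<close>.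
  Let \<open>K\<close> be the Airy kernel shifted by \<open>s\<close>, let \<open>\<sigma>\<close> be a cut-off of \<open>h - 1\<close>, and put
  \<open>Q = (1 + K \<sigma>)\<^sup>-\<^sup>1 Ai(s + \<cdot>)\<close>. Then \<open>\<partial>\<^sub>s\<^sup>2 Q = (u + x) Q\<close> with \<open>u = s - 2 \<integral> \<sigma>' Q\<^sup>2\<close>, so the moments
  \<open>g\<^sub>i = - 2 \<integral> Q\<^sup>2 h x\<^sup>-\<^sup>1\<^sup>-\<^sup>i\<close> satisfy \<open>g\<^sub>i''' = 4 u g\<^sub>i' + 2 u' g\<^sub>i + 4 g\<^sub>i\<^sub>-\<^sub>1'\<close>, where \<open>g\<^sub>-\<^sub>1\<close> is
  asymptotically constant by completeness of the Airy functions. As \<open>h' / h = 2 \<Sum>\<^sub>j j \<tau>\<^sub>j x\<^sup>-\<^sup>1\<^sup>-\<^sup>j\<close>, the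
  trace formula for \<open>u\<close> becomes \<open>u = s + 2 \<Sum>\<^sub>j j \<tau>\<^sub>j g\<^sub>j\<close> when the cut-off is removed. This limit
  needs bounds on the \<open>g\<^sub>i\<close> only, which follow from coercivity of \<open>1 + K \<sigma>\<close> and from Laplace
  transforms of \<open>Ai\<^sup>2\<close>; the derivatives are controlled by interpolation. The first integrals of the
  limit system, the coefficients of \<open>2 g g'' - g'\<^sup>2 - 4 (u + \<lambda>) g\<^sup>2\<close> for \<open>g = \<Sum>\<^sub>i g\<^sub>i \<lambda>\<^sup>i\<close>, are read off at
  \<open>s = \<infinity>\<close> from the asymptotics of the \<open>g\<^sub>i\<close>, and multiplication of \<open>g\<close> by a polynomial in \<open>\<lambda>\<close> turns
  them into the coupled system. Finally, the \<open>g\<^sub>i\<close> and their derivatives, together with \<open>s\<close> and \<open>1\<close>,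
  solve a quadratic system of differential equations, which makes every \<open>g\<^sub>i\<close> real analytic.
\<close>

text \<open>Formally, \<open>\<Sum>\<^sub>i g\<^sub>i \<lambda>\<^sup>i\<close> expands
  \<open>- 2 \<integral> Q\<^sup>2 h / (x - \<lambda>)\<close>, a diagonal Green function of
  \<open>\<psi>'' = (u + \<lambda>) \<psi>\<close>. The third-order equation is the one satisfied by
  products of two solutions; its first integral is minus the square of their Wronskian and takes the
  value -4 here. The flatness of h at 0 makes the moments finite, but it also destroys every
  pointwise lower bound on 1 + \<sigma>; the inverse has to be bounded through
  \<open>K\<^sup>2 \<le> K\<close> and the smoothing effect of K. Airy functions are not square
  integrable, so the moment of index -1 diverges. Only its derivative enters the equation for index
  0. Hence it suffices that this moment, regularised by exp (t x), is close to a large constant that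
  does not depend on s. The uniform estimates concern values and not derivatives. The limit is
  therefore taken in a first-order system for \<open>g\<^sub>i\<close>, its derivative and a
  remainder \<open>R\<^sub>i\<close> with \<open>R\<^sub>i' = 2 u g\<^sub>i'\<close>, in which the
  derivative of u does not occur.\<close>

lemmas HK_add = Henstock_Kurzweil_Integration.integral_add
lemmas HK_diff = Henstock_Kurzweil_Integration.integral_diff
lemmas HK_cong = Henstock_Kurzweil_Integration.integral_cong
lemmas HK_nonneg = Henstock_Kurzweil_Integration.integral_nonneg
lemmas Bochner_bound = Bochner_Integration.integrable_bound
lemmas Bochner_cong = Bochner_Integration.integral_cong
lemmas Bochner_add = Bochner_Integration.integrable_add
lemmas Bochner_diff = Bochner_Integration.integrable_diff
lemmas Bochner_nonneg = Bochner_Integration.integral_nonneg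
lemmas LINT_def = set_lebesgue_integral_def

section \<open>Differentiation under the integral sign\<close>

text \<open>The mean value theorem bounds all difference quotients by \<open>B\<close>, so dominated
  convergence applies along every sequence tending to \<open>y0\<close>. Measurability of
  \<open>f' y0\<close> comes out as that of a pointwise limit.\<close>

lemma has_real_derivative_lborel_integral:
 fixes f f' :: "real => real => real"
 assumes der: "\<And>y x. y \<in> {a<..<b} ==> DERIV (%y. f y x) y :> f' y x"
  and int: "\<And>y. y \<in> {a<..<b} ==> integrable lborel (f y)"
  and bd: "\<And>y x. y \<in> {a<..<b} ==> abs (f' y x) <= B x"
  and B: "integrable lborel B" and y0: "y0 \<in> {a<..<b}"
 shows "integrable lborel (f' y0)"
  and "DERIV (%y. (LINT x|lborel. f y x)) y0 :> (LINT x|lborel. f' y0 x)"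
proof -
 have key: "integrable lborel (f' y0) \<and>
   (%i. ((LINT x|lborel. f (S i) x) - (LINT x|lborel. f y0 x))/(S i - y0)) \<longlonglongrightarrow> (LINT x|lborel. f' y0 x)"
  if S: "\<And>i. S i \<in> {a<..<b} - {y0}" "S \<longlonglongrightarrow> y0" for S :: "nat => real"
 proof -
  define q where "q = (%i x. (f (S i) x - f y0 x)/(S i - y0))"
  have lim: "(%i. q i x) \<longlonglongrightarrow> f' y0 x" for x
  proof -
   have "((%y. (f y x - f y0 x)/(y - y0)) \<longlongrightarrow> f' y0 x) (at y0)"
    using der[OF y0, of x] by (simp add: has_field_derivative_iff)
   thus ?thesis
    using S unfolding q_def tendsto_at_iff_sequentially o_def by auto
  qed
  have qi: "integrable lborel (q i)" for i
   unfolding q_def using S(1)[of i] y0 by (intro integrable_divide Bochner_diff int) auto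
  have qb: "abs (q i x) <= B x" for i x
  proof -
   have "\<exists>z\<in>{a<..<b}. q i x = f' z x"
   proof (cases "S i < y0")
    case True
    hence "\<exists>z>S i. z < y0 \<and> f y0 x - f (S i) x = (y0 - S i)*f' z x"
     using S(1)[of i] y0 by (intro MVT2[where f="%y. f y x" and f'="%z. f' z x"]) (auto intro!: der)
    then obtain z where z: "z > S i" "z < y0" "f y0 x - f (S i) x = (y0 - S i)*f' z x" by blast
    hence "q i x = f' z x" unfolding q_def using True by (simp add: divide_simps algebra_simps)
    thus ?thesis using z S(1)[of i] y0 by auto
   next
    case False
    hence "S i > y0" using S(1)[of i] by auto
    hence "\<exists>z>y0. z < S i \<and> f (S i) x - f y0 x = (S i - y0)*f' z x"
     using S(1)[of i] y0 by (intro MVT2[where f="%y. f y x" and f'="%z. f' z x"]) (auto intro!: der)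
    then obtain z where z: "z > y0" "z < S i" "f (S i) x - f y0 x = (S i - y0)*f' z x" by blast
    hence "q i x = f' z x" unfolding q_def using \<open>S i > y0\<close> by (simp add: divide_simps algebra_simps)
    thus ?thesis using z S(1)[of i] y0 by auto
   qed
   thus ?thesis using bd by auto
  qed
  have meas: "f' y0 \<in> borel_measurable lborel"
   by (rule borel_measurable_LIMSEQ_real[OF lim]) (use qi in auto)
  have I: "integrable lborel (f' y0)" 
   by (rule Bochner_bound[OF B meas]) (use bd[OF y0] in \<open>auto intro!: AE_I2 intro: order_trans[OF _ abs_ge_self]\<close>)
  have "(%i. (LINT x|lborel. q i x)) \<longlonglongrightarrow> (LINT x|lborel. f' y0 x)"
   by (rule integral_dominated_convergence[where w=B]) (use meas qi B lim qb in auto)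
  moreover have "(LINT x|lborel. q i x) = ((LINT x|lborel. f (S i) x) - (LINT x|lborel. f y0 x))/(S i - y0)" for i
   unfolding q_def using S(1)[of i] y0 int by (simp add: Bochner_Integration.integral_diff)
  ultimately show ?thesis using I by simp
 qed
 \<comment> \<open>One concrete sequence inside the interval is enough to extract the integrability
   of \<open>f' y0\<close> from \<open>key\<close>.\<close>
 define S0 where "S0 = (%i::nat. y0 + (b - y0)/(real i + 2))"
 have "S0 \<longlonglongrightarrow> y0 + 0" unfolding S0_def
  by (intro tendsto_add tendsto_const) real_asymp
 moreover have "S0 i \<in> {a<..<b} - {y0}" for i
 proof -
  have "0 < (b - y0)/(real i + 2)" using y0 by auto
  moreover have "(b - y0)/(real i + 2) <= (b - y0)/2" using y0 by (intro divide_left_mono) auto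
  moreover have "(b - y0)/2 < b - y0" using y0 by simp
  moreover have "a < y0" using y0 by simp
  ultimately have "a < S0 i" "S0 i < b" "S0 i ~= y0" unfolding S0_def by linarith+
  thus ?thesis by simp
 qed
 ultimately show "integrable lborel (f' y0)" using key[of S0] by auto
 show "DERIV (%y. (LINT x|lborel. f y x)) y0 :> (LINT x|lborel. f' y0 x)"
  unfolding has_field_derivative_iff
 proof (subst tendsto_at_iff_sequentially, intro allI impI, unfold o_def)
  fix T :: "nat => real" assume T: "\<forall>i. T i \<in> UNIV - {y0}" "T \<longlonglongrightarrow> y0"
  have "eventually (%i. T i \<in> {a<..<b}) sequentially"
   using topological_tendstoD[OF T(2) open_greaterThanLessThan y0] .
  then obtain N where N: "\<And>i. i >= N ==> T i \<in> {a<..<b}" by (auto simp: eventually_sequentially)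
  have "(%i. ((LINT x|lborel. f (T (i + N)) x) - (LINT x|lborel. f y0 x))/(T (i + N) - y0)) \<longlonglongrightarrow> (LINT x|lborel. f' y0 x)"
   using key[of "%i. T (i + N)"] N T LIMSEQ_ignore_initial_segment[OF T(2), of N] by auto
  thus "(%i. ((LINT x|lborel. f (T i) x) - (LINT x|lborel. f y0 x))/(T i - y0)) \<longlonglongrightarrow> (LINT x|lborel. f' y0 x)"
   by (rule LIMSEQ_offset)
 qed
qed

lemma lborel_integral_derivative:
 fixes F f :: "real => real"
 assumes "\<And>x. DERIV F x :> f x" "continuous_on UNIV f" "integrable lborel f"
  "(F \<longlongrightarrow> A) at_bot" "(F \<longlongrightarrow> B) at_top"
 shows "(LINT x|lborel. f x) = B - A"
proof -
 have "(LBINT x=-\<infinity>..\<infinity>. f x) = B - A"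
 proof (rule interval_integral_FTC_integrable[where F=F])
  show "(F has_vector_derivative f x) (at x)" for x
   using assms(1) by (simp add: has_real_derivative_iff_has_vector_derivative)
  show "set_integrable lborel (einterval (- \<infinity>) \<infinity>) f"
   using assms(3) by (simp add: set_integrable_def einterval_eq)
  show "isCont f x" for x using assms(2) continuous_on_eq_continuous_at by blast
 qed (use assms(4,5) in \<open>auto simp: ereal_tendsto_simps\<close>)
 thus ?thesis by (simp add: interval_lebesgue_integral_def einterval_eq LINT_def)
qed

lemma lborel_integral_derivative_atLeast:
 fixes F f :: "real => real"
 assumes "\<And>x. DERIV F x :> f x" "continuous_on UNIV f" "set_integrable lborel {a..} f"
  "(F \<longlongrightarrow> B) at_top"
 shows "(LINT x:{a..}|lborel. f x) = B - F a"
proof -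
 have si: "set_integrable lborel {a<..} f"
  by (rule set_integrable_subset[OF assms(3)]) auto
 have "(LBINT x=a..\<infinity>. f x) = B - F a"
 proof (rule interval_integral_FTC_integrable[where F=F])
  show "(F has_vector_derivative f x) (at x)" for x
   using assms(1) by (simp add: has_real_derivative_iff_has_vector_derivative)
  show "set_integrable lborel (einterval a \<infinity>) f"
   using si by (simp add: einterval_eq)
  show "isCont f x" for x using assms(2) continuous_on_eq_continuous_at by blast
  have "isCont F a" using assms(1) DERIV_isCont by blast
  thus "((F \<circ> real_of_ereal) \<longlongrightarrow> F a) (at_right (ereal a))"
   by (auto simp: ereal_tendsto_simps isCont_def intro: filterlim_mono at_le)
 qed (use assms(4) in \<open>auto simp: ereal_tendsto_simps\<close>)
 hence "(LINT x:{a<..}|lborel. f x) = B - F a" by (simp add: interval_lebesgue_integral_def einterval_eq)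
 moreover have "(LINT x:{a<..}|lborel. f x) = (LINT x:{a..}|lborel. f x)"
  unfolding LINT_def
  by (rule integral_cong_AE) (use si assms(3) in \<open>auto simp: set_integrable_def indicator_def intro!: eventually_mono[OF AE_lborel_singleton[of a]]\<close>)
 ultimately show ?thesis by simp
qed


section \<open>Gaussian moments\<close>

lemma integrable_gaussian_moment:
 "integrable lborel (%t::real. abs t^k*exp (- t\<^sup>2))"
proof (cases "even k")
 case True
 then obtain j where j: "k = 2*j" by (rule evenE)
 have "has_bochner_integral lborel (%x. exp (-x\<^sup>2)*x^(2*j)) (2*((sqrt pi/2)*(fact (2*j)/(2^(2*j)*fact j)))::real)"
  using has_bochner_integral_even_function[OF gaussian_moment_even_pos[where k=j]] by simp
 thus ?thesis using j by (auto simp: has_bochner_integral_iff power_even_abs mult.commute)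
next
 case False
 then obtain j where j: "k = 2*j + 1" by (rule oddE)
 have "has_bochner_integral lborel (%x::real. indicator {0..} x *\<^sub>R (exp (-x\<^sup>2)*abs x^(2*j + 1))) (fact j/2)"
  by (rule has_bochner_integral_cong[THEN iffD1, OF _ _ _ gaussian_moment_odd_pos[of j]]) auto
 from has_bochner_integral_even_function[OF this]
 show ?thesis using j by (auto simp: has_bochner_integral_iff mult.commute)
qed

text \<open>The ratio of the two moments is 15/8. The factor 18 is what
  \<open>cos y \<ge> 1 - y^2/2\<close> produces at \<open>y = t^3/3\<close> in
  \<open>airy0_pos\<close>.\<close>

lemma gaussian_moment_6_less:
 "(LINT t|lborel. t^6*exp (- (t::real)\<^sup>2)) < 18*(LINT t|lborel. exp (- (t::real)\<^sup>2))"
proof -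
 have "has_bochner_integral lborel (%x. exp (-x\<^sup>2)*x^(2*j)) (2*((sqrt pi/2)*(fact (2*j)/(2^(2*j)*fact j)))::real)" for j
  using has_bochner_integral_even_function[OF gaussian_moment_even_pos[where k=j]] by simp
 from this[of 3] this[of 0] have "8*(LINT t|lborel. t^6*exp (- (t::real)\<^sup>2)) = sqrt pi*15"
  "(LINT t|lborel. exp (- (t::real)\<^sup>2)) = sqrt pi"
  by (simp_all add: has_bochner_integral_iff mult.commute fact_numeral)
 moreover have "sqrt pi > 0" by simp
 ultimately show ?thesis by linarith
qed

section \<open>The Airy function\<close>

text \<open>The real part of \<open>z^3/3 + x*z\<close> at \<open>z = t + \<i>\<close>. The
  imaginary part is \<open>t^2 + x - 1/3\<close>, whence the factors \<open>exp (- x)\<close> and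
  \<open>exp (- t^2)\<close> below; the constant \<open>exp (1/3)\<close> is dropped.\<close>

definition airy_phase :: "real => real => real" where
 "airy_phase x t = t^3/3 + (x - 1)*t"

text \<open>Up to a constant factor this is \<open>\<integral> exp (\<i> (z\<^sup>3 / 3 + x z)) dz\<close> along the line \<open>Im z = 1\<close>,
 on which the integral converges absolutely.\<close>

definition airy0 :: "real => real" where
 "airy0 x = exp (- x)*(LINT t|lborel. exp (- t\<^sup>2)*cos (airy_phase x t))"

definition airy0' :: "real => real" where
 "airy0' x = - exp (- x)*(LINT t|lborel. exp (- t\<^sup>2)*cos (airy_phase x t))
  - exp (- x)*(LINT t|lborel. exp (- t\<^sup>2)*t * sin (airy_phase x t))"

lemma gaussian_bound_integrable:
 fixes f :: "real => real"
 assumes "f \<in> borel_measurable borel" "\<And>t. abs (f t) <= 1"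
 shows "integrable lborel (%t. exp (- t\<^sup>2)*t^k*f t)"
 by (rule Bochner_bound[OF integrable_gaussian_moment[of k]])
  (use assms in \<open>auto simp: abs_mult power_abs intro!: AE_I2 mult_left_le\<close>)

lemma airy_phase_measurable [measurable]: "airy_phase x \<in> borel_measurable borel"
 unfolding airy_phase_def by measurable

lemma airy0_derivs:
 "DERIV airy0 x :> airy0' x"
 "DERIV airy0' x :> x*airy0 x"
proof -
 let ?e = "%t::real. exp (- t\<^sup>2)"
 have I: "integrable lborel (%t. ?e t*t^k*cos (airy_phase y t))"
     "integrable lborel (%t. ?e t*t^k * sin (airy_phase y t))" for k y
  by (rule gaussian_bound_integrable; simp)+
 have G: "integrable lborel (%t. abs t^k*?e t)" for k by (rule integrable_gaussian_moment)
 have d0: "((%x. (LINT t|lborel. ?e t*cos (airy_phase x t))) has_real_derivative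
   (LINT t|lborel. - (?e t*t * sin (airy_phase x t)))) (at x)" for x
  by (rule has_real_derivative_lborel_integral(2)[where a="x-1" and b="x+1" and B="%t. abs t^1*?e t" and f'="%x t. - (?e t*t * sin (airy_phase x t))"])
   (use I(1)[of 0] G[of 1] in \<open>auto simp: airy_phase_def abs_mult algebra_simps abs_sin_le_one intro!: derivative_eq_intros mult_left_mono mult_left_le\<close>)
 have aux: "abs t*(abs t*c) <= t*t" if "c <= 1" for t c :: real
  using mult_left_mono[OF that, of "t*t"] by (simp add: mult.assoc[symmetric])
 have d1: "((%x. (LINT t|lborel. ?e t*t * sin (airy_phase x t))) has_real_derivative
   (LINT t|lborel. ?e t*t^2*cos (airy_phase x t))) (at x)" for x
  by (rule has_real_derivative_lborel_integral(2)[where a="x-1" and b="x+1" and B="%t. abs t^2*?e t"])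
   (use I(2)[of 1] G[of 2] in \<open>auto simp: airy_phase_def abs_mult algebra_simps power2_eq_square abs_cos_le_one intro!: derivative_eq_intros aux\<close>)
 show "DERIV airy0 x :> airy0' x"
  unfolding airy0_def[abs_def] airy0'_def
  by (rule derivative_eq_intros d0 refl)+ (use I(2)[of 1 x] in \<open>simp add: algebra_simps\<close>)
 \<comment> \<open>Airy's equation is an integration by parts in \<open>t\<close>: this integrand is
   the derivative of \<open>- (exp (- t^2) * sin (airy_phase x t))\<close>, which vanishes at both
   ends.\<close>
 have z: "(LINT t|lborel. (1 - x - t^2)*?e t*cos (airy_phase x t) + 2*t*?e t * sin (airy_phase x t)) = 0 - 0"
 proof (rule lborel_integral_derivative)
  show "((%t. - (?e t * sin (airy_phase x t))) has_real_derivative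
   ((1 - x - t^2)*?e t*cos (airy_phase x t) + 2*t*?e t * sin (airy_phase x t))) (at t)" for t
   unfolding airy_phase_def
   by (auto intro!: derivative_eq_intros simp: algebra_simps power2_eq_square)
  show "continuous_on UNIV (%t. (1 - x - t^2)*?e t*cos (airy_phase x t) + 2*t*?e t * sin (airy_phase x t))"
   unfolding airy_phase_def by (intro continuous_intros) auto
  have "integrable lborel (%t. (1-x)*(?e t*t^0*cos (airy_phase x t)) - ?e t*t^2*cos (airy_phase x t) 
    + 2*(?e t*t^1 * sin (airy_phase x t)))"
   by (intro Bochner_add Bochner_diff integrable_mult_right I)
  thus "integrable lborel (%t. (1 - x - t^2)*?e t*cos (airy_phase x t) + 2*t*?e t * sin (airy_phase x t))"
   by (rule Bochner_Integration.integrable_cong[THEN iffD1, rotated 2]) (simp_all add: algebra_simps)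
  have "((%t::real. - (?e t * sin (airy_phase x t))) \<longlongrightarrow> 0) F" if "(?e \<longlongrightarrow> 0) F" for F
   by (rule Lim_null_comparison[OF _ that]) (auto simp: abs_mult intro!: eventuallyI mult_left_le abs_sin_le_one)
  moreover have "(?e \<longlongrightarrow> 0) at_bot" "(?e \<longlongrightarrow> 0) at_top" by real_asymp+
  ultimately show "((%t. - (?e t * sin (airy_phase x t))) \<longlongrightarrow> 0) at_bot"
   "((%t. - (?e t * sin (airy_phase x t))) \<longlongrightarrow> 0) at_top" by blast+
 qed
 have "(LINT t|lborel. (1 - x - t^2)*?e t*cos (airy_phase x t) + 2*t*?e t * sin (airy_phase x t))
  = (LINT t|lborel. (1-x)*(?e t*t^0*cos (airy_phase x t)) - ?e t*t^2*cos (airy_phase x t) 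
    + 2*(?e t*t^1 * sin (airy_phase x t)))"
  by (rule Bochner_cong) (simp_all add: algebra_simps)
 also have "... = (1-x)*(LINT t|lborel. ?e t*t^0*cos (airy_phase x t)) - (LINT t|lborel. ?e t*t^2*cos (airy_phase x t)) 
    + 2*(LINT t|lborel. ?e t*t^1 * sin (airy_phase x t))"
  by (simp only: Bochner_Integration.integral_add Bochner_Integration.integral_diff integral_mult_right_zero
   Bochner_add Bochner_diff integrable_mult_right I)
 finally have z': "(1-x)*(LINT t|lborel. ?e t*cos (airy_phase x t)) - (LINT t|lborel. ?e t*t^2*cos (airy_phase x t)) 
    + 2*(LINT t|lborel. ?e t*t * sin (airy_phase x t)) = 0" using z by simp
 show "DERIV airy0' x :> x*airy0 x"
  unfolding airy0_def airy0'_def[abs_def]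
  apply (rule derivative_eq_intros d0 d1 refl)+
  using arg_cong[OF z', of "%u. exp (-x)*u"] by (simp add: algebra_simps)
qed

text \<open>The rate 1 is the height of the line of integration. It is weaker than the true decay on
  the right, and it is why Laplace variables are confined to \<open>0 < t < 2\<close> below.\<close>

lemma airy0_bound: "\<exists>C. \<forall>x. abs (airy0 x) <= C*exp (- x) \<and> abs (airy0' x) <= C*exp (- x)"
proof -
 let ?e = "%t::real. exp (- t\<^sup>2)"
 have I: "integrable lborel (%t. ?e t*t^k*cos (airy_phase y t))"
     "integrable lborel (%t. ?e t*t^k * sin (airy_phase y t))" for k y
  by (rule gaussian_bound_integrable; simp)+
 have b0: "abs (LINT t|lborel. ?e t*cos (airy_phase x t)) <= (LINT t|lborel. ?e t)" for x
  by (rule integral_abs_bound_integral) (use I(1)[of 0 x] integrable_gaussian_moment[of 0] in \<open>auto simp: abs_mult abs_cos_le_one\<close>)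
 have b1: "abs (LINT t|lborel. ?e t*t * sin (airy_phase x t)) <= (LINT t|lborel. abs t*?e t)" for x
  by (rule integral_abs_bound_integral) (use I(2)[of 1 x] integrable_gaussian_moment[of 1] in \<open>auto simp: abs_mult abs_sin_le_one intro!: mult_left_le\<close>)
 define C where "C = (LINT t|lborel. ?e t) + (LINT t|lborel. abs t*?e t)"
 have p: "0 <= (LINT t|lborel. abs t*?e t)" by simp
 have "abs (airy0 x) <= exp (-x)*C" for x
 proof -
  have "abs (LINT t|lborel. ?e t*cos (airy_phase x t)) <= C" using b0[of x] p unfolding C_def by linarith
  thus ?thesis unfolding airy0_def by (simp add: abs_mult)
 qed
 moreover have "abs (airy0' x) <= exp (-x)*C" for x
 proof -
  have "airy0' x = - (exp (-x)*((LINT t|lborel. ?e t*cos (airy_phase x t)) + (LINT t|lborel. ?e t*t * sin (airy_phase x t))))"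
   unfolding airy0'_def by (simp add: algebra_simps)
  moreover have "abs ((LINT t|lborel. ?e t*cos (airy_phase x t)) + (LINT t|lborel. ?e t*t * sin (airy_phase x t))) <= C"
   using b0[of x] b1[of x] unfolding C_def by linarith
  ultimately show ?thesis by (simp add: abs_mult)
 qed
 ultimately show ?thesis by (intro exI[of _ C]) (auto simp: mult.commute)
qed

text \<open>Nontriviality, needed for the normalisation. At \<open>x = 1\<close> the linear term of
  the phase vanishes, and a quadratic lower bound of the cosine decides the sign.\<close>

lemma airy0_pos: "airy0 1 > 0"
proof -
 let ?e = "%t::real. exp (- t\<^sup>2)"
 have c: "1 - y^2/2 <= cos y" for y :: real
  using cos_double_sin[of "y/2"] power_mono[OF abs_sin_x_le_abs_x[of "y/2"], of 2]
  by (simp add: power_divide)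
 have I: "integrable lborel (%t. ?e t*cos (airy_phase 1 t))"
  using gaussian_bound_integrable[of "%t. cos (airy_phase 1 t)" 0] by simp
 have I6: "integrable lborel (%t. t^6*?e t)" and I0: "integrable lborel ?e"
  using integrable_gaussian_moment[of 6] integrable_gaussian_moment[of 0] by (simp_all add: power_even_abs)
 have "0 < (LINT t|lborel. ?e t) - (LINT t|lborel. t^6*?e t)/18"
  using gaussian_moment_6_less by simp
 also have "... = (LINT t|lborel. ?e t - t^6*?e t/18)"
  using I0 I6 by simp
 also have "... <= (LINT t|lborel. ?e t*cos (airy_phase 1 t))"
 proof (rule integral_mono)
  show "?e t - t^6*?e t/18 <= ?e t*cos (airy_phase 1 t)" for t
   using mult_left_mono[OF c[of "t^3/3"], of "?e t"]
   by (simp add: airy_phase_def algebra_simps power_divide power_mult[symmetric])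
 qed (use I I0 I6 in auto)
 finally show ?thesis unfolding airy0_def by simp
qed

section \<open>Exponential majorants for products of Airy functions\<close>

lemma integrable_exp_abs: 
 assumes "p > 0" shows "integrable lborel (%x::real. exp (- p*abs x))"
proof -
 have s: "set_integrable lborel {0<..} (%x. exp (-(x*p)))" using assms by (rule integrable_I0i_exp_mscale)
 hence 1: "integrable lborel (%x. indicator {0<..} x*exp (-(x*p)))" by (simp add: set_integrable_def)
 have 2: "integrable lborel (%x. indicator {0<..} (-x)*exp (-((-x)*p)))"
  using lborel_integrable_real_affine[OF 1, of "-1" 0] by simp
 have "integrable lborel (%x. indicator {0<..} x*exp (-(x*p)) + indicator {0<..} (-x)*exp (-((-x)*p)))"
  by (rule Bochner_add[OF 1 2])
 thus ?thesis
  by (rule integrable_cong_AE_imp)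
   (auto simp: indicator_def mult.commute intro!: eventually_mono[OF AE_lborel_singleton[of 0]])
qed

lemma one_plus_abs_exp_le:
 fixes x :: real assumes "p > 0"
 shows "(1 + abs x)*exp (- p*abs x) <= (1 + 2/p)*exp (- (p/2)*abs x)"
proof -
 have e: "1 + p/2*abs x <= exp (p/2*abs x)" by (rule exp_ge_add_one_self)
 have e1: "1 <= exp (p/2*abs x)" using assms by simp
 have "abs x <= 2/p*exp (p/2*abs x)" using e assms by (simp add: field_simps)
 hence "1 + abs x <= (1 + 2/p)*exp (p/2*abs x)" using e1 by (simp only: distrib_right mult_1)
 hence "(1 + abs x)*exp (- p*abs x) <= (1 + 2/p)*exp (p/2*abs x)*exp (- p*abs x)"
  by (rule mult_right_mono) simp
 also have "... = (1 + 2/p)*exp (- (p/2)*abs x)"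
  by (simp add: mult.assoc exp_add[symmetric] field_simps)
 finally show ?thesis .
qed

lemma integrable_one_plus_abs_exp: 
 assumes "p > 0" shows "integrable lborel (%x::real. (1 + abs x)*exp (- p*abs x))"
  "integrable lborel (%x::real. (1 + abs x)^2*exp (- p*abs x))"
proof -
 have i: "integrable lborel (%x::real. c*exp (- q*abs x))" if "q > 0" for q c
  using integrable_exp_abs[OF that] by simp
 show "integrable lborel (%x::real. (1 + abs x)*exp (- p*abs x))"
  by (rule Bochner_bound[OF i[of "p/2" "1 + 2/p"]])
   (use assms one_plus_abs_exp_le[OF assms] in \<open>auto simp: abs_mult intro!: AE_I2\<close>)
 have "(1 + abs x)^2*exp (- p*abs x) <= (1 + 2/p)*(1 + 4/p)*exp (- (p/4)*abs x)" for x :: real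
 proof -
  have "(1 + abs x)^2*exp (- p*abs x) <= (1 + abs x)*((1 + 2/p)*exp (- (p/2)*abs x))"
   using mult_left_mono[OF one_plus_abs_exp_le[OF assms, of x], of "1 + abs x"] by (simp add: power2_eq_square mult.assoc)
  also have "... = (1 + 2/p)*((1 + abs x)*exp (- (p/2)*abs x))" by (rule mult.left_commute)
  also have "... <= (1 + 2/p)*((1 + 2/(p/2))*exp (- ((p/2)/2)*abs x))"
   using assms by (intro mult_left_mono one_plus_abs_exp_le) auto
  finally show ?thesis by (simp add: mult.assoc)
 qed
 thus "integrable lborel (%x::real. (1 + abs x)^2*exp (- p*abs x))"
  by (intro Bochner_bound[OF i[of "p/4" "(1 + 2/p)*(1 + 4/p)"]])
   (use assms in \<open>auto simp: abs_mult intro!: AE_I2\<close>)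
qed

lemma airy0_isCont: "continuous_on UNIV airy0" "continuous_on UNIV airy0'"
 by (rule continuous_at_imp_continuous_on, rule ballI, rule DERIV_isCont, rule airy0_derivs)+

text \<open>The energy \<open>f\<^sup>2 - f'\<^sup>2 / x\<close> of a solution of \<open>f'' = x f\<close> is nondecreasing for negative \<open>x\<close>.\<close>

lemma airy0_bound_left: "\<exists>C. \<forall>x. abs (airy0 x) <= C \<and> abs (airy0' x) <= C*(1 + abs x)"
proof -
 define E where "E = (%x. (airy0 x)^2 - (airy0' x)^2/x)"
 have E: "E x <= E (-1)" if "x <= -1" for x
 proof (rule DERIV_nonneg_imp_nondecreasing[OF that], intro exI conjI)
  fix z :: real assume z: "x <= z" "z <= -1"
  show "DERIV E z :> (airy0' z)\<^sup>2/z^2" unfolding E_def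
   using z by (auto intro!: derivative_eq_intros airy0_derivs simp: field_simps power2_eq_square)
 qed simp
 obtain C where C: "\<And>x. abs (airy0 x) <= C*exp (- x) \<and> abs (airy0' x) <= C*exp (- x)" using airy0_bound by auto
 have C0: "C >= 0" using C[of 0] by auto
 define M where "M = C*exp 1 + sqrt (E (-1))"
 have E0: "E (-1) >= 0" unfolding E_def by simp
 have r: "abs (airy0 x) <= C*exp 1" "abs (airy0' x) <= C*exp 1" if "x >= -1" for x
  using C[of x] that C0 by (meson exp_le_cancel_iff mult_left_mono order_trans minus_le_iff)+
 have l: "abs (airy0 x) <= sqrt (E (-1))" "abs (airy0' x) <= sqrt (E (-1))*(1 + abs x)" if "x <= -1" for x
 proof -
  have a: "(airy0 x)^2 + (airy0' x)^2/abs x <= E (-1)" using E[OF that] that unfolding E_def by (simp add: field_simps)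
  have "(airy0' x)^2/abs x >= 0" by simp
  with a have "(airy0 x)^2 <= E (-1)" by linarith
  thus "abs (airy0 x) <= sqrt (E (-1))" using real_le_rsqrt by (metis power2_abs)
  have "(airy0' x)^2/abs x <= E (-1)" using a zero_le_power2[of "airy0 x"] by linarith
  hence "(airy0' x)^2 <= E (-1)*abs x" using that by (simp add: field_simps)
  also have "... <= E (-1)*(1 + abs x)^2" using E0 by (intro mult_left_mono) (auto simp: power2_eq_square algebra_simps)
  also have "... = (sqrt (E (-1))*(1 + abs x))^2" using E0 by (simp add: power_mult_distrib)
  finally show "abs (airy0' x) <= sqrt (E (-1))*(1 + abs x)" using E0 by (simp add: abs_le_square_iff[symmetric])
 qed
 have M: "sqrt (E (-1)) <= M" "C*exp 1 <= M" "0 <= M" unfolding M_def using C0 E0 by auto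
 have "abs (airy0 x) <= M \<and> abs (airy0' x) <= M*(1 + abs x)" for x
 proof (cases "x <= -1")
  case True
  have "sqrt (E (-1))*(1 + abs x) <= M*(1 + abs x)" using M by (intro mult_right_mono) auto
  thus ?thesis using l[OF True] M by linarith
 next
  case False
  have "M*1 <= M*(1 + abs x)" using M by (intro mult_left_mono) auto
  thus ?thesis using r[of x] False M by linarith
 qed
 thus ?thesis by blast
qed

lemma airy0_bounds_ex: "\<exists>C>0. \<forall>x. abs (airy0 x) <= C*exp (- x) \<and> abs (airy0' x) <= C*exp (- x) \<and>
 abs (airy0 x) <= C \<and> abs (airy0' x) <= C*(1 + abs x)"
proof -
 obtain C1 where C1: "\<And>x. abs (airy0 x) <= C1*exp (- x) \<and> abs (airy0' x) <= C1*exp (- x)" using airy0_bound by auto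
 obtain C2 where C2: "\<And>x. abs (airy0 x) <= C2 \<and> abs (airy0' x) <= C2*(1 + abs x)" using airy0_bound_left by auto
 define C where "C = abs C1 + abs C2 + 1"
 have "C1*exp (-x) <= C*exp (-x)" "C2*(1 + abs x) <= C*(1 + abs x)" "C2 <= C" for x
  unfolding C_def by (intro mult_right_mono; auto)+ linarith
 hence "abs (airy0 x) <= C*exp (- x) \<and> abs (airy0' x) <= C*exp (- x) \<and> abs (airy0 x) <= C \<and> abs (airy0' x) <= C*(1 + abs x)" for x
  using C1[of x] C2[of x] by (meson order_trans)
 moreover have "C > 0" unfolding C_def by linarith
 ultimately show ?thesis by blast
qed

definition airy_bound :: real where
 "airy_bound = (SOME C. C > 0 \<and> (\<forall>x. abs (airy0 x) <= C*exp (- x) \<and> abs (airy0' x) <= C*exp (- x) \<and>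
 abs (airy0 x) <= C \<and> abs (airy0' x) <= C*(1 + abs x)))"

lemma airy0_bounds:
 "airy_bound > 0" "abs (airy0 x) <= airy_bound*exp (- x)" "abs (airy0' x) <= airy_bound*exp (- x)"
 "abs (airy0 x) <= airy_bound" "abs (airy0' x) <= airy_bound*(1 + abs x)"
proof -
 have "airy_bound > 0 \<and> (\<forall>x. abs (airy0 x) <= airy_bound*exp (- x) \<and> abs (airy0' x) <= airy_bound*exp (- x) \<and>
 abs (airy0 x) <= airy_bound \<and> abs (airy0' x) <= airy_bound*(1 + abs x))"
  unfolding airy_bound_def by (rule someI_ex[OF airy0_bounds_ex[unfolded Bex_def]])
 thus "airy_bound > 0" "abs (airy0 x) <= airy_bound*exp (- x)" "abs (airy0' x) <= airy_bound*exp (- x)"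
 "abs (airy0 x) <= airy_bound" "abs (airy0' x) <= airy_bound*(1 + abs x)" by auto
qed

text \<open>On the right the two factors supply \<open>exp (- 2*x)\<close> against
  \<open>exp (t*x)\<close>; on the left only \<open>exp (t*x)\<close> decays. So \<open>y\<close>
  measures how far \<open>t\<close> stays from 0 and from 2. Each derivative factor costs one power
  of \<open>1 + abs x\<close>.\<close>

lemma airy0_prod_bounds:
 assumes t: "0 < y" "y <= t" "t <= 2 - y" and ab: "abs a <= R" "abs b <= R"
 shows "abs (airy0 (x + a)*airy0 (x + b)*exp (t*x)) <= airy_bound^2*exp (2*R)*exp (- y*abs x)"
  "abs (airy0' (x + a)*airy0 (x + b)*exp (t*x)) <= airy_bound^2*exp (2*R)*(1 + R)*((1 + abs x)*exp (- y*abs x))"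
  "abs (airy0' (x + a)*airy0' (x + b)*exp (t*x)) <= airy_bound^2*exp (2*R)*(1 + R)^2*((1 + abs x)^2*exp (- y*abs x))"
proof -
 let ?M = "airy_bound" let ?e = "if x >= 0 then exp (R - x) else exp R"
 note b = airy0_bounds
 have R: "R >= 0" using ab by linarith
 have M: "?M > 0" by (rule b)
 have k0: "abs (airy0 (x + c)) <= ?M*?e" and k1: "abs (airy0' (x + c)) <= ?M*?e*((1 + R)*(1 + abs x))" if c: "abs c <= R" for c
 proof -
  have e: "?M*exp (- (x + c)) <= ?M*exp (R - x)" using c M by (intro mult_left_mono) auto
  have o: "?M*1 <= ?M*exp R" using M R by (intro mult_left_mono) auto
  show "abs (airy0 (x + c)) <= ?M*?e" using b(2)[of "x+c"] b(4)[of "x+c"] e o by auto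
  have p: "1 <= (1 + R)*(1 + abs x)" "1 + abs (x + c) <= (1 + R)*(1 + abs x)"
  proof -
   have e: "(1 + R)*(1 + abs x) = 1 + abs x + R + R*abs x" by (simp add: algebra_simps)
   have "R*abs x >= 0" using R by simp
   with c R show "1 <= (1 + R)*(1 + abs x)" "1 + abs (x + c) <= (1 + R)*(1 + abs x)" unfolding e by linarith+
  qed
  show "abs (airy0' (x + c)) <= ?M*?e*((1 + R)*(1 + abs x))"
  proof (cases "x >= 0")
   case True
   have "?M*exp (R - x)*1 <= ?M*exp (R - x)*((1 + R)*(1 + abs x))"
    using p M by (intro mult_left_mono) auto
   thus ?thesis using b(3)[of "x+c"] e True by auto
  next
   case False
   have "?M*(1 + abs (x + c)) <= (?M*exp R)*((1 + R)*(1 + abs x))"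
    using p M R by (intro mult_mono) auto
   thus ?thesis using b(5)[of "x+c"] False by auto
  qed
 qed
 have ee: "?e*?e*exp (t*x) <= exp (2*R)*exp (- y*abs x)"
 proof (cases "x >= 0")
  case True
  have "t*x <= (2 - y)*x" using t True by (intro mult_right_mono) auto
  thus ?thesis using True by (simp add: exp_add[symmetric] algebra_simps)
 next
  case False
  have "t*x <= y*x" using t False by (intro mult_right_mono_neg) auto
  thus ?thesis using False by (simp add: exp_add[symmetric] algebra_simps)
 qed
 have e0: "?e >= 0" by simp
 have gen: "abs (u * v * exp (t*x)) <= ?M^2*exp (2*R)*(w*z*exp (- y*abs x))"
  if "abs u <= ?M*?e*w" "abs v <= ?M*?e*z" "w >= 0" "z >= 0" for u v w z
 proof -
  have "abs (u * v * exp (t*x)) <= (?M*?e*w)*(?M*?e*z)*exp (t*x)"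
   unfolding abs_mult using that e0 M by (intro mult_mono mult_nonneg_nonneg) auto
  also have "... = ?M^2*(w*z)*(?e*?e*exp (t*x))" by (simp add: power2_eq_square algebra_simps)
  also have "... <= ?M^2*(w*z)*(exp (2*R)*exp (- y*abs x))" using ee that by (intro mult_left_mono) auto
  finally show ?thesis by (simp add: algebra_simps)
 qed
 have q: "0 <= (1 + R)*(1 + abs x)" using R by simp
 show "abs (airy0 (x + a)*airy0 (x + b)*exp (t*x)) <= airy_bound^2*exp (2*R)*exp (- y*abs x)"
  using gen[of "airy0 (x + a)" 1 "airy0 (x + b)" 1] k0[OF ab(1)] k0[OF ab(2)] by simp
 show "abs (airy0' (x + a)*airy0 (x + b)*exp (t*x)) <= airy_bound^2*exp (2*R)*(1 + R)*((1 + abs x)*exp (- y*abs x))"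
  using gen[OF k1[OF ab(1)], of "airy0 (x + b)" 1] k0[OF ab(2)] q by (simp add: mult.assoc)
 show "abs (airy0' (x + a)*airy0' (x + b)*exp (t*x)) <= airy_bound^2*exp (2*R)*(1 + R)^2*((1 + abs x)^2*exp (- y*abs x))"
  using gen[OF k1[OF ab(1)] k1[OF ab(2)]] q by (simp add: mult_ac power2_eq_square)
qed

lemma tendsto_exp_abs:
 assumes "p > 0"
 shows "((%x::real. c*exp (- p*abs x)) \<longlongrightarrow> 0) at_top" "((%x::real. c*exp (- p*abs x)) \<longlongrightarrow> 0) at_bot"
  "((%x::real. c*((1 + abs x)*exp (- p*abs x))) \<longlongrightarrow> 0) at_top" "((%x::real. c*((1 + abs x)*exp (- p*abs x))) \<longlongrightarrow> 0) at_bot"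
  "((%x::real. c*((1 + abs x)^2*exp (- p*abs x))) \<longlongrightarrow> 0) at_top" "((%x::real. c*((1 + abs x)^2*exp (- p*abs x))) \<longlongrightarrow> 0) at_bot"
 using assms by real_asymp+

section \<open>Laplace transforms of products of Airy functions\<close>

definition airy0_laplace :: "real => real" where
 "airy0_laplace t = (LINT x|lborel. airy0 x*airy0 x*exp (t*x))"

lemma airy0_measurable [measurable]: "airy0 \<in> borel_measurable borel" "airy0' \<in> borel_measurable borel"
 using airy0_isCont by (auto intro: borel_measurable_continuous_onI)

lemma airy0_integrable:
 assumes t: "0 < t" "t < 2"
 shows "integrable lborel (%x. airy0 (x + a)*airy0 (x + b)*exp (t*x))"
  "integrable lborel (%x. airy0' (x + a)*airy0 (x + b)*exp (t*x))"
  "integrable lborel (%x. x*(airy0 (x + a)*airy0 (x + b)*exp (t*x)))"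
proof -
 define q where "q = min t (2 - t)"
 define R where "R = max (abs a) (abs b)"
 have p: "abs (airy0 (x + a)*airy0 (x + b)*exp (t*x)) <= airy_bound^2*exp (2*R)*exp (- q*abs x)"
  "abs (airy0' (x + a)*airy0 (x + b)*exp (t*x)) <= airy_bound^2*exp (2*R)*(1 + R)*((1 + abs x)*exp (- q*abs x))" for x
  by (rule airy0_prod_bounds; use t in \<open>auto simp: q_def R_def\<close>)+
 have q: "q > 0" using t by (auto simp: q_def)
 have i0: "integrable lborel (%x. c*exp (- q*abs x))" "integrable lborel (%x::real. c*((1 + abs x)*exp (- q*abs x)))" for c
  using integrable_exp_abs[OF q] integrable_one_plus_abs_exp[OF q] by simp_all
 show "integrable lborel (%x. airy0 (x + a)*airy0 (x + b)*exp (t*x))"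
  by (rule Bochner_bound[OF i0(1)[of "airy_bound^2*exp (2*R)"]])
   (use order_trans[OF p(1) abs_ge_self] in auto)
 show "integrable lborel (%x. airy0' (x + a)*airy0 (x + b)*exp (t*x))"
  by (rule Bochner_bound[OF i0(2)[of "airy_bound^2*exp (2*R)*(1 + R)"]])
   (use order_trans[OF p(2) abs_ge_self] in auto)
 have "abs (x*(airy0 (x + a)*airy0 (x + b)*exp (t*x))) <= airy_bound^2*exp (2*R)*((1 + abs x)*exp (- q*abs x))" for x
 proof -
  have "abs x*abs (airy0 (x + a)*airy0 (x + b)*exp (t*x)) <= (1 + abs x)*(airy_bound^2*exp (2*R)*exp (- q*abs x))"
   using p(1)[of x] by (intro mult_mono) auto
  thus ?thesis by (simp add: abs_mult mult_ac)
 qed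
 thus "integrable lborel (%x. x*(airy0 (x + a)*airy0 (x + b)*exp (t*x)))"
  by (intro Bochner_bound[OF i0(2)[of "airy_bound^2*exp (2*R)"]])
   (use order_trans[OF _ abs_ge_self] in auto)
qed

text \<open>The square \<open>w\<close> of a solution of Airy's equation satisfies
  \<open>w''' = 4*x*w' + 2*w\<close>. Integrated against \<open>exp (t*x)\<close>, this expresses
  the integral of \<open>x*w\<close> through that of \<open>w\<close>, which is a first-order
  equation in \<open>t\<close>.\<close>

lemma airy0_laplace_deriv:
 assumes t: "0 < t" "t < 2"
 shows "DERIV airy0_laplace t :> (t^2/4 - 1/(2*t))*airy0_laplace t"
proof -
 define p where "p = min t (2 - t)/2"
 have p: "p > 0" using t by (auto simp: p_def)
 let ?M = "airy_bound"
 have pb: "abs (airy0 x*airy0 x*exp (r*x)) <= ?M^2*exp (- p*abs x)"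
  "abs (airy0' x*airy0 x*exp (r*x)) <= ?M^2*((1 + abs x)*exp (- p*abs x))" 
  "abs (airy0' x*airy0' x*exp (r*x)) <= ?M^2*((1 + abs x)^2*exp (- p*abs x))" if "r \<in> {p<..<2-p}" for r x
  using airy0_prod_bounds[of p r 0 0 0 x] p that by auto
 have xb: "abs (x*(airy0 x*airy0 x*exp (r*x))) <= ?M^2*((1 + abs x)*exp (- p*abs x))" if "r \<in> {p<..<2-p}" for r x
 proof -
  have "abs x*abs (airy0 x*airy0 x*exp (r*x)) <= (1 + abs x)*(?M^2*exp (- p*abs x))"
   using pb(1)[OF that, of x] by (intro mult_mono) auto
  thus ?thesis by (simp add: abs_mult mult_ac)
 qed
 have tp: "t \<in> {p<..<2-p}" using t by (auto simp: p_def min_def field_simps)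
 have d: "DERIV airy0_laplace t :> (LINT x|lborel. x*(airy0 x*airy0 x*exp (t*x)))"
  unfolding airy0_laplace_def[abs_def]
 proof (rule has_real_derivative_lborel_integral(2)[where a=p and b="2-p"])
  show "integrable lborel (%x. ?M^2*((1 + abs x)*exp (- p*abs x)))"
   using integrable_one_plus_abs_exp[OF p] by simp
  show "integrable lborel (%x. airy0 x*airy0 x*exp (r*x))" if "r \<in> {p<..<2-p}" for r
   using airy0_integrable(1)[of r 0 0] that p by simp
 qed (use xb tp in \<open>auto intro!: derivative_eq_intros\<close>)
 have "(LINT x|lborel. (-2 + t^3)*(airy0 x*airy0 x*exp (t*x)) - 4*t*(x*(airy0 x*airy0 x*exp (t*x)))) = 0 - 0"
 proof (rule lborel_integral_derivative)
  \<comment> \<open>The boundary terms of that integration by parts: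
    \<open>w'' - 4*x*w - t*w' + t^2*w\<close> times the exponential, written in terms of
    \<open>airy0\<close> and \<open>airy0'\<close>.\<close>
  define G where "G = (%x. (2*(airy0' x)^2 - 2*x*(airy0 x)^2 - 2*t*airy0 x*airy0' x + t^2*(airy0 x)^2)*exp (t*x))"
  show "DERIV G x :> (-2 + t^3)*(airy0 x*airy0 x*exp (t*x)) - 4*t*(x*(airy0 x*airy0 x*exp (t*x)))" for x
   unfolding G_def by (auto intro!: derivative_eq_intros airy0_derivs) (simp add: algebra_simps power2_eq_square power3_eq_cube)
  show "continuous_on UNIV (%x. (-2 + t^3)*(airy0 x*airy0 x*exp (t*x)) - 4*t*(x*(airy0 x*airy0 x*exp (t*x))))"
   by (intro continuous_intros airy0_isCont)
  show "integrable lborel (%x. (-2 + t^3)*(airy0 x*airy0 x*exp (t*x)) - 4*t*(x*(airy0 x*airy0 x*exp (t*x))))"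
   using airy0_integrable(1,3)[of t 0 0] t by simp
  have *: "G x = 2*(airy0' x*airy0' x*exp (t*x)) - 2*(x*(airy0 x*airy0 x*exp (t*x))) - 2*t*(airy0' x*airy0 x*exp (t*x)) + t^2*(airy0 x*airy0 x*exp (t*x))" for x
   by (simp add: G_def algebra_simps power2_eq_square)
  have L: "(G \<longlongrightarrow> 0) F" if F: "F = at_top \<or> F = at_bot" for F
  proof -
   have c: "(f \<longlongrightarrow> 0) F" if "\<And>x. abs (f x) <= g x" "(g \<longlongrightarrow> 0) F" for f g :: "real => real"
    by (rule Lim_null_comparison[OF _ that(2)]) (use that(1) in \<open>auto intro!: always_eventually\<close>)
   have 1: "((%x. airy0' x*airy0' x*exp (t*x)) \<longlongrightarrow> 0) F"
    by (rule c[OF pb(3)[OF tp]]) (use F tendsto_exp_abs(5,6)[OF p, of "?M^2"] in blast)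
   have 2: "((%x. x*(airy0 x*airy0 x*exp (t*x))) \<longlongrightarrow> 0) F"
    by (rule c[OF xb[OF tp]]) (use F tendsto_exp_abs(3,4)[OF p, of "?M^2"] in blast)
   have 3: "((%x. airy0' x*airy0 x*exp (t*x)) \<longlongrightarrow> 0) F"
    by (rule c[OF pb(2)[OF tp]]) (use F tendsto_exp_abs(3,4)[OF p, of "?M^2"] in blast)
   have 4: "((%x. airy0 x*airy0 x*exp (t*x)) \<longlongrightarrow> 0) F"
    by (rule c[OF pb(1)[OF tp]]) (use F tendsto_exp_abs(1,2)[OF p, of "?M^2"] in blast)
   have "(G \<longlongrightarrow> 2*0 - 2*0 - 2*t*0 + t^2*0) F" unfolding *[abs_def]
    by (intro tendsto_add tendsto_diff tendsto_mult tendsto_const 1 2 3 4)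
   thus ?thesis by simp
  qed
  show "(G \<longlongrightarrow> 0) at_top" by (rule L) simp
  show "(G \<longlongrightarrow> 0) at_bot" by (rule L) simp
 qed
 hence "(-2 + t^3)*airy0_laplace t - 4*t*(LINT x|lborel. x*(airy0 x*airy0 x*exp (t*x))) = 0"
  using airy0_integrable(1,3)[of t 0 0] t by (simp add: airy0_laplace_def)
 hence "(LINT x|lborel. x*(airy0 x*airy0 x*exp (t*x))) = (t^2/4 - 1/(2*t))*airy0_laplace t"
  using t by (simp add: field_simps power2_eq_square power3_eq_cube)
 with d show ?thesis by simp
qed

text \<open>The constant of integration of the first-order equation, read off at
  \<open>t = 1\<close>. It is absorbed into the normalisation of \<open>airy\<close>, for which its
  sign is enough.\<close>

definition airy_const :: real where "airy_const = airy0_laplace 1*exp (- 1/12)"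

lemma airy0_laplace_eq:
 assumes t: "0 < t" "t < 2"
 shows "airy0_laplace t = airy_const*exp (t^3/12) / sqrt t"
proof -
 define p where "p = (%t. airy0_laplace t*(sqrt t*exp (- (t^3/12))))"
 have "\<exists>c. \<forall>t\<in>{0<..<2}. p t = c"
 proof (rule has_field_derivative_zero_constant)
  fix r :: real assume r: "r \<in> {0<..<2}"
  hence "DERIV p r :> 0"
   unfolding p_def
   by (auto intro!: derivative_eq_intros airy0_laplace_deriv simp: field_simps power2_eq_square)
  thus "(p has_field_derivative 0) (at r within {0<..<2})"
   by (rule DERIV_subset) simp
 qed simp
 hence "p t = p 1" using t by force
 hence "airy0_laplace t * sqrt t*exp (- (t^3/12)) = airy_const" by (simp add: p_def airy_const_def mult.assoc)
 thus ?thesis using t by (simp add: field_simps exp_minus)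
qed

lemma airy_const_pos: "airy_const > 0"
proof -
 have "isCont airy0 1" using airy0_derivs(1) DERIV_isCont by blast
 then obtain d where d: "d > 0" "\<And>x. abs (x - 1) < d ==> abs (airy0 x - airy0 1) < airy0 1/2"
  using airy0_pos unfolding continuous_at_eps_delta dist_real_def by (metis half_gt_zero)
 define e where "e = (airy0 1/2)^2*exp (1 - d)"
 have e: "e > 0" using airy0_pos unfolding e_def by simp
 have le: "e*indicator {1 - d<..<1 + d} x <= airy0 x*airy0 x*exp (1*x)" for x
 proof (cases "x \<in> {1 - d<..<1 + d}")
  case True
  hence "airy0 x >= airy0 1/2" using d(2)[of x] unfolding abs_less_iff by force
  hence "airy0 1/2*(airy0 1/2) <= airy0 x*airy0 x" using airy0_pos by (intro mult_mono) auto
  hence "airy0 1/2*(airy0 1/2)*exp (1 - d) <= airy0 x*airy0 x*exp (1*x)" 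
   by (rule mult_mono) (use True in auto)
  thus ?thesis using True by (simp add: e_def power2_eq_square)
 qed simp
 have "(LINT x|lborel. e*indicator {1 - d<..<1 + d} x) <= (LINT x|lborel. airy0 x*airy0 x*exp (1*x))"
  by (rule integral_mono) (use le airy0_integrable(1)[of 1 0 0] d in auto)
 moreover have "(LINT x|lborel. e*indicator {1 - d<..<1 + d} x) = e*(2*d)"
  using d by simp
 ultimately have "airy0_laplace 1 > 0" unfolding airy0_laplace_def using e d by (smt (verit) mult_pos_pos)
 thus ?thesis by (simp add: airy_const_def)
qed

text \<open>Normalised so that the Airy transform is an isometry of \<open>L\<^sup>2\<close>.\<close>

definition airy :: "real => real" where "airy x = airy0 x / sqrt (2 * sqrt pi*airy_const)"
definition airy' :: "real => real" where "airy' x = airy0' x / sqrt (2 * sqrt pi*airy_const)"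
definition AB :: real where "AB = airy_bound / sqrt (2 * sqrt pi*airy_const)"

lemma airy_deriv:
 "DERIV airy x :> airy' x" "DERIV airy' x :> x*airy x"
 unfolding airy_def[abs_def] airy'_def[abs_def] 
 using DERIV_cdivide[OF airy0_derivs(1)] DERIV_cdivide[OF airy0_derivs(2)] by simp_all

lemma airy_deriv_chain [derivative_intros]:
 assumes "(g has_real_derivative d) (at x within S)"
 shows "((%x. airy (g x)) has_real_derivative airy' (g x)*d) (at x within S)"
  "((%x. airy' (g x)) has_real_derivative g x*airy (g x)*d) (at x within S)"
 using DERIV_chain2[OF airy_deriv(1) assms] DERIV_chain2[OF airy_deriv(2) assms] by simp_all

lemma airy_continuous_on [continuous_intros]:
 assumes "continuous_on S f"
 shows "continuous_on S (%x. airy (f x))" "continuous_on S (%x. airy' (f x))"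
proof -
 have c: "continuous_on UNIV airy" "continuous_on UNIV airy'"
  by (auto intro!: continuous_at_imp_continuous_on DERIV_isCont[OF airy_deriv(1)] DERIV_isCont[OF airy_deriv(2)])
 show "continuous_on S (%x. airy (f x))" "continuous_on S (%x. airy' (f x))"
  by (rule continuous_on_compose2[OF c(1) assms subset_UNIV] continuous_on_compose2[OF c(2) assms subset_UNIV])+
qed

lemma airy_measurable [measurable]: "airy \<in> borel_measurable borel" "airy' \<in> borel_measurable borel"
 by (intro borel_measurable_continuous_onI airy_continuous_on[OF continuous_on_id])+

lemma airy_bounds:
 "AB > 0" "abs (airy x) <= AB*exp (- x)" "abs (airy' x) <= AB*exp (- x)"
 "abs (airy x) <= AB" "abs (airy' x) <= AB*(1 + abs x)"
proof -
 have k: "0 < sqrt (2 * sqrt pi*airy_const)" using airy_const_pos by simp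
 show "AB > 0" "abs (airy x) <= AB*exp (- x)" "abs (airy' x) <= AB*exp (- x)"
 "abs (airy x) <= AB" "abs (airy' x) <= AB*(1 + abs x)"
  unfolding airy_def airy'_def AB_def using airy0_bounds(2-5)[of x] airy0_bounds(1) k airy_const_pos
  by (simp_all add: abs_mult divide_right_mono)
qed

lemma airy_integrable:
 assumes t: "0 < t" "t < 2"
 shows "integrable lborel (%x. airy (x + a)*airy (x + b)*exp (t*x))"
proof -
 have "integrable lborel (%x. (airy0 (x + a)*airy0 (x + b)*exp (t*x))/(sqrt (2 * sqrt pi*airy_const) * sqrt (2 * sqrt pi*airy_const)))"
  using airy0_integrable(1)[OF t] by (rule integrable_divide)
 thus ?thesis by (simp add: airy_def)
qed

text \<open>The Laplace-regularised overlap of two translates of the Airy function. Up to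
  exponential factors it is the heat kernel at time \<open>t\<close>, so its behaviour as
  \<open>t\<close> tends to 0 expresses the orthogonality of the translates.\<close>

definition gauss_kernel :: "real => real => real => real" where
 "gauss_kernel t a b = exp (t^3/12 - t*(a + b)/2 - (a - b)^2/(4*t))/(2 * sqrt (pi*t))"

text \<open>As a function of the distance \<open>q\<close> the integral \<open>L\<close> satisfies
  \<open>L' = - (q/(2*t)) * L\<close>. The derivative in \<open>q\<close> is half the integral of
  the Wronskian \<open>W\<close> of the two translates times the exponential, and
  \<open>W' = q*(product) + t*W\<close> in \<open>x\<close> determines that integral.\<close>

lemma airy0_shifted_laplace:
 assumes t: "0 < t" "t < 2"
 shows "(LINT x|lborel. airy0 (x + q/2)*airy0 (x + - q/2)*exp (t*x)) = airy0_laplace t*exp (- q\<^sup>2/(4*t))"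
proof -
 define L where "L = (%q. (LINT x|lborel. airy0 (x + q/2)*airy0 (x + - q/2)*exp (t*x)))"
 define p where "p = min t (2 - t)"
 have p: "p > 0" "p <= t" "t <= 2 - p" using t by (auto simp: p_def)
 have dL: "DERIV L q :> - (q/(2*t))*L q" for q
 proof -
  define R where "R = abs q/2 + 1"
  define W where "W = (%q x. airy0' (x + q/2)*airy0 (x + - q/2)*exp (t*x) - airy0' (x + - q/2)*airy0 (x + q/2)*exp (t*x))"
  let ?c = "airy_bound^2*exp (2*R)*(1 + R)"
  have Wb: "abs (W z x) <= (2*?c)*((1 + abs x)*exp (- p*abs x))" if "z \<in> {q - 1<..<q + 1}" for z x
  proof -
   have "abs (airy0' (x + z/2)*airy0 (x + - z/2)*exp (t*x)) <= ?c*((1 + abs x)*exp (- p*abs x))"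
    "abs (airy0' (x + - z/2)*airy0 (x + z/2)*exp (t*x)) <= ?c*((1 + abs x)*exp (- p*abs x))"
    by (rule airy0_prod_bounds(2)[OF p]; use that in \<open>auto simp: R_def abs_if split: if_splits\<close>)+
   thus ?thesis unfolding W_def by (simp add: mult.assoc)
  qed
  have "DERIV (%q. (LINT x|lborel. airy0 (x + q/2)*airy0 (x + - q/2)*exp (t*x))) q :> (LINT x|lborel. W q x/2)"
  proof (rule has_real_derivative_lborel_integral(2)[where a="q-1" and b="q+1" and f'="%q x. W q x/2" and B="%x. (2*?c)*((1 + abs x)*exp (- p*abs x))"])
   fix z x :: real
   show "DERIV (%q. airy0 (x + q/2)*airy0 (x + - q/2)*exp (t*x)) z :> W z x/2"
    unfolding W_def by (auto intro!: derivative_eq_intros DERIV_chain2[OF airy0_derivs(1)] simp: field_simps)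
   show "integrable lborel (%x. airy0 (x + z/2)*airy0 (x + - z/2)*exp (t*x))"
    by (rule airy0_integrable[OF t])
   assume z: "z \<in> {q - 1<..<q + 1}"
   show "abs (W z x/2) <= (2*?c)*((1 + abs x)*exp (- p*abs x))" using Wb[OF z, of x] by (simp add: abs_if split: if_splits) 
  next
   show "integrable lborel (%x::real. (2*?c)*((1 + abs x)*exp (- p*abs x)))"
    using integrable_one_plus_abs_exp(1)[OF p(1)] by (rule integrable_mult_right)
  qed simp
  moreover have "(LINT x|lborel. W q x) = - (q/t)*L q"
  proof -
   let ?f = "%x. q*(airy0 (x + q/2)*airy0 (x + - q/2)*exp (t*x)) + t*W q x"
   have iW: "integrable lborel (W q)" unfolding W_def by (intro Bochner_diff airy0_integrable t)
   have iA: "integrable lborel (%x. airy0 (x + q/2)*airy0 (x + - q/2)*exp (t*x))" by (rule airy0_integrable[OF t])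
   have lim: "(W q \<longlongrightarrow> 0) F" if F: "F = at_top \<or> F = at_bot" for F
    by (rule Lim_null_comparison[where g="%x. (2*?c)*((1 + abs x)*exp (- p*abs x))"])
     (use F Wb[of q] tendsto_exp_abs(3,4)[OF p(1), of "2*?c"] in \<open>auto intro!: always_eventually\<close>)
   have "(LINT x|lborel. ?f x) = 0 - 0"
   proof (rule lborel_integral_derivative)
    show "DERIV (W q) x :> ?f x" for x
     unfolding W_def by (auto intro!: derivative_eq_intros DERIV_chain2[OF airy0_derivs(1)] DERIV_chain2[OF airy0_derivs(2)]) (simp add: algebra_simps)
    show "continuous_on UNIV ?f" unfolding W_def
     by (intro continuous_intros continuous_on_compose2[OF airy0_isCont(1)] continuous_on_compose2[OF airy0_isCont(2)]) auto
    show "integrable lborel ?f" using iW iA by simp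
    show "(W q \<longlongrightarrow> 0) at_bot" "(W q \<longlongrightarrow> 0) at_top" using lim by auto
   qed
   hence "q*L q + t*(LINT x|lborel. W q x) = 0" using iW iA unfolding L_def by simp
   thus ?thesis using t by (simp add: field_simps)
  qed
  ultimately show ?thesis unfolding L_def[symmetric] by (simp add: mult.commute)
 qed
 have "DERIV (%q. L q*exp (q^2/(4*t))) q :> 0" for q
  using t by (auto intro!: derivative_eq_intros dL simp: field_simps)
 hence "L q*exp (q^2/(4*t)) = L 0*exp (0^2/(4*t))" by (intro DERIV_isconst_all) auto
 moreover have "L 0 = airy0_laplace t" by (simp add: L_def airy0_laplace_def)
 ultimately have "L q = airy0_laplace t*exp (- q\<^sup>2/(4*t))" by (simp add: exp_minus field_simps)
 thus ?thesis by (simp add: L_def)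
qed

text \<open>Translation by the midpoint of \<open>a\<close> and \<open>b\<close> reduces to
  symmetric shifts. The normalisation cancels \<open>airy_const\<close> and leaves the constant of
  the heat kernel.\<close>

lemma airy_gauss:
 assumes t: "0 < t" "t < 2"
 shows "(LINT x|lborel. airy (x + a)*airy (x + b)*exp (t*x)) = gauss_kernel t a b"
proof -
 let ?p = "(a + b)/2" let ?q = "a - b" let ?k = "2 * sqrt pi*airy_const"
 have "(LINT x|lborel. airy0 (x + a)*airy0 (x + b)*exp (t*x))
  = (LINT x|lborel. airy0 ((- ?p + 1*x) + a)*airy0 ((- ?p + 1*x) + b)*exp (t*(- ?p + 1*x)))"
  using lborel_integral_real_affine[of 1 "%x. airy0 (x + a)*airy0 (x + b)*exp (t*x)" "- ?p"] by simp
 also have "... = (LINT x|lborel. exp (- t*?p)*(airy0 (x + ?q/2)*airy0 (x + - ?q/2)*exp (t*x)))"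
 proof (rule Bochner_cong)
  fix x :: real
  have "(- ?p + 1*x) + a = x + ?q/2" "(- ?p + 1*x) + b = x + - ?q/2" by (simp_all add: field_simps)
  moreover have "exp (t*(- ?p + 1*x)) = exp (- t*?p)*exp (t*x)" by (simp add: exp_add[symmetric] field_simps)
  ultimately show "airy0 ((- ?p + 1*x) + a)*airy0 ((- ?p + 1*x) + b)*exp (t*(- ?p + 1*x))
   = exp (- t*?p)*(airy0 (x + ?q/2)*airy0 (x + - ?q/2)*exp (t*x))" by (simp only: mult_ac)
 qed simp
 also have "... = exp (- t*?p)*(airy0_laplace t*exp (- ?q\<^sup>2/(4*t)))"
  by (simp only: airy0_shifted_laplace[OF t] integral_mult_right_zero)
 also have "... = airy_const / sqrt t*exp (t^3/12 - t*(a + b)/2 - (a - b)^2/(4*t))"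
 proof -
  have "exp (t^3/12 - t*(a + b)/2 - (a - b)^2/(4*t)) = exp (t^3/12)*exp (- t*?p)*exp (- ?q\<^sup>2/(4*t))"
   by (simp add: exp_add[symmetric])
  thus ?thesis by (simp add: airy0_laplace_eq[OF t])
 qed
 finally have *: "(LINT x|lborel. airy0 (x + a)*airy0 (x + b)*exp (t*x)) = airy_const / sqrt t*exp (t^3/12 - t*(a + b)/2 - (a - b)^2/(4*t))" .
 have "(LINT x|lborel. airy (x + a)*airy (x + b)*exp (t*x)) = (LINT x|lborel. (airy0 (x + a)*airy0 (x + b)*exp (t*x))/?k)"
  using airy_const_pos by (intro Bochner_cong) (simp_all add: airy_def)
 also have "... = (airy_const / sqrt t*exp (t^3/12 - t*(a + b)/2 - (a - b)^2/(4*t)))/?k"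
  using * by simp
 also have "... = gauss_kernel t a b" unfolding gauss_kernel_def using airy_const_pos t by (simp add: real_sqrt_mult)
 finally show ?thesis .
qed

section \<open>The Airy kernel\<close>

text \<open>Written as an integral over the half-line instead of the quotient in
  \<open>airyK_commutator\<close>: the diagonal is not singular, and the kernel appears as an
  operator times its adjoint.\<close>

definition airyK :: "real => real => real" where
 "airyK p q = (LINT r:{0..}|lborel. airy (p + r)*airy (q + r))"

definition airyK' :: "real => real => real" where
 "airyK' p q = (LINT r:{0..}|lborel. airy' (p + r)*airy (q + r))"

lemma integrable_exp_atLeast: "0 < u ==> integrable lborel (%r::real. c*(indicator {a..} r*exp (- (u*r))))"
proof -
 assume u: "0 < u"
 have "integrable lborel (%r::real. (exp (u*abs a)*exp (u*abs a))*exp (- u*abs r))" 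
  using integrable_exp_abs[OF u] by simp
 hence "integrable lborel (%r::real. indicator {a..} r*exp (- (u*r)))"
 proof (rule Bochner_bound)
  show "AE r in lborel. norm (indicator {a..} r*exp (- (u*r)) ::real) <= norm (exp (u*abs a)*exp (u*abs a)*exp (- u*abs r))"
  proof (rule AE_I2)
   fix r :: real
   have "- (u*r) <= u*abs a + u*abs a - u*abs r" if "a <= r"
   proof -
    have "- r <= abs a + abs a - abs r" using that by linarith
    hence "u*(- r) <= u*(abs a + abs a - abs r)" using u by (intro mult_left_mono) auto
    thus ?thesis by (simp add: algebra_simps)
   qed
   thus "norm (indicator {a..} r*exp (- (u*r)) ::real) <= norm (exp (u*abs a)*exp (u*abs a)*exp (- u*abs r))"
    by (auto simp: indicator_def exp_add[symmetric])
  qed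
 qed simp
 thus ?thesis by (rule integrable_mult_right)
qed

lemma airy_prod_exp_bound:
 assumes "\<And>x. abs (f x) <= AB*exp (- x)" "\<And>x. abs (g x) <= AB*exp (- x)"
 shows "abs (f (p + r)*g (q + r)) <= AB^2*exp (- p - q)*exp (- (2*r))"
proof -
 have "abs (f (p + r)*g (q + r)) <= (AB*exp (- (p + r)))*(AB*exp (- (q + r)))"
  unfolding abs_mult by (rule mult_mono[OF assms]) (use airy_bounds(1) in auto)
 also have "... = AB^2*(exp (- (p + r))*exp (- (q + r)))" by (simp add: power2_eq_square)
 also have "exp (- (p + r))*exp (- (q + r)) = exp (- p - q)*exp (- (2*r))" by (simp add: exp_add[symmetric])
 finally show ?thesis by (simp add: mult.assoc)
qed

lemma set_integrable_airy_prod: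
 assumes "\<And>x. abs (f x) <= AB*exp (- x)" "\<And>x. abs (g x) <= AB*exp (- x)"
  "f \<in> borel_measurable borel" "g \<in> borel_measurable borel"
 shows "set_integrable lborel {a..} (%r. f (p + r)*g (q + r))"
 unfolding set_integrable_def
proof (rule Bochner_bound[OF integrable_exp_atLeast[of 2 "AB^2*exp (- p - q)" a]])
 show "AE r in lborel. norm (indicator {a..} r *\<^sub>R (f (p + r)*g (q + r))) <= norm (AB^2*exp (- p - q)*(indicator {a..} r*exp (- (2*r))))"
  using airy_prod_exp_bound[OF assms(1,2), of p _ q] by (auto simp: indicator_def abs_mult mult.assoc intro!: AE_I2)
qed (use assms(3,4) in simp_all)

lemma set_lebesgue_integral_airy_prod_le:
 assumes "\<And>x. abs (f x) <= AB*exp (- x)" "\<And>x. abs (g x) <= AB*exp (- x)"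
  "f \<in> borel_measurable borel" "g \<in> borel_measurable borel"
 shows "abs (LINT r:{0..}|lborel. f (p + r)*g (q + r)) <= AB^2*exp (- p - q)"
proof -
 have half: "(LINT r|lborel. indicator {0..} r*exp (- (2*r::real))) = 1/2"
 proof -
  have "(LINT r:{0..}|lborel. exp (- (2*r::real))) = 0 - (- exp (- (2*0))/2)"
   by (rule lborel_integral_derivative_atLeast)
    (use integrable_exp_atLeast[of 2 1 0] in \<open>auto simp: set_integrable_def intro!: derivative_eq_intros continuous_intros\<close>, real_asymp)
  thus ?thesis by (simp add: LINT_def)
 qed
 have "abs (LINT r:{0..}|lborel. f (p + r)*g (q + r)) <= (LINT r|lborel. AB^2*exp (- p - q)*(indicator {0..} r*exp (- (2*r))))"
  unfolding LINT_def
 proof (rule integral_abs_bound_integral)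
  show "integrable lborel (%r. indicat_real {0..} r *\<^sub>R (f (p + r)*g (q + r)))"
   using set_integrable_airy_prod[OF assms, of 0 p q] by (simp add: set_integrable_def)
  show "abs (indicat_real {0..} r *\<^sub>R (f (p + r)*g (q + r))) <= AB^2*exp (- p - q)*(indicator {0..} r*exp (- (2*r)))" for r
   using airy_prod_exp_bound[OF assms(1,2), of p r q] by (auto simp: indicator_def abs_mult mult.assoc)
 qed (rule integrable_exp_atLeast, simp)
 also have "... = AB^2*exp (- p - q)*(1/2)" using half by simp
 also have "... <= AB^2*exp (- p - q)" by simp
 finally show ?thesis .
qed

lemma isCont_airy_prod_integral:
 assumes "\<And>x. abs (f x) <= AB*exp (- x)" "\<And>x. abs (g x) <= AB*exp (- x)"
  "continuous_on UNIV f" "continuous_on UNIV g"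
 shows "continuous_on UNIV (%z. LINT r:{0..}|lborel. f (fst z + r)*g (snd z + r))"
proof (rule continuous_on_sequentiallyI)
 fix u :: "nat => real \<times> real" and a assume u: "u \<longlonglongrightarrow> a"
 have u1: "(%n. fst (u n)) \<longlonglongrightarrow> fst a" and u2: "(%n. snd (u n)) \<longlonglongrightarrow> snd a"
  using u by (auto intro: tendsto_intros)
 obtain M1 where M1: "\<And>n. norm (fst (u n)) <= M1" using convergent_imp_Bseq[OF convergentI[OF u1]] unfolding Bseq_def by auto
 obtain M2 where M2: "\<And>n. norm (snd (u n)) <= M2" using convergent_imp_Bseq[OF convergentI[OF u2]] unfolding Bseq_def by auto
 have m: "f \<in> borel_measurable borel" "g \<in> borel_measurable borel" using assms(3,4) by (auto intro: borel_measurable_continuous_onI)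
 show "(%n. LINT r:{0..}|lborel. f (fst (u n) + r)*g (snd (u n) + r)) \<longlonglongrightarrow> (LINT r:{0..}|lborel. f (fst a + r)*g (snd a + r))"
  unfolding LINT_def
 proof (rule integral_dominated_convergence[where w="%r. AB^2*exp (M1 + M2)*(indicator {0..} r*exp (- (2*r)))"])
  show "AE r in lborel. (%n. indicat_real {0..} r *\<^sub>R (f (fst (u n) + r)*g (snd (u n) + r))) \<longlonglongrightarrow> indicat_real {0..} r *\<^sub>R (f (fst a + r)*g (snd a + r))"
  proof (rule AE_I2)
   fix r :: real
   have "(%n. f (fst (u n) + r)) \<longlonglongrightarrow> f (fst a + r)" "(%n. g (snd (u n) + r)) \<longlonglongrightarrow> g (snd a + r)"
    by (rule continuous_on_tendsto_compose[OF assms(3)] continuous_on_tendsto_compose[OF assms(4)]; use u1 u2 in \<open>auto intro!: tendsto_intros\<close>)+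
   thus "(%n. indicat_real {0..} r *\<^sub>R (f (fst (u n) + r)*g (snd (u n) + r))) \<longlonglongrightarrow> indicat_real {0..} r *\<^sub>R (f (fst a + r)*g (snd a + r))"
    by (intro tendsto_intros)
  qed
  show "AE r in lborel. norm (indicat_real {0..} r *\<^sub>R (f (fst (u n) + r)*g (snd (u n) + r))) <= AB^2*exp (M1 + M2)*(indicator {0..} r*exp (- (2*r)))" for n
  proof (rule AE_I2)
   fix r :: real
   have "exp (- fst (u n) - snd (u n)) <= exp (M1 + M2)" using M1[of n] M2[of n] by auto
   hence "AB^2*exp (- fst (u n) - snd (u n))*exp (- (2*r)) <= AB^2*exp (M1 + M2)*exp (- (2*r))"
    by (intro mult_right_mono mult_left_mono) auto
   with airy_prod_exp_bound[OF assms(1,2), of "fst (u n)" r "snd (u n)"]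
   show "norm (indicat_real {0..} r *\<^sub>R (f (fst (u n) + r)*g (snd (u n) + r))) <= AB^2*exp (M1 + M2)*(indicator {0..} r*exp (- (2*r)))"
    by (auto simp: indicator_def)
  qed
 qed (use m integrable_exp_atLeast[of 2 "AB^2*exp (M1 + M2)" 0] in simp_all)
qed

lemma airyK_continuous_on [continuous_intros]:
 assumes "continuous_on S f" "continuous_on S g"
 shows "continuous_on S (%x. airyK (f x) (g x))" "continuous_on S (%x. airyK' (f x) (g x))"
proof -
 have c: "continuous_on UNIV airy" "continuous_on UNIV airy'" by (intro continuous_intros)+
 have "continuous_on UNIV (%z. airyK (fst z) (snd z))" "continuous_on UNIV (%z. airyK' (fst z) (snd z))"
  unfolding airyK_def airyK'_def
  by (rule isCont_airy_prod_integral[OF airy_bounds(2) airy_bounds(2)] isCont_airy_prod_integral[OF airy_bounds(3) airy_bounds(2)]; intro c)+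
 thus "continuous_on S (%x. airyK (f x) (g x))" "continuous_on S (%x. airyK' (f x) (g x))"
  using continuous_on_compose2[OF _ continuous_on_Pair[OF assms], of UNIV] by fastforce+
qed

lemma airyK_sym: "airyK p q = airyK q p"
 unfolding airyK_def by (simp add: mult.commute)

lemma airyK_diag_nonneg: "0 <= airyK p p"
 unfolding airyK_def LINT_def by (rule Bochner_nonneg) simp

lemma airyK_bound: "abs (airyK p q) <= AB^2*exp (- p - q)"
 unfolding airyK_def by (rule set_lebesgue_integral_airy_prod_le[OF airy_bounds(2) airy_bounds(2)]) auto

lemma airy_prod_lim: 
 assumes "\<And>x. abs (f x) <= AB*exp (- x)" "\<And>x. abs (g x) <= AB*exp (- x)"
 shows "((%r. f (p + r)*g (q + r)) \<longlongrightarrow> 0) at_top"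
 by (rule Lim_null_comparison[where g="%r. AB^2*exp (- p - q)*exp (- (2*r))"])
  (use airy_prod_exp_bound[OF assms, of p _ q] in \<open>auto intro!: always_eventually\<close>, real_asymp)

lemma airyK_deriv:
 "DERIV (%p. airyK p q) p :> airyK' p q"
proof -
 let ?g = "%r. AB^2*exp (1 - p - q)*(indicator {0..} r*exp (- (2*r)))"
 show ?thesis
  unfolding airyK_def[abs_def] airyK'_def LINT_def
 proof (rule has_real_derivative_lborel_integral(2)[where a="p-1" and b="p+1" and B="?g"])
  show "integrable lborel ?g" by (rule integrable_exp_atLeast) simp
  fix y r :: real
  show "integrable lborel (%r. indicat_real {0..} r *\<^sub>R (airy (y + r)*airy (q + r)))"
   using set_integrable_airy_prod[OF airy_bounds(2) airy_bounds(2), of 0 y q] by (simp add: set_integrable_def)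
  show "DERIV (%p. indicat_real {0..} r *\<^sub>R (airy (p + r)*airy (q + r))) y :> indicat_real {0..} r *\<^sub>R (airy' (y + r)*airy (q + r))"
   by (auto intro!: derivative_eq_intros)
  assume y: "y \<in> {p - 1<..<p + 1}"
  have "AB^2*exp (- y - q)*exp (- (2*r)) <= AB^2*exp (1 - p - q)*exp (- (2*r))"
   using y by (intro mult_right_mono mult_left_mono) auto
  thus "abs (indicat_real {0..} r *\<^sub>R (airy' (y + r)*airy (q + r))) <= ?g r"
   using airy_prod_exp_bound[OF airy_bounds(3) airy_bounds(2), of y r q] by (auto simp: indicator_def)
 qed simp
qed

text \<open>The integrand is a total derivative in \<open>r\<close>, so the sum of the two partial
  derivatives of the kernel has rank one.\<close>

lemma airyK'_sum: "airyK' p q + airyK' q p = - (airy p*airy q)"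
proof -
 have i: "set_integrable lborel {0..} (%r. airy' (p + r)*airy (q + r))" "set_integrable lborel {0..} (%r. airy' (q + r)*airy (p + r))"
  by (rule set_integrable_airy_prod[OF airy_bounds(3) airy_bounds(2)]; simp)+
 have "airyK' p q + airyK' q p = (LINT r:{0..}|lborel. airy' (p + r)*airy (q + r) + airy' (q + r)*airy (p + r))"
  unfolding airyK'_def by (rule set_integral_add(2)[OF i, symmetric])
 also have "... = 0 - airy (p + 0)*airy (q + 0)"
  by (rule lborel_integral_derivative_atLeast)
   (use i airy_prod_lim[OF airy_bounds(2) airy_bounds(2), of p q] in \<open>auto intro!: derivative_eq_intros continuous_intros set_integral_add\<close>)
 finally show ?thesis by simp
qed

text \<open>The Christoffel-Darboux formula, from the derivative of a Wronskian of translates. It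
  says that the commutator of the kernel with multiplication by the variable has rank two.\<close>

lemma airyK_commutator: "(p - q)*airyK p q = airy p*airy' q - airy' p*airy q"
proof -
 have i: "set_integrable lborel {0..} (%r. airy (p + r)*airy (q + r))"
  by (rule set_integrable_airy_prod[OF airy_bounds(2) airy_bounds(2)]; simp)
 have "(p - q)*airyK p q = (LINT r:{0..}|lborel. (p - q)*(airy (p + r)*airy (q + r)))"
  unfolding airyK_def by simp
 also have "... = (0 - 0) - (airy' (p + 0)*airy (q + 0) - airy (p + 0)*airy' (q + 0))"
 proof (rule lborel_integral_derivative_atLeast)
  show "DERIV (%r. airy' (p + r)*airy (q + r) - airy (p + r)*airy' (q + r)) r :> (p - q)*(airy (p + r)*airy (q + r))" for r
   by (auto intro!: derivative_eq_intros simp: algebra_simps)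
  show "set_integrable lborel {0..} (%r. (p - q)*(airy (p + r)*airy (q + r)))" using i by simp
  show "((%r. airy' (p + r)*airy (q + r) - airy (p + r)*airy' (q + r)) \<longlongrightarrow> 0 - 0) at_top"
   by (intro tendsto_diff airy_prod_lim airy_bounds)
 qed (intro continuous_intros)
 finally show ?thesis by simp
qed

text \<open>Rank one in the parameter \<open>s\<close>: this lets the \<open>s\<close>-derivative of
  a solution of the integral equation be expressed by solutions of the same equation.\<close>

lemma airyK_shift_deriv:
 "DERIV (%s. airyK (s + x) (s + y)) s :> - (airy (s + x)*airy (s + y))"
proof -
 let ?g = "%r. 2*AB^2*exp (2 - 2 * s - x - y)*(indicator {0..} r*exp (- (2*r)))"
 have "DERIV (%s. airyK (s + x) (s + y)) s :> (LINT r|lborel. indicator {0..} r *\<^sub>R (airy' (s + x + r)*airy (s + y + r) + airy' (s + y + r)*airy (s + x + r)))"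
  unfolding airyK_def[abs_def] LINT_def
 proof (rule has_real_derivative_lborel_integral(2)[where a="s-1" and b="s+1" and B="?g"])
  show "integrable lborel ?g" by (rule integrable_exp_atLeast) simp
  fix z r :: real
  show "integrable lborel (%r. indicat_real {0..} r *\<^sub>R (airy (z + x + r)*airy (z + y + r)))"
   using set_integrable_airy_prod[OF airy_bounds(2) airy_bounds(2), of 0 "z+x" "z+y"] by (simp add: set_integrable_def)
  show "DERIV (%s. indicat_real {0..} r *\<^sub>R (airy (s + x + r)*airy (s + y + r))) z :> indicat_real {0..} r *\<^sub>R (airy' (z + x + r)*airy (z + y + r) + airy' (z + y + r)*airy (z + x + r))"
   by (auto intro!: derivative_eq_intros)
  assume z: "z \<in> {s - 1<..<s + 1}"
  have "AB^2*exp (- (z+x) - (z+y))*exp (- (2*r)) <= AB^2*exp (2 - 2 * s - x - y)*exp (- (2*r))"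
   using z by (intro mult_right_mono mult_left_mono) auto
  moreover have "abs (airy' (z + x + r)*airy (z + y + r)) <= AB^2*exp (- (z+x) - (z+y))*exp (- (2*r))"
   "abs (airy' (z + y + r)*airy (z + x + r)) <= AB^2*exp (- (z+y) - (z+x))*exp (- (2*r))"
   by (rule airy_prod_exp_bound[OF airy_bounds(3) airy_bounds(2)])+
  moreover have "exp (- (z+y) - (z+x)) = exp (- (z+x) - (z+y))" by (simp add: algebra_simps)
  ultimately have "abs (airy' (z + x + r)*airy (z + y + r) + airy' (z + y + r)*airy (z + x + r)) <= 2*(AB^2*exp (2 - 2 * s - x - y)*exp (- (2*r)))"
   by (simp only:)
  thus "abs (indicat_real {0..} r *\<^sub>R (airy' (z + x + r)*airy (z + y + r) + airy' (z + y + r)*airy (z + x + r))) <= ?g r"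
   by (auto simp: indicator_def)
 qed simp
 moreover have "(LINT r|lborel. indicator {0..} r *\<^sub>R (airy' (s + x + r)*airy (s + y + r) + airy' (s + y + r)*airy (s + x + r))) = airyK' (s+x) (s+y) + airyK' (s+y) (s+x)"
  unfolding airyK'_def LINT_def[symmetric]
  by (rule set_integral_add(2); rule set_integrable_airy_prod[OF airy_bounds(3) airy_bounds(2)]; simp)
 ultimately show ?thesis by (simp add: airyK'_sum)
qed

section \<open>The Airy transform\<close>

lemma lborel_Fubini_dominated:
 fixes F :: "real => real => real"
 assumes meas [measurable]: "case_prod F \<in> borel_measurable (lborel \<Otimes>\<^sub>M lborel)"
  and i: "integrable lborel p" "integrable lborel q" and bd: "\<And>x y. abs (F x y) <= p x*q y"
 shows "(LINT x|lborel. (LINT y|lborel. F x y)) = (LINT y|lborel. (LINT x|lborel. F x y))"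
  "integrable lborel (%x. (LINT y|lborel. F x y))" "integrable lborel (%y. (LINT x|lborel. F x y))"
proof -
 have m1 [measurable]: "(%y. F x y) \<in> borel_measurable lborel" for x
  using measurable_compose[OF measurable_Pair1' meas, of x] by simp
 have iy: "integrable lborel (%y. F x y)" for x
  by (rule Bochner_bound[OF integrable_mult_right[OF i(2), of "p x"]])
   (use order_trans[OF bd abs_ge_self] in auto)
 have "integrable (lborel \<Otimes>\<^sub>M lborel) (case_prod F)"
 proof (rule lborel_pair.Fubini_integrable[OF meas])
  have "abs (LINT y|lborel. abs (F x y)) <= (LINT y|lborel. p x*q y)" for x
   by (rule integral_abs_bound_integral) (use iy i bd in auto)
  hence "abs (LINT y|lborel. abs (F x y)) <= abs (p x*(LINT y|lborel. q y))" for x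
   by (simp add: order_trans[OF _ abs_ge_self])
  thus "integrable lborel (%x. (LINT y|lborel. norm (case_prod F (x, y))))"
   by (intro Bochner_bound[OF integrable_mult_left[OF i(1), of "LINT y|lborel. q y"]]) auto
  show "AE x in lborel. integrable lborel (%y. case_prod F (x, y))" using iy by auto
 qed
 note I = this
 show "(LINT x|lborel. (LINT y|lborel. F x y)) = (LINT y|lborel. (LINT x|lborel. F x y))"
  by (rule lborel_pair.Fubini_integral[symmetric, OF I])
 show "integrable lborel (%x. (LINT y|lborel. F x y))" by (rule lborel_pair.integrable_fst[OF I])
 show "integrable lborel (%y. (LINT x|lborel. F x y))" by (rule lborel_pair.integrable_snd[OF I])
qed

lemma integral_Cauchy_Schwarz:
 fixes f g :: "'a => real"
 assumes [measurable]: "f \<in> borel_measurable M" "g \<in> borel_measurable M"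
  and i: "integrable M (%x. (f x)^2)" "integrable M (%x. (g x)^2)"
 shows "integrable M (%x. f x*g x)"
  "(LINT x|M. f x*g x)^2 <= (LINT x|M. (f x)^2)*(LINT x|M. (g x)^2)"
proof -
 have "abs (f x*g x) <= (f x)^2 + (g x)^2" for x
 proof -
  have "0 <= (abs (f x) - abs (g x))^2" "0 <= abs (f x)*abs (g x)" by simp_all
  moreover have "(abs (f x) - abs (g x))^2 = (f x)^2 + (g x)^2 - 2*(abs (f x)*abs (g x))" by (simp add: power2_diff)
  ultimately show ?thesis unfolding abs_mult by linarith
 qed
 thus fg: "integrable M (%x. f x*g x)"
  by (intro Bochner_bound[OF Bochner_add[OF i]]) auto
 define F G P where "F = (LINT x|M. (f x)^2)" and "G = (LINT x|M. (g x)^2)" and "P = (LINT x|M. f x*g x)"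
 have q: "0 <= F - 2*l*P + l^2*G" for l
 proof -
  have "0 <= (LINT x|M. (f x - l*g x)^2)" by simp
  also have "... = (LINT x|M. (f x)^2 - 2*l*(f x*g x) + l^2*(g x)^2)"
   by (rule Bochner_cong) (simp_all add: power2_diff power_mult_distrib algebra_simps)
  also have "... = F - 2*l*P + l^2*G" unfolding F_def G_def P_def using i fg by simp
  finally show ?thesis .
 qed
 have "G >= 0" "F >= 0" by (simp_all add: G_def F_def)
 show "P^2 <= F*G"
 proof (cases "G = 0")
  case True
  have "P = 0"
  proof (rule ccontr)
   assume "P ~= 0"
   thus False using q[of "(F + 1)/(2*P)"] True by simp
  qed
  thus ?thesis using \<open>F \<ge> 0\<close> \<open>G \<ge> 0\<close> by simp
 next
  case False
  hence "G > 0" using \<open>G \<ge> 0\<close> by simp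
  thus ?thesis using q[of "P/G"] by (simp add: field_simps power2_eq_square)
 qed
qed

section \<open>The Airy transform of functions on the half-line\<close>

definition rapid :: "(real => real) => bool" where
 "rapid c \<longleftrightarrow> c \<in> borel_measurable borel \<and> (\<exists>M. \<forall>p\<ge>0. abs (c p) <= M*exp (- p))"

definition airyT :: "real => (real => real) => real => real" where
 "airyT s c x = (LINT p:{0..}|lborel. airy (s + p + x)*c p)"

text \<open>Up to the factor \<open>AB\<close>, a majorant of \<open>airy (s + p + x)\<close> that
  is uniform in \<open>p \<ge> 0\<close>. It separates the variables \<open>p\<close> and
  \<open>x\<close> and so provides the majorants for Fubini.\<close>

definition am :: "real => real => real" where "am s x = min 1 (exp (- s - x))"

lemma am_nonneg [simp]: "0 <= am s x" by (simp add: am_def)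

lemma am_measurable [measurable]: "am s \<in> borel_measurable borel"
 unfolding am_def[abs_def] by measurable

lemma airy_am: "p >= 0 ==> abs (airy (s + p + x)) <= AB*am s x"
proof -
 assume p: "p >= 0"
 have "AB*exp (- (s + p + x)) <= AB*exp (- s - x)" using p airy_bounds(1) by (intro mult_left_mono) auto
 from order_trans[OF airy_bounds(2) this] show ?thesis using airy_bounds(4)[of "s + p + x"]
  unfolding am_def min_def by simp
qed

lemma rapid_measurable: "rapid c ==> c \<in> borel_measurable borel" by (simp add: rapid_def)

lemma rapidE:
 assumes "rapid c" obtains M where "M >= 0" "\<And>p. p >= 0 ==> abs (c p) <= M*exp (- p)"
proof -
 obtain M where M: "\<And>p. p >= 0 ==> abs (c p) <= M*exp (- p)" using assms unfolding rapid_def by blast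
 have "M >= 0" using M[of 0] by auto
 thus ?thesis using M that by blast
qed

lemma integrable_exp_half: "integrable lborel (%p::real. c*(indicator {0..} p*exp (- p)))"
 using integrable_exp_atLeast[of 1 c 0] by simp

lemma integral_exp_half: "(LINT p|lborel. c*(indicator {0..} p*exp (- p))) = (c::real)"
proof -
 have "(LINT p:{0..}|lborel. exp (- p::real)) = 0 - (- exp (- 0))"
  by (rule lborel_integral_derivative_atLeast)
   (use integrable_exp_half[of 1] in \<open>auto simp: set_integrable_def intro!: derivative_eq_intros continuous_intros\<close>, real_asymp)
 hence "(LINT p|lborel. indicator {0..} p*exp (- p::real)) = 1" by (simp add: LINT_def)
 thus ?thesis by simp
qed

lemma rapid_mult_set_integrable:
 assumes "rapid c" "f \<in> borel_measurable borel" "\<And>p. p >= 0 ==> abs (f p) <= B"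
 shows "set_integrable lborel {0..} (%p. f p*c p)"
proof -
 obtain M where M: "M >= 0" "\<And>p. p >= 0 ==> abs (c p) <= M*exp (- p)" using rapidE[OF assms(1)] by blast
 note [measurable] = rapid_measurable[OF assms(1)] assms(2)
 have b: "abs (f p*c p) <= B*M*exp (- p)" if "p >= 0" for p
  using mult_mono[OF assms(3)[OF that] M(2)[OF that]] assms(3)[OF that] by (auto simp: abs_mult mult.assoc)
 show ?thesis unfolding set_integrable_def
  by (rule Bochner_bound[OF integrable_exp_half[of "B*M"]])
   (use order_trans[OF b abs_ge_self] in \<open>auto simp: indicator_def intro!: AE_I2\<close>)
qed

lemma rapid_bounded:
 assumes "rapid c" obtains M where "\<And>p. p >= 0 ==> abs (c p) <= M"
proof -
 obtain M where M: "M >= 0" "\<And>p. p >= 0 ==> abs (c p) <= M*exp (- p)" using rapidE[OF assms(1)] by blast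
 have "abs (c p) <= M" if "p >= 0" for p
 proof -
  have "M*exp (- p) <= M*1" using M that by (intro mult_left_mono) auto
  thus ?thesis using M(2)[OF that] by linarith
 qed
 thus ?thesis using that by blast
qed

lemma rapid_set_integrable:
 assumes "rapid c" "rapid d" shows "set_integrable lborel {0..} (%p. c p*d p)"
proof -
 obtain M where "\<And>p. p >= 0 ==> abs (c p) <= M" using rapid_bounded[OF assms(1)] by blast
 thus ?thesis by (rule rapid_mult_set_integrable[OF assms(2) rapid_measurable[OF assms(1)]])
qed

lemma airyT_measurable: "rapid c ==> airyT s c \<in> borel_measurable borel"
proof -
 assume "rapid c"
 note [measurable] = rapid_measurable[OF this]
 show ?thesis unfolding airyT_def[abs_def] LINT_def by measurable
qed

lemma airyT_bound:
 assumes "\<And>p. p >= 0 ==> abs (c p) <= M*exp (- p)" and r: "rapid c"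
 shows "abs (airyT s c x) <= AB*M*am s x"
proof -
 have s: "set_integrable lborel {0..} (%p. airy (s + p + x)*c p)"
  by (rule rapid_mult_set_integrable[OF r, of _ AB]) (use airy_bounds(4) in auto)
 have "abs (airyT s c x) <= (LINT p|lborel. AB*am s x*M*(indicator {0..} p*exp (- p)))"
  unfolding airyT_def LINT_def
 proof (rule integral_abs_bound_integral)
  fix p :: real
  show "abs (indicat_real {0..} p *\<^sub>R (airy (s + p + x)*c p)) <= AB*am s x*M*(indicator {0..} p*exp (- p))"
   using mult_mono[OF airy_am[of p s x] assms(1)[of p]] airy_bounds(1) by (auto simp: indicator_def abs_mult mult.assoc)
 qed (use s integrable_exp_half in \<open>auto simp: set_integrable_def\<close>)
 thus ?thesis by (simp only: integral_exp_half) (simp add: mult_ac)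
qed

lemma airyT_transpose:
 assumes r: "rapid c" and u [measurable]: "u \<in> borel_measurable borel" and iu: "integrable lborel (%x. abs (u x)*am s x)"
 shows "integrable lborel (%x. u x*airyT s c x)"
  "(LINT x|lborel. u x*airyT s c x) = (LINT p:{0..}|lborel. c p*(LINT x|lborel. u x*airy (s + p + x)))"
proof -
 obtain M where M: "M >= 0" "\<And>p. p >= 0 ==> abs (c p) <= M*exp (- p)" using rapidE[OF r] by blast
 note [measurable] = rapid_measurable[OF r]
 define F where "F = (%x p. u x*(indicator {0..} p*(airy (s + p + x)*c p)))"
 have m: "case_prod F \<in> borel_measurable (lborel \<Otimes>\<^sub>M lborel)" unfolding F_def by measurable
 have bd: "abs (F x p) <= (AB*(abs (u x)*am s x))*(M*(indicator {0..} p*exp (- p)))" for x p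
 proof (cases "p >= 0")
  case True
  have "abs (u x)*(abs (airy (s + p + x))*abs (c p)) <= abs (u x)*((AB*am s x)*(M*exp (- p)))"
   using airy_am[OF True, of s x] M(2)[OF True] airy_bounds(1) by (intro mult_left_mono mult_mono) auto
  thus ?thesis using True by (simp add: F_def abs_mult mult_ac)
 qed (simp add: F_def)
 note f = lborel_Fubini_dominated[OF m integrable_mult_right[OF iu, of AB] integrable_exp_half[of M] bd]
 have 1: "(LINT p|lborel. F x p) = u x*airyT s c x" for x
  unfolding F_def airyT_def LINT_def by simp
 have 2: "(LINT x|lborel. F x p) = indicator {0..} p *\<^sub>R (c p*(LINT x|lborel. u x*airy (s + p + x)))" for p
 proof -
  have "(LINT x|lborel. F x p) = (LINT x|lborel. (indicator {0..} p*c p)*(u x*airy (s + p + x)))"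
   unfolding F_def by (rule Bochner_cong) (simp_all add: mult_ac)
  thus ?thesis by (simp add: mult.assoc)
 qed
 show "integrable lborel (%x. u x*airyT s c x)" using f(2) unfolding 1 .
 show "(LINT x|lborel. u x*airyT s c x) = (LINT p:{0..}|lborel. c p*(LINT x|lborel. u x*airy (s + p + x)))"
  using f(1) unfolding 1 2 LINT_def .
qed

lemma integrable_am_exp:
 assumes t: "0 < t" "t < 2"
 shows "integrable lborel (%x. am s x*am s x*exp (t*x))"
proof -
 define p where "p = min t (2 - t)"
 have p: "p > 0" "p <= t" "t <= 2 - p" using t by (auto simp: p_def)
 have b: "am s x*am s x*exp (t*x) <= exp (2*abs s)*exp (- p*abs x)" for x
 proof (cases "x >= 0")
  case True
  have "(t - 2)*x <= - p*x" using p True by (intro mult_right_mono) auto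
  hence e: "- s - x + (- s - x) + t*x <= 2*abs s - p*abs x" using True by (simp add: algebra_simps abs_if) 
  have "am s x*am s x*exp (t*x) <= exp (- s - x)*exp (- s - x)*exp (t*x)"
   by (intro mult_right_mono mult_mono) (auto simp: am_def)
  also have "... = exp (- s - x + (- s - x) + t*x)" by (simp only: exp_add)
  also have "... <= exp (2*abs s - p*abs x)" using e by simp
  finally show ?thesis by (simp add: exp_add[symmetric])
 next
  case False
  have "t*x <= p*x" using p False by (intro mult_right_mono_neg) auto
  moreover have "p*abs x = - (p*x)" using False by simp
  ultimately have e: "t*x <= 2*abs s - p*abs x" using abs_ge_zero[of s] by linarith
  have "am s x*am s x*exp (t*x) <= 1*1*exp (t*x)"
   by (intro mult_right_mono mult_mono) (auto simp: am_def)
  also have "... <= exp (2*abs s - p*abs x)" using e by simp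
  finally show ?thesis by (simp add: exp_add[symmetric])
 qed
 have "integrable lborel (%x. exp (2*abs s)*exp (- p*abs x))" using integrable_exp_abs[OF p(1)] by simp
 thus ?thesis
  by (rule Bochner_bound) (use b in \<open>auto intro!: AE_I2\<close>)
qed

lemma airyT_gauss1:
 assumes r: "rapid c" and t: "0 < t" "t < 2" and e: "q >= 0"
 shows "integrable lborel (%x. airy (s + q + x)*exp (t*x)*airyT s c x)"
  "(LINT x|lborel. airy (s + q + x)*exp (t*x)*airyT s c x) = (LINT p:{0..}|lborel. c p*gauss_kernel t (s + q) (s + p))"
proof -
 have i: "integrable lborel (%x. abs (airy (s + q + x)*exp (t*x))*am s x)"
 proof (rule Bochner_bound[OF integrable_mult_right[OF integrable_am_exp[OF t], of AB s]])
  have "abs (airy (s + q + x))*(am s x*exp (t*x)) <= (AB*am s x)*(am s x*exp (t*x))" for x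
   using airy_am[OF e, of s x] by (intro mult_right_mono) auto
  thus "AE x in lborel. norm (abs (airy (s + q + x)*exp (t*x))*am s x) <= norm (AB*(am s x*am s x*exp (t*x)))"
   using airy_bounds(1) by (auto simp: abs_mult mult_ac intro!: AE_I2)
 qed simp
 show "integrable lborel (%x. airy (s + q + x)*exp (t*x)*airyT s c x)"
  by (rule airyT_transpose(1)[OF r _ i]) simp
 have g: "(LINT x|lborel. airy (s + q + x)*exp (t*x)*airy (s + p + x)) = gauss_kernel t (s + q) (s + p)" for p
  using airy_gauss[OF t, of "s + q" "s + p"] by (simp add: mult_ac add_ac)
 show "(LINT x|lborel. airy (s + q + x)*exp (t*x)*airyT s c x) = (LINT p:{0..}|lborel. c p*gauss_kernel t (s + q) (s + p))"
  using airyT_transpose(2)[OF r _ i] unfolding g by simp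
qed

text \<open>A Plancherel formula regularised by \<open>exp (t*x)\<close>: as \<open>t\<close> tends
  to 0 the Gauss kernel acts as an approximate identity.\<close>

lemma airyT_gauss2:
 assumes r: "rapid c" "rapid d" and t: "0 < t" "t < 2"
 shows "integrable lborel (%x. airyT s d x*exp (t*x)*airyT s c x)"
  "(LINT x|lborel. airyT s d x*exp (t*x)*airyT s c x)
   = (LINT p:{0..}|lborel. c p*(LINT q:{0..}|lborel. d q*gauss_kernel t (s + p) (s + q)))"
proof -
 note [measurable] = airyT_measurable[OF r(1)] airyT_measurable[OF r(2)]
 obtain M where M: "M >= 0" "\<And>p. p >= 0 ==> abs (d p) <= M*exp (- p)" using rapidE[OF r(2)] by blast
 have i: "integrable lborel (%x. abs (airyT s d x*exp (t*x))*am s x)"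
 proof (rule Bochner_bound[OF integrable_mult_right[OF integrable_am_exp[OF t], of "AB*M" s]])
  have "abs (airyT s d x)*(am s x*exp (t*x)) <= (AB*M*am s x)*(am s x*exp (t*x))" for x
   using airyT_bound[OF M(2) r(2), of s x] by (intro mult_right_mono) auto
  thus "AE x in lborel. norm (abs (airyT s d x*exp (t*x))*am s x) <= norm (AB*M*(am s x*am s x*exp (t*x)))"
   using airy_bounds(1) M by (auto simp: abs_mult mult_ac intro!: AE_I2)
 qed simp
 show "integrable lborel (%x. airyT s d x*exp (t*x)*airyT s c x)"
  by (rule airyT_transpose(1)[OF r(1) _ i]) simp
 have g: "(LINT x|lborel. airyT s d x*exp (t*x)*airy (s + p + x)) = (LINT q:{0..}|lborel. d q*gauss_kernel t (s + p) (s + q))" if "p >= 0" for p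
  using airyT_gauss1(2)[OF r(2) t that] by (simp add: mult_ac)
 show "(LINT x|lborel. airyT s d x*exp (t*x)*airyT s c x)
   = (LINT p:{0..}|lborel. c p*(LINT q:{0..}|lborel. d q*gauss_kernel t (s + p) (s + q)))"
  using airyT_transpose(2)[OF r(1) _ i] by (auto intro!: set_lebesgue_integral_cong simp: g)
qed

section \<open>The heat kernel and Bessel's inequality\<close>

definition heat :: "real => real => real" where "heat t z = exp (- z\<^sup>2/(4*t))/(2 * sqrt (pi*t))"

lemma heat_normal_density: "t > 0 ==> heat t z = normal_density m (sqrt (2*t)) (z + m)"
proof -
 assume t: "t > 0"
 have "sqrt (2*pi*(sqrt (2*t))^2) = sqrt (4*(pi*t))" using t by (simp add: mult_ac)
 also have "... = 2 * sqrt (pi*t)" by (simp add: real_sqrt_mult)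
 finally show ?thesis using t by (simp add: heat_def normal_density_def)
qed

lemma heat_nonneg: "t > 0 ==> heat t z >= 0" by (simp add: heat_def)

lemma heat_integral: 
 assumes "t > 0" shows "integrable lborel (%z. heat t (z - m))" "(LINT z|lborel. heat t (z - m)) = 1"
  "integrable lborel (%z. heat t (m - z))" "(LINT z|lborel. heat t (m - z)) = 1"
proof -
 have e: "heat t (z - m) = normal_density m (sqrt (2*t)) z" "heat t (m - z) = normal_density m (sqrt (2*t)) z" for z
  using heat_normal_density[OF assms, of "z - m" m] by (simp_all add: heat_def power2_commute)
 show "integrable lborel (%z. heat t (z - m))" "(LINT z|lborel. heat t (z - m)) = 1"
  "integrable lborel (%z. heat t (m - z))" "(LINT z|lborel. heat t (m - z)) = 1"
  unfolding e using assms integral_normal_density[of "sqrt (2*t)" m] integrable_normal_moment[of "sqrt (2*t)" m 0] by simp_all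
qed

lemma gauss_kernel_heat: "gauss_kernel t (s + p) (s + q) = exp (t^3/12 - t * s)*(exp (- t*p/2)*exp (- t*q/2)*heat t (p - q))"
proof -
 have "exp (t^3/12 - t*((s + p) + (s + q))/2 - ((s + p) - (s + q))^2/(4*t))
  = exp (t^3/12 - t * s)*(exp (- t*p/2)*exp (- t*q/2)*exp (- (p - q)\<^sup>2/(4*t)))"
  by (simp add: exp_add[symmetric] field_simps)
 thus ?thesis by (simp add: gauss_kernel_def heat_def)
qed

lemma heat_measurable [measurable]: "heat t \<in> borel_measurable borel"
 unfolding heat_def[abs_def] by measurable

text \<open>Bessel's inequality for the Airy transform: the Schur test applied to the heat kernel.\<close>

lemma airyT_Bessel:
 assumes r: "rapid c"
 shows "(LINT x:{l..u}|lborel. (airyT s c x)^2) <= (LINT p:{0..}|lborel. (c p)^2)"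
proof -
 note [measurable] = airyT_measurable[OF r] rapid_measurable[OF r]
 define N where "N = (LINT p:{0..}|lborel. (c p)^2)"
 have ic: "integrable lborel (%p. indicator {0..} p*(c p)^2)"
  using rapid_set_integrable[OF r r] by (simp add: set_integrable_def power2_eq_square)
 obtain M where M: "M >= 0" "\<And>p. p >= 0 ==> abs (c p) <= M*exp (- p)" using rapidE[OF r] by blast
 have main: "(LINT x|lborel. airyT s c x*exp (t*x)*airyT s c x) <= exp (t^3/12 - t * s)*N"
  if t: "0 < t" "t < 2" for t
 proof -
  let ?g = "%p q. gauss_kernel t (s + p) (s + q)" let ?K = "exp (t^3/12 - t * s)"
  have gn: "0 <= ?g p q" for p q using t by (simp add: gauss_kernel_def)
  \<comment> \<open>On the half-line the exponential factors are at most 1. What remains is the heat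
    kernel, whose mass in each variable is 1.\<close>
  have gh: "?g p q <= ?K*heat t (p - q)" if "p >= 0" "q >= 0" for p q
   unfolding gauss_kernel_heat using that t heat_nonneg[OF t(1), of "p - q"]
   by (intro mult_left_mono mult_left_le_one_le) (auto simp: mult_le_one)
  define G where "G = (%p q. indicator {0..} p*(c p*(indicator {0..} q*(c q*?g p q))))"
  define H where "H = (%p q. ?K/2*((indicator {0..} p*(c p)^2)*heat t (p - q) + (indicator {0..} q*(c q)^2)*heat t (p - q)))"
  have [measurable]: "case_prod G \<in> borel_measurable (lborel \<Otimes>\<^sub>M lborel)" 
   unfolding G_def gauss_kernel_def by measurable
  have GH: "abs (G p q) <= H p q" for p q
  proof (cases "p >= 0 \<and> q >= 0")
   case True
   have "2*(abs (c p)*abs (c q)) <= (c p)^2 + (c q)^2" 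
    using zero_le_power2[of "abs (c p) - abs (c q)"] by (simp add: power2_diff)
   hence "abs (c p)*abs (c q)*?g p q <= ((c p)^2 + (c q)^2)/2*(?K*heat t (p - q))"
    using gh gn True by (intro mult_mono) auto
   thus ?thesis using True gn[of p q] by (simp add: G_def H_def abs_mult algebra_simps)
  qed (auto simp: G_def H_def heat_nonneg[OF t(1)] intro!: mult_nonneg_nonneg add_nonneg_nonneg)
  define F1 where "F1 = (%p q. ?K/2*((indicator {0..} p*(c p)^2)*heat t (p - q)))"
  define F2 where "F2 = (%p q. ?K/2*((indicator {0..} q*(c q)^2)*heat t (p - q)))"
  have H12: "H p q = F1 p q + F2 p q" for p q by (simp add: H_def F1_def F2_def algebra_simps)
  have i1: "integrable lborel (F1 p)" for p unfolding F1_def using heat_integral(3)[OF t(1)] by simp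
  have I1: "(LINT q|lborel. F1 p q) = ?K/2*(indicator {0..} p*(c p)^2)" for p
   unfolding F1_def using heat_integral(4)[OF t(1)] by simp
  have i2': "integrable (lborel \<Otimes>\<^sub>M lborel) (case_prod F2)"
  proof -
   have "integrable (lborel \<Otimes>\<^sub>M lborel) (case_prod F1)"
   proof (rule lborel_pair.Fubini_integrable)
    show "case_prod F1 \<in> borel_measurable (lborel \<Otimes>\<^sub>M lborel)" unfolding F1_def by measurable
    have "(%x. (LINT y|lborel. norm (case x of x => F1 x y))) = (%p. ?K/2*(indicator {0..} p*(c p)^2))"
    proof
     fix p
     have "norm (F1 p q) = F1 p q" for q using heat_nonneg[OF t(1)] by (simp add: F1_def)
     thus "(LINT y|lborel. norm (F1 p y)) = ?K/2*(indicator {0..} p*(c p)^2)" using I1 by simp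
    qed
    thus "integrable lborel (%x. (LINT y|lborel. norm (case_prod F1 (x, y))))" using ic by simp
    show "AE x in lborel. integrable lborel (%y. case_prod F1 (x, y))" using i1 by simp
   qed
   hence "integrable (lborel \<Otimes>\<^sub>M lborel) (%(x, y). F1 y x)"
    using lborel_pair.integrable_product_swap[of "case_prod F1"] by simp
   moreover have "(%(x, y). F1 y x) = case_prod F2" by (auto simp: fun_eq_iff F1_def F2_def heat_def power2_commute)
   ultimately show ?thesis by simp
  qed
  have I2: "integrable lborel (%p. (LINT q|lborel. F2 p q))" "(LINT p|lborel. (LINT q|lborel. F2 p q)) = ?K/2*N"
  proof -
   show "integrable lborel (%p. (LINT q|lborel. F2 p q))" using lborel_pair.integrable_fst[OF i2'] by simp
   have "(LINT p|lborel. (LINT q|lborel. F2 p q)) = (LINT q|lborel. (LINT p|lborel. F2 p q))"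
    using lborel_pair.Fubini_integral[of F2] i2' by simp
   also have "... = (LINT q|lborel. ?K/2*(indicator {0..} q*(c q)^2))"
    unfolding F2_def using heat_integral(2)[OF t(1)] by simp
   finally show "(LINT p|lborel. (LINT q|lborel. F2 p q)) = ?K/2*N" by (simp add: N_def LINT_def)
  qed
  have i2: "integrable lborel (F2 p)" for p
  proof (rule Bochner_bound)
   show "integrable lborel (%q. ?K/2*(M*M)*heat t (p - q))" using heat_integral(3)[OF t(1)] by simp
   have "(c q)^2 <= M*M" if "q >= 0" for q
   proof -
    have "M*exp (- q) <= M*1" using M that by (intro mult_left_mono) auto
    hence "abs (c q) <= M" using M(2)[OF that] by linarith
    hence "abs (c q)*abs (c q) <= M*M" by (intro mult_mono) auto
    thus ?thesis by (simp add: power2_eq_square)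
   qed
   hence "(c q)^2*heat t (p - q) <= M*(M*heat t (p - q))" if "q >= 0" for q
    using mult_right_mono[of "(c q)^2" "M*M" "heat t (p - q)"] that heat_nonneg[OF t(1)] by (simp add: mult.assoc)
   thus "AE q in lborel. norm (F2 p q) <= norm (?K/2*(M*M)*heat t (p - q))"
    using heat_nonneg[OF t(1)] M by (auto simp: F2_def indicator_def abs_mult mult.assoc intro!: AE_I2 mult_right_mono)
  qed (simp add: F2_def)
  have iG: "integrable lborel (G p)" for p
   by (rule Bochner_bound[OF Bochner_add[OF i1[of p] i2[of p]]])
    (use GH[of p] H12 in \<open>auto simp: G_def gauss_kernel_def intro!: AE_I2 order_trans[OF _ abs_ge_self]\<close>)
  have "(LINT x|lborel. airyT s c x*exp (t*x)*airyT s c x) = (LINT p|lborel. (LINT q|lborel. G p q))"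
   unfolding airyT_gauss2(2)[OF r r t] LINT_def G_def by (simp add: mult.assoc)
  also have "... <= (LINT p|lborel. ?K/2*(indicator {0..} p*(c p)^2) + (LINT q|lborel. F2 p q))"
  proof (rule integral_mono')
   fix p
   have "(LINT q|lborel. G p q) <= (LINT q|lborel. F1 p q + F2 p q)"
    by (rule integral_mono[OF iG Bochner_add[OF i1 i2]]) (use GH[of p] H12 in \<open>auto intro: order_trans[OF abs_ge_self]\<close>)
   thus "(LINT q|lborel. G p q) <= ?K/2*(indicator {0..} p*(c p)^2) + (LINT q|lborel. F2 p q)"
    using i1 i2 I1 by simp
   show "0 <= ?K/2*(indicator {0..} p*(c p)^2) + (LINT q|lborel. F2 p q)"
    by (intro add_nonneg_nonneg Bochner_nonneg) (auto simp: F2_def heat_nonneg[OF t(1)])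
  qed (use ic I2 in simp)
  also have "... = ?K/2*N + ?K/2*N" using ic I2 by (simp add: N_def LINT_def mult.commute)
  finally show ?thesis by (simp add: mult.commute)
 qed
 \<comment> \<open>On \<open>{l..u}\<close> the regularising factor is at least
   \<open>exp (- t*L)\<close>, so dropping it costs a factor that tends to 1 with
   \<open>t\<close>.\<close>
 define L where "L = abs l + abs u"
 have ub: "(LINT x:{l..u}|lborel. (airyT s c x)^2) <= exp (t*L)*(exp (t^3/12 - t * s)*N)" if t: "0 < t" "t < 2" for t
 proof -
  have "(LINT x:{l..u}|lborel. (airyT s c x)^2) <= (LINT x|lborel. exp (t*L)*(airyT s c x*exp (t*x)*airyT s c x))"
   unfolding LINT_def
  proof (rule integral_mono')
   show "integrable lborel (%x. exp (t*L)*(airyT s c x*exp (t*x)*airyT s c x))"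
    using airyT_gauss2(1)[OF r r t] by simp
   have sq: "0 <= airyT s c x*exp (t*x)*airyT s c x" for x 
    using mult_nonneg_nonneg[OF zero_le_power2[of "airyT s c x"], of "exp (t*x)"] by (simp add: power2_eq_square mult_ac)
   thus "0 <= exp (t*L)*(airyT s c x*exp (t*x)*airyT s c x)" for x by simp
   fix x
   show "indicat_real {l..u} x *\<^sub>R (airyT s c x)\<^sup>2 <= exp (t*L)*(airyT s c x*exp (t*x)*airyT s c x)"
   proof (cases "x \<in> {l..u}")
    case True
    hence "- L <= x" unfolding L_def by auto
    hence "t*L + t*x >= 0" using t by (simp flip: distrib_left)
    hence "1 <= exp (t*L)*exp (t*x)" by (simp add: exp_add[symmetric])
    hence "1*(airyT s c x)^2 <= (exp (t*L)*exp (t*x))*(airyT s c x)^2" by (intro mult_right_mono) auto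
    thus ?thesis using True by (simp add: power2_eq_square mult_ac)
   qed (use sq in simp)
  qed
  also have "... <= exp (t*L)*(exp (t^3/12 - t * s)*N)" using main[OF t] by simp
  finally show ?thesis .
 qed
 have lim: "((%t. exp (t*L)*(exp (t^3/12 - t * s)*N)) \<longlongrightarrow> exp (0*L)*(exp (0^3/12 - 0 * s)*N)) (at_right 0)"
  by (intro tendsto_intros) auto
 have "(LINT x:{l..u}|lborel. (airyT s c x)^2) <= exp (0*L)*(exp (0^3/12 - 0 * s)*N)"
  by (rule tendsto_lowerbound[OF lim]) (use ub in \<open>auto simp: eventually_at_right_field intro!: exI[of _ 2]\<close>)
 thus ?thesis by (simp add: N_def)
qed

section \<open>The Airy kernel as a positive operator\<close>

text \<open>The adjoint of \<open>airyT s\<close> on functions that live on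
  \<open>{a..b}\<close>.\<close>

definition airyC :: "real => real => real => (real => real) => real => real" where
 "airyC s a b v p = integral {a..b} (%x. airy (s + p + x) * v x)"

lemma integral_eq_lborel:
 fixes f :: "real => real"
 assumes "continuous_on {a..b} f"
 shows "integral {a..b} f = (LINT x:{a..b}|lborel. f x)"
 using set_borel_integral_eq_integral(2)[OF borel_integrable_atLeastAtMost'[OF assms]] by simp

lemma airyC_continuous_on:
 assumes "continuous_on {a..b} v" shows "continuous_on UNIV (airyC s a b v)"
proof -
 have "continuous_on (UNIV \<times> {a..b}) (%(p, x). airy (s + p + x) * v x)"
  unfolding case_prod_beta 
  by (intro continuous_intros continuous_on_compose2[OF assms]) auto
 hence "continuous_on (UNIV \<times> cbox a b) (%(p, x). airy (s + p + x) * v x)" by simp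
 from integral_continuous_on_param[OF this]
 show ?thesis by (simp add: airyC_def[abs_def])
qed

lemma airyC_bound:
 assumes v: "continuous_on {a..b} v" and B: "\<And>x. x \<in> {a..b} ==> abs (v x) <= B" and ab: "a <= b" 
 shows "abs (airyC s a b v p) <= AB*exp (- s - a)*B*(b - a)*exp (- p)"
proof -
 have "norm (integral {a..b} (%x. airy (s + p + x) * v x)) <= (AB*exp (- s - a - p)*B)*(b - a)"
 proof (rule integral_bound[OF ab])
  show "continuous_on {a..b} (%x. airy (s + p + x) * v x)" by (intro continuous_intros v)
  fix x assume x: "x \<in> {a..b}"
  have "AB*exp (- (s + p + x)) <= AB*exp (- s - a - p)" using x airy_bounds(1) by (intro mult_left_mono) auto
  hence "abs (airy (s + p + x))*abs (v x) <= (AB*exp (- s - a - p))*B"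
   using order_trans[OF airy_bounds(2)] B[OF x] airy_bounds(1) by (intro mult_mono) auto
  thus "norm (airy (s + p + x) * v x) <= AB*exp (- s - a - p)*B" by (simp add: abs_mult)
 qed
 also have "exp (- s - a - p) = exp (- s - a)*exp (- p)" by (simp add: exp_add[symmetric])
 finally show ?thesis by (simp add: airyC_def mult_ac)
qed

lemma airyC_rapid:
 assumes v: "continuous_on {a..b} v" and ab: "a <= b" 
 shows "rapid (airyC s a b v)"
proof -
 have "compact (v ` {a..b})" using v by (intro compact_continuous_image) auto
 then obtain B where "\<And>x. x \<in> {a..b} ==> abs (v x) <= B" by (drule_tac compact_imp_bounded) (force simp: bounded_iff)
 from airyC_bound[OF v this ab] show ?thesis unfolding rapid_def
  using borel_measurable_continuous_onI[OF airyC_continuous_on[OF v]] by blast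
qed

lemma airyT_transpose_interval:
 assumes r: "rapid c" and v: "continuous_on {a..b} v"
  and cT: "continuous_on {a..b} (%x. v x*airyT s c x)"
 shows "integral {a..b} (%x. v x*airyT s c x) = (LINT p:{0..}|lborel. c p*airyC s a b v p)"
proof -
 define u where "u = (%x. indicator {a..b} x *\<^sub>R v x)"
 have iu: "integrable lborel u" using borel_integrable_atLeastAtMost'[OF v] unfolding u_def set_integrable_def .
 hence [measurable]: "u \<in> borel_measurable borel" by auto
 have iu': "integrable lborel (%x. abs (u x)*am s x)"
  by (rule Bochner_bound[OF iu]) (auto intro!: AE_I2 mult_left_le simp: abs_mult am_def)
 have "integral {a..b} (%x. v x*airyT s c x) = (LINT x|lborel. u x*airyT s c x)"
  unfolding integral_eq_lborel[OF cT] LINT_def u_def by (simp add: mult.assoc)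
 also have "... = (LINT p:{0..}|lborel. c p*(LINT x|lborel. u x*airy (s + p + x)))"
  by (rule airyT_transpose(2)[OF r _ iu']) simp
 also have "(%p. (LINT x|lborel. u x*airy (s + p + x))) = airyC s a b v"
 proof
  fix p
  have "continuous_on {a..b} (%x. airy (s + p + x) * v x)" by (intro continuous_intros v)
  from integral_eq_lborel[OF this]
  show "(LINT x|lborel. u x*airy (s + p + x)) = airyC s a b v p"
   unfolding airyC_def LINT_def u_def by (simp add: mult_ac)
 qed
 finally show ?thesis .
qed

text \<open>The factorisation of the Airy kernel operator into the Airy transform and its adjoint.
  It is the transposition formula for \<open>c p = airy (s + p + x)\<close>, whose Airy transform is
  the kernel itself.\<close>

lemma airyT_airyC:
 assumes v: "continuous_on {a..b} v" and ab: "a <= b"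
 shows "airyT s (airyC s a b v) x = integral {a..b} (%y. airyK (s + x) (s + y) * v y)"
proof -
 define c where "c = (%p. if p >= 0 then airy (s + p + x) else 0)"
 have r: "rapid c" unfolding rapid_def
 proof
  show "c \<in> borel_measurable borel" unfolding c_def by measurable
  have "abs (airy (s + p + x)) <= AB*exp (- s - x)*exp (- p)" for p
   using airy_bounds(2)[of "s + p + x"] by (simp add: mult.assoc exp_add[symmetric] algebra_simps)
  thus "\<exists>M. \<forall>p\<ge>0. abs (c p) <= M*exp (- p)" by (auto simp: c_def)
 qed
 have T: "airyT s c y = airyK (s + x) (s + y)" for y
  unfolding airyT_def airyK_def c_def by (auto intro!: set_lebesgue_integral_cong simp: add_ac mult_ac)
 have "integral {a..b} (%y. v y*airyT s c y) = (LINT p:{0..}|lborel. c p*airyC s a b v p)"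
  by (rule airyT_transpose_interval[OF r v]) (unfold T, intro continuous_intros v)
 also have "... = airyT s (airyC s a b v) x"
  unfolding airyT_def c_def by (auto intro!: set_lebesgue_integral_cong)
 finally show ?thesis unfolding T by (simp add: mult.commute)
qed

definition airyQ :: "real => real => real => (real => real) => real => real" where
 "airyQ s a b v x = integral {a..b} (%y. airyK (s + x) (s + y) * v y)"

lemma airyQ_continuous_on:
 assumes "continuous_on {a..b} v" shows "continuous_on UNIV (airyQ s a b v)"
proof -
 have "continuous_on (UNIV \<times> {a..b}) (%(x, y). airyK (s + x) (s + y) * v y)"
  unfolding case_prod_beta 
  by (intro continuous_intros continuous_on_compose2[OF assms]) auto
 hence "continuous_on (UNIV \<times> cbox a b) (%(x, y). airyK (s + x) (s + y) * v y)" by simp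
 from integral_continuous_on_param[OF this]
 show ?thesis by (simp add: airyQ_def[abs_def])
qed

lemma airyC_norm:
 assumes v: "continuous_on {a..b} v" and ab: "a <= b"
 shows "(LINT p:{0..}|lborel. (airyC s a b v p)^2) = integral {a..b} (%x. v x*airyQ s a b v x)"
proof -
 have "integral {a..b} (%x. v x*airyT s (airyC s a b v) x) = (LINT p:{0..}|lborel. airyC s a b v p*airyC s a b v p)"
 proof (rule airyT_transpose_interval[OF airyC_rapid[OF v ab] v])
  show "continuous_on {a..b} (%x. v x*airyT s (airyC s a b v) x)"
   unfolding airyT_airyC[OF v ab] airyQ_def[symmetric]
   by (intro continuous_intros v continuous_on_subset[OF airyQ_continuous_on[OF v]]) auto
 qed
 thus ?thesis unfolding airyT_airyC[OF v ab] airyQ_def by (simp add: power2_eq_square)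
qed

text \<open>This is \<open>K\<^sup>2 \<le> K\<close>: Bessel's inequality applied to the inner
  factor of \<open>K\<close>, whose squared norm is the quadratic form of \<open>K\<close>.\<close>

lemma airyQ_Bessel:
 assumes v: "continuous_on {a..b} v" and ab: "a <= b"
 shows "integral {l..u} (%x. (airyQ s a b v x)^2) <= integral {a..b} (%x. v x*airyQ s a b v x)"
proof -
 have "continuous_on {l..u} (%x. (airyQ s a b v x)^2)"
  by (intro continuous_intros continuous_on_subset[OF airyQ_continuous_on[OF v]]) auto
 hence "integral {l..u} (%x. (airyQ s a b v x)^2) = (LINT x:{l..u}|lborel. (airyT s (airyC s a b v) x)^2)"
  unfolding airyT_airyC[OF v ab] airyQ_def[symmetric] by (rule integral_eq_lborel)
 also have "... <= (LINT p:{0..}|lborel. (airyC s a b v p)^2)" by (rule airyT_Bessel[OF airyC_rapid[OF v ab]])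
 finally show ?thesis unfolding airyC_norm[OF v ab] .
qed

lemma airyQ_form_nonneg:
 assumes v: "continuous_on {a..b} v" and ab: "a <= b"
 shows "0 <= integral {a..b} (%x. v x*airyQ s a b v x)"
 unfolding airyC_norm[OF v ab, symmetric] LINT_def by (rule Bochner_nonneg) simp

text \<open>The reproducing-kernel bound: Cauchy-Schwarz in the half-line variable between
  \<open>airy (s + p + x)\<close>, of squared norm \<open>airyK (s + x) (s + x)\<close>, and
  \<open>airyC s a b v\<close>.\<close>

lemma airyQ_pointwise:
 assumes v: "continuous_on {a..b} v" and ab: "a <= b"
 shows "(airyQ s a b v x)^2 <= airyK (s + x) (s + x)*integral {a..b} (%x. v x*airyQ s a b v x)"
proof -
 note r = airyC_rapid[OF v ab, of s]
 note [measurable] = rapid_measurable[OF r]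
 let ?f = "%p. indicator {0..} p*airy (s + p + x)" let ?g = "%p. indicator {0..} p*airyC s a b v p"
 have 1: "(?f p)^2 = indicator {0..} p *\<^sub>R (airy (s + x + p)*airy (s + x + p))" for p
  by (simp add: indicator_def power2_eq_square add_ac)
 have 2: "(?g p)^2 = indicator {0..} p *\<^sub>R (airyC s a b v p)\<^sup>2" for p by (simp add: indicator_def)
 have 3: "?f p*?g p = indicator {0..} p *\<^sub>R (airy (s + p + x)*airyC s a b v p)" for p by (simp add: indicator_def)
 have "(LINT p|lborel. ?f p*?g p)^2 <= (LINT p|lborel. (?f p)^2)*(LINT p|lborel. (?g p)^2)"
 proof (rule integral_Cauchy_Schwarz(2))
  show "integrable lborel (%p. (?f p)^2)" unfolding 1
   using set_integrable_airy_prod[OF airy_bounds(2) airy_bounds(2), of 0 "s+x" "s+x"] by (simp add: set_integrable_def)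
  show "integrable lborel (%p. (?g p)^2)" unfolding 2
   using rapid_set_integrable[OF r r] by (simp add: set_integrable_def power2_eq_square)
 qed simp_all
 thus ?thesis
  unfolding 1 2 3 LINT_def[symmetric] airyT_def[symmetric] airyK_def[symmetric] airyC_norm[OF v ab] airyT_airyC[OF v ab] airyQ_def[symmetric] .
qed

text \<open>An a priori bound along the segment from 1 to \<open>1 + N\<close> takes the place of a
  Fredholm alternative. Where \<open>1 + q N\<close> is onto, its inverse is bounded by
  \<open>m\<close>, and a contraction makes \<open>1 + q' N\<close> onto for all \<open>q'\<close>
  within a distance \<open>p\<close> that does not depend on \<open>q\<close>; finitely many steps
  lead from 0 to 1.\<close>

lemma method_of_continuity:
 fixes N :: "'a::{real_normed_vector, complete_space} => 'a"
 assumes N: "bounded_linear N" and M: "\<And>q f. q \<in> {0..1} ==> norm f <= M*norm (f + q *\<^sub>R N f)"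
 shows "\<exists>f. f + N f = g"
proof -
 interpret N: bounded_linear N by (rule N)
 obtain K where K: "K > 0" "\<And>x. norm (N x) <= norm x*K" using N.pos_bounded by blast
 define P where "P = (%q. \<forall>g. \<exists>f. f + q *\<^sub>R N f = g)"
 define m where "m = abs M + 1"
 have m: "m > 0" and Mm: "norm f <= m*norm (f + q *\<^sub>R N f)" if "q \<in> {0..1}" for q f
 proof -
  have "M*norm (f + q *\<^sub>R N f) <= m*norm (f + q *\<^sub>R N f)" unfolding m_def by (intro mult_right_mono) auto
  with M[OF that, of f] show "norm f <= m*norm (f + q *\<^sub>R N f)" by linarith
 qed (auto simp: m_def)
 have m: "m > 0" by (simp add: m_def)
 \<comment> \<open>Chosen so that \<open>m*p*K = 1/2\<close>, the contraction factor.\<close>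
 define p where "p = 1/(2*m*K)"
 have p: "p > 0" using m K unfolding p_def by simp
 have step: "P q'" if q: "q \<in> {0..1}" "abs (q' - q) <= p" "P q" for q q'
  unfolding P_def
 proof
  fix g
  define S where "S = (%h. SOME f. f + q *\<^sub>R N f = h)"
  have S: "S h + q *\<^sub>R N (S h) = h" for h
   unfolding S_def using someI_ex[of "%f. f + q *\<^sub>R N f = h"] q(3) unfolding P_def by blast
  define T where "T = (%f. S (g - (q' - q) *\<^sub>R N f))"
  have "dist (T x) (T y) <= 1/2*dist x y" for x y
  proof -
   have "(T x - T y) + q *\<^sub>R N (T x - T y) = (T x + q *\<^sub>R N (T x)) - (T y + q *\<^sub>R N (T y))"
    by (simp add: N.diff algebra_simps)
   also have "... = - ((q' - q) *\<^sub>R N (x - y))" unfolding T_def S by (simp add: N.diff algebra_simps)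
   finally have "norm (T x - T y) <= m*norm ((q' - q) *\<^sub>R N (x - y))" using Mm[OF q(1), of "T x - T y"] by simp
   also have "... <= m*(p*(norm (x - y)*K))"
    using q(2) K m by (simp add: mult_mono)
   also have "... = 1/2*norm (x - y)" using m K unfolding p_def by (simp add: field_simps)
   finally show ?thesis by (simp add: dist_norm)
  qed
  hence "\<exists>!f. T f = f" by (intro banach_fix_type[of "1/2"]) auto
  then obtain f where "T f = f" by blast
  hence "f + q *\<^sub>R N f = g - (q' - q) *\<^sub>R N f" using S unfolding T_def by metis
  hence "f + q' *\<^sub>R N f = g" by (simp add: algebra_simps)
  thus "\<exists>f. f + q' *\<^sub>R N f = g" by blast
 qed
 have "P (min 1 (real n*p))" for n
 proof (induction n)
  case 0
  thus ?case by (simp add: P_def)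
 next
  case (Suc n)
  define x where "x = real n*p"
  have x: "x >= 0" "real (Suc n)*p = x + p" using p by (simp_all add: x_def algebra_simps)
  have "abs (min 1 (x + p) - min 1 x) <= p" using p by (simp add: min_def)
  thus ?case using step[of "min 1 x" "min 1 (x + p)"] Suc x p unfolding x(2) x_def[symmetric] by simp
 qed
 moreover obtain n where "real n*p >= 1" using reals_Archimedean3[OF p] by (meson less_imp_le)
 hence "min 1 (real n*p) = 1" by simp
 ultimately have "P 1" by metis
 thus ?thesis by (simp add: P_def)
qed

lemma integral_Cauchy_Schwarz_interval:
 fixes f g :: "real => real"
 assumes f: "continuous_on {a..b} f" and g: "continuous_on {a..b} g"
 shows "(integral {a..b} (%x. f x*g x))^2 <= integral {a..b} (%x. (f x)^2)*integral {a..b} (%x. (g x)^2)"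
proof -
 let ?f = "%x. indicator {a..b} x *\<^sub>R f x" let ?g = "%x. indicator {a..b} x *\<^sub>R g x"
 have i: "integrable lborel ?f" "integrable lborel ?g"
  using borel_integrable_atLeastAtMost'[OF f] borel_integrable_atLeastAtMost'[OF g] unfolding set_integrable_def by simp_all
 have c: "continuous_on {a..b} (%x. (f x)^2)" "continuous_on {a..b} (%x. (g x)^2)" "continuous_on {a..b} (%x. f x*g x)"
  by (intro continuous_intros f g)+
 have e: "(?f x)^2 = indicator {a..b} x *\<^sub>R (f x)\<^sup>2" "(?g x)^2 = indicator {a..b} x *\<^sub>R (g x)\<^sup>2"
  "?f x*?g x = indicator {a..b} x *\<^sub>R (f x*g x)" for x by (simp_all add: indicator_def)
 have "(LINT x|lborel. ?f x*?g x)^2 <= (LINT x|lborel. (?f x)^2)*(LINT x|lborel. (?g x)^2)"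
 proof (rule integral_Cauchy_Schwarz(2))
  show "integrable lborel (%x. (?f x)^2)" "integrable lborel (%x. (?g x)^2)"
   unfolding e using borel_integrable_atLeastAtMost'[OF c(1)] borel_integrable_atLeastAtMost'[OF c(2)]
   unfolding set_integrable_def by blast+
 qed (use i in auto)
 thus ?thesis unfolding e LINT_def[symmetric] using c by (simp add: integral_eq_lborel)
qed

lemma integral_indicator_le:
 assumes "e >= 0"
 shows "indicat_real {-e..e} integrable_on {a..b}" "integral {a..b} (indicat_real {-e..e}) <= 2*e"
proof -
 have lm: "{-e..e} \<inter> {a..b} \<in> lmeasurable" by (simp add: Int_atLeastAtMost)
 show "indicat_real {-e..e} integrable_on {a..b}"
  using lm by (subst integrable_on_indicator) (simp_all add: Int_commute)
 have "integral {a..b} (indicat_real {-e..e}) = measure lebesgue ({-e..e} \<inter> {a..b})"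
  using lm by (subst integral_indicator) (simp_all add: Int_commute)
 also have "... <= measure lebesgue {-e..e}" by (rule measure_mono_fmeasurable) auto
 finally show "integral {a..b} (indicat_real {-e..e}) <= 2*e" using assms by simp
qed

text \<open>Coercivity. A function in the range of the Airy kernel cannot concentrate near the zero of
 \<open>1 + \<sigma>\<close> at the origin, because its values are bounded by its norm.\<close>

lemma airyQ_coercive:
 assumes f: "continuous_on {a..b} f" and g: "continuous_on {a..b} g" and \<sigma>: "continuous_on {a..b} \<sigma>" and ab: "a <= b"
  and eq: "\<And>x. x \<in> {a..b} ==> f x + airyQ s a b (%y. \<sigma> y*f y) x = g x"
  and s1: "\<And>x. x \<in> {a..b} ==> - \<sigma> x <= 1" and s2: "\<And>x. x \<in> {a..b} ==> e <= abs x ==> - \<sigma> x <= p"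
  and p: "0 <= p" "p < 1" and e: "0 <= e" "4*e*C <= 1"
  and C: "\<And>x. abs x <= e ==> airyK (s + x) (s + x) <= C"
 shows "integral {a..b} (%x. (\<sigma> x*f x)*airyQ s a b (%y. \<sigma> y*f y) x) <= (2/(1 - p))^2*integral {a..b} (%x. (\<sigma> x*g x)^2)"
proof -
 let ?v = "%y. \<sigma> y*f y"
 define q where "q = airyQ s a b ?v"
 define B where "B = integral {a..b} (%x. ?v x*q x)"
 define S where "S = integral {a..b} (%x. (\<sigma> x*g x)^2)"
 have v: "continuous_on {a..b} ?v" by (intro continuous_intros f \<sigma>)
 have q: "continuous_on {a..b} q" unfolding q_def by (rule continuous_on_subset[OF airyQ_continuous_on[OF v]]) auto
 have B0: "B >= 0" unfolding B_def q_def by (rule airyQ_form_nonneg[OF v ab])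
 have B1: "integral {a..b} (%x. (q x)^2) <= B" unfolding B_def q_def by (rule airyQ_Bessel[OF v ab])
 have B2: "(q x)^2 <= airyK (s + x) (s + x)*B" for x unfolding B_def q_def by (rule airyQ_pointwise[OF v ab])
 have iq: "(%x. (q x)^2) integrable_on {a..b}" "(%x. \<sigma> x*(q x)^2) integrable_on {a..b}"
  "(%x. (\<sigma> x*g x)*q x) integrable_on {a..b}"
  by (intro integrable_continuous_real continuous_intros q \<sigma> g)+
 \<comment> \<open>The equation \<open>f = g - q\<close> paired with
   \<open>\<sigma> q\<close>.\<close>
 have ee: "B = integral {a..b} (%x. (\<sigma> x*g x)*q x) - integral {a..b} (%x. \<sigma> x*(q x)^2)"
 proof -
  have "?v x*q x = (\<sigma> x*g x)*q x - \<sigma> x*(q x)^2" if "x \<in> {a..b}" for x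
  proof -
   have "f x = g x - q x" using eq[OF that] unfolding q_def by simp
   show ?thesis unfolding \<open>f x = g x - q x\<close> by (simp add: power2_eq_square algebra_simps)
  qed
  hence "B = integral {a..b} (%x. (\<sigma> x*g x)*q x - \<sigma> x*(q x)^2)"
   unfolding B_def by (intro HK_cong) auto
  thus ?thesis using iq by (simp add: HK_diff)
 qed
 have "- integral {a..b} (%x. \<sigma> x*(q x)^2) = integral {a..b} (%x. - (\<sigma> x*(q x)^2))" by simp
 \<comment> \<open>For \<open>abs x \<le> e\<close> it is only known that
   \<open>- \<sigma> \<le> 1 = p + (1 - p)\<close>. The excess is paid with
   \<open>q\<^sup>2 \<le> C*B\<close> on an interval of length at most \<open>2*e\<close>; by
   \<open>4*e*C \<le> 1\<close> this uses up at most half of the gap \<open>1 - p\<close>.\<close>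
 also have "... <= integral {a..b} (%x. p*(q x)^2 + (1 - p)*(C*B)*indicat_real {-e..e} x)"
 proof (rule integral_le)
  show "(%x. - (\<sigma> x*(q x)^2)) integrable_on {a..b}" using iq(2) by (rule integrable_neg)
  show "(%x. p*(q x)^2 + (1 - p)*(C*B)*indicat_real {- e..e} x) integrable_on {a..b}"
   by (intro integrable_add integrable_on_mult_right iq integral_indicator_le e)
  fix x assume x: "x \<in> {a..b}"
  show "- (\<sigma> x*(q x)^2) <= p*(q x)^2 + (1 - p)*(C*B)*indicat_real {- e..e} x"
  proof (cases "abs x <= e")
   case True
   have "(q x)^2 <= C*B" using B2[of x] mult_right_mono[OF C[OF True] B0] by linarith
   hence "(1 - p)*(q x)^2 <= (1 - p)*(C*B)" using p by (intro mult_left_mono) auto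
   moreover have "(- \<sigma> x)*(q x)^2 <= 1*(q x)^2" by (intro mult_right_mono s1[OF x]) simp
   ultimately show ?thesis using True by (auto simp: algebra_simps indicator_def abs_le_iff)
  next
   case False
   have "(- \<sigma> x)*(q x)^2 <= p*(q x)^2" using False x by (intro mult_right_mono s2) auto
   thus ?thesis using False by (auto simp: indicator_def)
  qed
 qed
 also have "... = p*integral {a..b} (%x. (q x)^2) + (1 - p)*(C*B)*integral {a..b} (indicat_real {-e..e})"
  by (subst HK_add) (auto intro!: integrable_on_mult_right iq integral_indicator_le e)
 also have "... <= p*B + (1 - p)*(B/2)"
 proof (rule add_mono)
  show "p*integral {a..b} (%x. (q x)^2) <= p*B" using B1 p by (intro mult_left_mono) auto
  have C0: "C >= 0" using C[of 0] e airyK_diag_nonneg[of "s+0"] by (auto intro: order_trans)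
  have "(1 - p)*(C*B)*integral {a..b} (indicat_real {-e..e}) <= (1 - p)*(C*B)*(2*e)"
   using integral_indicator_le(2)[OF e(1)] p B0 C0 by (intro mult_left_mono) auto
  also have "... = (1 - p)*((4*e*C)*(B/2))" by simp
  also have "... <= (1 - p)*(1*(B/2))" using p e B0 by (intro mult_left_mono mult_right_mono) auto
  finally show "(1 - p)*(C*B)*integral {a..b} (indicat_real {-e..e}) <= (1 - p)*(B/2)" by simp
 qed
 finally have "- integral {a..b} (%x. \<sigma> x*(q x)^2) <= p*B + (1 - p)*(B/2)" .
 moreover have "(1 - p)/2*B = B - (p*B + (1 - p)*(B/2))" by (simp add: field_simps)
 ultimately have k: "(1 - p)/2*B <= integral {a..b} (%x. (\<sigma> x*g x)*q x)" using ee by linarith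
 have k0: "0 <= (1 - p)/2*B" using p B0 by simp
 have S0: "S >= 0" unfolding S_def by (intro HK_nonneg integrable_continuous_real continuous_intros \<sigma> g) auto
 \<comment> \<open>Cauchy-Schwarz together with Bessel's bound of
   \<open>\<integral> q\<^sup>2\<close> by \<open>B\<close> leaves one factor \<open>B\<close> on
   the right, which cancels against the square on the left.\<close>
 have "((1 - p)/2*B)^2 <= (integral {a..b} (%x. (\<sigma> x*g x)*q x))^2"
  using k k0 by (intro power_mono) auto
 also have "... <= S*integral {a..b} (%x. (q x)^2)" unfolding S_def
  by (rule integral_Cauchy_Schwarz_interval) (intro continuous_intros \<sigma> g q)+
 also have "... <= S*B" using B1 S0 by (intro mult_left_mono) auto
 finally have "((1 - p)/2)^2*B*B <= S*B" by (simp add: power2_eq_square mult_ac)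
 hence "((1 - p)/2)^2*B <= S" using B0 S0 
  by (cases "B = 0") (auto simp: mult_le_cancel_right)
 hence "B <= S/((1 - p)/2)^2" using p by (simp add: field_simps)
 thus ?thesis using p by (simp add: B_def S_def q_def power_divide field_simps)
qed

lemma continuous_on_bounded_ex:
 fixes f :: "real => real"
 assumes "continuous_on {a..b} f" shows "\<exists>B\<ge>0. \<forall>x\<in>{a..b}. abs (f x) <= B"
proof -
 have "compact (f ` {a..b})" using assms by (intro compact_continuous_image) auto
 then obtain B where "\<forall>x\<in>{a..b}. abs (f x) <= B" by (drule_tac compact_imp_bounded) (force simp: bounded_iff)
 thus ?thesis by (intro exI[of _ "abs B"]) force
qed

text \<open>The reproducing-kernel bound turns the estimate of the quadratic form into a bound of
  the values. The exponential bounds the diagonal of the kernel for \<open>s \<ge> s1\<close> and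
  \<open>x \<ge> - L\<close>; \<open>sqrt (b - a)\<close> comes from estimating an
  \<open>L\<^sup>2\<close> norm by a supremum.\<close>

lemma airyQ_sup_bound:
 assumes f: "continuous_on {a..b} f" and g: "continuous_on {a..b} g" and \<sigma>: "continuous_on {a..b} \<sigma>" and ab: "a <= b"
  and eq: "\<And>x. x \<in> {a..b} ==> f x + airyQ s a b (%y. \<sigma> y*f y) x = g x"
  and s1: "\<And>x. x \<in> {a..b} ==> - \<sigma> x <= 1" and s2: "\<And>x. x \<in> {a..b} ==> e <= abs x ==> - \<sigma> x <= p"
  and p: "0 <= p" "p < 1" and e: "0 <= e" "4*e*C <= 1"
  and C: "\<And>x. abs x <= e ==> airyK (s + x) (s + x) <= C"
  and G: "\<And>x. x \<in> {a..b} ==> abs (g x) <= G" and W: "\<And>x. x \<in> {a..b} ==> abs (\<sigma> x) <= W"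
  and L: "s1 <= s" "- L <= x"
 shows "abs (airyQ s a b (%y. \<sigma> y*f y) x) <= AB*exp (L - s1)*(2/(1 - p))*W * sqrt (b - a)*G"
proof -
 let ?v = "%y. \<sigma> y*f y"
 define B where "B = integral {a..b} (%x. ?v x*airyQ s a b ?v x)"
 have v: "continuous_on {a..b} ?v" by (intro continuous_intros f \<sigma>)
 have G0: "G >= 0" "W >= 0" using G[of a] W[of a] ab by auto
 have S: "integral {a..b} (%x. (\<sigma> x*g x)^2) <= (W*G)^2*(b - a)"
 proof -
  have "norm (integral {a..b} (%x. (\<sigma> x*g x)^2)) <= (W*G)^2*(b - a)"
  proof (rule integral_bound[OF ab])
   show "continuous_on {a..b} (%x. (\<sigma> x*g x)^2)" by (intro continuous_intros \<sigma> g)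
   fix x assume "x \<in> {a..b}"
   hence "abs (\<sigma> x*g x) <= W*G" unfolding abs_mult using G W G0 by (intro mult_mono) auto
   thus "norm ((\<sigma> x*g x)^2) <= (W*G)^2" using power_mono[of "abs (\<sigma> x*g x)" "W*G" 2] by simp
  qed
  thus ?thesis by simp
 qed
 have "B <= (2/(1 - p))^2*integral {a..b} (%x. (\<sigma> x*g x)^2)"
  unfolding B_def by (rule airyQ_coercive[OF f g \<sigma> ab eq s1 s2 p e C])
 also have "... <= (2/(1 - p))^2*((W*G)^2*(b - a))" using S by (intro mult_left_mono) auto
 finally have B: "B <= (2/(1 - p))^2*((W*G)^2*(b - a))" .
 have B0: "B >= 0" unfolding B_def by (rule airyQ_form_nonneg[OF v ab])
 have K: "airyK (s + x) (s + x) <= (AB*exp (L - s1))^2"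
 proof -
  have "airyK (s + x) (s + x) <= AB^2*exp (- (s + x) - (s + x))" using airyK_bound[of "s+x" "s+x"] by auto
  also have "... <= AB^2*exp ((L - s1) + (L - s1))" using L by (intro mult_left_mono) auto
  also have "... = (AB*exp (L - s1))^2" by (simp only: exp_add power2_eq_square mult_ac)
  finally show ?thesis .
 qed
 have "(airyQ s a b ?v x)^2 <= airyK (s + x) (s + x)*B" unfolding B_def by (rule airyQ_pointwise[OF v ab])
 also have "... <= (AB*exp (L - s1))^2*((2/(1 - p))^2*((W*G)^2*(b - a)))"
  using K B B0 airyK_diag_nonneg by (intro mult_mono) auto
 also have "... = (AB*exp (L - s1)*(2/(1 - p))*W * sqrt (b - a)*G)^2"
  using ab by (simp add: power_mult_distrib power_divide mult_ac)
 finally show ?thesis using p G0 ab airy_bounds(1) by (simp add: abs_le_square_iff[symmetric])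
qed

lemma airyQ_linear:
 assumes "continuous_on {a..b} u" "continuous_on {a..b} v"
 shows "airyQ s a b (%y. c*u y + d * v y) x = c*airyQ s a b u x + d*airyQ s a b v x"
proof -
 have i: "(%y. airyK (s + x) (s + y)*u y) integrable_on {a..b}" "(%y. airyK (s + x) (s + y) * v y) integrable_on {a..b}"
  by (intro integrable_continuous_real continuous_intros assms)+
 have "airyQ s a b (%y. c*u y + d * v y) x = integral {a..b} (%y. c*(airyK (s + x) (s + y)*u y) + d*(airyK (s + x) (s + y) * v y))"
  unfolding airyQ_def by (simp add: algebra_simps)
 also have "... = c*airyQ s a b u x + d*airyQ s a b v x"
  unfolding airyQ_def by (subst HK_add) (auto intro!: integrable_on_mult_right i)
 finally show ?thesis .
qed

lemma airyQ_solvable: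
 assumes g: "continuous_on {a..b} g" and \<sigma>: "continuous_on {a..b} \<sigma>" and ab: "a <= b"
  and s1: "\<And>x. x \<in> {a..b} ==> - \<sigma> x <= 1" and s2: "\<And>x. x \<in> {a..b} ==> e <= abs x ==> - \<sigma> x <= p"
  and p: "0 <= p" "p < 1" and e: "0 <= e" "4*e*C <= 1"
  and C: "\<And>x. abs x <= e ==> airyK (s + x) (s + x) <= C"
 shows "\<exists>f. continuous_on {a..b} f \<and> (\<forall>x\<in>{a..b}. f x + airyQ s a b (%y. \<sigma> y*f y) x = g x)"
proof -
 obtain W where W: "W >= 0" "\<And>x. x \<in> {a..b} ==> abs (\<sigma> x) <= W" using continuous_on_bounded_ex[OF \<sigma>] by blast
 obtain K where K: "K >= 0" "\<And>x y. x \<in> {a..b} ==> y \<in> {a..b} ==> abs (airyK (s + x) (s + y)) <= K"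
 proof
  show "0 <= AB^2*exp (- (2 * s + 2*a))" by simp
  fix x y assume "x \<in> {a..b}" "y \<in> {a..b}"
  hence "AB^2*exp (- (s + x) - (s + y)) <= AB^2*exp (- (2 * s + 2*a))" by (intro mult_left_mono) auto
  thus "abs (airyK (s + x) (s + y)) <= AB^2*exp (- (2 * s + 2*a))" using airyK_bound[of "s+x" "s+y"] by linarith
 qed
 \<comment> \<open>The Banach space is a type, that of bounded continuous functions on the whole
   line. Composition with the retraction onto \<open>{a..b}\<close> transports continuous functions
   on the interval into it.\<close>
 define cl where "cl = clamp a b"
 have cl: "cl x \<in> {a..b}" for x using clamp_in_interval[of a b x] ab by (simp add: cl_def)
 have cl_id: "cl x = x" if "x \<in> {a..b}" for x using that by (simp add: cl_def)
 have cc: "continuous_on UNIV (%x. h (cl x))" if "continuous_on {a..b} h" for h :: "real => real"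
  unfolding cl_def using clamp_continuous_on[of a b h UNIV] that by simp
 have bc: "(%x. h (cl x)) \<in> bcontfun" if h: "continuous_on {a..b} h" for h :: "real => real"
 proof -
  obtain B where "\<forall>x\<in>{a..b}. abs (h x) <= B" using continuous_on_bounded_ex[OF h] by blast
  thus ?thesis using cl by (intro bcontfun_normI[OF cc[OF h], of B]) auto
 qed
 define op where "op = (%q :: real \<Rightarrow>\<^sub>C real. Bcontfun (%x. airyQ s a b (%y. \<sigma> y*apply_bcontfun q y) (cl x)))"
 have v: "continuous_on {a..b} (%y. \<sigma> y*apply_bcontfun q y)" for q by (intro continuous_intros \<sigma>) auto
 have aq: "continuous_on {a..b} (airyQ s a b (%y. \<sigma> y*apply_bcontfun q y))" for q
  by (rule continuous_on_subset[OF airyQ_continuous_on[OF v]]) auto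
 have op: "apply_bcontfun (op q) x = airyQ s a b (%y. \<sigma> y*apply_bcontfun q y) (cl x)" for q x
  unfolding op_def by (subst Bcontfun_inverse[OF bc[OF aq]]) simp
 have bl: "bounded_linear op"
 proof (rule bounded_linear_intro[where K="K*W*(b - a)"])
  fix x y :: "real \<Rightarrow>\<^sub>C real" and r :: real
  show "op (x + y) = op x + op y"
   by (rule bcontfun_eqI) (use airyQ_linear[OF v[of x] v[of y], of s 1 1] in \<open>simp add: op algebra_simps\<close>)
  show "op (r *\<^sub>R x) = r *\<^sub>R op x"
   by (rule bcontfun_eqI) (use airyQ_linear[OF v[of x] v[of x], of s r 0] in \<open>simp add: op algebra_simps\<close>)
  show "norm (op x) <= norm x*(K*W*(b - a))"
  proof (rule norm_bound)
   fix z
   have "norm (airyQ s a b (%y. \<sigma> y*apply_bcontfun x y) (cl z)) <= (K*(W*norm x))*(b - a)"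
    unfolding airyQ_def
   proof (rule integral_bound[OF ab])
    show "continuous_on {a..b} (%y. airyK (s + cl z) (s + y)*(\<sigma> y*apply_bcontfun x y))" by (intro continuous_intros v)
    fix y assume y: "y \<in> {a..b}"
    show "norm (airyK (s + cl z) (s + y)*(\<sigma> y*apply_bcontfun x y)) <= K*(W*norm x)"
     unfolding real_norm_def abs_mult using K W cl[of z] y norm_bounded[of x y] by (intro mult_mono) auto
   qed
   thus "norm (apply_bcontfun (op x) z) <= norm x*(K*W*(b - a))" by (simp add: op mult_ac)
  qed
 qed
 define M where "M = 1 + AB*exp ((abs a) - s)*(2/(1 - p))*W * sqrt (b - a)"
 have M: "norm f <= M*norm (f + r *\<^sub>R op f)" if r: "r \<in> {0..1}" for r f
 proof (rule norm_bound)
  fix z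
  let ?g = "f + r *\<^sub>R op f"
  have lin: "airyQ s a b (%y. (r*\<sigma> y)*apply_bcontfun f y) x = r*airyQ s a b (%y. \<sigma> y*apply_bcontfun f y) x" for x
   using airyQ_linear[OF v[of f] v[of f], of s r 0 x] by (simp add: mult_ac)
  \<comment> \<open>Scaling \<sigma> by a factor in [0, 1] preserves the hypotheses of coercivity,
    so the a priori bound holds along the whole segment.\<close>
  have rle: "- (r*\<sigma> x) <= max 0 (- \<sigma> x)" for x
  proof -
   have "r*(- \<sigma> x) <= r*max 0 (- \<sigma> x)" using r by (intro mult_left_mono) auto
   also have "... <= 1*max 0 (- \<sigma> x)" using r by (intro mult_right_mono) auto
   finally show ?thesis by simp
  qed
  have bd: "abs (airyQ s a b (%y. (r*\<sigma> y)*apply_bcontfun f y) (cl z)) <= AB*exp (abs a - s)*(2/(1 - p))*W * sqrt (b - a)*norm ?g"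
  proof (rule airyQ_sup_bound[where g="apply_bcontfun ?g", OF _ _ _ ab _ _ _ p e C])
   show "continuous_on {a..b} (%y. r*\<sigma> y)" by (intro continuous_intros \<sigma>)
   show "apply_bcontfun f x + airyQ s a b (%y. r*\<sigma> y*apply_bcontfun f y) x = apply_bcontfun ?g x" if "x \<in> {a..b}" for x
    using that by (simp add: lin op cl_id)
   show "- (r*\<sigma> x) <= 1" if "x \<in> {a..b}" for x using rle[of x] s1[OF that] by auto
   show "- (r*\<sigma> x) <= p" if "x \<in> {a..b}" "e <= abs x" for x using rle[of x] s2[OF that] p by auto
   show "abs (apply_bcontfun ?g x) <= norm ?g" for x using norm_bounded[of ?g x] by simp
   show "abs (r*\<sigma> x) <= W" if "x \<in> {a..b}" for x
    using mult_mono[of r 1 "abs (\<sigma> x)" W] W(2)[OF that] r by (auto simp: abs_mult)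
   show "- abs a <= cl z" using cl[of z] by auto
  qed (rule continuous_on_apply_bcontfun order_refl | assumption)+
  have "apply_bcontfun f z = apply_bcontfun ?g z - airyQ s a b (%y. (r*\<sigma> y)*apply_bcontfun f y) (cl z)"
   by (simp add: lin op)
  thus "norm (apply_bcontfun f z) <= M*norm ?g" 
   using bd norm_bounded[of ?g z] unfolding M_def by (simp add: distrib_right)
 qed
 obtain f where f: "f + op f = Bcontfun (%x. g (cl x))" using method_of_continuity[OF bl M] by blast
 have "apply_bcontfun f x + airyQ s a b (%y. \<sigma> y*apply_bcontfun f y) x = g x" if "x \<in> {a..b}" for x
  using arg_cong[OF f, of "%h. apply_bcontfun h x"] that by (simp add: op Bcontfun_inverse[OF bc[OF g]] cl_id)
 thus ?thesis by (intro exI[of _ "apply_bcontfun f"]) auto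
qed

section \<open>Dressing of the Airy function\<close>

lemma jointly_continuous_uniform:
 fixes p :: "real => real => real"
 assumes c: "continuous_on UNIV (%z. p (fst z) (snd z))" and e: "e > 0"
 shows "\<exists>d>0. \<forall>s' x. abs (s' - s) < d --> x \<in> {-L..L} --> abs (p s' x - p s x) < e"
proof -
 have k: "compact ({s-1..s+1} \<times> {-L..L})" by (intro compact_Times compact_Icc)
 have c': "continuous_on ({s-1..s+1} \<times> {-L..L}) (%z. p (fst z) (snd z))" using c by (rule continuous_on_subset) auto
 obtain d where d: "d > 0" "\<And>z z'. z \<in> {s-1..s+1} \<times> {-L..L} ==> z' \<in> {s-1..s+1} \<times> {-L..L} ==> dist z' z < d ==> dist (p (fst z') (snd z')) (p (fst z) (snd z)) < e"
  using compact_uniformly_continuous[OF c' k] e unfolding uniformly_continuous_on_def by metis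
 show ?thesis
 proof (intro exI[of _ "min d 1"] conjI allI impI)
  fix s' x assume a: "abs (s' - s) < min d 1" "x \<in> {-L..L}"
  hence "s - 1 <= s'" "s' <= s + 1" by linarith+
  thus "abs (p s' x - p s x) < e"
   using d(2)[of "(s, x)" "(s', x)"] a by (auto simp: dist_Pair_Pair dist_real_def)
 qed (use d in auto)
qed

lemma uniform_difference_quotient:
 fixes p p1 :: "real => real => real"
 assumes der: "\<And>s x. DERIV (%s. p s x) s :> p1 s x"
  and c: "continuous_on UNIV (%z. p1 (fst z) (snd z))" and e: "e > 0"
 shows "\<exists>d>0. \<forall>s' x. s' ~= s --> abs (s' - s) < d --> x \<in> {-L..L} --> abs ((p s' x - p s x)/(s' - s) - p1 s x) < e"
proof -
 obtain d where d: "d > 0" "\<And>s' x. abs (s' - s) < d ==> x \<in> {-L..L} ==> abs (p1 s' x - p1 s x) < e"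
  using jointly_continuous_uniform[OF c e] by blast
 show ?thesis
 proof (intro exI[of _ d] conjI allI impI)
  fix s' x assume s: "s' ~= s" "abs (s' - s) < d" "x \<in> {-L..L}"
  have "\<exists>z. abs (z - s) < d \<and> (p s' x - p s x)/(s' - s) = p1 z x"
  proof (cases "s < s'")
   case True
   have "\<exists>z>s. z < s' \<and> p s' x - p s x = (s' - s)*p1 z x"
    using True by (intro MVT2[where f="%s. p s x" and f'="%s. p1 s x"] der)
   then obtain z where z: "z > s" "z < s'" "p s' x - p s x = (s' - s)*p1 z x" by blast
   thus ?thesis using s True by (intro exI[of _ z]) (simp add: field_simps)
  next
   case False
   hence "s' < s" using s by simp
   hence "\<exists>z>s'. z < s \<and> p s x - p s' x = (s - s')*p1 z x"
    by (intro MVT2[where f="%s. p s x" and f'="%s. p1 s x"] der)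
   then obtain z where z: "z > s'" "z < s" "p s x - p s' x = (s - s')*p1 z x" by blast
   hence "(p s' x - p s x)/(s' - s) = p1 z x" using \<open>s' < s\<close> by (simp add: divide_simps) (simp add: algebra_simps)
   thus ?thesis using s z by (intro exI[of _ z]) auto
  qed
  thus "abs ((p s' x - p s x)/(s' - s) - p1 s x) < e" using d(2) s by metis
 qed (rule d)
qed

lemma jointly_continuousI:
 fixes F :: "real => real => real"
 assumes c: "\<And>s. continuous_on UNIV (F s)"
  and u: "\<And>s L e. e > 0 ==> \<exists>d>0. \<forall>s' x. abs (s' - s) < d --> x \<in> {-L..L} --> abs (F s' x - F s x) < e"
 shows "continuous_on UNIV (%z. F (fst z) (snd z))"
 unfolding continuous_on_eq_continuous_at[OF open_UNIV] continuous_at_eps_delta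
proof (intro ballI allI impI)
 fix z :: "real \<times> real" and e :: real assume e: "0 < e"
 obtain s x where z: "z = (s, x)" by (cases z)
 obtain d1 where d1: "d1 > 0" "\<And>s' y. abs (s' - s) < d1 ==> y \<in> {-(abs x+1)..abs x+1} ==> abs (F s' y - F s y) < e/2"
  using u[of "e/2" s "abs x+1"] e by auto
 have "isCont (F s) x" using c continuous_on_eq_continuous_at by blast
 then obtain d2 where d2: "d2 > 0" "\<And>y. abs (y - x) < d2 ==> abs (F s y - F s x) < e/2"
  unfolding continuous_at_eps_delta dist_real_def using e by (metis half_gt_zero)
 show "\<exists>d>0. \<forall>x'. dist x' z < d --> dist (F (fst x') (snd x')) (F (fst z) (snd z)) < e"
 proof (intro exI[of _ "min (min d1 d2) 1"] conjI allI impI)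
  fix z' assume d: "dist z' z < min (min d1 d2) 1"
  obtain s' x' where z': "z' = (s', x')" by (cases z')
  have "dist s' s <= dist z' z" "dist x' x <= dist z' z" unfolding z z'
   using dist_fst_le[of "(s',x')" "(s,x)"] dist_snd_le[of "(s',x')" "(s,x)"] by simp_all
  hence "abs (F s' x' - F s x') < e/2" "abs (F s x' - F s x) < e/2"
   using d by (intro d1 d2; auto simp: dist_real_def)+
  thus "dist (F (fst z') (snd z')) (F (fst z) (snd z)) < e" unfolding z z' dist_real_def fst_conv snd_conv by linarith
 qed (use d1 d2 in auto)
qed

lemma airyQ_jointly_continuous:
 assumes "continuous_on {a..b} v" shows "continuous_on UNIV (%z. airyQ (fst z) a b v (snd z))"
proof -
 have "continuous_on (UNIV \<times> {a..b}) (%(z, y). airyK (fst z + snd z) (fst z + y) * v y)"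
  unfolding case_prod_beta 
  by (intro continuous_intros continuous_on_compose2[OF assms]) auto
 hence "continuous_on (UNIV \<times> cbox a b) (%(z :: real \<times> real, y). airyK (fst z + snd z) (fst z + y) * v y)" by simp
 from integral_continuous_on_param[OF this]
 show ?thesis by (simp add: airyQ_def[abs_def])
qed

lemma interval_integral_deriv:
 fixes f f' :: "real => real => real"
 assumes "\<And>s y. y \<in> {a..b} ==> DERIV (%s. f s y) s :> f' s y"
  "\<And>s. continuous_on {a..b} (f s)" "continuous_on (UNIV \<times> {a..b}) (%z. f' (fst z) (snd z))"
 shows "DERIV (%s. integral {a..b} (f s)) s :> integral {a..b} (f' s)"
proof -
 have "((%s. integral (cbox a b) (f s)) has_field_derivative integral (cbox a b) (f' s)) (at s within UNIV)"
  by (rule leibniz_rule_field_derivative)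
   (use assms in \<open>auto simp: case_prod_beta intro!: integrable_continuous_real\<close>)
 thus ?thesis by simp
qed

lemma airyQ_deriv:
 assumes v: "continuous_on {a..b} v"
 shows "DERIV (%s. airyQ s a b v x) s :> - (airy (s + x)*integral {a..b} (%y. airy (s + y) * v y))"
proof -
 have "DERIV (%s. airyQ s a b v x) s :> integral {a..b} (%y. - (airy (s + x)*airy (s + y)) * v y)"
  unfolding airyQ_def
 proof (rule interval_integral_deriv)
  fix s y :: real
  show "DERIV (%s. airyK (s + x) (s + y) * v y) s :> - (airy (s + x)*airy (s + y)) * v y"
   by (intro DERIV_cmult_right airyK_shift_deriv)
  show "continuous_on {a..b} (%y. airyK (s + x) (s + y) * v y)" by (intro continuous_intros v)
  show "continuous_on (UNIV \<times> {a..b}) (%z. - (airy (fst z + x)*airy (fst z + snd z)) * v (snd z))"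
   by (intro continuous_intros continuous_on_compose2[OF v]) auto
 qed
 also have "integral {a..b} (%y. - (airy (s + x)*airy (s + y)) * v y) = integral {a..b} (%y. - airy (s + x)*(airy (s + y) * v y))"
  by (simp add: mult.assoc)
 also have "... = - airy (s + x)*integral {a..b} (%y. airy (s + y) * v y)" by (rule integral_mult_right)
 finally show ?thesis by simp
qed

lemma airyQ_symmetric:
 assumes u: "continuous_on {a..b} u" and v: "continuous_on {a..b} v"
 shows "integral {a..b} (%x. u x*airyQ s a b v x) = integral {a..b} (%x. v x*airyQ s a b u x)"
proof -
 have c: "continuous_on (cbox (a, a) (b, b)) (%(x, y). u x*(airyK (s + x) (s + y) * v y))"
  unfolding case_prod_beta cbox_Pair_eq cbox_interval
  by (intro continuous_intros continuous_on_compose2[OF u] continuous_on_compose2[OF v]) auto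
 have "integral {a..b} (%x. u x*airyQ s a b v x) = integral (cbox a b) (%x. integral (cbox a b) (%y. u x*(airyK (s + x) (s + y) * v y)))"
  unfolding airyQ_def by simp
 also have "... = integral (cbox a b) (%y. integral (cbox a b) (%x. u x*(airyK (s + x) (s + y) * v y)))"
  by (rule integral_swap_continuous[OF c])
 also have "... = integral (cbox a b) (%y. integral (cbox a b) (%x. v y*(airyK (s + y) (s + x)*u x)))"
  by (simp add: airyK_sym mult_ac)
 also have "... = integral {a..b} (%x. v x*airyQ s a b u x)"
  unfolding airyQ_def by simp
 finally show ?thesis .
qed

text \<open>An admissible radius \<open>e\<close> for \<open>airyQ_coercive\<close>: the expression
  in the denominator is \<open>4*C\<close>, where \<open>C\<close> bounds the diagonal of the kernel
  for \<open>abs x \<le> 1\<close> and \<open>s \<ge> s1\<close>. The minimum with 1 keeps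
  \<open>x\<close> in that range.\<close>

definition airy_eps :: "real => real" where
 "airy_eps s1 = min 1 (1/(4*(AB^2*exp (2 - 2 * s1))))"

lemma airy_eps:
 "airy_eps s1 > 0" "4*airy_eps s1*(AB^2*exp (2 - 2 * s1)) <= 1"
 "s1 <= s ==> abs x <= airy_eps s1 ==> airyK (s + x) (s + x) <= AB^2*exp (2 - 2 * s1)"
proof -
 let ?C = "AB^2*exp (2 - 2 * s1)"
 have C: "?C > 0" using airy_bounds(1) by simp
 show "airy_eps s1 > 0" using airy_bounds(1) unfolding airy_eps_def by (simp only: min_less_iff_conj) simp
 have "4*airy_eps s1*?C <= 4*(1/(4*?C))*?C"
  unfolding airy_eps_def using C by (intro mult_right_mono mult_left_mono) auto
 also have "... = 1" using airy_bounds(1) by simp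
 finally show "4*airy_eps s1*?C <= 1" .
 assume s: "s1 <= s" "abs x <= airy_eps s1"
 have "abs x <= 1" using s(2) unfolding airy_eps_def by simp
 hence "AB^2*exp (- (s + x) - (s + x)) <= ?C" using s by (intro mult_left_mono) auto
 thus "airyK (s + x) (s + x) <= ?C" using airyK_bound[of "s+x" "s+x"] by linarith
qed

text \<open>Here \<open>\<sigma>\<close> stands for a cut-off of \<open>h - 1\<close>; the zero of \<open>1 + \<sigma>\<close> at the origin is the only obstruction to coercivity.\<close>

locale dressing =
 fixes X :: real and \<sigma> \<sigma>' :: "real => real"
 assumes X: "X > 0"
  and \<sigma>_deriv: "\<And>x. DERIV \<sigma> x :> \<sigma>' x" and \<sigma>'_cont: "continuous_on UNIV \<sigma>'"
  and \<sigma>_supp: "\<And>x. X <= abs x ==> \<sigma> x = 0"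
  and \<sigma>_ge: "\<And>x. - \<sigma> x <= 1"
  and \<sigma>_gap: "\<And>e. e > 0 ==> \<exists>p\<ge>0. p < 1 \<and> (\<forall>x. e <= abs x --> - \<sigma> x <= p)"
begin

lemma \<sigma>_cont: "continuous_on S \<sigma>"
 by (rule continuous_on_subset[of UNIV]) (auto intro!: continuous_at_imp_continuous_on DERIV_isCont[OF \<sigma>_deriv])

definition N :: "real => (real => real) => real => real" where
 "N s f = airyQ s (-X) X (%y. \<sigma> y*f y)"

lemma N_cont:
 assumes "continuous_on {-X..X} f" shows "continuous_on S (N s f)"
 unfolding N_def by (rule continuous_on_subset[OF airyQ_continuous_on]) (auto intro!: continuous_intros \<sigma>_cont assms)

lemma N_linear:
 assumes f: "continuous_on {-X..X} f" and g: "continuous_on {-X..X} g"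
 shows "N s (%y. c*f y + d*g y) x = c*N s f x + d*N s g x"
proof -
 have "continuous_on {-X..X} (%y. \<sigma> y*f y)" "continuous_on {-X..X} (%y. \<sigma> y*g y)"
  by (intro continuous_intros \<sigma>_cont f g)+
 from airyQ_linear[OF this, of s c d x] show ?thesis unfolding N_def by (simp add: algebra_simps)
qed

text \<open>One constant for all \<open>s \<ge> s1\<close> and all \<open>f\<close> and
  \<open>g\<close>. Applied to differences of solutions, it yields uniqueness, continuity and
  differentiability in \<open>s\<close>.\<close>

lemma N_bound_ex:
 "\<exists>M\<ge>0. \<forall>s f g G x. s1 <= s --> continuous_on {-X..X} f --> continuous_on {-X..X} g -->
  (\<forall>x\<in>{-X..X}. f x + N s f x = g x) --> (\<forall>x\<in>{-X..X}. abs (g x) <= G) --> - L <= x --> abs (N s f x) <= M*G"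
proof -
 obtain p where p: "p >= 0" "p < 1" "\<And>x. airy_eps s1 <= abs x ==> - \<sigma> x <= p"
  using \<sigma>_gap[OF airy_eps(1)[of s1]] by blast
 obtain W where W: "W >= 0" "\<And>x. x \<in> {-X..X} ==> abs (\<sigma> x) <= W" using continuous_on_bounded_ex[OF \<sigma>_cont] by blast
 show ?thesis
 proof (intro exI[of _ "AB*exp (L - s1)*(2/(1 - p))*W * sqrt (X - (- X))"] conjI allI impI)
  show "0 <= AB*exp (L - s1)*(2/(1 - p))*W * sqrt (X - (- X))" using airy_bounds(1) p W X by simp
  fix s f g G x
  assume a: "s1 <= s" "continuous_on {-X..X} f" "continuous_on {-X..X} g"
  "\<forall>x\<in>{-X..X}. f x + N s f x = g x" "\<forall>x\<in>{-X..X}. abs (g x) <= G" "- L <= x"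
  show "abs (N s f x) <= AB*exp (L - s1)*(2/(1 - p))*W * sqrt (X - (- X))*G"
   unfolding N_def
   by (rule airyQ_sup_bound[OF a(2,3) \<sigma>_cont _ _ \<sigma>_ge p(3) p(1,2) less_imp_le[OF airy_eps(1)[of s1]] airy_eps(2)[of s1] airy_eps(3)[OF a(1)] _ W(2) a(1,6)])
    (use a X in \<open>auto simp: N_def\<close>)
 qed
qed

lemma solvable:
 assumes g: "continuous_on UNIV g"
 shows "\<exists>f. continuous_on UNIV f \<and> (\<forall>x. f x + N s f x = g x)"
proof -
 have g': "continuous_on {-X..X} g" using g by (rule continuous_on_subset) auto
 obtain p where p: "p >= 0" "p < 1" "\<And>x. airy_eps s <= abs x ==> - \<sigma> x <= p"
  using \<sigma>_gap[OF airy_eps(1)[of s]] by blast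
 have "\<exists>f. continuous_on {-X..X} f \<and> (\<forall>x\<in>{-X..X}. f x + airyQ s (-X) X (%y. \<sigma> y*f y) x = g x)"
  by (rule airyQ_solvable[OF g' \<sigma>_cont _ \<sigma>_ge p(3) p(1,2) less_imp_le[OF airy_eps(1)[of s]] airy_eps(2)[of s] airy_eps(3)[OF order_refl]])
   (use X in auto)
 then obtain f where f: "continuous_on {-X..X} f" "\<And>x. x \<in> {-X..X} ==> f x + N s f x = g x"
  unfolding N_def by blast
 \<comment> \<open>The operator sees only the values on \<open>{-X..X}\<close>, so the equation
   itself extends the solution to the whole line.\<close>
 define F where "F = (%x. g x - N s f x)"
 have eq: "F x = f x" if "x \<in> {-X..X}" for x using f(2)[OF that] by (simp add: F_def)
 have "N s F x = N s f x" for x unfolding N_def airyQ_def 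
  by (rule HK_cong) (simp add: eq)
 hence "F x + N s F x = g x" for x by (simp add: F_def)
 moreover have "continuous_on UNIV F" unfolding F_def by (intro continuous_intros g N_cont f)
 ultimately show ?thesis by blast
qed

definition sol :: "real => (real => real) => real => real" where
 "sol s g = (SOME f. continuous_on UNIV f \<and> (\<forall>x. f x + N s f x = g x))"

lemma sol:
 assumes "continuous_on UNIV g"
 shows "continuous_on S (sol s g)" "sol s g x + N s (sol s g) x = g x"
proof -
 have "continuous_on UNIV (sol s g) \<and> (\<forall>x. sol s g x + N s (sol s g) x = g x)"
  unfolding sol_def by (rule someI_ex[OF solvable[OF assms]])
 thus "continuous_on S (sol s g)" "sol s g x + N s (sol s g) x = g x"
  using continuous_on_subset by auto
qed

lemma sol_unique:
 assumes g: "continuous_on UNIV g" and f: "continuous_on UNIV f" "\<And>x. f x + N s f x = g x"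
 shows "f x = sol s g x"
proof -
 obtain M where M: "M >= 0" "\<And>f g G. continuous_on {-X..X} f ==> continuous_on {-X..X} g ==>
  (\<And>x. x\<in>{-X..X} ==> f x + N s f x = g x) ==> (\<And>x. x\<in>{-X..X} ==> abs (g x) <= G) ==> abs (N s f x) <= M*G"
  using N_bound_ex[of s "-x"] by (metis minus_minus order_refl)
 let ?d = "%x. 1*f x + (-1) * sol s g x"
 have c: "continuous_on {-X..X} f" by (rule continuous_on_subset[OF f(1)]) simp
 note c = c sol(1)[OF g, of "{-X..X}" s]
 have e: "?d y + N s ?d y = 0" for y
  unfolding N_linear[OF c] using f(2)[of y] sol(2)[OF g, of s y] by simp
 have "abs (N s ?d x) <= M*0"
  by (rule M(2)[where g="%_. 0"]) (use e c in \<open>auto intro!: continuous_intros\<close>)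
 thus ?thesis using e[of x] by simp
qed

text \<open>The increment of the solution solves the integral equation at the new parameter with a
  small right-hand side, and so does the difference quotient minus its expected limit. Smallness is
  locally uniform in \<open>x\<close>, and the a priori bound transfers it to the solutions.\<close>

lemma sol_family:
 assumes G: "\<And>s. continuous_on UNIV (G s)"
  and der: "\<And>s x. DERIV (%s. G s x) s :> G1 s x"
  and G1: "continuous_on UNIV (%z. G1 (fst z) (snd z))"
 shows "continuous_on UNIV (%z. sol (fst z) (G (fst z)) (snd z))"
  "((%s. sol s (G s) x) has_real_derivative
   sol s (%x. G1 s x + airy (s + x)*integral {-X..X} (%y. airy (s + y)*(\<sigma> y * sol s (G s) y))) x) (at s)"
proof -
 define F where "F = (%s. sol s (G s))"
 have Fc: "continuous_on S (F s)" for S s unfolding F_def by (rule sol(1)[OF G])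
 have Fe: "F s x + N s (F s) x = G s x" for s x unfolding F_def by (rule sol(2)[OF G])
 have vF: "continuous_on {-X..X} (%y. \<sigma> y*F s y)" for s by (intro continuous_intros \<sigma>_cont Fc)
 \<comment> \<open>What the equation at \<open>s'\<close> leaves over when the solution for
   \<open>s\<close> is inserted. Then \<open>F s' - F s\<close> solves the equation at
   \<open>s'\<close> with right-hand side \<open>H s s' - H s s\<close>.\<close>
 define H where "H = (%s s' x. G s' x - N s' (F s) x)"
 define H1 where "H1 = (%s s' x. G1 s' x + airy (s' + x)*integral {-X..X} (%y. airy (s' + y)*(\<sigma> y*F s y)))"
 have Hs: "H s s x = F s x" for s x using Fe[of s x] by (simp add: H_def)
 have Hder: "DERIV (%s'. H s s' x) s' :> H1 s s' x" for s s' x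
  unfolding H_def H1_def N_def using DERIV_diff[OF der airyQ_deriv[OF vF]] by simp
 have H1c: "continuous_on UNIV (%z. H1 s (fst z) (snd z))" for s
 proof -
  have "continuous_on (UNIV \<times> cbox (-X) X) (%(z, y). airy (z + y)*(\<sigma> y*F s y))"
   unfolding case_prod_beta by (intro continuous_intros continuous_on_compose2[OF vF]) auto
  from integral_continuous_on_param[OF this]
  have i: "continuous_on UNIV (%z. integral {-X..X} (%y. airy (z + y)*(\<sigma> y*F s y)))" by simp
  show ?thesis unfolding H1_def
   by (intro continuous_intros G1 continuous_on_compose2[OF i]) auto
 qed
 have sG1c: "continuous_on UNIV (H1 s s')" for s s'
  using continuous_on_compose2[OF H1c[of s], of UNIV "%x. (s', x)"] by (simp add: continuous_on_Pair continuous_on_const continuous_on_id)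
 have Deq: "(F s' x - F s x) + N s' (%x. F s' x - F s x) x = H s s' x - H s s x" for s s' x
 proof -
  have "N s' (%x. 1*F s' x + (-1)*F s x) x = 1*N s' (F s') x + (-1)*N s' (F s) x"
   by (rule N_linear[OF Fc Fc])
  thus ?thesis using Fe[of s' x] Fe[of s x] by (simp add: H_def)
 qed
 have Hcont: "continuous_on UNIV (H s s')" for s s' unfolding H_def by (intro continuous_intros G N_cont Fc)
 have Hu: "\<exists>d>0. \<forall>s' x. abs (s' - s) < d --> x \<in> {-L..L} --> abs (H s s' x - H s s x) < e" if e: "e > 0" for s L e
 proof -
  have c1: "continuous_on ({s-1..s+1} \<times> {-abs L..abs L}) (%z. H1 s (fst z) (snd z))" by (rule continuous_on_subset[OF H1c]) auto
  have "compact ((%z. H1 s (fst z) (snd z)) ` ({s-1..s+1} \<times> {-abs L..abs L}))"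
   by (intro compact_continuous_image[OF c1] compact_Times compact_Icc)
  then obtain B where B: "\<And>r x. r \<in> {s-1..s+1} ==> x \<in> {-abs L..abs L} ==> abs (H1 s r x) <= B"
   by (drule_tac compact_imp_bounded) (force simp: bounded_iff)
  have B0: "B >= 0" using B[of s 0] by auto
  show ?thesis
  proof (intro exI[of _ "min 1 (e/(B + 1))"] conjI allI impI)
   show "0 < min 1 (e/(B + 1))" using e B0 by simp
   fix s' x assume s': "abs (s' - s) < min 1 (e/(B + 1))" and x: "x \<in> {-L..L}"
   have "norm (H s s' x - H s s x) <= B*norm (s' - s)"
   proof (rule field_differentiable_bound[of "{s-1..s+1}" "%r. H s r x" "%r. H1 s r x"])
    show "((%r. H s r x) has_field_derivative H1 s z x) (at z within {s-1..s+1})" for z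
     by (rule DERIV_subset[OF Hder]) simp
   qed (use s' x B in auto)
   also have "... <= B*(e/(B + 1))" using s' B0 by (intro mult_left_mono) auto
   also have "... < e" using e B0 by (simp add: field_simps)
   finally show "abs (H s s' x - H s s x) < e" by simp
  qed
 qed
 have Nbd: "\<exists>M\<ge>0. \<forall>s' f g G x. s - 1 <= s' --> continuous_on UNIV f --> continuous_on UNIV g -->
  (\<forall>x. f x + N s' f x = g x) --> (\<forall>x\<in>{-X..X}. abs (g x) <= G) --> - L <= x --> abs (N s' f x) <= M*G" for s L
 proof -
  obtain M where "M\<ge>0" "\<forall>s' f g G x. s - 1 <= s' --> continuous_on {-X..X} f --> continuous_on {-X..X} g -->
  (\<forall>x\<in>{-X..X}. f x + N s' f x = g x) --> (\<forall>x\<in>{-X..X}. abs (g x) <= G) --> - L <= x --> abs (N s' f x) <= M*G"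
   using N_bound_ex[of "s - 1" L] by blast
  thus ?thesis using continuous_on_subset[OF _ subset_UNIV] by (intro exI[of _ M]) blast
 qed
 have Fu: "\<exists>d>0. \<forall>s' x. abs (s' - s) < d --> x \<in> {-L..L} --> abs (F s' x - F s x) < e" if e: "e > 0" for s L e
 proof -
  obtain M where M: "M >= 0" "\<And>s' f g G x. s - 1 <= s' ==> continuous_on UNIV f ==> continuous_on UNIV g ==>
  (\<forall>x. f x + N s' f x = g x) ==> (\<forall>x\<in>{-X..X}. abs (g x) <= G) ==> - L <= x ==> abs (N s' f x) <= M*G"
   using Nbd[of s L] by blast
  define p where "p = e/(2*(1 + M))"
  have p: "p > 0" using e M unfolding p_def by simp
  obtain d where d: "d > 0" "\<And>s' x. abs (s' - s) < d ==> x \<in> {- max L X..max L X} ==> abs (H s s' x - H s s x) < p"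
   using Hu[OF p, of s "max L X"] by blast
  show ?thesis
  proof (intro exI[of _ "min d 1"] conjI allI impI)
   fix s' x assume s': "abs (s' - s) < min d 1" and x: "x \<in> {-L..L}"
   have h: "abs (H s s' y - H s s y) < p" if "y \<in> {-X..X} \<union> {-L..L}" for y
    by (rule d(2)) (use s' that in \<open>auto simp: max_def\<close>)
   have "abs (N s' (%x. F s' x - F s x) x) <= M*p"
    by (rule M(2)[where g="%x. H s s' x - H s s x"])
     (use s' x h in \<open>auto intro!: continuous_intros Fc Hcont Deq less_imp_le\<close>)
   moreover have "abs (H s s' x - H s s x) < p" using h x by auto
   ultimately have "abs (F s' x - F s x) < p + M*p" using Deq[of s' x s] by linarith
   also have "... = p*(1 + M)" by (simp add: algebra_simps)
   also have "... = e/2"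
   proof -
    have "e/(2*K)*K = e/2" if "K > 0" for K using that by simp
    from this[of "1 + M"] show ?thesis unfolding p_def using M(1) by simp
   qed
   finally show "abs (F s' x - F s x) < e" using e by simp
  qed (use d in auto)
 qed
 show "continuous_on UNIV (%z. sol (fst z) (G (fst z)) (snd z))"
  using jointly_continuousI[of F, OF Fc Fu] unfolding F_def .
 \<comment> \<open>The expected derivative: the solution whose right-hand side is the derivative of
   \<open>H s s'\<close> in \<open>s'\<close> at \<open>s' = s\<close>.\<close>
 define Z where "Z = sol s (H1 s s)"
 have Zc: "continuous_on S Z" for S unfolding Z_def by (rule sol(1)[OF sG1c])
 have Ze: "Z x + N s Z x = H1 s s x" for x unfolding Z_def by (rule sol(2)[OF sG1c])
 have vZ: "continuous_on {-X..X} (%y. \<sigma> y*Z y)" by (intro continuous_intros \<sigma>_cont Zc)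
 have "DERIV (%s. F s x) s :> Z x"
  unfolding has_field_derivative_iff LIM_eq
 proof (intro allI impI)
  fix e :: real assume e: "e > 0"
  obtain M where M: "M >= 0" "\<And>s' f g G y. s - 1 <= s' ==> continuous_on UNIV f ==> continuous_on UNIV g ==>
  (\<forall>x. f x + N s' f x = g x) ==> (\<forall>x\<in>{-X..X}. abs (g x) <= G) ==> - abs x <= y ==> abs (N s' f y) <= M*G"
   using Nbd[of s "abs x"] by blast
  define p where "p = e/(3*(1 + M))"
  have p: "p > 0" using e M unfolding p_def by simp
  let ?L = "max (abs x) X"
  obtain d1 where d1: "d1 > 0" "\<And>s' y. s' ~= s ==> abs (s' - s) < d1 ==> y \<in> {-?L..?L} ==> abs ((H s s' y - H s s y)/(s' - s) - H1 s s y) < p"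
   using uniform_difference_quotient[of "H s" "H1 s", OF Hder H1c p, of s ?L] by blast
  obtain d2 where d2: "d2 > 0" "\<And>s' y. abs (s' - s) < d2 ==> y \<in> {-?L..?L} ==> abs (N s' Z y - N s Z y) < p"
   using jointly_continuous_uniform[of "%s. N s Z", OF _ p, of s ?L] airyQ_jointly_continuous[OF vZ] unfolding N_def by blast
  show "\<exists>d>0. \<forall>y. y ~= s \<and> norm (y - s) < d --> norm ((F y x - F s x)/(y - s) - Z x) < e"
  proof (intro exI[of _ "min (min d1 d2) 1"] conjI allI impI)
   fix s' assume "s' ~= s \<and> norm (s' - s) < min (min d1 d2) 1"
   hence s': "s' ~= s" "abs (s' - s) < d1" "abs (s' - s) < d2" "abs (s' - s) < 1" by auto
   define E where "E = (%y. (F s' y - F s y)/(s' - s) - Z y)"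
   define r where "r = (%y. ((H s s' y - H s s y)/(s' - s) - H1 s s y) - (N s' Z y - N s Z y))"
   have Er: "E y + N s' E y = r y" for y
   proof -
    have "N s' (%y. (1/(s' - s))*(F s' y - F s y) + (-1)*Z y) y = (1/(s' - s))*N s' (%y. F s' y - F s y) y + (-1)*N s' Z y"
     by (rule N_linear) (intro continuous_intros Fc Zc)+
    hence NE: "N s' E y = (1/(s' - s))*N s' (%y. F s' y - F s y) y + (-1)*N s' Z y"
     unfolding E_def by simp
    have "E y + N s' E y = (1/(s' - s))*((F s' y - F s y) + N s' (%y. F s' y - F s y) y) - (Z y + N s' Z y)"
     unfolding NE by (simp add: E_def add_divide_distrib diff_divide_distrib)
    thus ?thesis unfolding Deq r_def using Ze[of y] by simp
   qed
   have rb: "abs (r y) <= 2*p" if "y \<in> {-X..X} \<union> {-abs x..abs x}" for y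
   proof -
    have that: "y \<in> {-?L..?L}" using that by (auto simp: max_def)
    show ?thesis
    using d1(2)[OF s'(1,2) that] d2(2)[OF s'(3) that] unfolding r_def by linarith
   qed
   have Ec: "continuous_on UNIV E" unfolding E_def using s' by (intro continuous_intros Fc Zc) auto
   have rc: "continuous_on UNIV r" unfolding r_def using s' by (intro continuous_intros Hcont sG1c N_cont Zc) auto
   have "abs (N s' E x) <= M*(2*p)"
    by (rule M(2)[where g=r]) (use s' Er Ec rc rb in auto)
   moreover have "abs (r x) <= 2*p" by (rule rb) (auto simp: abs_if)
   ultimately have "abs (E x) <= 2*p + M*(2*p)" using Er[of x] by linarith
   also have "... = 2*(p*(1 + M))" by (simp add: algebra_simps)
   also have "... = 2*e/3"
   proof -
    have "e/(3*K)*K = e/3" if "K > 0" for K using that by simp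
    from this[of "1 + M"] have "p*(1 + M) = e/3" unfolding p_def using M(1) by simp
    thus ?thesis by simp
   qed
   also have "... < e" using e by simp
   finally show "norm ((F s' x - F s x)/(s' - s) - Z x) < e" by (simp add: E_def)
  qed (use d1 d2 in auto)
 qed
 thus "((%s. sol s (G s) x) has_real_derivative
   sol s (%x. G1 s x + airy (s + x)*integral {-X..X} (%y. airy (s + y)*(\<sigma> y * sol s (G s) y))) x) (at s)"
  unfolding F_def Z_def H1_def .
qed

end

section \<open>Derivatives in the spectral variable\<close>

lemma airyQ_derivative:
 assumes v: "continuous_on {a..b} v"
 shows "DERIV (%x. airyQ s a b v x) x :> integral {a..b} (%y. airyK' (s + x) (s + y) * v y)"
 unfolding airyQ_def
proof (rule interval_integral_deriv)
 fix x y :: real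
 show "DERIV (%x. airyK (s + x) (s + y) * v y) x :> airyK' (s + x) (s + y) * v y"
 proof -
  have "DERIV (%x. airyK (s + x) (s + y)) x :> airyK' (s + x) (s + y)*1"
   by (rule DERIV_chain2[OF airyK_deriv]) (auto intro!: derivative_eq_intros)
  thus ?thesis using DERIV_cmult_right by fastforce
 qed
 show "continuous_on {a..b} (%y. airyK (s + x) (s + y) * v y)" by (intro continuous_intros v)
 show "continuous_on (UNIV \<times> {a..b}) (%z. airyK' (s + fst z) (s + snd z) * v (snd z))"
  by (intro continuous_intros continuous_on_compose2[OF v]) auto
qed

lemma airyQ_derivative_continuous:
 assumes v: "continuous_on {a..b} v"
 shows "continuous_on UNIV (%x. integral {a..b} (%y. airyK' (s + x) (s + y) * v y))"
proof -
 have "continuous_on (UNIV \<times> cbox a b) (%(x, y). airyK' (s + x) (s + y) * v y)"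
  unfolding case_prod_beta by (intro continuous_intros continuous_on_compose2[OF v]) auto
 from integral_continuous_on_param[OF this] show ?thesis by simp
qed

lemma integral_derivative_vanishing:
 fixes F f :: "real => real"
 assumes "a <= b" "\<And>x. DERIV F x :> f x" "F a = 0" "F b = 0"
 shows "(f has_integral 0) {a..b}"
proof -
 have "(f has_integral (F b - F a)) {a..b}"
  by (rule fundamental_theorem_of_calculus[OF assms(1)])
   (use assms(2) in \<open>auto simp: has_real_derivative_iff_has_vector_derivative intro: has_vector_derivative_at_within\<close>)
 thus ?thesis using assms(3,4) by simp
qed

section \<open>The Schroedinger equation and the trace formula\<close>

context dressing
begin

definition Q :: "real => real => real" where "Q s = sol s (%x. airy (s + x))"
definition P :: "real => real => real" where "P s = sol s (%x. airy' (s + x))"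
definition v0 :: "real => real" where "v0 s = integral {-X..X} (%y. airy (s + y)*(\<sigma> y*Q s y))"
definition v1 :: "real => real" where "v1 s = integral {-X..X} (%y. airy' (s + y)*(\<sigma> y*Q s y))"
text \<open>By \<open>v0_deriv\<close> this is \<open>s + 2*v0'\<close>, the potential for which
  \<open>Q'_deriv\<close> is the Schroedinger equation.\<close>

definition u :: "real => real" where "u s = s + 2*(2 * v1 s + (v0 s)^2)"
definition Q' :: "real => real => real" where "Q' s x = P s x + v0 s*Q s x"

lemma Q_cont: "continuous_on S (Q s)" and Q_eq: "Q s x + N s (Q s) x = airy (s + x)"
 unfolding Q_def by (rule sol; intro continuous_intros)+

lemma P_cont: "continuous_on S (P s)" and P_eq: "P s x + N s (P s) x = airy' (s + x)"
 unfolding P_def by (rule sol; intro continuous_intros)+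

text \<open>Symmetry of the kernel passes to the resolvent: inserting \<open>airy = Q + N Q\<close>
  on one side and \<open>airy' = P + N P\<close> on the other gives the same two integrals.\<close>

lemma v1_eq: "integral {-X..X} (%y. airy (s + y)*(\<sigma> y*P s y)) = v1 s"
proof -
 have c: "continuous_on {-X..X} (%y. \<sigma> y*Q s y)" "continuous_on {-X..X} (%y. \<sigma> y*P s y)"
  by (intro continuous_intros \<sigma>_cont Q_cont P_cont)+
 have i: "(%y. Q s y*(\<sigma> y*P s y)) integrable_on {-X..X}" "(%y. P s y*(\<sigma> y*Q s y)) integrable_on {-X..X}"
  "(%y. (\<sigma> y*P s y)*N s (Q s) y) integrable_on {-X..X}" "(%y. (\<sigma> y*Q s y)*N s (P s) y) integrable_on {-X..X}"
  by (intro integrable_continuous_real continuous_intros \<sigma>_cont Q_cont P_cont N_cont)+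
 have "integral {-X..X} (%y. airy (s + y)*(\<sigma> y*P s y)) = integral {-X..X} (%y. Q s y*(\<sigma> y*P s y) + (\<sigma> y*P s y)*N s (Q s) y)"
  by (rule HK_cong) (simp only: Q_eq[of s, symmetric], simp add: algebra_simps)
 also have "... = integral {-X..X} (%y. Q s y*(\<sigma> y*P s y)) + integral {-X..X} (%y. (\<sigma> y*P s y)*N s (Q s) y)"
  by (rule HK_add[OF i(1,3)])
 also have "integral {-X..X} (%y. (\<sigma> y*P s y)*N s (Q s) y) = integral {-X..X} (%y. (\<sigma> y*Q s y)*N s (P s) y)"
  unfolding N_def by (rule airyQ_symmetric[OF c(2,1)])
 also have "integral {-X..X} (%y. Q s y*(\<sigma> y*P s y)) = integral {-X..X} (%y. P s y*(\<sigma> y*Q s y))"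
  by (simp add: mult_ac)
 also have "... + integral {-X..X} (%y. (\<sigma> y*Q s y)*N s (P s) y) = integral {-X..X} (%y. P s y*(\<sigma> y*Q s y) + (\<sigma> y*Q s y)*N s (P s) y)"
  by (rule HK_add[OF i(2,4), symmetric])
 also have "... = v1 s" unfolding v1_def
  by (rule HK_cong) (simp only: P_eq[of s, symmetric], simp add: algebra_simps)
 finally show ?thesis .
qed

text \<open>The Christoffel-Darboux formula moves the spectral variable out of the operator at the
  price of two rank-one terms.\<close>

lemma N_mult_x: "N s (%y. y*Q s y) x = x*N s (Q s) x - (airy (s + x) * v1 s - airy' (s + x) * v0 s)"
proof -
 have i: "(%y. airyK (s + x) (s + y)*(\<sigma> y*Q s y)) integrable_on {-X..X}"
  "(%y. airy' (s + y)*(\<sigma> y*Q s y)) integrable_on {-X..X}"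
  "(%y. airy (s + y)*(\<sigma> y*Q s y)) integrable_on {-X..X}"
  by (intro integrable_continuous_real continuous_intros \<sigma>_cont Q_cont)+
 have e: "airyK (s + x) (s + y)*(\<sigma> y*(y*Q s y)) = x*(airyK (s + x) (s + y)*(\<sigma> y*Q s y))
  - (airy (s + x)*(airy' (s + y)*(\<sigma> y*Q s y)) - airy' (s + x)*(airy (s + y)*(\<sigma> y*Q s y)))" for y
 proof -
  have "(x - y)*airyK (s + x) (s + y) = airy (s + x)*airy' (s + y) - airy' (s + x)*airy (s + y)"
   using airyK_commutator[of "s+x" "s+y"] by simp
  hence "(x - y)*airyK (s + x) (s + y)*(\<sigma> y*Q s y) = (airy (s + x)*airy' (s + y) - airy' (s + x)*airy (s + y))*(\<sigma> y*Q s y)"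
   by simp
  thus ?thesis by (simp add: algebra_simps)
 qed
 show ?thesis unfolding N_def airyQ_def e v0_def v1_def
  using i by (simp add: HK_diff integrable_on_mult_right integrable_diff)
qed

text \<open>The rank-one derivative of the kernel adds \<open>v0 s * airy (s + x)\<close> to the
  differentiated right-hand side \<open>airy' (s + x)\<close>. By linearity and uniqueness the
  solution for the sum is \<open>P + v0 Q\<close>.\<close>

lemma Q_family:
 "continuous_on UNIV (%z. Q (fst z) (snd z))" "DERIV (%s. Q s x) s :> Q' s x"
proof -
 note F = sol_family[of "%s x. airy (s + x)" "%s x. airy' (s + x)"]
 show "continuous_on UNIV (%z. Q (fst z) (snd z))" unfolding Q_def
  by (rule F(1)) (auto intro!: continuous_intros derivative_eq_intros)
 have "DERIV (%s. Q s x) s :> sol s (%x. airy' (s + x) + airy (s + x) * v0 s) x"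
  unfolding Q_def v0_def by (rule F(2)) (auto intro!: continuous_intros derivative_eq_intros)
 moreover have "Q' s x = sol s (%x. airy' (s + x) + airy (s + x) * v0 s) x"
 proof (rule sol_unique)
  show "continuous_on UNIV (Q' s)" unfolding Q'_def by (intro continuous_intros P_cont Q_cont)
  fix x
  have "N s (Q' s) x = 1*N s (P s) x + v0 s*N s (Q s) x"
   unfolding Q'_def using N_linear[where f="P s" and g="Q s" and s=s and c=1 and d="v0 s" and x=x, OF P_cont Q_cont] by simp
  hence "Q' s x + N s (Q' s) x = (P s x + N s (P s) x) + v0 s*(Q s x + N s (Q s) x)"
   by (simp add: Q'_def algebra_simps)
  thus "Q' s x + N s (Q' s) x = airy' (s + x) + airy (s + x) * v0 s"
   unfolding P_eq Q_eq by (simp add: mult.commute)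
 qed (intro continuous_intros)
 ultimately show "DERIV (%s. Q s x) s :> Q' s x" by simp
qed

text \<open>By Airy's equation the differentiated right-hand side contains the factor
  \<open>s + x\<close>. The commutator formula shows that the solution is \<open>(s + x) Q\<close>
  corrected by multiples of \<open>Q\<close> and \<open>P\<close>.\<close>

lemma P_family:
 "continuous_on UNIV (%z. P (fst z) (snd z))"
 "DERIV (%s. P s x) s :> (s + x + 2 * v1 s)*Q s x - v0 s*P s x"
proof -
 note F = sol_family[of "%s x. airy' (s + x)" "%s x. (s + x)*airy (s + x)"]
 show "continuous_on UNIV (%z. P (fst z) (snd z))" unfolding P_def
  by (rule F(1)) (auto intro!: continuous_intros derivative_eq_intros)
 have "DERIV (%s. P s x) s :> sol s (%x. (s + x)*airy (s + x) + airy (s + x) * v1 s) x"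
  unfolding P_def v1_eq[unfolded P_def, symmetric] by (rule F(2)) (auto intro!: continuous_intros derivative_eq_intros)
 moreover have "(s + x + 2 * v1 s)*Q s x - v0 s*P s x = sol s (%x. (s + x)*airy (s + x) + airy (s + x) * v1 s) x"
 proof (rule sol_unique)
  show "continuous_on UNIV (%x. (s + x + 2 * v1 s)*Q s x - v0 s*P s x)" by (intro continuous_intros P_cont Q_cont)
  fix x
  have c: "continuous_on {-X..X} (%y. y*Q s y)" "continuous_on {-X..X} (%y. (s + 2 * v1 s)*Q s y + (- v0 s)*P s y)"
   by (intro continuous_intros Q_cont P_cont)+
  have "N s (%x. (s + x + 2 * v1 s)*Q s x - v0 s*P s x) x
   = N s (%y. 1*(y*Q s y) + 1*((s + 2 * v1 s)*Q s y + (- v0 s)*P s y)) x"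
   by (simp add: algebra_simps)
  also have "... = N s (%y. y*Q s y) x + ((s + 2 * v1 s)*N s (Q s) x + (- v0 s)*N s (P s) x)"
   unfolding N_linear[OF c] N_linear[OF Q_cont P_cont] by simp
  finally have "(s + x + 2 * v1 s)*Q s x - v0 s*P s x + N s (%x. (s + x + 2 * v1 s)*Q s x - v0 s*P s x) x
   = (s + x + 2 * v1 s)*(Q s x + N s (Q s) x) - v0 s*(P s x + N s (P s) x) - (airy (s + x) * v1 s - airy' (s + x) * v0 s)"
   unfolding N_mult_x by (simp add: algebra_simps)
  thus "(s + x + 2 * v1 s)*Q s x - v0 s*P s x + N s (%x. (s + x + 2 * v1 s)*Q s x - v0 s*P s x) x
   = (s + x)*airy (s + x) + airy (s + x) * v1 s"
   unfolding Q_eq P_eq by (simp add: algebra_simps)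
 qed (intro continuous_intros)
 ultimately show "DERIV (%s. P s x) s :> (s + x + 2 * v1 s)*Q s x - v0 s*P s x" by simp
qed

lemma Q_jointly [continuous_intros]:
 "continuous_on S f ==> continuous_on S g ==> continuous_on S (%z. Q (f z) (g z))"
 "continuous_on S f ==> continuous_on S g ==> continuous_on S (%z. P (f z) (g z))"
 using continuous_on_compose2[OF Q_family(1) continuous_on_Pair, of S f g] continuous_on_compose2[OF P_family(1) continuous_on_Pair, of S f g] by auto

lemma \<sigma>_cont_comp [continuous_intros]: "continuous_on S f ==> continuous_on S (%z. \<sigma> (f z))"
 by (rule continuous_on_compose2[OF \<sigma>_cont[of UNIV]]) auto

lemma v_continuous: "continuous_on UNIV v0" "continuous_on UNIV v1"
proof -
 have "continuous_on (UNIV \<times> cbox (-X) X) (%(s, y). airy (s + y)*(\<sigma> y*Q s y))"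
  unfolding case_prod_beta by (intro continuous_intros)
 from integral_continuous_on_param[OF this] show "continuous_on UNIV v0" by (simp add: v0_def[abs_def])
 have "continuous_on (UNIV \<times> cbox (-X) X) (%(s, y). airy' (s + y)*(\<sigma> y*Q s y))"
  unfolding case_prod_beta by (intro continuous_intros)
 from integral_continuous_on_param[OF this] show "continuous_on UNIV v1" by (simp add: v1_def[abs_def])
qed

lemma v_cont_comp [continuous_intros]:
 "continuous_on S f ==> continuous_on S (%z. v0 (f z))" "continuous_on S f ==> continuous_on S (%z. v1 (f z))"
 by (rule continuous_on_compose2[OF v_continuous(1)] continuous_on_compose2[OF v_continuous(2)]; simp)+

lemma u_continuous: "continuous_on S u" unfolding u_def by (intro continuous_intros)

lemma v0_deriv: "DERIV v0 s :> 2 * v1 s + (v0 s)^2"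
proof -
 have "DERIV v0 s :> integral {-X..X} (%y. airy' (s + y)*(\<sigma> y*Q s y) + airy (s + y)*(\<sigma> y*Q' s y))"
  unfolding v0_def[abs_def]
 proof (rule interval_integral_deriv)
  fix s y :: real
  show "DERIV (%s. airy (s + y)*(\<sigma> y*Q s y)) s :> airy' (s + y)*(\<sigma> y*Q s y) + airy (s + y)*(\<sigma> y*Q' s y)"
   by (auto intro!: derivative_eq_intros Q_family(2))
  show "continuous_on {-X..X} (%y. airy (s + y)*(\<sigma> y*Q s y))" by (intro continuous_intros)
  show "continuous_on (UNIV \<times> {-X..X}) (%z. airy' (fst z + snd z)*(\<sigma> (snd z)*Q (fst z) (snd z)) + airy (fst z + snd z)*(\<sigma> (snd z)*Q' (fst z) (snd z)))"
   unfolding Q'_def by (intro continuous_intros)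
 qed
 also have "integral {-X..X} (%y. airy' (s + y)*(\<sigma> y*Q s y) + airy (s + y)*(\<sigma> y*Q' s y))
  = integral {-X..X} (%y. airy' (s + y)*(\<sigma> y*Q s y) + (airy (s + y)*(\<sigma> y*P s y) + v0 s*(airy (s + y)*(\<sigma> y*Q s y))))"
  by (rule HK_cong) (simp add: Q'_def algebra_simps)
 also have "... = v1 s + (v1 s + v0 s * v0 s)"
 proof -
  have i: "(%y. airy' (s + y)*(\<sigma> y*Q s y)) integrable_on {-X..X}" "(%y. airy (s + y)*(\<sigma> y*P s y)) integrable_on {-X..X}"
   "(%y. v0 s*(airy (s + y)*(\<sigma> y*Q s y))) integrable_on {-X..X}"
   by (intro integrable_continuous_real continuous_intros)+
  show ?thesis using i by (simp add: HK_add integrable_add v1_eq) (simp add: v1_def v0_def)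
 qed
 finally show ?thesis by (simp add: power2_eq_square)
qed

lemma Q'_deriv: "DERIV (%s. Q' s x) s :> (u s + x)*Q s x"
 unfolding Q'_def[abs_def] u_def
 by (auto intro!: derivative_eq_intros P_family(2) Q_family(2) v0_deriv) (simp add: Q'_def algebra_simps power2_eq_square)

text \<open>The derivative of \<open>v0\<close> is obtained from the invariance of the kernel under simultaneous
 translation in \<open>s\<close> and in the spectral variable; \<open>Qs - Qx\<close> solves the integral
 equation whose right-hand side contains \<open>\<sigma>'\<close> in place of \<open>\<sigma>\<close>.\<close>

lemma v0_trace: "2 * v1 s + (v0 s)^2 = - integral {-X..X} (%y. \<sigma>' y*(Q s y)^2)"
proof -
 have X0: "-X <= X" using X by simp
 have \<sigma>b: "\<sigma> X = 0" "\<sigma> (-X) = 0" using \<sigma>_supp X by auto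
 have s'c [continuous_intros]: "continuous_on S \<sigma>'" for S using \<sigma>'_cont continuous_on_subset by blast
 let ?A = "%y. airy (s + y)"
 let ?v = "%y. \<sigma> y*Q s y" let ?w = "%y. \<sigma>' y*Q s y"
 have vc: "continuous_on S ?v" "continuous_on S ?w" for S by (intro continuous_intros)+
 \<comment> \<open>The \<open>x\<close>-derivative of \<open>Q s\<close>, read off from the integral
   equation, where \<open>x\<close> enters only through the kernel and the Airy function.\<close>
 define Qx where "Qx = (%x. airy' (s + x) - integral {-X..X} (%y. airyK' (s + x) (s + y)*?v y))"
 have Qs: "Q s = (%x. ?A x - airyQ s (-X) X ?v x)" using Q_eq[of s] unfolding N_def by (auto simp: fun_eq_iff algebra_simps)
 have Qxd: "DERIV (Q s) x :> Qx x" for x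
  by (subst Qs, unfold Qx_def, rule DERIV_diff[OF _ airyQ_derivative[OF vc(1)]]) (auto intro!: derivative_eq_intros)
 have Qxc [continuous_intros]: "continuous_on S Qx" for S unfolding Qx_def
  by (rule continuous_on_subset[of UNIV]) (intro continuous_intros airyQ_derivative_continuous vc, simp)
 define Z where "Z = (%x. Q' s x - Qx x)"
 have Q'c [continuous_intros]: "continuous_on S (Q' s)" for S unfolding Q'_def by (intro continuous_intros)
 have Zc [continuous_intros]: "continuous_on S Z" for S unfolding Z_def by (intro continuous_intros)
 \<comment> \<open>Integration by parts in \<open>y\<close>; the boundary terms vanish because
   \<sigma> does so at both ends of the interval.\<close>
 have NQx: "N s Qx x = - integral {-X..X} (%y. airyK' (s + y) (s + x)*?v y) - airyQ s (-X) X ?w x" for x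
 proof -
  have d: "((%y. airyK (s + x) (s + y)*(\<sigma> y*Q s y)) has_real_derivative
   airyK' (s + y) (s + x)*?v y + (airyK (s + x) (s + y)*?w y + airyK (s + x) (s + y)*(\<sigma> y*Qx y))) (at y)" for y
  proof -
   have "DERIV (%y. airyK (s + y) (s + x)) y :> airyK' (s + y) (s + x)*1"
    by (rule DERIV_chain2[OF airyK_deriv]) (auto intro!: derivative_eq_intros)
   hence "DERIV (%y. airyK (s + x) (s + y)) y :> airyK' (s + y) (s + x)"
    by (simp add: airyK_sym[of "s + x"])
   from DERIV_mult[OF this DERIV_mult[OF \<sigma>_deriv Qxd]] show ?thesis by (simp add: algebra_simps)
  qed
  have "((%y. airyK' (s + y) (s + x)*?v y + (airyK (s + x) (s + y)*?w y + airyK (s + x) (s + y)*(\<sigma> y*Qx y))) has_integral 0) {-X..X}"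
   by (rule integral_derivative_vanishing[OF X0 d]) (use \<sigma>b in auto)
  hence z: "integral {-X..X} (%y. airyK' (s + y) (s + x)*?v y + (airyK (s + x) (s + y)*?w y + airyK (s + x) (s + y)*(\<sigma> y*Qx y))) = 0"
   by (rule integral_unique)
  have i: "(%y. airyK' (s + y) (s + x)*?v y) integrable_on {-X..X}" "(%y. airyK (s + x) (s + y)*?w y) integrable_on {-X..X}"
   "(%y. airyK (s + x) (s + y)*(\<sigma> y*Qx y)) integrable_on {-X..X}"
   by (intro integrable_continuous_real continuous_intros)+
  show ?thesis using z i unfolding N_def airyQ_def by (simp add: HK_add integrable_add)
 qed
 \<comment> \<open>The two kernel derivatives add up to a rank-one term that cancels the
   contribution of \<open>v0 s * Q s\<close>, so that only the term with \<sigma>' survives.\<close>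
 have Ze: "Z x + N s Z x = airyQ s (-X) X ?w x" for x
 proof -
  have i: "(%y. airyK' (s + x) (s + y)*?v y) integrable_on {-X..X}" "(%y. airyK' (s + y) (s + x)*?v y) integrable_on {-X..X}"
   by (intro integrable_continuous_real continuous_intros)+
  have "N s Z x = 1*N s (Q' s) x + (-1)*N s Qx x"
   unfolding Z_def using N_linear[of "Q' s" Qx s 1 "-1" x] by (simp add: Q'c Qxc)
  moreover have "N s (Q' s) x = 1*N s (P s) x + v0 s*N s (Q s) x"
   unfolding Q'_def using N_linear[where f="P s" and g="Q s" and s=s and c=1 and d="v0 s" and x=x, OF P_cont Q_cont] by simp
  ultimately have "Z x + N s Z x = (P s x + N s (P s) x) + v0 s*(Q s x + N s (Q s) x) - airy' (s + x)
   + (integral {-X..X} (%y. airyK' (s + x) (s + y)*?v y) + integral {-X..X} (%y. airyK' (s + y) (s + x)*?v y)) + airyQ s (-X) X ?w x"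
   unfolding NQx by (simp add: Z_def Q'_def Qx_def algebra_simps)
  also have "integral {-X..X} (%y. airyK' (s + x) (s + y)*?v y) + integral {-X..X} (%y. airyK' (s + y) (s + x)*?v y)
   = integral {-X..X} (%y. airyK' (s + x) (s + y)*?v y + airyK' (s + y) (s + x)*?v y)"
   by (rule HK_add[OF i, symmetric])
  also have "... = integral {-X..X} (%y. (- airy (s + x))*(airy (s + y)*?v y))"
   by (rule HK_cong) (use airyK'_sum in \<open>simp add: distrib_right[symmetric]\<close>)
  also have "... = - airy (s + x) * v0 s" unfolding v0_def by (rule integral_mult_right)
  finally show ?thesis unfolding P_eq Q_eq by (simp add: mult.commute)
 qed
 have I: "(%y. airy' (s + y)*?v y) integrable_on {-X..X}" "(%y. ?A y*?w y) integrable_on {-X..X}" "(%y. ?A y*(\<sigma> y*Qx y)) integrable_on {-X..X}"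
  "(%y. ?A y*(\<sigma> y*Z y)) integrable_on {-X..X}" "(%y. ?v y*Z y) integrable_on {-X..X}" "(%y. ?v y*N s Z y) integrable_on {-X..X}"
  "(%y. \<sigma>' y*(Q s y)^2) integrable_on {-X..X}" "(%y. \<sigma> y*Z y*N s (Q s) y) integrable_on {-X..X}" "(%y. ?A y*(\<sigma> y*P s y)) integrable_on {-X..X}"
  "(%y. v0 s*(?A y*?v y)) integrable_on {-X..X}"
  by (intro integrable_continuous_real continuous_intros N_cont)+
 have "((%y. airy' (s + y)*?v y + (?A y*?w y + ?A y*(\<sigma> y*Qx y))) has_integral 0) {-X..X}"
 proof (rule integral_derivative_vanishing[OF X0])
  have "DERIV (%y. airy (s + y)) y :> airy' (s + y)" for y by (auto intro!: derivative_eq_intros)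
  note d = DERIV_mult[OF this DERIV_mult[OF \<sigma>_deriv Qxd]]
  show "DERIV (%y. ?A y*?v y) y :> airy' (s + y)*?v y + (?A y*?w y + ?A y*(\<sigma> y*Qx y))" for y
   by (rule DERIV_cong[OF d]) (simp add: algebra_simps)
 qed (use \<sigma>b in auto)
 hence "integral {-X..X} (%y. airy' (s + y)*?v y + (?A y*?w y + ?A y*(\<sigma> y*Qx y))) = 0" by (rule integral_unique)
 hence 1: "v1 s + (integral {-X..X} (%y. ?A y*?w y) + integral {-X..X} (%y. ?A y*(\<sigma> y*Qx y))) = 0"
  using I by (simp add: HK_add integrable_add v1_def)
 have 2: "v1 s + v0 s * v0 s = integral {-X..X} (%y. ?A y*(\<sigma> y*Z y)) + integral {-X..X} (%y. ?A y*(\<sigma> y*Qx y))"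
 proof -
  have "v1 s + v0 s * v0 s = integral {-X..X} (%y. ?A y*(\<sigma> y*P s y)) + integral {-X..X} (%y. v0 s*(?A y*?v y))"
   by (simp add: v1_eq) (simp add: v0_def)
  also have "... = integral {-X..X} (%y. ?A y*(\<sigma> y*P s y) + v0 s*(?A y*?v y))"
   by (rule HK_add[OF I(9,10), symmetric])
  also have "... = integral {-X..X} (%y. ?A y*(\<sigma> y*Z y) + ?A y*(\<sigma> y*Qx y))"
   by (rule HK_cong) (simp add: Z_def Q'_def algebra_simps)
  finally show ?thesis using I by (simp add: HK_add)
 qed
 \<comment> \<open>Inserting \<open>airy = Q + N Q\<close> and moving the operator by symmetry gives
   the pairing of \<open>\<sigma> Q\<close> with \<open>Z + N Z\<close>, which is known from
   \<open>Ze\<close>.\<close>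
 have 3: "integral {-X..X} (%y. ?A y*(\<sigma> y*Z y)) = integral {-X..X} (%y. ?w y*N s (Q s) y)"
 proof -
  have "integral {-X..X} (%y. ?A y*(\<sigma> y*Z y)) = integral {-X..X} (%y. ?v y*Z y + \<sigma> y*Z y*N s (Q s) y)"
   by (rule HK_cong) (simp only: Q_eq[of s, symmetric], simp add: algebra_simps)
  also have "... = integral {-X..X} (%y. ?v y*Z y) + integral {-X..X} (%y. \<sigma> y*Z y*N s (Q s) y)"
   by (rule HK_add[OF I(5,8)])
  also have "integral {-X..X} (%y. \<sigma> y*Z y*N s (Q s) y) = integral {-X..X} (%y. ?v y*N s Z y)"
   unfolding N_def by (rule airyQ_symmetric) (intro continuous_intros)+
  also have "integral {-X..X} (%y. ?v y*Z y) + ... = integral {-X..X} (%y. ?v y*Z y + ?v y*N s Z y)"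
   by (rule HK_add[OF I(5,6), symmetric])
  also have "... = integral {-X..X} (%y. ?v y*airyQ s (-X) X ?w y)" by (simp add: Ze[symmetric] distrib_left)
  also have "... = integral {-X..X} (%y. ?w y*airyQ s (-X) X ?v y)" by (rule airyQ_symmetric[OF vc])
  finally show ?thesis unfolding N_def .
 qed
 have "integral {-X..X} (%y. ?w y*N s (Q s) y) = integral {-X..X} (%y. ?A y*?w y - \<sigma>' y*(Q s y)^2)"
  by (rule HK_cong) (simp only: Q_eq[of s, symmetric], simp add: algebra_simps power2_eq_square)
 also have "... = integral {-X..X} (%y. ?A y*?w y) - integral {-X..X} (%y. \<sigma>' y*(Q s y)^2)"
  using I by (simp add: HK_diff)
 finally show ?thesis using 1 2 3 by (simp add: power2_eq_square)
qed

lemma u_trace: "u s = s - 2*integral {-X..X} (%y. \<sigma>' y*(Q s y)^2)"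
 unfolding u_def v0_trace by simp

text \<open>Quadratic moments \<open>g\<close> of \<open>Q\<close> satisfy \<open>g''' = 4 u g' + 2 u' g + 4 f'\<close>, stated here in a form without \<open>u'\<close>.\<close>

definition mom :: "real => real => (real => real) => real => real" where
 "mom a b w s = integral {a..b} (%x. (Q s x)^2*w x)"
definition mom1 :: "real => real => (real => real) => real => real" where
 "mom1 a b w s = integral {a..b} (%x. 2*Q s x*Q' s x*w x)"
definition mom2 :: "real => real => (real => real) => real => real" where
 "mom2 a b w s = integral {a..b} (%x. 2*(Q' s x)^2*w x)"

lemma mom_derivs:
 assumes w: "continuous_on {a..b} w"
 shows "DERIV (mom a b w) s :> mom1 a b w s"
  "DERIV (mom1 a b w) s :> (mom2 a b w s + 2*(u s*mom a b w s + mom a b (%x. x*w x) s))"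
  "DERIV (mom2 a b w) s :> 2*(u s*mom1 a b w s + mom1 a b (%x. x*w x) s)"
proof -
 have w' [continuous_intros]: "continuous_on (UNIV \<times> {a..b}) (%z. w (snd z))" by (rule continuous_on_compose2[OF w]) (auto intro!: continuous_intros)
 have Q'j [continuous_intros]: "continuous_on S f ==> continuous_on S g ==> continuous_on S (%z. Q' (f z) (g z))" for S :: "(real \<times> real) set" and f g
  unfolding Q'_def by (intro continuous_intros)
 have Q'k [continuous_intros]: "continuous_on S (Q' s)" for S s unfolding Q'_def by (intro continuous_intros)
 have uc [continuous_intros]: "continuous_on S f ==> continuous_on S (%z. u (f z))" for S :: "(real \<times> real) set" and f
  by (rule continuous_on_compose2[OF u_continuous[of UNIV]]) auto
 show "DERIV (mom a b w) s :> mom1 a b w s"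
  unfolding mom_def[abs_def] mom1_def
 proof (rule interval_integral_deriv)
  show "DERIV (%s. (Q s x)^2*w x) s :> 2*Q s x*Q' s x*w x" for s x
   by (auto intro!: derivative_eq_intros Q_family(2))
 qed (intro continuous_intros w)+
 have i: "(%x. 2*(Q' s x)^2*w x) integrable_on {a..b}" "(%x. (Q s x)^2*w x) integrable_on {a..b}"
  "(%x. (Q s x)^2*(x*w x)) integrable_on {a..b}" "(%x. 2*Q s x*Q' s x*w x) integrable_on {a..b}"
  "(%x. 2*Q s x*Q' s x*(x*w x)) integrable_on {a..b}"
  by (intro integrable_continuous_real continuous_intros w)+
 have "DERIV (mom1 a b w) s :> integral {a..b} (%x. 2*(Q' s x)^2*w x + 2*(u s*((Q s x)^2*w x) + (Q s x)^2*(x*w x)))"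
  unfolding mom1_def[abs_def]
 proof (rule interval_integral_deriv)
  show "DERIV (%s. 2*Q s x*Q' s x*w x) s :> 2*(Q' s x)^2*w x + 2*(u s*((Q s x)^2*w x) + (Q s x)^2*(x*w x))" for s x
   by (auto intro!: derivative_eq_intros Q_family(2) Q'_deriv) (simp add: algebra_simps power2_eq_square)
 qed (intro continuous_intros w)+
 also have "integral {a..b} (%x. 2*(Q' s x)^2*w x + 2*(u s*((Q s x)^2*w x) + (Q s x)^2*(x*w x)))
  = mom2 a b w s + 2*(u s*mom a b w s + mom a b (%x. x*w x) s)"
  unfolding mom_def mom2_def using i 
  by (simp only: HK_add Henstock_Kurzweil_Integration.integral_mult_right integrable_on_mult_right integrable_add)
 finally show "DERIV (mom1 a b w) s :> (mom2 a b w s + 2*(u s*mom a b w s + mom a b (%x. x*w x) s))" .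
 have "DERIV (mom2 a b w) s :> integral {a..b} (%x. 2*(u s*(2*Q s x*Q' s x*w x) + 2*Q s x*Q' s x*(x*w x)))"
  unfolding mom2_def[abs_def]
 proof (rule interval_integral_deriv)
  show "DERIV (%s. 2*(Q' s x)^2*w x) s :> 2*(u s*(2*Q s x*Q' s x*w x) + 2*Q s x*Q' s x*(x*w x))" for s x
   by (auto intro!: derivative_eq_intros Q_family(2) Q'_deriv) (simp add: algebra_simps power2_eq_square)
 qed (intro continuous_intros w)+
 also have "integral {a..b} (%x. 2*(u s*(2*Q s x*Q' s x*w x) + 2*Q s x*Q' s x*(x*w x)))
  = 2*(u s*mom1 a b w s + mom1 a b (%x. x*w x) s)"
  unfolding mom1_def using i 
  by (simp only: HK_add Henstock_Kurzweil_Integration.integral_mult_right integrable_on_mult_right integrable_add)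
 finally show "DERIV (mom2 a b w) s :> 2*(u s*mom1 a b w s + mom1 a b (%x. x*w x) s)" .
qed

end

section \<open>Completeness\<close>

lemma heat_second_moment:
 assumes t: "t > 0"
 shows "integrable lborel (%z. z^2*heat t z)" "(LINT z|lborel. z^2*heat t z) = 2*t"
proof -
 have h: "heat t z = normal_density 0 (sqrt (2*t)) z" for z using heat_normal_density[OF t, of z 0] by simp
 have "has_bochner_integral lborel (%x. normal_density 0 (sqrt (2*t)) x*(x - 0)^(2*1)) (fact (2*1)/((2/(sqrt (2*t))^2)^1*fact 1))"
  by (rule normal_moment_even) (use t in simp)
 hence "has_bochner_integral lborel (%x. x^2*heat t x) (2*t)" using t by (simp add: h mult.commute)
 thus "integrable lborel (%z. z^2*heat t z)" "(LINT z|lborel. z^2*heat t z) = 2*t"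
  by (auto simp: has_bochner_integral_iff)
qed

lemma heat_even: "heat t (- z) = heat t z" "heat t (a - b) = heat t (b - a)"
 by (simp_all add: heat_def power2_commute)

lemma heat_shift_integral:
 fixes f :: "real => real"
 shows "(LINT z|lborel. f (p - z)) = (LINT z|lborel. f z)" "integrable lborel f ==> integrable lborel (%z. f (p - z))"
 using lborel_integral_real_affine[of "-1" f p] lborel_integrable_real_affine[of f "-1" p] by simp_all

text \<open>The arithmetic-geometric mean inequality at scale \<open>sqrt t\<close> reduces the
  first moment to those of order 0 and 2.\<close>

lemma heat_first_moment:
 assumes t: "t > 0"
 shows "integrable lborel (%z. abs (p - z)*heat t (p - z))" "(LINT z|lborel. abs (p - z)*heat t (p - z)) <= 3/2 * sqrt t"
proof -
 have le: "abs z*heat t z <= sqrt t/2*heat t z + 1/(2 * sqrt t)*(z^2*heat t z)" for z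
 proof -
  have "0 <= (abs z - sqrt t)^2" by simp
  moreover have "(abs z - sqrt t)^2 = z^2 - 2*(abs z * sqrt t) + sqrt t * sqrt t" using t by (simp add: power2_diff)
  ultimately have "2*(abs z * sqrt t) <= z^2 + sqrt t * sqrt t" by linarith
  hence "abs z <= sqrt t/2 + 1/(2 * sqrt t)*z^2" using t by (simp add: field_simps)
  hence "abs z*heat t z <= (sqrt t/2 + 1/(2 * sqrt t)*z^2)*heat t z" by (rule mult_right_mono) (simp add: heat_nonneg t)
  thus ?thesis by (simp add: distrib_right mult.assoc)
 qed
 have i0: "integrable lborel (heat t)" using heat_integral(1)[OF t, of 0] by simp
 have I0: "(LINT z|lborel. heat t z) = 1" using heat_integral(2)[OF t, of 0] by simp
 have r: "integrable lborel (%z. sqrt t/2*heat t z + 1/(2 * sqrt t)*(z^2*heat t z))"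
  using i0 heat_second_moment(1)[OF t] by simp
 have i: "integrable lborel (%z. abs z*heat t z)"
  by (rule Bochner_bound[OF r]) (use le heat_nonneg[OF t] in \<open>auto simp: abs_mult intro!: AE_I2 order_trans[OF _ abs_ge_self]\<close>)
 show "integrable lborel (%z. abs (p - z)*heat t (p - z))" using heat_shift_integral(2)[OF i] .
 have "(LINT z|lborel. abs (p - z)*heat t (p - z)) = (LINT z|lborel. abs z*heat t z)"
  by (rule heat_shift_integral(1)[of "%z. abs z*heat t z"])
 also have "... <= (LINT z|lborel. sqrt t/2*heat t z + 1/(2 * sqrt t)*(z^2*heat t z))"
  by (rule integral_mono[OF i r le])
 also have "... = sqrt t/2 + 1/(2 * sqrt t)*(2*t)" using i0 I0 heat_second_moment[OF t] by simp
 also have "1/(2 * sqrt t)*(2*t) = sqrt t" using t real_div_sqrt[of t] by simp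
 finally show "(LINT z|lborel. abs (p - z)*heat t (p - z)) <= 3/2 * sqrt t" by simp
qed

text \<open>The comparison is with \<open>d p\<close> times the mass retained on the half-line and
  not with \<open>d p\<close>: near the end point part of the mass is lost, which
  \<open>heat_mass\<close> quantifies.\<close>

lemma heat_average:
 assumes t: "t > 0" and m [measurable]: "d \<in> borel_measurable borel" and p: "p >= 0"
  and dL: "\<And>q. q >= 0 ==> abs (d q - d p) <= L*abs (p - q)" 
 shows "set_integrable lborel {0..} (%q. d q*heat t (p - q))"
  "abs ((LINT q:{0..}|lborel. d q*heat t (p - q)) - d p*(LINT q:{0..}|lborel. heat t (p - q))) <= L*(3/2 * sqrt t)"
proof -
 have ih: "integrable lborel (%q. indicator {0..} q*heat t (p - q))"
  using integrable_real_mult_indicator[OF _ heat_integral(3)[OF t, of p], of "{0..}"] by (simp add: mult.commute)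
 have L0: "L >= 0" using dL[of "p + 1"] p by (simp add: order_trans[OF abs_ge_zero])
 have r: "integrable lborel (%q. L*(abs (p - q)*heat t (p - q)))" using heat_first_moment(1)[OF t] by simp
 have b: "abs (indicator {0..} q*((d q - d p)*heat t (p - q))) <= L*(abs (p - q)*heat t (p - q))" for q
  using mult_right_mono[OF dL[of q] heat_nonneg[OF t, of "p - q"]] heat_nonneg[OF t, of "p - q"] L0
  by (auto simp: indicator_def abs_mult mult.assoc)
 have i: "integrable lborel (%q. indicator {0..} q*((d q - d p)*heat t (p - q)))"
  by (rule Bochner_bound[OF r]) (use b in \<open>auto intro!: AE_I2 intro: order_trans[OF _ abs_ge_self]\<close>)
 have e: "indicator {0..} q *\<^sub>R (d q*heat t (p - q)) = indicator {0..} q*((d q - d p)*heat t (p - q)) + d p*(indicator {0..} q*heat t (p - q))" for q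
  by (simp add: algebra_simps)
 show "set_integrable lborel {0..} (%q. d q*heat t (p - q))"
  unfolding set_integrable_def e using i ih by simp
 have "(LINT q:{0..}|lborel. d q*heat t (p - q)) - d p*(LINT q:{0..}|lborel. heat t (p - q))
  = (LINT q|lborel. indicator {0..} q*((d q - d p)*heat t (p - q)))"
  unfolding LINT_def e using i ih by simp
 also have "abs ... <= (LINT q|lborel. L*(abs (p - q)*heat t (p - q)))"
  by (rule integral_abs_bound_integral[OF i r]) (use b in auto)
 also have "... <= L*(3/2 * sqrt t)" using mult_left_mono[OF heat_first_moment(2)[OF t, of p] L0] by simp
 finally show "abs ((LINT q:{0..}|lborel. d q*heat t (p - q)) - d p*(LINT q:{0..}|lborel. heat t (p - q))) <= L*(3/2 * sqrt t)" .
qed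

text \<open>The lower bound away from the end point is Chebyshev's inequality with the second moment
  \<open>2*t\<close>. At the end point symmetry leaves exactly half of the mass, which explains the
  factor 2 in the first estimate of \<open>gauss_kernel_limit\<close>.\<close>

lemma heat_mass:
 assumes t: "t > 0"
 shows "0 <= (LINT q:{0..}|lborel. heat t (p - q))" "(LINT q:{0..}|lborel. heat t (p - q)) <= 1"
  "0 < y ==> y <= p ==> 1 - 2*t/y^2 <= (LINT q:{0..}|lborel. heat t (p - q))"
  "(LINT q:{0..}|lborel. heat t (0 - q)) = 1/2"
proof -
 have ih: "integrable lborel (%q. heat t (p - q))" "(LINT q|lborel. heat t (p - q)) = 1" for p using heat_integral[OF t] by auto
 have ii: "integrable lborel (%q. indicator A q*heat t (p - q))" if "A \<in> sets lborel" for A p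
  using integrable_real_mult_indicator[OF that ih(1)[of p]] by (simp add: mult.commute)
 show "0 <= (LINT q:{0..}|lborel. heat t (p - q))"
  unfolding LINT_def by (rule Bochner_nonneg) (simp add: heat_nonneg t)
 have "(LINT q|lborel. indicator {0..} q*heat t (p - q)) <= (LINT q|lborel. heat t (p - q))"
  by (rule integral_mono[OF ii ih(1)]) (auto simp: indicator_def heat_nonneg t)
 thus "(LINT q:{0..}|lborel. heat t (p - q)) <= 1" using ih(2) by (simp add: LINT_def)
 have split: "(LINT q|lborel. indicator {0..} q*heat t (p - q)) = 1 - (LINT q|lborel. indicator {..<0} q*heat t (p - q))" for p
 proof -
  have "1 = (LINT q|lborel. indicator {0..} q*heat t (p - q) + indicator {..<0} q*heat t (p - q))"
   unfolding ih(2)[of p, symmetric] by (rule Bochner_cong) (auto simp: indicator_def)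
  thus ?thesis using ii[of "{0..}" p] ii[of "{..<0}" p] by simp
 qed
 show "1 - 2*t/y^2 <= (LINT q:{0..}|lborel. heat t (p - q))" if y: "0 < y" "y <= p"
 proof -
  have i2: "integrable lborel (%q. (p - q)^2*heat t (p - q))" "(LINT q|lborel. (p - q)^2*heat t (p - q)) = 2*t"
   using heat_shift_integral[of "%z. z^2*heat t z" p] heat_second_moment[OF t] by auto
  have "(LINT q|lborel. indicator {..<0} q*heat t (p - q)) <= (LINT q|lborel. 1/y^2*((p - q)^2*heat t (p - q)))"
  proof (rule integral_mono[OF ii])
   fix q :: real
   show "indicator {..<0} q*heat t (p - q) <= 1/y^2*((p - q)^2*heat t (p - q))"
   proof (cases "q < 0")
    case True
    have "y^2 <= (p - q)^2" using y True by (intro power_mono) auto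
    hence "1 <= 1/y^2*(p - q)^2" using y by (simp add: field_simps)
    hence "1*heat t (p - q) <= (1/y^2*(p - q)^2)*heat t (p - q)" by (intro mult_right_mono) (auto simp: heat_nonneg t)
    thus ?thesis using True by (simp add: mult.assoc)
   qed (auto simp: heat_nonneg t)
  qed (use i2 in auto)
  also have "... = 1/y^2*(2*t)" using i2 by simp
  finally show ?thesis unfolding LINT_def using split[of p] by simp
 qed
 have "(LINT q|lborel. indicator {..<0} q*heat t (0 - q)) = (LINT q|lborel. indicator {..<0} (0 - q)*heat t (0 - (0 - q)))"
  by (rule heat_shift_integral(1)[symmetric, where f="%q. indicator {..<0} q*heat t (0 - q)"])
 also have "... = (LINT q|lborel. indicator {0..} q*heat t (0 - q))"
  by (rule integral_cong_AE) (auto simp: indicator_def heat_even intro!: eventually_mono[OF AE_lborel_singleton[of 0]])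
 finally show "(LINT q:{0..}|lborel. heat t (0 - q)) = 1/2" unfolding LINT_def using split[of 0] by simp
qed

text \<open>Quantitative limits as \<open>t\<close> tends to 0: the single integral sees half of the
  boundary value \<open>c 0\<close>, the double integral tends to the squared norm. Here
  \<open>y\<close> is the free width of a boundary layer in which the lost mass is estimated
  trivially.\<close>

lemma gauss_kernel_limit:
 fixes s :: real
 assumes t: "0 < t" "t <= 1" and c: "c \<in> borel_measurable borel" "M >= 0"
  and cb: "\<And>p. p >= 0 ==> abs (c p) <= M*exp (- p)"
  and cl: "\<And>p q. p >= 0 ==> q >= 0 ==> abs (c p - c q) <= M*abs (p - q)" and y: "y > 0"
 defines "k \<equiv> exp (t^3/12 - t * s)"
 shows "abs (2*(LINT p:{0..}|lborel. c p*gauss_kernel t s (s + p)) - c 0) <= k*(6*M * sqrt t) + abs (k - 1)*M"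
  "abs ((LINT p:{0..}|lborel. c p*(LINT q:{0..}|lborel. c q*gauss_kernel t (s + p) (s + q))) - (LINT p:{0..}|lborel. (c p)^2))
   <= k*(M^2*(3 * sqrt t + y + 2*t/y^2)) + k*(M^2*t) + abs (k - 1)*M^2"
proof -
 note [measurable] = c(1)
 \<comment> \<open>Absorbs the exponential factors of \<open>gauss_kernel_heat\<close>, so that a
   pure heat kernel remains.\<close>
 define d where "d = (%p. c p*exp (- t*p/2))"
 have dm [measurable]: "d \<in> borel_measurable borel" unfolding d_def by measurable
 have k0: "k > 0" by (simp add: k_def)
 have el: "abs (exp (- t*p/2) - exp (- t*q/2)) <= abs (p - q)" if "p >= 0" "q >= 0" for p q
 proof -
  have *: "abs (exp (- t*p/2) - exp (- t*q/2)) <= abs (p - q)" if h: "p >= 0" "q >= p" for p q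
  proof -
   have e: "exp (- t*q/2) = exp (- t*p/2)*exp (- t*(q - p)/2)" by (simp add: exp_add[symmetric] field_simps)
   define T E where "T = t*(q - p)" and "E = exp (- t*(q - p)/2)"
   have "1 - T/2 <= E" using exp_ge_add_one_self[of "- t*(q - p)/2"] by (simp add: T_def E_def)
   moreover have "T <= 1*(q - p)" using t h unfolding T_def by (intro mult_right_mono) auto
   ultimately have "1 - E <= q - p" using h by simp
   hence "1 - exp (- t*(q - p)/2) <= q - p" by (simp only: E_def)
   moreover have "0 <= 1 - exp (- t*(q - p)/2)" using t h by simp
   moreover have "exp (- t*p/2) <= 1" using t h by simp
   ultimately have "exp (- t*p/2)*(1 - exp (- t*(q - p)/2)) <= 1*(q - p)" by (intro mult_mono) auto
   moreover have "0 <= exp (- t*p/2)*(1 - exp (- t*(q - p)/2))" using t h by simp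
   ultimately show ?thesis using h unfolding e by (simp add: algebra_simps)
  qed
  show ?thesis using *[of p q] *[of q p] that by (cases "p <= q") auto
 qed
 have cM: "abs (c p) <= M" if "p >= 0" for p
 proof -
  have "M*exp (- p) <= M*1" using that c(2) by (intro mult_left_mono) auto
  thus ?thesis using cb[OF that] by linarith
 qed
 have db: "abs (d p) <= M*exp (- p)" if "p >= 0" for p
 proof -
  have "abs (c p)*exp (- t*p/2) <= (M*exp (- p))*1" using cb[OF that] that t c(2) by (intro mult_mono) auto
  thus ?thesis by (simp add: d_def abs_mult)
 qed
 have dl: "abs (d q - d p) <= (2*M)*abs (p - q)" if "p >= 0" "q >= 0" for p q
 proof -
  have "d q - d p = (c q - c p)*exp (- t*q/2) + c p*(exp (- t*q/2) - exp (- t*p/2))"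
   by (simp add: d_def algebra_simps)
  hence "abs (d q - d p) <= abs (c q - c p)*exp (- t*q/2) + abs (c p)*abs (exp (- t*q/2) - exp (- t*p/2))"
   by (metis abs_exp_cancel abs_mult abs_triangle_ineq)
  also have "... <= (M*abs (q - p))*1 + M*abs (q - p)"
   using cl[OF that(2,1)] cM[OF that(1)] el[OF that(2,1)] t that c(2) by (intro add_mono mult_mono) auto
  finally show ?thesis by (simp add: abs_minus_commute)
 qed
 have gk: "gauss_kernel t (s + p) (s + q) = k*(exp (- t*p/2)*exp (- t*q/2)*heat t (p - q))" for p q
  unfolding gauss_kernel_heat k_def ..
 have 1: "2*(LINT p:{0..}|lborel. c p*gauss_kernel t s (s + p)) = k*(2*(LINT p:{0..}|lborel. d p*heat t (0 - p)))"
 proof -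
  have "c p*gauss_kernel t s (s + p) = k*(d p*heat t (0 - p))" for p
   using gk[of 0 p] by (simp add: d_def)
  thus ?thesis by simp
 qed
 have "abs (2*(LINT p:{0..}|lborel. d p*heat t (0 - p)) - d 0) <= 6*M * sqrt t"
 proof -
  let ?I = "LINT p:{0..}|lborel. d p*heat t (0 - p)"
  have "abs (?I - d 0*(1/2)) <= 3*M * sqrt t"
   using heat_average(2)[OF t(1) dm _ dl, of 0] unfolding heat_mass(4)[OF t(1)] by simp
  moreover have "2*?I - d 0 = 2*(?I - d 0*(1/2))" by simp
  ultimately show ?thesis by (simp only: abs_mult)
 qed
 hence "k*abs (2*(LINT p:{0..}|lborel. d p*heat t (0 - p)) - c 0) <= k*(6*M * sqrt t)" using k0 by (simp add: d_def)
 moreover have "abs (k - 1)*abs (c 0) <= abs (k - 1)*M" using cM[of 0] by (intro mult_left_mono) auto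
 moreover have "abs (k*z - c 0) <= k*abs (z - c 0) + abs (k - 1)*abs (c 0)" for z
 proof -
  have "k*z - c 0 = k*(z - c 0) + (k - 1)*c 0" by (simp add: algebra_simps)
  thus ?thesis using k0 by (metis abs_mult abs_of_pos abs_triangle_ineq)
 qed
 ultimately show "abs (2*(LINT p:{0..}|lborel. c p*gauss_kernel t s (s + p)) - c 0) <= k*(6*M * sqrt t) + abs (k - 1)*M"
  unfolding 1 by (meson add_mono order_trans)
 define av where "av = (%p. LINT q:{0..}|lborel. d q*heat t (p - q))"
 have avm [measurable]: "av \<in> borel_measurable borel" unfolding av_def[abs_def] LINT_def by measurable
 have av: "abs (av p - d p) <= 3*M * sqrt t + M*exp (- p)*(indicator {0..y} p + 2*t/y^2)" if p: "p >= 0" for p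
 proof -
  let ?m = "LINT q:{0..}|lborel. heat t (p - q)"
  have "abs (av p - d p*?m) <= 3*M * sqrt t" unfolding av_def using heat_average(2)[OF t(1) dm p dl] p by simp
  moreover have "abs (d p*?m - d p) <= M*exp (- p)*(indicator {0..y} p + 2*t/y^2)"
  proof -
   have "abs (?m - 1) <= indicator {0..y} p + 2*t/y^2"
   proof (cases "p <= y")
    case True
    have "0 <= 2*t/y^2" using t by simp
    thus ?thesis using True p heat_mass(1,2)[OF t(1), of p] by simp
   next
    case False
    thus ?thesis using heat_mass(3)[OF t(1), of y p] heat_mass(2)[OF t(1), of p] y by simp
   qed
   hence "abs (d p)*abs (?m - 1) <= (M*exp (- p))*(indicator {0..y} p + 2*t/y^2)"
    using db[OF p] c(2) by (intro mult_mono) auto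
   thus ?thesis by (simp add: abs_mult[symmetric] algebra_simps)
  qed
  ultimately show ?thesis by linarith
 qed
 have rd: "rapid d" unfolding rapid_def using db by auto
 have rc: "rapid c" unfolding rapid_def using cb by auto
 have idd: "set_integrable lborel {0..} (%p. d p*d p)" by (rule rapid_set_integrable[OF rd rd])
 have icc: "set_integrable lborel {0..} (%p. c p*c p)" by (rule rapid_set_integrable[OF rc rc])
 have bdd: "abs (d p*(av p - d p)) <= M^2*(3 * sqrt t + 2*t/y^2)*exp (- p) + M^2*indicator {0..y} p" if p: "p >= 0" for p
 proof -
  have "abs (d p*(av p - d p)) <= (M*exp (- p))*(3*M * sqrt t + M*exp (- p)*(indicator {0..y} p + 2*t/y^2))"
   unfolding abs_mult using db[OF p] av[OF p] c(2) by (intro mult_mono) auto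
  also have "... = M^2*(3 * sqrt t)*exp (- p) + M^2*(exp (- p)*exp (- p))*(indicator {0..y} p + 2*t/y^2)"
   by (simp add: algebra_simps power2_eq_square)
  also have "... = M^2*(3 * sqrt t)*exp (- p) + M^2*(2*t/y^2)*(exp (- p)*exp (- p)) + M^2*indicator {0..y} p*(exp (- p)*exp (- p))"
   by (simp only: distrib_left distrib_right mult_ac add_ac)
  also have "... <= M^2*(3 * sqrt t)*exp (- p) + M^2*(2*t/y^2)*(exp (- p)*1) + M^2*indicator {0..y} p*1"
   using p t by (intro add_mono mult_left_mono order_refl mult_le_one) auto
  finally show ?thesis by (simp add: algebra_simps)
 qed
 have iB: "integrable lborel (%p. M^2*(3 * sqrt t + 2*t/y^2)*(indicator {0..} p*exp (- p)) + M^2*indicator {0..y} p)"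
  by (intro Bochner_add integrable_exp_half integrable_mult_right) (use y in \<open>auto\<close>)
 have bdd': "abs (indicator {0..} p*(d p*(av p - d p))) <= M^2*(3 * sqrt t + 2*t/y^2)*(indicator {0..} p*exp (- p)) + M^2*indicator {0..y} p" for p
  using bdd[of p] y by (auto simp: indicator_def)
 have iav: "integrable lborel (%p. indicator {0..} p*(d p*(av p - d p)))"
  by (rule Bochner_bound[OF iB]) (use bdd' in \<open>auto intro!: AE_I2 intro: order_trans[OF _ abs_ge_self]\<close>)
 have 2: "(LINT p:{0..}|lborel. c p*(LINT q:{0..}|lborel. c q*gauss_kernel t (s + p) (s + q)))
  = k*((LINT p|lborel. indicator {0..} p*(d p*(av p - d p))) + (LINT p:{0..}|lborel. d p*d p))"
 proof -
  have "c p*(LINT q:{0..}|lborel. c q*gauss_kernel t (s + p) (s + q)) = k*(d p*av p)" for p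
  proof -
   have "c q*gauss_kernel t (s + p) (s + q) = (k*exp (- t*p/2))*(d q*heat t (p - q))" for q
    by (simp add: gk d_def)
   hence "(LINT q:{0..}|lborel. c q*gauss_kernel t (s + p) (s + q)) = (k*exp (- t*p/2))*av p"
    by (simp only: set_integral_mult_right av_def)
   thus ?thesis by (simp only: d_def mult_ac)
  qed
  hence "(LINT p:{0..}|lborel. c p*(LINT q:{0..}|lborel. c q*gauss_kernel t (s + p) (s + q))) = k*(LINT p:{0..}|lborel. d p*av p)" by simp
  also have "(LINT p:{0..}|lborel. d p*av p) = (LINT p|lborel. indicator {0..} p*(d p*(av p - d p)) + indicator {0..} p*(d p*d p))"
   unfolding LINT_def by (rule Bochner_cong) (simp_all add: algebra_simps)
  also have "... = (LINT p|lborel. indicator {0..} p*(d p*(av p - d p))) + (LINT p:{0..}|lborel. d p*d p)"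
   using iav idd by (simp add: set_integrable_def LINT_def)
  finally show ?thesis .
 qed
 have R1: "abs (LINT p|lborel. indicator {0..} p*(d p*(av p - d p))) <= M^2*(3 * sqrt t + y + 2*t/y^2)"
 proof -
  have "abs (LINT p|lborel. indicator {0..} p*(d p*(av p - d p))) <= (LINT p|lborel. M^2*(3 * sqrt t + 2*t/y^2)*(indicator {0..} p*exp (- p)) + M^2*indicator {0..y} p)"
   by (rule integral_abs_bound_integral[OF iav iB]) (use bdd' in auto)
  also have "... = (LINT p|lborel. M^2*(3 * sqrt t + 2*t/y^2)*(indicator {0..} p*exp (- p))) + (LINT p|lborel. M^2*indicator {0..y} p)"
   by (intro Bochner_Integration.integral_add integrable_exp_half integrable_mult_right) (use y in auto)
  also have "... = M^2*(3 * sqrt t + 2*t/y^2) + M^2*y" unfolding integral_exp_half using y by simp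
  finally show ?thesis by (simp add: algebra_simps)
 qed
 have R2: "abs ((LINT p:{0..}|lborel. d p*d p) - (LINT p:{0..}|lborel. c p*c p)) <= M^2*t"
 proof -
  have b: "abs (d p*d p - c p*c p) <= M^2*t*exp (- p)" if p: "p >= 0" for p
  proof -
   have e: "d p*d p = c p*c p*exp (- t*p)" by (simp add: d_def exp_add[symmetric] mult_ac)
   have "1 - t*p <= exp (- t*p)" using exp_ge_add_one_self[of "- t*p"] by simp
   hence "abs (exp (- t*p) - 1) <= t*p" using t p by simp
   moreover have "abs (c p)*abs (c p) <= (M*exp (- p))*(M*exp (- p))" using cb[OF p] c(2) by (intro mult_mono) auto
   ultimately have "(abs (c p)*abs (c p))*abs (exp (- t*p) - 1) <= ((M*exp (- p))*(M*exp (- p)))*(t*p)"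
    using c(2) by (rule_tac mult_mono) auto
   also have "... = M^2*t*exp (- p)*(p*exp (- p))" by (simp add: power2_eq_square)
   also have "... <= M^2*t*exp (- p)*1"
   proof (rule mult_left_mono)
    have "p <= exp p" using exp_ge_add_one_self[of p] by linarith
    thus "p*exp (- p) <= 1" by (simp add: exp_minus field_simps)
   qed (use t in simp)
   finally have "abs (c p*c p*(exp (- t*p) - 1)) <= M^2*t*exp (- p)" by (simp add: abs_mult)
   thus ?thesis unfolding e by (simp add: algebra_simps)
  qed
  have i: "integrable lborel (%p. indicator {0..} p*(d p*d p) - indicator {0..} p*(c p*c p))"
   using idd icc unfolding set_integrable_def by simp
  have "(LINT p:{0..}|lborel. d p*d p) - (LINT p:{0..}|lborel. c p*c p) = (LINT p|lborel. indicator {0..} p*(d p*d p) - indicator {0..} p*(c p*c p))"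
   using idd icc unfolding set_integrable_def LINT_def by simp
  also have "abs ... <= (LINT p|lborel. M^2*t*(indicator {0..} p*exp (- p)))"
   by (rule integral_abs_bound_integral[OF i integrable_exp_half]) (use b in \<open>auto simp: indicator_def\<close>)
  finally show ?thesis unfolding integral_exp_half .
 qed
 have c2: "(LINT p:{0..}|lborel. (c p)^2) = (LINT p:{0..}|lborel. c p*c p)" by (simp add: power2_eq_square)
 have R3: "abs (LINT p:{0..}|lborel. c p*c p) <= M^2"
 proof -
  have "abs (LINT p:{0..}|lborel. c p*c p) <= (LINT p|lborel. M^2*(indicator {0..} p*exp (- p)))"
   unfolding LINT_def
  proof (rule integral_abs_bound_integral[OF _ integrable_exp_half])
   show "integrable lborel (%p. indicat_real {0..} p *\<^sub>R (c p*c p))" using icc by (simp add: set_integrable_def)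
   fix p :: real
   have "abs (c p)*abs (c p) <= M*(M*exp (- p))" if "p >= 0" using cb[OF that] cM[OF that] c(2) by (intro mult_mono) auto
   thus "abs (indicat_real {0..} p *\<^sub>R (c p*c p)) <= M^2*(indicator {0..} p*exp (- p))"
    by (auto simp: indicator_def abs_mult power2_eq_square)
  qed
  thus ?thesis unfolding integral_exp_half .
 qed
 have fin: "abs (k*(a + b) - e) <= k*A + k*B + abs (k - 1)*E" if "abs a <= A" "abs (b - e) <= B" "abs e <= E" for a b e A B E :: real
 proof -
  have "k*(a + b) - e = k*a + k*(b - e) + (k - 1)*e" by (simp add: algebra_simps)
  hence "abs (k*(a + b) - e) <= k*abs a + k*abs (b - e) + abs (k - 1)*abs e"
   using k0 abs_triangle_ineq[of "k*a + k*(b - e)" "(k - 1)*e"] abs_triangle_ineq[of "k*a" "k*(b - e)"] by (simp add: abs_mult)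
  also have "... <= k*A + k*B + abs (k - 1)*E" using that k0 by (intro add_mono mult_left_mono) auto
  finally show ?thesis .
 qed
 show "abs ((LINT p:{0..}|lborel. c p*(LINT q:{0..}|lborel. c q*gauss_kernel t (s + p) (s + q))) - (LINT p:{0..}|lborel. (c p)^2))
   <= k*(M^2*(3 * sqrt t + y + 2*t/y^2)) + k*(M^2*t) + abs (k - 1)*M^2"
  unfolding 2 c2 by (rule fin[OF R1 R2 R3])
qed

lemma airyC_lipschitz:
 assumes v: "continuous_on {a..b} v" and B: "\<And>x. x \<in> {a..b} ==> abs (v x) <= B" and ab: "a <= b"
  and p: "p >= 0" "q >= 0"
 shows "abs (airyC s a b v p - airyC s a b v q) <= AB*exp (- s - a)*B*(b - a)*abs (p - q)"
proof -
 let ?d = "%p. integral {a..b} (%x. airy' (s + p + x) * v x)"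
 have v' [continuous_intros]: "continuous_on (UNIV \<times> {a..b}) (%z. v (snd z))" by (rule continuous_on_compose2[OF v]) (auto intro!: continuous_intros)
 have B0: "B >= 0" using B[of a] ab by auto
 have d: "DERIV (airyC s a b v) p :> ?d p" for p
  unfolding airyC_def[abs_def]
 proof (rule interval_integral_deriv)
  show "DERIV (%p. airy (s + p + y) * v y) z :> airy' (s + z + y) * v y" for z y
   by (auto intro!: derivative_eq_intros)
 qed (intro continuous_intros v)+
 have db: "abs (?d p) <= AB*exp (- s - a)*B*(b - a)" if "p >= 0" for p
 proof -
  have "norm (?d p) <= (AB*exp (- s - a)*B)*(b - a)"
  proof (rule integral_bound[OF ab])
   show "continuous_on {a..b} (%x. airy' (s + p + x) * v x)" by (intro continuous_intros v)
   fix x assume x: "x \<in> {a..b}"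
   have "AB*exp (- (s + p + x)) <= AB*exp (- s - a)" using x that airy_bounds(1) by (intro mult_left_mono) auto
   hence "abs (airy' (s + p + x))*abs (v x) <= (AB*exp (- s - a))*B"
    using order_trans[OF airy_bounds(3)] B[OF x] airy_bounds(1) by (intro mult_mono) auto
   thus "norm (airy' (s + p + x) * v x) <= AB*exp (- s - a)*B" by (simp add: abs_mult)
  qed
  thus ?thesis by simp
 qed
 have "norm (airyC s a b v p - airyC s a b v q) <= (AB*exp (- s - a)*B*(b - a))*norm (p - q)"
  by (rule field_differentiable_bound[of "{0..}" _ ?d]) (use p d db in \<open>auto intro: DERIV_subset\<close>)
 thus ?thesis by simp
qed

section \<open>Completeness for the dressed functions\<close>

context dressing
begin

text \<open>The half-line coefficients of \<open>Q s\<close>: it is the Airy function minus the Airy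
  transform of \<open>cQ s\<close>. The quadratic form \<open>BQ s\<close> is the squared norm of
  \<open>cQ s\<close>.\<close>

definition cQ :: "real => real => real" where "cQ s = airyC s (-X) X (%y. \<sigma> y*Q s y)"
definition BQ :: "real => real" where "BQ s = integral {-X..X} (%x. (\<sigma> x*Q s x)*N s (Q s) x)"

lemma X0: "- X <= X" using X by simp

lemma vQ_cont: "continuous_on S (%y. \<sigma> y*Q s y)" by (intro continuous_intros)

lemma cQ_rapid: "rapid (cQ s)" unfolding cQ_def by (rule airyC_rapid[OF vQ_cont X0])

lemma cQ_norm: "(LINT p:{0..}|lborel. (cQ s p)^2) = BQ s"
 unfolding cQ_def BQ_def N_def by (rule airyC_norm[OF vQ_cont X0])

lemma NQ_airyT: "N s (Q s) x = airyT s (cQ s) x"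
 unfolding N_def cQ_def airyT_airyC[OF vQ_cont X0] airyQ_def ..

lemma Q_airyT: "Q s x = airy (s + x) - airyT s (cQ s) x"
 using Q_eq[of s x] unfolding NQ_airyT by simp

lemma BQ_nonneg: "0 <= BQ s" unfolding BQ_def N_def by (rule airyQ_form_nonneg[OF vQ_cont X0])

lemma NQ_Bessel: "integral {l..r} (%x. (N s (Q s) x)^2) <= BQ s"
 unfolding BQ_def N_def by (rule airyQ_Bessel[OF vQ_cont X0])

lemma NQ_pointwise: "(N s (Q s) x)^2 <= airyK (s + x) (s + x)*BQ s"
 unfolding BQ_def N_def by (rule airyQ_pointwise[OF vQ_cont X0])

text \<open>The integral equation paired with \<open>\<sigma> Q\<close>; the right-hand side is
  \<open>cQ s 0\<close>. These three terms are the limits that occur in \<open>completeness\<close>,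
  where they therefore cancel.\<close>

lemma BQ_identity: "- cQ s 0 + BQ s + integral {-X..X} (%x. \<sigma> x*(Q s x)^2) = 0"
proof -
 have i: "(%x. (\<sigma> x*Q s x)*N s (Q s) x) integrable_on {-X..X}" "(%x. \<sigma> x*(Q s x)^2) integrable_on {-X..X}"
  by (intro integrable_continuous_real continuous_intros N_cont)+
 have "BQ s + integral {-X..X} (%x. \<sigma> x*(Q s x)^2) = integral {-X..X} (%x. (\<sigma> x*Q s x)*N s (Q s) x + \<sigma> x*(Q s x)^2)"
  unfolding BQ_def by (rule HK_add[OF i, symmetric])
 also have "... = integral {-X..X} (%x. airy (s + 0 + x)*(\<sigma> x*Q s x))"
  by (rule HK_cong) (simp only: add_0_right Q_eq[symmetric], simp add: algebra_simps power2_eq_square)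
 finally show ?thesis by (simp add: cQ_def airyC_def)
qed

lemma cQ_bounds:
 "\<exists>M\<ge>0. \<forall>s\<in>{-S..S}. (\<forall>p\<ge>0. abs (cQ s p) <= M*exp (- p)) \<and> (\<forall>p\<ge>0. \<forall>q\<ge>0. abs (cQ s p - cQ s q) <= M*abs (p - q)) \<and>
  (\<forall>x\<in>{-X..X}. abs (\<sigma> x*(Q s x)^2) <= M)"
proof -
 have c1: "continuous_on ({-S..S} \<times> {-X..X}) (%z. \<sigma> (snd z)*Q (fst z) (snd z))"
  "continuous_on ({-S..S} \<times> {-X..X}) (%z. \<sigma> (snd z)*(Q (fst z) (snd z))^2)" by (intro continuous_intros)+
 have k: "compact ({-S..S} \<times> {-X..X})" by (intro compact_Times compact_Icc)
 have "\<exists>B. \<forall>z\<in>{-S..S} \<times> {-X..X}. abs (\<sigma> (snd z)*Q (fst z) (snd z)) <= B"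
  using compact_imp_bounded[OF compact_continuous_image[OF c1(1) k]] unfolding bounded_iff by auto
 then obtain B where B: "\<And>s x. s \<in> {-S..S} ==> x \<in> {-X..X} ==> abs (\<sigma> x*Q s x) <= B" by force
 have "\<exists>B. \<forall>z\<in>{-S..S} \<times> {-X..X}. abs (\<sigma> (snd z)*(Q (fst z) (snd z))^2) <= B"
  using compact_imp_bounded[OF compact_continuous_image[OF c1(2) k]] unfolding bounded_iff by auto
 then obtain B2 where B2: "\<And>s x. s \<in> {-S..S} ==> x \<in> {-X..X} ==> abs (\<sigma> x*(Q s x)^2) <= B2" by force
 define M where "M = AB*exp (S + X)*abs B*(2*X) + abs B2"
 have M0: "M >= 0" unfolding M_def using airy_bounds(1) X by simp
 have "(\<forall>p\<ge>0. abs (cQ s p) <= M*exp (- p)) \<and> (\<forall>p\<ge>0. \<forall>q\<ge>0. abs (cQ s p - cQ s q) <= M*abs (p - q)) \<and>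
  (\<forall>x\<in>{-X..X}. abs (\<sigma> x*(Q s x)^2) <= M)" if s: "s \<in> {-S..S}" for s
 proof -
  have b: "abs (\<sigma> x*Q s x) <= abs B" if "x \<in> {-X..X}" for x using B[OF s that] by linarith
  have "AB*exp (- s - - X)*abs B*(X - - X) <= AB*exp (S + X)*abs B*(2*X)"
   using s airy_bounds(1) X by (intro mult_right_mono mult_left_mono mult_mono) auto
  hence m: "AB*exp (- s - - X)*abs B*(X - - X) <= M" unfolding M_def by linarith
  have 1: "abs (cQ s p) <= M*exp (- p)" for p
   unfolding cQ_def by (rule order_trans[OF airyC_bound[OF vQ_cont b X0] mult_right_mono[OF m]]) auto
  have 2: "abs (cQ s p - cQ s q) <= M*abs (p - q)" if "p >= 0" "q >= 0" for p q
   unfolding cQ_def by (rule order_trans[OF airyC_lipschitz[OF vQ_cont b X0 that] mult_right_mono[OF m]]) auto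
  have 3: "abs (\<sigma> x*(Q s x)^2) <= M" if "x \<in> {-X..X}" for x
  proof -
   have "0 <= AB*exp (S + X)*abs B*(2*X)" using airy_bounds(1) X by simp
   thus ?thesis using B2[OF s that] unfolding M_def by linarith
  qed
  show ?thesis using 1 2 3 by blast
 qed
 with M0 show ?thesis by blast
qed

lemma Q2_full:
 assumes t: "0 < t" "t < 2"
 shows "integrable lborel (%x. (Q s x)^2*exp (t*x))"
  "(LINT x|lborel. (Q s x)^2*exp (t*x)) = gauss_kernel t s s - 2*(LINT p:{0..}|lborel. cQ s p*gauss_kernel t s (s + p))
   + (LINT p:{0..}|lborel. cQ s p*(LINT q:{0..}|lborel. cQ s q*gauss_kernel t (s + p) (s + q)))"
proof -
 have i: "integrable lborel (%x. airy (x + s)*airy (x + s)*exp (t*x))" by (rule airy_integrable[OF t])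
 note g1 = airyT_gauss1[OF cQ_rapid t order_refl, of s s, simplified]
 note g2 = airyT_gauss2[OF cQ_rapid cQ_rapid t, of s s]
 have e: "(Q s x)^2*exp (t*x) = airy (x + s)*airy (x + s)*exp (t*x) - 2*(airy (s + x)*exp (t*x)*airyT s (cQ s) x)
  + airyT s (cQ s) x*exp (t*x)*airyT s (cQ s) x" for x
  by (simp add: Q_airyT power2_eq_square algebra_simps)
 show "integrable lborel (%x. (Q s x)^2*exp (t*x))" unfolding e using i g1(1) g2(1) by simp
 show "(LINT x|lborel. (Q s x)^2*exp (t*x)) = gauss_kernel t s s - 2*(LINT p:{0..}|lborel. cQ s p*gauss_kernel t s (s + p))
   + (LINT p:{0..}|lborel. cQ s p*(LINT q:{0..}|lborel. cQ s q*gauss_kernel t (s + p) (s + q)))"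
  unfolding e using i g1 g2 airy_gauss[OF t, of s s] by simp
qed

text \<open>The regularised completeness relation: \<open>\<integral> Q\<^sup>2 (1 + \<sigma>) exp (t x) dx\<close> agrees with its
 value for the unperturbed Airy function up to an error that vanishes with \<open>t\<close>.\<close>

lemma completeness:
 assumes S: "S >= 0" and d: "d > 0"
 shows "eventually (%t. 0 < t \<and> t < 1 \<and> (\<forall>s\<in>{-S..S}. abs ((LINT x|lborel. (Q s x)^2*exp (t*x)) + integral {-X..X} (%x. \<sigma> x*(Q s x)^2*exp (t*x))
   - gauss_kernel t 0 0) <= d)) (at_right 0)"
proof -
 obtain M where M: "M >= 0" "\<And>s p. s \<in> {-S..S} ==> p >= 0 ==> abs (cQ s p) <= M*exp (- p)"
  "\<And>s p q. s \<in> {-S..S} ==> p >= 0 ==> q >= 0 ==> abs (cQ s p - cQ s q) <= M*abs (p - q)"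
  "\<And>s x. s \<in> {-S..S} ==> x \<in> {-X..X} ==> abs (\<sigma> x*(Q s x)^2) <= M"
  using cQ_bounds[of S] by blast
 define K where "K = exp (1 + S)"
 define y where "y = (%t. K*(6*M * sqrt t) + (exp (t*(1 + S)) - 1)*M + (K*(M^2*(3 * sqrt t + sqrt (sqrt t) + 2 * sqrt t)) + K*(M^2*t)
  + (exp (t*(1 + S)) - 1)*M^2) + M*(exp (t*X) - 1)*(2*X) + exp 1*(exp (t*S) - 1)/(2 * sqrt (pi*t)))"
 have main: "abs ((LINT x|lborel. (Q s x)^2*exp (t*x)) + integral {-X..X} (%x. \<sigma> x*(Q s x)^2*exp (t*x)) - gauss_kernel t 0 0) <= y t"
  if t: "0 < t" "t < 1" and s: "s \<in> {-S..S}" for t s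
 proof -
  let ?k = "exp (t^3/12 - t * s)"
  have t3: "t^3 <= t" using t power_decreasing[of 1 3 t] by simp
  have t30: "0 <= t^3" using t by simp
  have ts: "abs (t * s) <= t*S" using s t by (simp add: abs_mult) (auto simp: abs_if)
  have z: "abs (t^3/12 - t * s) <= t*(1 + S)" using t3 t30 ts unfolding distrib_left by linarith
  have abs_exp: "abs (exp x - 1) <= exp (abs x) - 1" for x :: real
  proof (cases "x >= 0")
   case False
   have "2 <= exp x + exp (- x)"
   proof -
    have "0 <= (exp (x/2) - exp (- x/2))^2" by simp
    thus ?thesis by (simp add: power2_eq_square algebra_simps exp_add[symmetric])
   qed
   thus ?thesis using False by simp
  qed simp
  have k1: "abs (?k - 1) <= exp (t*(1 + S)) - 1" using abs_exp[of "t^3/12 - t * s"] z by (meson diff_right_mono exp_le_cancel_iff order_trans)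
  have kK: "?k <= K"
  proof -
   have "t*(1 + S) <= 1*(1 + S)" using t S by (intro mult_right_mono) auto
   thus ?thesis using z unfolding K_def by simp
  qed
  \<comment> \<open>The free width in \<open>gauss_kernel_limit\<close> is taken as the fourth root
    of \<open>t\<close>; then both it and the Chebyshev error \<open>2*t/y^2\<close> tend to
    0.\<close>
  have s4: "sqrt (sqrt t) > 0" using t by simp
  have s2: "2*t/(sqrt (sqrt t))^2 = 2 * sqrt t" using t real_div_sqrt[of t] by simp
  note gl = gauss_kernel_limit[OF t(1) less_imp_le[OF t(2)] rapid_measurable[OF cQ_rapid[of s]] M(1) M(2)[OF s] M(3)[OF s] s4, of s, unfolded s2]
  have 1: "abs (2*(LINT p:{0..}|lborel. cQ s p*gauss_kernel t s (s + p)) - cQ s 0) <= K*(6*M * sqrt t) + (exp (t*(1 + S)) - 1)*M"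
  proof -
   have "?k*(6*M * sqrt t) + abs (?k - 1)*M <= K*(6*M * sqrt t) + (exp (t*(1 + S)) - 1)*M"
    by (intro add_mono mult_right_mono) (use kK k1 M(1) t in auto)
   note kk = this
   show ?thesis by (rule order_trans[OF gl(1) kk]; assumption)
  qed
  have 2: "abs ((LINT p:{0..}|lborel. cQ s p*(LINT q:{0..}|lborel. cQ s q*gauss_kernel t (s + p) (s + q))) - BQ s)
   <= K*(M^2*(3 * sqrt t + sqrt (sqrt t) + 2 * sqrt t)) + K*(M^2*t) + (exp (t*(1 + S)) - 1)*M^2"
  proof -
   have "?k*(M^2*(3 * sqrt t + sqrt (sqrt t) + 2 * sqrt t)) + ?k*(M^2*t) + abs (?k - 1)*M^2
    <= K*(M^2*(3 * sqrt t + sqrt (sqrt t) + 2 * sqrt t)) + K*(M^2*t) + (exp (t*(1 + S)) - 1)*M^2"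
    by (intro add_mono mult_right_mono) (use kK k1 M(1) t in auto)
   note kk = this
   show ?thesis unfolding cQ_norm[symmetric] by (rule order_trans[OF gl(2) kk]; assumption)
  qed
  have i: "(%x. \<sigma> x*(Q s x)^2) integrable_on {-X..X}" "(%x. \<sigma> x*(Q s x)^2*exp (t*x)) integrable_on {-X..X}"
   by (intro integrable_continuous_real continuous_intros)+
  have 3: "abs (integral {-X..X} (%x. \<sigma> x*(Q s x)^2*exp (t*x)) - integral {-X..X} (%x. \<sigma> x*(Q s x)^2)) <= M*(exp (t*X) - 1)*(2*X)"
  proof -
   have "norm (integral {-X..X} (%x. \<sigma> x*(Q s x)^2*exp (t*x) - \<sigma> x*(Q s x)^2)) <= M*(exp (t*X) - 1)*(X - - X)"
   proof (rule integral_bound[OF X0])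
    show "continuous_on {- X..X} (%x. \<sigma> x*(Q s x)^2*exp (t*x) - \<sigma> x*(Q s x)^2)" by (intro continuous_intros)
    fix x assume x: "x \<in> {-X..X}"
    have "abs (t*x) <= t*X" using x t by (simp add: abs_mult) (auto simp: abs_if)
    hence "abs (exp (t*x) - 1) <= exp (t*X) - 1" using abs_exp[of "t*x"] by (meson diff_right_mono exp_le_cancel_iff order_trans)
    hence "abs (\<sigma> x*(Q s x)^2)*abs (exp (t*x) - 1) <= M*(exp (t*X) - 1)" using M(4)[OF s x] M(1) by (intro mult_mono) auto
    thus "norm (\<sigma> x*(Q s x)^2*exp (t*x) - \<sigma> x*(Q s x)^2) <= M*(exp (t*X) - 1)"
     by (simp add: abs_mult[symmetric] algebra_simps)
   qed
   thus ?thesis using i by (simp add: HK_diff)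
  qed
  \<comment> \<open>Both kernels grow like \<open>1 / sqrt t\<close>, but \<open>s\<close> enters
    only through \<open>exp (- (t * s))\<close>, so their difference is of order
    \<open>sqrt t\<close>.\<close>
  have 4: "abs (gauss_kernel t s s - gauss_kernel t 0 0) <= exp 1*(exp (t*S) - 1)/(2 * sqrt (pi*t))"
  proof -
   have "gauss_kernel t s s - gauss_kernel t 0 0 = exp (t^3/12)*(exp (- (t * s)) - 1)/(2 * sqrt (pi*t))"
   proof -
    have "exp (t^3/12 - t*(s + s)/2 - (s - s)^2/(4*t)) = exp (t^3/12)*exp (- (t * s))"
     by (simp add: exp_add[symmetric])
    thus ?thesis unfolding gauss_kernel_def by (simp add: diff_divide_distrib right_diff_distrib)
   qed
   moreover have "abs (exp (t^3/12)*(exp (- (t * s)) - 1)) <= exp 1*(exp (t*S) - 1)"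
   proof -
    have "abs (exp (- (t * s)) - 1) <= exp (t*S) - 1" using abs_exp[of "- (t * s)"] ts by (simp only: abs_minus_cancel) (meson diff_right_mono exp_le_cancel_iff order_trans)
    moreover have "exp (t^3/12) <= exp 1" using t3 t by simp
    ultimately show ?thesis unfolding abs_mult by (intro mult_mono) auto
   qed
   ultimately show ?thesis using t by (simp add: divide_right_mono)
  qed
  show ?thesis using 1 2 3 4 BQ_identity[of s] Q2_full(2)[of t s] t unfolding y_def by linarith
 qed
 have "(y \<longlongrightarrow> 0) (at_right 0)"
 proof -
  have l1: "((%t::real. sqrt t) \<longlongrightarrow> 0) (at_right 0)" "((%t::real. sqrt (sqrt t)) \<longlongrightarrow> 0) (at_right 0)" 
   "((%t::real. t) \<longlongrightarrow> 0) (at_right 0)" by real_asymp+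
  have l2: "((%t::real. exp (t*a) - 1) \<longlongrightarrow> 0) (at_right 0)" for a by real_asymp
  have l3: "((%t::real. exp 1*(exp (t*S) - 1)/(2 * sqrt (pi*t))) \<longlongrightarrow> 0) (at_right 0)"
   by real_asymp
  have "(y \<longlongrightarrow> K*(6*M*0) + 0*M + (K*(M^2*(3*0 + 0 + 2*0)) + K*(M^2*0) + 0*M^2) + M*0*(2*X) + 0) (at_right 0)"
   unfolding y_def by (intro tendsto_add tendsto_mult tendsto_const l1 l2 l3)
  thus ?thesis by simp
 qed
 hence "eventually (%t. y t < d) (at_right 0)" using d by (rule order_tendstoD)
 moreover have "eventually (%t::real. 0 < t \<and> t < 1) (at_right 0)"
  by (auto simp: eventually_at_right_field intro!: exI[of _ 1])
 ultimately show ?thesis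
  by eventually_elim (use main in \<open>fastforce intro: order_trans less_imp_le\<close>)
qed

definition I2 :: real where "I2 = (LINT x|lborel. exp (- (1/2)*abs x))"

text \<open>Up to the factor -2 this moment has index -1. The parameter \<open>t\<close> is chosen
  first, for completeness. Then \<open>Y\<close> is chosen, because on the far left only
  \<open>exp (t*x)\<close> decays. The tail beyond \<open>X\<close> is bounded by the decay of the
  Airy function and leaves the explicit last term.\<close>

lemma J_almost_constant:
 assumes S: "S >= 0" and d: "d > 0" and B0: "\<And>s. s \<in> {-S..S} ==> BQ s <= B0" and t0: "t0 > 0"
 shows "\<exists>t>0. t < t0 \<and> t < 1 \<and> (\<exists>Y\<ge>X. \<forall>s\<in>{-S..S}. abs (mom (-Y) X (%x. (1 + \<sigma> x)*exp (t*x)) s - gauss_kernel t 0 0)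
   <= d + 2*AB^2*(1 + B0)*exp (2*S)*exp (- X/2)*I2)"
proof -
 have ev: "eventually (%t::real. t < t0) (at_right 0)" using t0 by (auto simp: eventually_at_right_field)
 obtain t where t: "0 < t" "t < 1" "t < t0" and E: "\<And>s. s\<in>{-S..S} ==> abs ((LINT x|lborel. (Q s x)^2*exp (t*x)) + integral {-X..X} (%x. \<sigma> x*(Q s x)^2*exp (t*x))
   - gauss_kernel t 0 0) <= d/2"
  using eventually_happens'[OF _ eventually_conj[OF completeness[OF S, of "d/2"] ev]] d by auto
 obtain M where M: "M >= 0" "\<And>s p. s \<in> {-S..S} ==> p >= 0 ==> abs (cQ s p) <= M*exp (- p)"
  using cQ_bounds[of S] by blast
 define D where "D = (AB*(1 + M))^2"
 have Qb: "(Q s x)^2 <= D" if "s \<in> {-S..S}" for s x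
 proof -
  have "AB*M*am s x <= AB*M*1" using airy_bounds(1) M(1) by (intro mult_left_mono) (auto simp: am_def)
  hence "abs (Q s x) <= AB*(1 + M)" using airyT_bound[OF M(2)[OF that] cQ_rapid, of s x] airy_bounds(4)[of "s + x"] unfolding Q_airyT by (simp add: distrib_left)
  thus ?thesis unfolding D_def using power_mono[of "abs (Q s x)" "AB*(1 + M)" 2] by simp
 qed
 define It where "It = (LINT x|lborel. exp (- (t/2)*abs x))"
 have It: "integrable lborel (%x. exp (- (t/2)*abs x))" by (rule integrable_exp_abs) (use t in simp)
 have I2: "integrable lborel (%x::real. exp (- (1/2)*abs x))" by (rule integrable_exp_abs) simp
 have It0: "It >= 0" unfolding It_def by (rule Bochner_nonneg) simp
 have "((%Y::real. D*exp (- (t*Y/2))*It) \<longlongrightarrow> 0) at_top" using t by real_asymp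
 hence "eventually (%Y. D*exp (- (t*Y/2))*It < d/2) at_top" using d by (intro order_tendstoD) auto
 from eventually_happens'[OF _ eventually_conj[OF this eventually_ge_at_top[of X]]]
 obtain Y where Y: "D*exp (- (t*Y/2))*It < d/2" "X <= Y" by auto
 have "abs (mom (-Y) X (%x. (1 + \<sigma> x)*exp (t*x)) s - gauss_kernel t 0 0)
   <= d + 2*AB^2*(1 + B0)*exp (2*S)*exp (- X/2)*I2" if s: "s \<in> {-S..S}" for s
 proof -
  let ?q = "%x. (Q s x)^2*exp (t*x)"
  have iq: "integrable lborel ?q" by (rule Q2_full(1)) (use t in auto)
  have cq: "continuous_on {-Y..X} ?q" by (intro continuous_intros)
  have YX: "- Y <= - X" "- X <= X" using Y X by auto
  have isg: "(%x. \<sigma> x*(Q s x)^2*exp (t*x)) integrable_on {a..b}" "?q integrable_on {a..b}" for a b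
   by (intro integrable_continuous_real continuous_intros)+
  have "mom (-Y) X (%x. (1 + \<sigma> x)*exp (t*x)) s = integral {-Y..X} (%x. ?q x + \<sigma> x*(Q s x)^2*exp (t*x))"
   unfolding mom_def by (rule HK_cong) (simp add: algebra_simps)
  also have "... = integral {-Y..X} ?q + integral {-Y..X} (%x. \<sigma> x*(Q s x)^2*exp (t*x))"
   by (rule HK_add[OF isg(2,1)])
  also have "integral {-Y..X} (%x. \<sigma> x*(Q s x)^2*exp (t*x)) = integral {-Y..-X} (%x. \<sigma> x*(Q s x)^2*exp (t*x)) + integral {-X..X} (%x. \<sigma> x*(Q s x)^2*exp (t*x))"
   by (rule Henstock_Kurzweil_Integration.integral_combine[OF YX isg(1), symmetric])
  also have "integral {-Y..-X} (%x. \<sigma> x*(Q s x)^2*exp (t*x)) = integral {-Y..-X} (%x. 0)"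
   by (rule HK_cong) (use \<sigma>_supp in auto)
  also have "integral {-Y..X} ?q = (LINT x|lborel. indicator {-Y..X} x*?q x)"
   unfolding integral_eq_lborel[OF cq] LINT_def by simp
  finally have m: "mom (-Y) X (%x. (1 + \<sigma> x)*exp (t*x)) s = (LINT x|lborel. indicator {-Y..X} x*?q x) + integral {-X..X} (%x. \<sigma> x*(Q s x)^2*exp (t*x))"
   by simp
  have iqi: "integrable lborel (%x. indicator {-Y..X} x*?q x)" using borel_integrable_atLeastAtMost'[OF cq] by (simp add: set_integrable_def)
  let ?R = "%x. D*exp (- (t*Y/2))*exp (- (t/2)*abs x) + 2*AB^2*(1 + B0)*exp (2*S)*exp (- X/2)*exp (- (1/2)*abs x)"
  have iR: "integrable lborel ?R" using It I2 by simp
  have D0: "D >= 0" by (simp add: D_def)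
  have B00: "B0 >= 0" using B0[OF s] BQ_nonneg[of s] by linarith
  have b: "abs (?q x - indicator {-Y..X} x*?q x) <= ?R x" for x
  proof -
   have r1: "0 <= D*exp (- (t*Y/2))*exp (- (t/2)*abs x)" using D0 by simp
   have r2: "0 <= 2*AB^2*(1 + B0)*exp (2*S)*exp (- X/2)*exp (- (1/2)*abs x)" using B00 by simp
   consider "x \<in> {-Y..X}" | "x < - Y" | "x > X" by fastforce
   thus ?thesis
   proof cases
    case 1 thus ?thesis using r1 r2 by simp
   next
    case 2
    have "t*x <= - (t*Y/2) + - (t/2)*abs x"
    proof -
     have "t*x <= t*(- Y/2 - abs x/2)" using 2 t Y X by (intro mult_left_mono) auto
     thus ?thesis by (simp add: algebra_simps)
    qed
    hence "exp (t*x) <= exp (- (t*Y/2))*exp (- (t/2)*abs x)" by (simp only: exp_add[symmetric] exp_le_cancel_iff)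
    hence "?q x <= D*(exp (- (t*Y/2))*exp (- (t/2)*abs x))" using Qb[OF s] D0 by (intro mult_mono) auto
    hence "?q x <= D*exp (- (t*Y/2))*exp (- (t/2)*abs x)" by (simp only: mult.assoc)
    moreover have "abs (?q x - indicator {-Y..X} x*?q x) = ?q x" using 2 by simp
    ultimately show ?thesis using r2 by linarith
   next
    case 3
    have xp: "x > 0" using 3 X by simp
    have A2: "(airy (s + x))^2 <= AB^2*exp (- (s + x) - (s + x))"
    proof -
     have "(abs (airy (s + x)))^2 <= (AB*exp (- (s + x)))^2" using airy_bounds(2)[of "s + x"] by (intro power_mono) auto
     also have "... = AB^2*(exp (- (s + x))*exp (- (s + x)))" by (simp add: power2_eq_square)
     also have "exp (- (s + x))*exp (- (s + x)) = exp (- (s + x) - (s + x))" by (simp add: exp_add[symmetric])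
     finally show ?thesis by simp
    qed
    have q2: "(N s (Q s) x)^2 <= AB^2*exp (- (s + x) - (s + x))*B0"
     using NQ_pointwise[of s x] mult_mono[OF abs_le_D1[OF airyK_bound[of "s+x" "s+x"]] B0[OF s]] BQ_nonneg[of s] by (auto intro: order_trans)
    have "Q s x = airy (s + x) - N s (Q s) x" using Q_eq[of s x] by simp
    hence "(Q s x)^2 <= 2*(airy (s + x))^2 + 2*(N s (Q s) x)^2"
    proof -
     have "0 <= (airy (s + x) + N s (Q s) x)^2" by simp
     thus ?thesis unfolding \<open>Q s x = airy (s + x) - N s (Q s) x\<close> by (simp add: power2_sum power2_diff)
    qed
    also have "... <= 2*AB^2*(1 + B0)*exp (- (s + x) - (s + x))" using A2 q2 by (simp add: algebra_simps)
    finally have Q2: "(Q s x)^2 <= 2*AB^2*(1 + B0)*exp (- (s + x) - (s + x))" .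
    have "t*x <= x" using t xp by simp
    hence "- (s + x) - (s + x) + t*x <= 2*S + - X/2 + - (1/2)*abs x" using s 3 xp unfolding atLeastAtMost_iff abs_of_pos[OF xp] by linarith
    hence e: "exp (- (s + x) - (s + x))*exp (t*x) <= exp (2*S)*exp (- X/2)*exp (- (1/2)*abs x)" by (simp only: exp_add[symmetric] exp_le_cancel_iff)
    have "?q x <= (2*AB^2*(1 + B0)*exp (- (s + x) - (s + x)))*exp (t*x)" using Q2 by (intro mult_right_mono) auto
    also have "... = 2*AB^2*(1 + B0)*(exp (- (s + x) - (s + x))*exp (t*x))" by simp
    also have "... <= 2*AB^2*(1 + B0)*(exp (2*S)*exp (- X/2)*exp (- (1/2)*abs x))" using e B00 by (intro mult_left_mono) auto
    finally show ?thesis using 3 X r1 by (simp add: mult.assoc)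
   qed
  qed
  have "abs ((LINT x|lborel. ?q x) - (LINT x|lborel. indicator {-Y..X} x*?q x)) = abs (LINT x|lborel. ?q x - indicator {-Y..X} x*?q x)"
   using iq iqi by simp
  also have "... <= (LINT x|lborel. ?R x)"
   by (rule integral_abs_bound_integral[OF Bochner_diff[OF iq iqi] iR b])
  also have "... = D*exp (- (t*Y/2))*It + 2*AB^2*(1 + B0)*exp (2*S)*exp (- X/2)*I2"
   using It I2 by (simp add: It_def I2_def)
  finally show ?thesis using E[OF s] Y(1) unfolding m by linarith
 qed
 thus ?thesis using t Y(2) by blast
qed

end

section \<open>Decay of quadratic Airy moments\<close>

lemma Gamma_laplace:
 assumes x: "x > 0" and s: "s > 0"
 shows "integrable lborel (%t::real. indicator {0..} t*(t powr (x - 1)*exp (- (t * s))))"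
  "(LINT t|lborel. indicator {0..} t*(t powr (x - 1)*exp (- (t * s)))) = Gamma x * s powr (- x)"
proof -
 let ?f = "%t::real. indicator {0..} t*(t powr (x - 1)*exp (- t))"
 have nn: "(\<integral>\<^sup>+t. ennreal (?f t) \<partial>lborel) = ennreal (Gamma x)"
  unfolding Gamma_conv_nn_integral_real[OF x] by (intro nn_integral_cong) (simp add: exp_minus divide_inverse mult_ac)
 have i: "integrable lborel ?f" and I: "(LINT t|lborel. ?f t) = Gamma x"
  using integrable_iff_bounded[of lborel ?f] integral_eq_nn_integral[of ?f lborel] nn Gamma_real_pos[OF x] by (auto simp: indicator_def)
 have e: "?f (0 + s*t) = s powr (x - 1)*(indicator {0..} t*(t powr (x - 1)*exp (- (t * s))))" for t
 proof (cases "t >= 0")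
  case True
  thus ?thesis using s by (simp add: powr_mult mult_ac)
 next
  case False
  hence "s*t < 0" using s by (simp add: mult_pos_neg)
  thus ?thesis using False by simp
 qed
 have sp: "s powr (x - 1) > 0" using s by simp
 have "integrable lborel (%t. ?f (0 + s*t))" using lborel_integrable_real_affine[OF i, of s 0] s by simp
 hence "integrable lborel (%t. (1 / s powr (x - 1))*?f (0 + s*t))" by (rule integrable_mult_right)
 thus "integrable lborel (%t::real. indicator {0..} t*(t powr (x - 1)*exp (- (t * s))))"
  unfolding e using sp by simp
 have "Gamma x = s*(LINT t|lborel. ?f (0 + s*t))"
  using lborel_integral_real_affine[of s ?f 0] s I by simp
 also have "... = (s * s powr (x - 1))*(LINT t|lborel. indicator {0..} t*(t powr (x - 1)*exp (- (t * s))))"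
  unfolding e by simp
 also have "s * s powr (x - 1) = s powr x" using s by (simp add: powr_diff)
 finally show "(LINT t|lborel. indicator {0..} t*(t powr (x - 1)*exp (- (t * s)))) = Gamma x * s powr (- x)"
  using s by (simp add: powr_minus field_simps)
qed

text \<open>A model for \<open>abs x\<close> to the power \<open>- (i + 1)\<close> on the negative
  axis without the singularity at 0. On the positive axis the decay of the Airy function makes the
  constant 1 sufficient.\<close>

definition wt :: "nat => real => real" where
 "wt i x = (if x <= 0 then 1/(1 - x)^(i + 1) else 1)"

text \<open>A superposition of exponentials that dominates \<open>wt i\<close>; its moments against
  the squared Airy function are explicit integrals of the Gauss kernel.\<close>

definition lw :: "nat => real => real" where
 "lw i x = (LINT \<tau>:{0..1}|lborel. \<tau>^i*exp (\<tau>*x))"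

definition Om :: "nat => real => real" where
 "Om i s = (LINT x|lborel. (airy (s + x))^2*wt i x)"

definition Rl :: "nat => real => real" where
 "Rl i s = (LINT \<tau>:{0..1}|lborel. \<tau>^i*gauss_kernel \<tau> s s)"

lemma wt_pos: "0 < wt i x" and wt_measurable [measurable]: "wt i \<in> borel_measurable borel"
 by (auto simp: wt_def[abs_def])

lemma wt_le_1: "wt i x <= 1"
proof (cases "x <= 0")
 case True
 hence "1 <= (1 - x)^(i + 1)" by (intro one_le_power) simp
 thus ?thesis using True by (simp only: wt_def if_True divide_le_eq_1) simp
qed (simp add: wt_def)

lemma wt_mult: "wt i x*wt j x = wt (i + j + 1) x"
 by (simp add: wt_def power_add mult_ac)

lemma wt_antimono: "i <= j ==> wt j x <= wt i x"
 unfolding wt_def by (auto intro!: divide_left_mono power_increasing mult_pos_pos)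

lemma lw_eq: "lw i x = integral {0..1} (%\<tau>. \<tau>^i*exp (\<tau>*x))"
 unfolding lw_def by (rule integral_eq_lborel[symmetric]) (intro continuous_intros)

text \<open>The integral is restricted to \<open>[0, c]\<close> with \<open>c = 1/(1 - x)\<close>
  for negative \<open>x\<close> and \<open>c = 1\<close> otherwise. There the exponent is at least
  -1, and the integral of the power is \<open>c^(i + 1)/(i + 1)\<close>.\<close>

lemma wt_le_lw: "wt i x <= exp 1*(real i + 1)*lw i x"
proof -
 define c where "c = (if x <= 0 then 1/(1 - x) else 1)"
 have c: "0 < c" "c <= 1" "wt i x = c^(i + 1)" unfolding c_def wt_def by (auto simp: power_divide field_simps)
 have int: "((%\<tau>. exp (-1)*\<tau>^i) has_integral exp (-1)*(c^(i + 1)/(real i + 1))) {0..c}"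
 proof (rule has_integral_mult_right)
  have d: "((%\<tau>. \<tau>^(i + 1)/(real i + 1)) has_real_derivative \<tau>^i) (at \<tau> within {0..c})" for \<tau> :: real
   using DERIV_cdivide[OF DERIV_power[OF DERIV_ident, of "i + 1" \<tau> "{0..c}"], of "real i + 1"] by (simp add: add.commute)
  have "((%\<tau>. \<tau>^i) has_integral (c^(i + 1)/(real i + 1) - 0^(i + 1)/(real i + 1))) {0..c}"
   by (rule fundamental_theorem_of_calculus)
    (use c d in \<open>auto simp: has_real_derivative_iff_has_vector_derivative[symmetric]\<close>)
  thus "((%\<tau>. \<tau>^i) has_integral (c^(i + 1)/(real i + 1))) {0..c}" by simp
 qed
 have ic: "(%\<tau>. \<tau>^i*exp (\<tau>*x)) integrable_on {a..b}" for a b by (intro integrable_continuous_real continuous_intros)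
 have "exp (-1)*(c^(i + 1)/(real i + 1)) = integral {0..c} (%\<tau>. exp (-1)*\<tau>^i)" by (rule integral_unique[OF int, symmetric])
 also have "... <= integral {0..c} (%\<tau>. \<tau>^i*exp (\<tau>*x))"
 proof (rule integral_le[OF has_integral_integrable[OF int] ic])
  fix \<tau> assume \<tau>: "\<tau> \<in> {0..c}"
  have "-1 <= \<tau>*x"
  proof (cases "x <= 0")
   case True
   have "c*(1 - x) = 1" using True by (simp add: c_def)
   hence "c*(- x) <= 1" using c by (simp add: algebra_simps)
   moreover have "\<tau>*(- x) <= c*(- x)" using \<tau> True by (intro mult_right_mono) auto
   ultimately show ?thesis by simp
  next
   case False
   thus ?thesis using \<tau> by (smt (verit) atLeastAtMost_iff mult_nonneg_nonneg)
  qed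
  hence "exp (-1)*\<tau>^i <= exp (\<tau>*x)*\<tau>^i" using \<tau> by (intro mult_right_mono) auto
  thus "exp (-1)*\<tau>^i <= \<tau>^i*exp (\<tau>*x)" by (simp add: mult.commute)
 qed
 also have "... <= integral {0..1} (%\<tau>. \<tau>^i*exp (\<tau>*x))"
  by (rule integral_subset_le) (use c ic in auto)
 finally have "exp (-1)*(wt i x/(real i + 1)) <= lw i x" using c by (simp add: lw_eq)
 hence "exp 1*(real i + 1)*(exp (-1)*(wt i x/(real i + 1))) <= exp 1*(real i + 1)*lw i x" by (intro mult_left_mono) auto
 moreover have "exp 1*(real i + 1)*(exp (-1)*(wt i x/(real i + 1))) = (exp 1*exp (-1))*((real i + 1)*(wt i x/(real i + 1)))"
  by (simp only: mult_ac)
 moreover have "exp 1*exp (-1) = (1::real)" by (simp add: exp_minus)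
 moreover have "(real i + 1)*(wt i x/(real i + 1)) = wt i x" by simp
 ultimately show ?thesis by (simp only: mult_1_left)
qed

lemma gauss_kernel_diag:
 assumes "0 < \<tau>"
 shows "gauss_kernel \<tau> s s = exp (\<tau>^3/12)*(\<tau> powr (- (1/2))*exp (- (\<tau> * s)))/(2 * sqrt pi)"
proof -
 have "\<tau> powr (- (1/2)) = 1 / sqrt \<tau>" using assms powr_minus_divide[of \<tau> "1/2"] powr_half_sqrt[of \<tau>] by simp
 moreover have "exp (\<tau>^3/12 - \<tau>*(s + s)/2 - (s - s)^2/(4*\<tau>)) = exp (\<tau>^3/12)*exp (- (\<tau> * s))"
  by (simp add: exp_add[symmetric])
 ultimately show ?thesis by (simp add: gauss_kernel_def real_sqrt_mult)
qed

lemma Rl_integrable: "integrable lborel (%\<tau>. indicator {0..1} \<tau>*(\<tau>^i*gauss_kernel \<tau> s s))"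
proof (rule Bochner_bound[OF integrable_mult_right[OF Gamma_laplace(1)[of "1/2" 1], of "exp 1*exp (1 + abs s)"]])
 show "(%\<tau>. indicat_real {0..1} \<tau>*(\<tau>^i*gauss_kernel \<tau> s s)) \<in> borel_measurable lborel"
  unfolding gauss_kernel_def by measurable
 show "AE \<tau> in lborel. norm (indicat_real {0..1} \<tau>*(\<tau>^i*gauss_kernel \<tau> s s))
     <= norm (exp 1*exp (1 + abs s)*(indicat_real {0..} \<tau>*(\<tau> powr (1/2 - 1)*exp (- (\<tau>*1)))))"
 proof (rule AE_I2)
  fix \<tau> :: real
  show "norm (indicat_real {0..1} \<tau>*(\<tau>^i*gauss_kernel \<tau> s s))
     <= norm (exp 1*exp (1 + abs s)*(indicat_real {0..} \<tau>*(\<tau> powr (1/2 - 1)*exp (- (\<tau>*1)))))"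
  proof (cases "0 < \<tau> \<and> \<tau> <= 1")
   case True
   have "- (\<tau> * s) <= \<tau>*abs s" using True by (simp add: abs_if)
   also have "... <= 1*abs s" using True by (intro mult_right_mono) auto
   finally have "- (\<tau> * s) <= 1 + abs s - \<tau>" using True by simp
   hence e: "exp (- (\<tau> * s)) <= exp (1 + abs s)*exp (- \<tau>)" by (simp add: exp_add[symmetric])
   have "\<tau>^3 <= 1" using True by (simp add: power_le_one)
   hence e3: "exp (\<tau>^3/12) <= exp 1" by simp
   have sp: "1 <= 2 * sqrt pi" using pi_gt3 real_sqrt_ge_one[of pi] by linarith
   have "\<tau>^i*gauss_kernel \<tau> s s <= 1*gauss_kernel \<tau> s s"
    using True by (intro mult_right_mono power_le_one) (auto simp: gauss_kernel_def)
   also have "... = exp (\<tau>^3/12)*(\<tau> powr (- (1/2))*exp (- (\<tau> * s)))/(2 * sqrt pi)"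
    using gauss_kernel_diag[of \<tau> s] True by simp
   also have "... <= exp (\<tau>^3/12)*(\<tau> powr (- (1/2))*exp (- (\<tau> * s)))/1"
    using sp by (intro divide_left_mono) auto
   also have "... = exp (\<tau>^3/12)*(\<tau> powr (- (1/2))*exp (- (\<tau> * s)))" by simp
   also have "... <= exp 1*(\<tau> powr (- (1/2))*(exp (1 + abs s)*exp (- \<tau>)))"
    using e e3 by (intro mult_mono mult_left_mono) auto
   finally have "\<tau>^i*gauss_kernel \<tau> s s <= exp 1*(\<tau> powr (- (1/2))*(exp (1 + abs s)*exp (- \<tau>)))" .
   moreover have "0 <= \<tau>^i*gauss_kernel \<tau> s s" using True by (simp add: gauss_kernel_def)
   ultimately show ?thesis using True by (simp add: mult_ac)
  next
   case False
   thus ?thesis by (auto simp: gauss_kernel_def indicator_def)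
  qed
 qed
qed auto

lemma airy_lw:
 "integrable lborel (%x. (airy (s + x))^2*lw i x)" "(LINT x|lborel. (airy (s + x))^2*lw i x) = Rl i s"
proof -
 define F where "F = (%\<tau> x. indicator {0..1} \<tau>*(\<tau>^i*(airy (x + s)*airy (x + s)*exp (\<tau>*x))))"
 have m [measurable]: "case_prod F \<in> borel_measurable (lborel \<Otimes>\<^sub>M lborel)" unfolding F_def by measurable
 have g: "(LINT x|lborel. F \<tau> x) = indicator {0..1} \<tau>*(\<tau>^i*gauss_kernel \<tau> s s)" "integrable lborel (F \<tau>)" if "\<tau> ~= 0" for \<tau>
 proof -
  show "(LINT x|lborel. F \<tau> x) = indicator {0..1} \<tau>*(\<tau>^i*gauss_kernel \<tau> s s)"
   using airy_gauss[of \<tau> s s] that by (auto simp: F_def indicator_def)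
  show "integrable lborel (F \<tau>)"
   using airy_integrable[of \<tau> s s] that by (auto simp: F_def indicator_def)
 qed
 have nn: "norm (F \<tau> x) = F \<tau> x" "abs (F \<tau> x) = F \<tau> x" for \<tau> x by (auto simp: F_def indicator_def)
 have "integrable (lborel \<Otimes>\<^sub>M lborel) (case_prod F)"
 proof (rule lborel_pair.Fubini_integrable[OF m])
  show "integrable lborel (%x. (LINT y|lborel. norm (case_prod F (x, y))))"
   by (rule integrable_cong_AE_imp[OF Rl_integrable[of i s]])
    (auto simp: nn g intro!: eventually_mono[OF AE_lborel_singleton[of 0]])
  show "AE x in lborel. integrable lborel (%y. case_prod F (x, y))"
   by (rule eventually_mono[OF AE_lborel_singleton[of 0]]) (simp add: g)
 qed
 note I = this
 have e: "(LINT \<tau>|lborel. F \<tau> x) = (airy (s + x))^2*lw i x" for x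
 proof -
  have "F \<tau> x = (airy (s + x))^2*(indicator {0..1} \<tau>*(\<tau>^i*exp (\<tau>*x)))" for \<tau>
   by (simp add: F_def power2_eq_square add_ac mult_ac)
  thus ?thesis by (simp add: lw_def LINT_def)
 qed
 show "integrable lborel (%x. (airy (s + x))^2*lw i x)" using lborel_pair.integrable_snd[OF I] unfolding e .
 have "(LINT x|lborel. (airy (s + x))^2*lw i x) = (LINT \<tau>|lborel. (LINT x|lborel. F \<tau> x))"
  unfolding e[symmetric] using lborel_pair.Fubini_integral[OF I] by simp
 also have "... = Rl i s" unfolding Rl_def LINT_def real_scaleR_def
  by (rule integral_cong_AE) (auto simp: gauss_kernel_def g intro!: eventually_mono[OF AE_lborel_singleton[of 0]] borel_measurable_integrable[OF lborel_pair.integrable_fst[OF I]]  g(1)[unfolded gauss_kernel_def])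
 finally show "(LINT x|lborel. (airy (s + x))^2*lw i x) = Rl i s" .
qed

lemma Om_integrable: "integrable lborel (%x. (airy (s + x))^2*wt i x)"
 and Om_le: "Om i s <= exp 1*(real i + 1)*Rl i s" and Om_nonneg: "0 <= Om i s"
proof -
 have b: "(airy (s + x))^2*wt i x <= exp 1*(real i + 1)*((airy (s + x))^2*lw i x)" for x
  using mult_left_mono[OF wt_le_lw[of i x], of "(airy (s + x))^2"] by (simp add: mult_ac)
 have i: "integrable lborel (%x. exp 1*(real i + 1)*((airy (s + x))^2*lw i x))" using airy_lw(1) by simp
 show 1: "integrable lborel (%x. (airy (s + x))^2*wt i x)"
 proof (rule Bochner_bound[OF i _ AE_I2])
  show "norm ((airy (s + x))^2*wt i x) <= norm (exp 1*(real i + 1)*((airy (s + x))^2*lw i x))" for x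
   using order_trans[OF b abs_ge_self, of x] less_imp_le[OF wt_pos[of i x]] by (simp only: real_norm_def abs_mult[of _ "wt i x"] abs_power2 abs_of_nonneg)
 qed measurable
 have "Om i s <= (LINT x|lborel. exp 1*(real i + 1)*((airy (s + x))^2*lw i x))"
  unfolding Om_def by (rule integral_mono[OF 1 i b])
 thus "Om i s <= exp 1*(real i + 1)*Rl i s" using airy_lw(2)[of s i] by simp
 show "0 <= Om i s" unfolding Om_def by (rule Bochner_nonneg) (simp add: less_imp_le[OF wt_pos])
qed

text \<open>Watson's lemma with an explicit error. On \<open>[0, 1]\<close> one has
  \<open>exp (t^3/12) - 1 \<le> 3*t\<close>, and beyond 1 the omitted integrand is smaller than
  \<open>t\<close> times itself; so the error is dominated by three times the integrand of the next
  order.\<close>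

lemma Rl_asymp:
 assumes s: "s > 0"
 shows "abs (Rl i s - Gamma (real i + 1/2)/(2 * sqrt pi) * s powr (- (real i + 1/2))) <= 3*Gamma (real i + 3/2) * s powr (- (real i + 3/2))"
proof -
 let ?G = "%t. indicator {0..} t*(t powr (real i + 1/2 - 1)*exp (- (t * s)))"
 let ?H = "%t. indicator {0..} t*(t powr (real i + 3/2 - 1)*exp (- (t * s)))"
 let ?R = "%\<tau>. indicator {0..1} \<tau>*(\<tau>^i*gauss_kernel \<tau> s s)"
 have G: "integrable lborel ?G" "(LINT t|lborel. ?G t) = Gamma (real i + 1/2) * s powr (- (real i + 1/2))"
  and H: "integrable lborel ?H" "(LINT t|lborel. ?H t) = Gamma (real i + 3/2) * s powr (- (real i + 3/2))"
  by (rule Gamma_laplace; use s in simp)+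
 have sp: "1 <= 2 * sqrt pi" using pi_gt3 real_sqrt_ge_one[of pi] by linarith
 have b: "abs (?R t - ?G t/(2 * sqrt pi)) <= 3*?H t" for t
 proof (cases "t > 0")
  case True
  have p: "t powr (real i + 1/2 - 1) = t^i*t powr (- (1/2))" "t powr (real i + 3/2 - 1) = t*(t^i*t powr (- (1/2)))"
  proof -
   show 1: "t powr (real i + 1/2 - 1) = t^i*t powr (- (1/2))" using True powr_add[of t "real i" "-(1/2)"] by (simp add: powr_realpow)
   have "t powr (real i + 3/2 - 1) = t powr (1 + (real i + 1/2 - 1))" by (simp add: algebra_simps)
   also have "... = t*t powr (real i + 1/2 - 1)" using True by (subst powr_add) simp
   finally show "t powr (real i + 3/2 - 1) = t*(t^i*t powr (- (1/2)))" unfolding 1 .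
  qed
  define z where "z = t^i*t powr (- (1/2))*exp (- (t * s))"
  have z0: "z >= 0" using True unfolding z_def by simp
  have Gz: "?G t = z" and Hz: "?H t = t*z" using True unfolding p z_def by simp_all
  show ?thesis
  proof (cases "t <= 1")
   case True2: True
   have Rz: "?R t = exp (t^3/12)*z/(2 * sqrt pi)" using True True2 gauss_kernel_diag[OF True, of s] by (simp add: z_def mult_ac)
   have e: "exp (t^3/12) - 1 <= 3*t"
   proof -
    have "t^3/12 <= 1" "t^3 <= t" using True True2 power_le_one[of t 3] power_decreasing[of 1 3 t] by auto
    have "0 <= t^3/12" using True by simp
    hence "exp (t^3/12) <= 1 + t^3/12 + (t^3/12)^2" using \<open>t ^ 3 / 12 \<le> 1\<close> by (rule exp_bound)
    also have "(t^3/12)^2 <= (t^3/12)*1" unfolding power2_eq_square using \<open>0 \<le> t ^ 3 / 12\<close> \<open>t ^ 3 / 12 \<le> 1\<close> by (intro mult_left_mono)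
    finally show ?thesis using \<open>t ^ 3 \<le> t\<close> True by linarith
   qed
   have e0: "0 <= exp (t^3/12) - 1" using True by simp
   have RG: "?R t - ?G t/(2 * sqrt pi) = (exp (t^3/12) - 1)*z/(2 * sqrt pi)" unfolding Rz Gz by (simp add: diff_divide_distrib left_diff_distrib)
   have "abs (?R t - ?G t/(2 * sqrt pi)) = (exp (t^3/12) - 1)*z/(2 * sqrt pi)" unfolding RG using e0 z0 by simp
   also have "... <= (exp (t^3/12) - 1)*z/1" using sp e0 z0 by (intro divide_left_mono) auto
   also have "... <= (3*t)*z" using e z0 by (simp add: mult_right_mono)
   finally show ?thesis unfolding Hz by simp
  next
   case False
   have "z/(2 * sqrt pi) <= z/1" using sp z0 by (intro divide_left_mono) auto
   also have "... <= 3*(t*z)" using mult_right_mono[of 1 "3*t" z] False z0 by simp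
   finally show ?thesis unfolding Gz Hz using False z0 by simp
  qed
 next
  case False
  thus ?thesis by (auto simp: indicator_def gauss_kernel_def)
 qed
 have RG: "Rl i s - Gamma (real i + 1/2)/(2 * sqrt pi) * s powr (- (real i + 1/2)) = (LINT t|lborel. ?R t - ?G t/(2 * sqrt pi))"
  using Rl_integrable[of i s] G by (simp add: Rl_def LINT_def)
 have "abs (LINT t|lborel. ?R t - ?G t/(2 * sqrt pi)) <= (LINT t|lborel. 3*?H t)"
  by (rule integral_abs_bound_integral) (use Rl_integrable[of i s] G H b in auto)
 also have "... = 3*Gamma (real i + 3/2) * s powr (- (real i + 3/2))" using H by simp
 finally show ?thesis unfolding RG .
qed

lemma Rl_decay: "\<exists>C>0. \<forall>s\<ge>1. Rl i s <= C * s powr (- (real i + 1/2))"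
proof -
 define C where "C = Gamma (real i + 1/2)/(2 * sqrt pi) + 3*Gamma (real i + 3/2)"
 have G: "Gamma (real i + 1/2) > 0" "Gamma (real i + 3/2) > 0" by (intro Gamma_real_pos; simp)+
 have "Rl i s <= C * s powr (- (real i + 1/2))" if s: "s >= 1" for s
 proof -
  have "s powr (- (real i + 3/2)) <= s powr (- (real i + 1/2))" using s by (intro powr_mono) auto
  hence "3*Gamma (real i + 3/2) * s powr (- (real i + 3/2)) <= 3*Gamma (real i + 3/2) * s powr (- (real i + 1/2))" using G by (intro mult_left_mono) auto
  thus ?thesis using Rl_asymp[of s i] s unfolding C_def distrib_right by linarith
 qed
 moreover have "C > 0" unfolding C_def using G by (simp add: add_pos_pos)
 ultimately show ?thesis by blast
qed

lemma Om_decay: "\<exists>C>0. \<forall>s\<ge>1. Om i s <= C * s powr (- (real i + 1/2))"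
proof -
 obtain C where C: "C > 0" "\<And>s. s >= 1 ==> Rl i s <= C * s powr (- (real i + 1/2))" using Rl_decay by blast
 have "Om i s <= (exp 1*(real i + 1)*C) * s powr (- (real i + 1/2))" if "s >= 1" for s
  using order_trans[OF Om_le mult_left_mono[OF C(2)[OF that]]] by (simp add: mult.assoc)
 moreover have "0 < exp 1*(real i + 1)*C" using C(1) by simp
 ultimately show ?thesis by blast
qed

lemma Om_bounded: "\<exists>C\<ge>0. \<forall>s\<ge>-S. Om i s <= C"
proof -
 define C where "C = exp 1*(real i + 1)*Rl i (- abs S)"
 have mono: "Rl i s <= Rl i (- abs S)" if "s >= - S" for s
  unfolding Rl_def LINT_def
 proof (rule integral_mono)
  fix \<tau> :: real
  show "indicat_real {0..1} \<tau> *\<^sub>R (\<tau>^i*gauss_kernel \<tau> s s) <= indicat_real {0..1} \<tau> *\<^sub>R (\<tau>^i*gauss_kernel \<tau> (- abs S) (- abs S))"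
  proof (cases "0 < \<tau> \<and> \<tau> <= 1")
   case True
   have "\<tau>*(- abs S) <= \<tau> * s" using True that by (intro mult_left_mono) auto
   hence "gauss_kernel \<tau> s s <= gauss_kernel \<tau> (- abs S) (- abs S)"
    using True unfolding gauss_kernel_diag[of \<tau>, OF conjunct1[OF True]] by (intro divide_right_mono mult_left_mono) auto
   thus ?thesis using True by (simp add: mult_left_mono)
  next
   case False
   thus ?thesis by (auto simp: indicator_def gauss_kernel_def)
  qed
 qed (use Rl_integrable in auto)
 have Cb: "Om i s <= C" if "s >= - S" for s
  using Om_le[of i s] mult_left_mono[OF mono[OF that], of "exp 1*(real i + 1)"] unfolding C_def by (rule order_trans) simp
 moreover have "C >= 0" by (rule order_trans[OF Om_nonneg Cb[of "abs S"]]) simp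
 ultimately show ?thesis by blast
qed

lemma airy_wt_interval:
 assumes w: "continuous_on {a..b} w" and E: "\<And>x. x \<in> {a..b} ==> abs (w x) <= E*wt i x" "E >= 0"
 shows "integral {a..b} (%x. (airy (s + x))^2*abs (w x)) <= E*Om i s"
proof -
 have c: "continuous_on {a..b} (%x. (airy (s + x))^2*abs (w x))" by (intro continuous_intros w)
 have "integral {a..b} (%x. (airy (s + x))^2*abs (w x)) = (LINT x|lborel. indicator {a..b} x*((airy (s + x))^2*abs (w x)))"
  unfolding integral_eq_lborel[OF c] LINT_def by simp
 also have "... <= (LINT x|lborel. E*((airy (s + x))^2*wt i x))"
 proof (rule integral_mono')
  fix x
  show "indicator {a..b} x*((airy (s + x))^2*abs (w x)) <= E*((airy (s + x))^2*wt i x)"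
   using mult_left_mono[OF E(1), of x "(airy (s + x))^2"] E(2) less_imp_le[OF wt_pos[of i x]] by (auto simp: indicator_def mult_ac)
  show "0 <= E*((airy (s + x))^2*wt i x)" using E(2) less_imp_le[OF wt_pos[of i x]] by simp
 qed (use Om_integrable in simp)
 finally show ?thesis by (simp add: Om_def)
qed

definition I1 :: real where "I1 = (LINT x|lborel. exp (- abs x))"

section \<open>Moments of the dressed functions compared with Airy moments\<close>

context dressing
begin

lemma BQ_le:
 assumes s: "s1 <= s" and th: "\<And>x. airy_eps s1 <= abs x ==> - \<sigma> x <= p" "0 <= p" "p < 1"
  and D: "\<And>x. abs (\<sigma> x) <= D*wt 0 x" "D >= 0"
 shows "BQ s <= (2/(1 - p))^2*(D^2*Om 1 s)"
proof -
 have "BQ s <= (2/(1 - p))^2*integral {-X..X} (%x. (\<sigma> x*airy (s + x))^2)"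
  unfolding BQ_def N_def
 proof (rule airyQ_coercive[OF _ _ \<sigma>_cont X0 _ \<sigma>_ge th less_imp_le[OF airy_eps(1)[of s1]] airy_eps(2)[of s1] airy_eps(3)[OF s]])
  show "Q s x + airyQ s (- X) X (%y. \<sigma> y*Q s y) x = airy (s + x)" for x using Q_eq[of s x] unfolding N_def .
 qed (auto intro!: continuous_intros)
 also have "integral {-X..X} (%x. (\<sigma> x*airy (s + x))^2) = integral {-X..X} (%x. (airy (s + x))^2*abs ((\<sigma> x)^2))"
  by (simp add: power_mult_distrib mult.commute)
 also have "... <= D^2*Om 1 s"
 proof (rule airy_wt_interval)
  show "continuous_on {- X..X} (%x. (\<sigma> x)^2)" by (intro continuous_intros)
  fix x
  have "(abs (\<sigma> x))^2 <= (D*wt 0 x)^2" using D by (intro power_mono) auto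
  thus "abs ((\<sigma> x)^2) <= D^2*wt 1 x" using wt_mult[of 0 x 0] by (simp add: power_mult_distrib power2_eq_square mult_ac)
 qed simp
 finally show ?thesis by (simp add: mult_left_mono)
qed

text \<open>Writing \<open>Q\<close> as the Airy function minus \<open>q\<close>, the cross term is
  estimated by Cauchy-Schwarz with the whole weight on the Airy factor, so that Bessel's inequality
  applies to \<open>q\<close>; squaring the weight turns index \<open>i\<close> into
  \<open>2*i + 1\<close>. The bound \<open>T\<close> of the quadratic term stays a parameter, to be
  used with either estimate of \<open>NQ_weight_le\<close>.\<close>

lemma mom_bounds:
 assumes w: "continuous_on {a..b} w" and E: "\<And>x. x \<in> {a..b} ==> abs (w x) <= E*wt i x" "E >= 0"
  and T: "integral {a..b} (%x. (N s (Q s) x)^2*abs (w x)) <= E*T"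
 shows "abs (mom a b w s - integral {a..b} (%x. (airy (s + x))^2*w x)) <= E*(2 * sqrt (Om (2*i + 1) s*BQ s) + T)"
proof -
 let ?A = "%x. airy (s + x)" let ?q = "N s (Q s)"
 have qc [continuous_intros]: "continuous_on S ?q" for S by (rule N_cont) (intro continuous_intros)
 have i: "(%x. (?A x)^2*w x) integrable_on {a..b}" "(%x. (?A x*w x)*?q x) integrable_on {a..b}" "(%x. (?q x)^2*w x) integrable_on {a..b}"
  "(%x. (?q x)^2*abs (w x)) integrable_on {a..b}" "(%x. (?q x)^2*w x - 2*((?A x*w x)*?q x)) integrable_on {a..b}" "(%x. 2*((?A x*w x)*?q x)) integrable_on {a..b}"
  by (intro integrable_continuous_real continuous_intros w)+
 have "mom a b w s = integral {a..b} (%x. (?A x)^2*w x + ((?q x)^2*w x - 2*((?A x*w x)*?q x)))"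
  unfolding mom_def
 proof (rule HK_cong)
  fix x
  have "Q s x = ?A x - ?q x" using Q_eq[of s x] by simp
  thus "(Q s x)^2*w x = (?A x)^2*w x + ((?q x)^2*w x - 2*((?A x*w x)*?q x))"
   by (simp only: power2_diff) (simp add: algebra_simps)
 qed
 also have "... = integral {a..b} (%x. (?A x)^2*w x) + (integral {a..b} (%x. (?q x)^2*w x) - 2*integral {a..b} (%x. (?A x*w x)*?q x))"
  using i by (simp add: HK_add HK_diff)
 finally have e: "mom a b w s - integral {a..b} (%x. (?A x)^2*w x) = integral {a..b} (%x. (?q x)^2*w x) - 2*integral {a..b} (%x. (?A x*w x)*?q x)" by simp
 have 1: "abs (integral {a..b} (%x. (?q x)^2*w x)) <= E*T"
 proof -
  have "norm (integral {a..b} (%x. (?q x)^2*w x)) <= integral {a..b} (%x. (?q x)^2*abs (w x))"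
   by (rule integral_norm_bound_integral[OF i(3,4)]) (simp add: abs_mult)
  thus ?thesis using T by simp
 qed
 have 2: "abs (integral {a..b} (%x. (?A x*w x)*?q x)) <= E * sqrt (Om (2*i + 1) s*BQ s)"
 proof -
  have "(integral {a..b} (%x. (?A x*w x)*?q x))^2 <= integral {a..b} (%x. (?A x*w x)^2)*integral {a..b} (%x. (?q x)^2)"
   by (rule integral_Cauchy_Schwarz_interval) (intro continuous_intros w)+
  also have "... <= (E^2*Om (2*i + 1) s)*BQ s"
  proof (rule mult_mono)
   have "integral {a..b} (%x. (?A x*w x)^2) = integral {a..b} (%x. (?A x)^2*abs ((w x)^2))" by (simp add: power_mult_distrib)
   also have "... <= E^2*Om (2*i + 1) s"
   proof (rule airy_wt_interval)
    show "continuous_on {a..b} (%x. (w x)^2)" by (intro continuous_intros w)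
    fix x assume "x \<in> {a..b}"
    hence "(abs (w x))^2 <= (E*wt i x)^2" using E by (intro power_mono) auto
    thus "abs ((w x)^2) <= E^2*wt (2*i + 1) x" unfolding wt_mult[of i x i, folded power2_eq_square mult_2, symmetric] by (simp add: power_mult_distrib)
   qed simp
   finally show "integral {a..b} (%x. (?A x*w x)^2) <= E^2*Om (2*i + 1) s" .
   show "integral {a..b} (%x. (?q x)^2) <= BQ s" by (rule NQ_Bessel)
   show "0 <= integral {a..b} (%x. (?q x)^2)"
    by (rule HK_nonneg) (auto intro!: integrable_continuous_real continuous_intros)
  qed (use Om_nonneg in simp)
  finally have "(integral {a..b} (%x. (?A x*w x)*?q x))^2 <= (E * sqrt (Om (2*i + 1) s*BQ s))^2"
   using Om_nonneg BQ_nonneg by (simp add: power_mult_distrib mult.assoc)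
  thus ?thesis using E(2) Om_nonneg BQ_nonneg by (simp add: abs_le_square_iff[symmetric])
 qed
 have "E*(2 * sqrt (Om (2*i + 1) s*BQ s) + T) = 2*(E * sqrt (Om (2*i + 1) s*BQ s)) + E*T" by (simp add: algebra_simps)
 thus ?thesis unfolding e using 1 2 by linarith
qed

text \<open>The first estimate uses Bessel's inequality alone. The second gains decay in
  \<open>s\<close> and is needed for the asymptotics at infinity.\<close>

lemma NQ_weight_le:
 assumes w: "continuous_on {a..b} w" and E: "\<And>x. x \<in> {a..b} ==> abs (w x) <= E*wt i x" "E >= 0"
 shows "integral {a..b} (%x. (N s (Q s) x)^2*abs (w x)) <= E*BQ s"
  "s >= 1 ==> integral {a..b} (%x. (N s (Q s) x)^2*abs (w x)) <= E*(BQ s*(1/(1 + s/2)^(i + 1) + AB^2*exp (- s)*I1))"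
proof -
 let ?q = "N s (Q s)"
 have qc [continuous_intros]: "continuous_on S ?q" for S by (rule N_cont) (intro continuous_intros)
 have i: "(%x. (?q x)^2*abs (w x)) integrable_on {a..b}" "(%x. (?q x)^2) integrable_on {a..b}" "(%x. E*(?q x)^2) integrable_on {a..b}"
  "(%x. c*(?q x)^2 + d*exp (- abs (x + s/2))) integrable_on {a..b}" "(%x. exp (- abs (x + s/2))) integrable_on {a..b}" for c d
  by (intro integrable_continuous_real continuous_intros w)+
 have "integral {a..b} (%x. (?q x)^2*abs (w x)) <= integral {a..b} (%x. E*(?q x)^2)"
 proof (rule integral_le[OF i(1,3)])
  fix x assume "x \<in> {a..b}"
  hence "abs (w x) <= E" using E(1)[of x] mult_left_mono[OF wt_le_1[of i x] E(2)] by simp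
  thus "(?q x)^2*abs (w x) <= E*(?q x)^2" unfolding mult.commute[of E] by (intro mult_left_mono) auto
 qed
 also have "... = E*integral {a..b} (%x. (?q x)^2)" by simp
 also have "... <= E*BQ s" using NQ_Bessel E(2) by (intro mult_left_mono)
 finally show "integral {a..b} (%x. (N s (Q s) x)^2*abs (w x)) <= E*BQ s" .
 assume s: "s >= 1"
 let ?c = "1/(1 + s/2)^(i + 1)" let ?d = "BQ s*(AB^2*exp (- s))"
 have c0: "?c > 0" and d0: "?d >= 0" using s BQ_nonneg[of s] by simp_all
 have "integral {a..b} (%x. (?q x)^2*abs (w x)) <= integral {a..b} (%x. (E*?c)*(?q x)^2 + (E*?d)*exp (- abs (x + s/2)))"
 proof (rule integral_le[OF i(1,4)])
  fix x assume x: "x \<in> {a..b}"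
  show "(?q x)^2*abs (w x) <= (E*?c)*(?q x)^2 + (E*?d)*exp (- abs (x + s/2))"
  \<comment> \<open>To the left of \<open>- s/2\<close> the weight is small. To the right of it the
    diagonal of the kernel is at most \<open>AB^2*exp (- s)\<close> times an integrable
    exponential.\<close>
  proof (cases "x <= - s/2")
   case True
   have "(1 + s/2)^(i + 1) <= (1 - x)^(i + 1)" "0 < (1 + s/2)^(i + 1)" using True s by (intro power_mono zero_less_power; simp)+
   hence "wt i x <= ?c" unfolding wt_def using True s by (auto intro!: divide_left_mono simp del: power_Suc simp: Suc_eq_plus1[symmetric])
   hence "abs (w x) <= E*?c" using E(1)[OF x] mult_left_mono[OF _ E(2), of "wt i x" ?c] by linarith
   hence "(?q x)^2*abs (w x) <= (?q x)^2*(E*?c)" by (intro mult_left_mono) auto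
   moreover have "0 <= (E*?d)*exp (- abs (x + s/2))" using E(2) d0 by simp
   ultimately show ?thesis by (simp add: mult.commute)
  next
   case False
   have "(?q x)^2 <= airyK (s + x) (s + x)*BQ s" by (rule NQ_pointwise)
   also have "... <= (AB^2*exp (- (s + x) - (s + x)))*BQ s" using airyK_bound[of "s+x" "s+x"] BQ_nonneg by (intro mult_right_mono) auto
   also have "... <= (AB^2*(exp (- s)*exp (- abs (x + s/2))))*BQ s"
   proof -
    have "- (s + x) - (s + x) <= - s + - abs (x + s/2)" using False by simp
    hence "exp (- (s + x) - (s + x)) <= exp (- s)*exp (- abs (x + s/2))" by (simp only: exp_add[symmetric] exp_le_cancel_iff)
    thus ?thesis using BQ_nonneg by (intro mult_right_mono mult_left_mono) auto
   qed
   finally have q: "(?q x)^2 <= ?d*exp (- abs (x + s/2))" by (simp add: mult_ac)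
   have "abs (w x) <= E" using E(1)[OF x] mult_left_mono[OF wt_le_1[of i x] E(2)] by simp
   hence "(?q x)^2*abs (w x) <= (?d*exp (- abs (x + s/2)))*E" using q d0 by (intro mult_mono) auto
   moreover have "0 <= (E*?c)*(?q x)^2" using E(2) c0 by simp
   ultimately show ?thesis by (simp add: mult_ac)
  qed
 qed
 also have "... = (E*?c)*integral {a..b} (%x. (?q x)^2) + (E*?d)*integral {a..b} (%x. exp (- abs (x + s/2)))"
  using i by (subst HK_add) (auto intro!: integrable_on_mult_right simp del: times_divide_eq_right times_divide_eq_left)
 also have "... <= (E*?c)*BQ s + (E*?d)*I1"
 proof (intro add_mono mult_left_mono NQ_Bessel)
  have ia: "integrable lborel (%x::real. exp (- abs x))" using integrable_exp_abs[of 1] by simp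
  have ia': "integrable lborel (%x::real. exp (- abs (x + s/2)))" "(LINT x|lborel. exp (- abs (x + s/2))) = I1"
   using lborel_integrable_real_affine[OF ia, of 1 "s/2"] lborel_integral_real_affine[of 1 "%x. exp (- abs x)" "s/2"] by (simp_all add: I1_def add.commute)
  have "integral {a..b} (%x. exp (- abs (x + s/2))) = (LINT x|lborel. indicator {a..b} x*exp (- abs (x + s/2)))"
   by (subst integral_eq_lborel) (auto simp: LINT_def intro!: continuous_intros)
  also have "... <= (LINT x|lborel. exp (- abs (x + s/2)))"
   by (rule integral_mono') (use ia' in \<open>auto simp: indicator_def\<close>)
  finally show "integral {a..b} (%x. exp (- abs (x + s/2))) <= I1" using ia' by simp
 qed (use E(2) c0 d0 in auto)
 also have "... = E*(BQ s*(?c + AB^2*exp (- s)*I1))" by (simp add: algebra_simps)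
 finally show "integral {a..b} (%x. (N s (Q s) x)^2*abs (w x)) <= E*(BQ s*(?c + AB^2*exp (- s)*I1))" .
qed

end

section \<open>The weight and its cut-off\<close>

lemma sum_abs_le:
 fixes f g :: "nat => real"
 shows "(\<And>j. j \<in> A ==> abs (f j) <= g j) ==> abs (sum f A) <= sum g A"
 using sum_norm_le[of A f g] by simp

lemma abs_exp_minus_1_le: "abs (exp z - 1) <= abs z*exp (max 0 z)" for z :: real
proof (cases "z >= 0")
 case True
 have "exp z*(1 - z) <= exp z*exp (- z)" using exp_ge_add_one_self[of "-z"] by (intro mult_left_mono) auto
 thus ?thesis using True by (simp add: exp_minus algebra_simps)
next
 case False
 hence "exp z < 1" "max 0 z = 0" by auto
 thus ?thesis using exp_ge_add_one_self[of z] False by (simp del: exp_ge_add_one_self)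
qed

lemma tendsto_linear_bound:
 fixes f :: "real => real"
 assumes "\<And>x. x ~= a ==> abs (x - a) < 1 ==> abs (f x - l) <= C*abs (x - a)"
 shows "(f \<longlongrightarrow> l) (at a)"
proof (rule LIM_zero_cancel, rule Lim_null_comparison)
 show "eventually (%x. norm (f x - l) <= C*abs (x - a)) (at a)"
  unfolding eventually_at using assms by (intro exI[of _ 1]) (auto simp: dist_real_def)
 show "((%x. C*abs (x - a)) \<longlongrightarrow> 0) (at a)"
  by (rule tendsto_eq_intros refl | simp)+
qed

locale tau_data =
 fixes m :: nat and \<tau> :: "nat => real"
 assumes m: "m >= 1" and \<tau>: "\<tau> (2*m) > 0"
begin

definition hT :: "real => real" where "hT x = (\<Sum>j=1..2*m. \<tau> j*inverse x^j)"
text \<open>The logarithmic derivative of \<open>hh\<close>. Since \<open>inverse 0 = 0\<close>, it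
  vanishes at 0, and \<open>hh x*TT x\<close> is the derivative of \<open>hh\<close> there
  too.\<close>

definition TT :: "real => real" where "TT x = (\<Sum>j=1..2*m. 2*real j*\<tau> j*inverse x^(j + 1))"
definition hh :: "real => real" where "hh x = (if x = 0 then 0 else exp (- 2*hT x))"

lemma hh_nonneg: "0 <= hh x" by (simp add: hh_def)

lemma TT_0: "TT 0 = 0" by (simp add: TT_def)

lemma hT_deriv:
 assumes "x ~= 0"
 shows "DERIV hT x :> - TT x/2"
proof -
 have "DERIV (%x. \<tau> j*inverse x^j) x :> - (real j*\<tau> j*inverse x^(j + 1))" for j
  using DERIV_cmult[OF DERIV_power[OF DERIV_inverse[OF assms, of UNIV], of j], of "\<tau> j"]
  by (cases j) (simp_all add: power2_eq_square algebra_simps)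
 hence "DERIV hT x :> (\<Sum>j=1..2*m. - (real j*\<tau> j*inverse x^(j + 1)))"
  unfolding hT_def[abs_def] by (intro DERIV_sum)
 moreover have "(\<Sum>j=1..2*m. - (real j*\<tau> j*inverse x^(j + 1))) = - TT x/2"
  unfolding TT_def sum_divide_distrib minus_divide_left[symmetric] sum_negf[symmetric] by (intro sum.cong) auto
 ultimately show ?thesis by simp
qed

lemma hh_deriv_nonzero:
 assumes "x ~= 0"
 shows "DERIV hh x :> hh x*TT x"
proof -
 have d: "DERIV (%x. exp (- 2*hT x)) x :> hh x*TT x"
  using assms by (auto intro!: derivative_eq_intros hT_deriv simp: hh_def)
 have ev: "eventually (%x. exp (- 2*hT x) = hh x) (nhds x)"
  using t1_space_nhds[OF assms] by (auto elim!: eventually_mono simp: hh_def)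
 show ?thesis using d DERIV_cong_ev[OF refl ev refl] by (rule iffD1[rotated])
qed

text \<open>The top power is even and has a positive coefficient, so \<open>hT\<close> tends to
  infinity on both sides of 0 at least linearly in \<open>1/abs x\<close>; the exponential beats
  every power.\<close>

lemma hh_flat: "\<exists>C\<ge>0. \<forall>x. 0 < abs x \<and> abs x <= 1 --> hh x*abs (inverse x)^k <= C"
proof -
 define a b where "a = \<tau> (2*m)" and "b = (\<Sum>j=1..2*m - 1. abs (\<tau> j))"
 have a: "a > 0" and b: "b >= 0" using \<tau> by (auto simp: a_def b_def intro: sum_nonneg)
 \<comment> \<open>Serves the range where the top power does not dominate: there
   \<open>a/2*y < b\<close>, which the first summand covers, and \<open>y \<le> 2*b/a\<close>, so
   that the second summand bounds the lower powers.\<close>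
 define c0 where "c0 = b + b*(2*b/a)^(2*m - 1)"
 \<comment> \<open>One more than \<open>k\<close>, so that the exponent in
   \<open>(1 + x/n)^n \<le> exp x\<close> is not 0.\<close>
 define K where "K = Suc k"
 define C where "C = exp (2*c0)*(K/a)^K"
 have low: "hT x >= a/2*abs (inverse x) - c0" if x: "0 < abs x" "abs x <= 1" for x
 proof -
  define y where "y = abs (inverse x)"
  have y: "y >= 1" using x unfolding y_def abs_inverse by (simp add: one_le_inverse)
  have S: "{1..2*m} = insert (2*m) {1..2*m - 1}" using m by auto
  have "hT x = a*inverse x^(2*m) + (\<Sum>j=1..2*m - 1. \<tau> j*inverse x^j)"
   unfolding hT_def S a_def using m by (subst sum.insert) auto
  also have "inverse x^(2*m) = y^(2*m)" unfolding y_def by (rule power_even_abs[symmetric]) simp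
  also have "(\<Sum>j=1..2*m - 1. \<tau> j*inverse x^j) >= (\<Sum>j=1..2*m - 1. - (abs (\<tau> j)*y^(2*m - 1)))"
  proof (rule sum_mono)
   fix j assume j: "j \<in> {1..2*m - 1}"
   have "abs (\<tau> j*inverse x^j) = abs (\<tau> j)*y^j" by (simp add: abs_mult y_def power_abs)
   also have "... <= abs (\<tau> j)*y^(2*m - 1)" using j y by (intro mult_left_mono power_increasing) auto
   finally show "- (abs (\<tau> j)*y^(2*m - 1)) <= \<tau> j*inverse x^j" by linarith
  qed
  moreover have "(\<Sum>j=1..2*m - 1. - (abs (\<tau> j)*y^(2*m - 1))) = - (b*y^(2*m - 1))" by (simp add: b_def sum_negf sum_distrib_right)
  ultimately have 1: "hT x >= a*y^(2*m) - b*y^(2*m - 1)" by simp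
  have "y^(2*m) = y*y^(2*m - 1)" using m by (simp add: power_eq_if)
  hence 2: "a*y^(2*m) - b*y^(2*m - 1) = y^(2*m - 1)*(a*y - b)" by (simp add: algebra_simps)
  have p: "y^(2*m-1) >= 1" using y by (rule one_le_power)
  have bb: "0 <= b*(2*b/a)^(2*m - 1)" using a b by simp
  show ?thesis
  proof (cases "b <= a/2*y")
   case True
   hence "1*(a/2*y) <= y^(2*m - 1)*(a*y - b)" using p a y by (intro mult_mono) auto
   thus ?thesis using 1 2 bb b unfolding c0_def y_def[symmetric] by linarith
  next
   case False
   hence "y <= 2*b/a" using a by (simp add: field_simps)
   hence "y^(2*m-1) <= (2*b/a)^(2*m-1)" using y by (intro power_mono) auto
   hence "b*y^(2*m-1) <= b*(2*b/a)^(2*m-1)" using b by (intro mult_left_mono)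
   moreover have "0 <= a*y^(2*m)" using a y by simp
   ultimately show ?thesis using 1 False unfolding c0_def y_def[symmetric] by linarith
  qed
 qed
 have "hh x*abs (inverse x)^k <= C" if x: "0 < abs x" "abs x <= 1" for x
 proof -
  define y where "y = abs (inverse x)"
  have y: "y >= 1" using x unfolding y_def abs_inverse by (simp add: one_le_inverse)
  have "hh x = exp (- 2*hT x)" using x by (simp add: hh_def)
  also have "... <= exp (2*c0)*exp (- (a*y))" using low[OF x] unfolding y_def[symmetric] exp_add[symmetric] by simp
  finally have 1: "hh x <= exp (2*c0)*exp (- (a*y))" .
  have "(a*y/K)^K <= (1 + a*y/K)^K" using a y by (intro power_mono) auto
  also have "... <= exp (a*y)" using a y by (intro exp_ge_one_plus_x_over_n_power_n) (auto simp: K_def intro: order_trans[of _ 0])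
  finally have "(K/a)^K*(a*y/K)^K <= (K/a)^K*exp (a*y)" using a by (intro mult_left_mono) auto
  moreover have "(K/a)^K*(a*y/K)^K = y^K" unfolding power_mult_distrib[symmetric] using a by (simp add: K_def)
  moreover have "y^k <= y^K" using y by (intro power_increasing) (auto simp: K_def)
  ultimately have 2: "y^k <= (K/a)^K*exp (a*y)" by linarith
  have "hh x*y^k <= (exp (2*c0)*exp (- (a*y)))*((K/a)^K*exp (a*y))"
   using 1 2 y by (intro mult_mono) auto
  also have "... = C*(exp (- (a*y))*exp (a*y))" by (simp only: C_def mult_ac)
  also have "... = C" by (simp add: exp_minus)
  finally show ?thesis unfolding y_def .
 qed
 moreover have "C >= 0" using a by (simp add: C_def)
 ultimately show ?thesis by blast
qed

lemma inverse_power_wt: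
 assumes "abs x >= 1"
 shows "abs (inverse x)^(k + 1) <= 2^(k + 1)*wt k x"
proof (cases "x <= 0")
 case True
 have "abs (inverse x)^(k + 1) <= (2/(1 - x))^(k + 1)"
  using True assms by (intro power_mono) (auto simp: field_simps)
 thus ?thesis using True by (simp add: wt_def power_divide)
next
 case False
 have "abs (inverse x)^(k + 1) <= 1" using assms by (intro power_le_one) (auto simp: field_simps)
 also have "... <= 2^(k + 1)" by (rule one_le_power) simp
 finally show ?thesis using False by (simp add: wt_def)
qed

lemma wt_lower: "abs x <= 1 ==> 1 <= 2^(k + 1)*wt k x"
proof (cases "x <= 0")
 case True
 assume "abs x <= 1"
 hence "(1 - x)^(k + 1) <= 2^(k + 1)" using True by (intro power_mono) auto
 moreover have "0 < (1 - x)^(k + 1)" using True by (intro zero_less_power) simp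
 ultimately have "1 <= 2^(k + 1)/(1 - x)^(k + 1)" by (simp only: le_divide_eq_1_pos)
 thus ?thesis using True by (simp add: wt_def)
next
 case False
 have "(1::real) <= 2^(k + 1)" by (rule one_le_power) simp
 thus ?thesis using False by (simp add: wt_def)
qed

lemma sum_inverse_power_le:
 fixes x :: real
 assumes "abs x >= 1"
 shows "abs (\<Sum>j=1..2*m. c j*inverse x^(j + d)) <= (\<Sum>j=1..2*m. abs (c j))*abs (inverse x)^(d + 1)"
proof -
 have "abs (\<Sum>j=1..2*m. c j*inverse x^(j + d)) <= (\<Sum>j=1..2*m. abs (c j)*abs (inverse x)^(d + 1))"
 proof (rule sum_abs_le)
  fix j assume "j \<in> {1..2*m}"
  hence "abs (inverse x)^(j + d) <= abs (inverse x)^(d + 1)" using assms by (intro power_decreasing) (auto simp: field_simps)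
  thus "abs (c j*inverse x^(j + d)) <= abs (c j)*abs (inverse x)^(d + 1)" by (simp only: abs_mult power_abs) (rule mult_left_mono; simp)
 qed
 thus ?thesis by (simp add: sum_distrib_right)
qed

text \<open>All size estimates share one constant that depends on the data \<open>m\<close> and
  \<tau> only; the later uniformity in the cut-off rests on this.\<close>

definition hh_bound :: "real => bool" where
 "hh_bound B \<longleftrightarrow> B > 0 \<and> (\<forall>x. abs (hh x - 1) <= B*wt 0 x) \<and> (\<forall>x. hh x <= B) \<and> (\<forall>x k. k <= 2*m + 1 --> hh x*abs (inverse x)^(k + 1) <= B*wt k x)
  \<and> (\<forall>x. abs x <= 1 --> hh x <= B*x^2) \<and> (\<forall>x. abs x >= 1 --> abs (TT x) <= B*(inverse x)^2)
  \<and> (\<forall>x. abs x <= 1 --> hh x*abs (TT x) <= B*abs x) \<and> (\<forall>x. hh x*abs (TT x)*abs x <= B*wt 0 x)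
  \<and> (\<forall>x. abs x <= 1 --> abs (TT x)*abs x^(2*m + 2) <= B*abs x)"

lemma hh_bounds: "\<exists>B. hh_bound B"
proof -
 obtain F where F: "\<And>k x. 0 < abs x ==> abs x <= 1 ==> hh x*abs (inverse x)^k <= F k" "\<And>k. F k >= 0"
  using hh_flat by metis
 define G where "G = (\<Sum>k\<le>2*m+2. F k)"
 have G: "hh x*abs (inverse x)^k <= G" if "k <= 2*m+2" "0 < abs x" "abs x <= 1" for k x
  using F(1)[OF that(2,3), of k] member_le_sum[of k "{..2*m+2}" F] F(2) that(1) unfolding G_def by force
 have G0: "G >= 0" unfolding G_def using F(2) by (intro sum_nonneg)
 define b c where "b = (\<Sum>j=1..2*m. abs (\<tau> j))" and "c = (\<Sum>j=1..2*m. abs (2*real j*\<tau> j))"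
 have b0: "b >= 0" "c >= 0" by (auto simp: b_def c_def intro: sum_nonneg)
 define H where "H = G + exp (2*b)"
 have H1: "H >= 1" unfolding H_def using G0 b0 by (simp add: add_increasing)
 have hT1: "abs (hT x) <= b*abs (inverse x)" if "abs x >= 1" for x
  using sum_inverse_power_le[OF that, of \<tau> 0] by (simp add: hT_def b_def)
 have TT1: "abs (TT x) <= c*(inverse x)^2" if "abs x >= 1" for x
  using sum_inverse_power_le[OF that, of "%j. 2*real j*\<tau> j" 1]
  unfolding TT_def c_def by (simp only: one_add_one power2_abs)
 have i1: "abs (inverse x) <= 1" if "abs x >= 1" for x :: real using that by (auto simp: field_simps)
 have hb: "hh x <= exp (2*b)" if "abs x >= 1" for x
 proof -
  have "abs (hT x) <= b" using hT1[OF that] mult_left_mono[OF i1[OF that] b0(1)] by simp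
  thus ?thesis using that by (auto simp: hh_def)
 qed
 have hH: "hh x <= H" for x
 proof (cases "abs x >= 1")
  case True
  thus ?thesis using hb[of x] G0 by (simp add: H_def)
 next
  case False
  show ?thesis
  proof (cases "x = 0")
   case True thus ?thesis using H1 by (simp add: hh_def)
  next
   case False2: False
   have "hh x <= G" using G[of 0 x] False False2 by simp
   thus ?thesis by (simp add: H_def add_increasing2)
  qed
 qed
 have p1: "abs (hh x - 1) <= (2*(1 + H) + 4*b*H)*wt 0 x" for x
 proof (cases "abs x >= 1")
  case True
  have hT: "abs (hT x) <= b" using hT1[OF True] mult_left_mono[OF i1[OF True] b0(1)] by simp
  have "abs (hh x - 1) = abs (exp (- 2*hT x) - 1)" using True by (auto simp: hh_def)
  also have "... <= abs (- 2*hT x)*exp (max 0 (- 2*hT x))" by (rule abs_exp_minus_1_le)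
  also have "... <= (2*(b*abs (inverse x)))*exp (2*b)" using hT1[OF True] hT b0 by (intro mult_mono) auto
  also have "... <= (2*(b*(2*wt 0 x)))*H"
   using inverse_power_wt[OF True, of 0] b0 G0 by (intro mult_mono mult_left_mono) (auto simp: H_def intro!: mult_nonneg_nonneg less_imp_le[OF wt_pos])
  also have "... <= (2*(1 + H) + 4*b*H)*wt 0 x" using H1 less_imp_le[OF wt_pos[of 0 x]] by (simp add: algebra_simps)
  finally show ?thesis .
 next
  case False
  have "abs (hh x - 1) <= (1 + H)*1" using hH[of x] hh_nonneg[of x] H1 by simp
  also have "... <= (1 + H)*(2*wt 0 x)" using wt_lower[of x 0] False H1 by (intro mult_left_mono) auto
  also have "... <= (2*(1 + H) + 4*b*H)*wt 0 x" using H1 b0 less_imp_le[OF wt_pos[of 0 x]] by (simp add: algebra_simps)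
  finally show ?thesis .
 qed
 have p3: "hh x*abs (inverse x)^(k + 1) <= (H*2^(2*m + 2))*wt k x" if k: "k <= 2*m + 1" for x k
 proof -
  have kk: "2^(k + 1) <= (2^(2*m + 2) :: real)" using k by (intro power_increasing) auto
  have "hh x*abs (inverse x)^(k + 1) <= H*(2^(k + 1)*wt k x)"
  proof (cases "abs x >= 1")
   case True
   thus ?thesis using inverse_power_wt[OF True, of k] hH[of x] hh_nonneg[of x] H1 by (intro mult_mono) auto
  next
   case False
   have "hh x*abs (inverse x)^(k + 1) <= H*1" using G[of "k + 1" x] False k hh_nonneg[of x] H1 by (cases "x = 0") (auto simp: H_def add_increasing2 add_increasing)
   also have "... <= H*(2^(k + 1)*wt k x)" using wt_lower[of x k] False H1 by (intro mult_left_mono) auto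
   finally show ?thesis .
  qed
  also have "... <= H*(2^(2*m + 2)*wt k x)" using kk H1 less_imp_le[OF wt_pos[of k x]] by (intro mult_left_mono mult_right_mono) auto
  finally show ?thesis by (simp only: mult_ac)
 qed
 have p4: "hh x <= G*x^2" if "abs x <= 1" for x
 proof (cases "x = 0")
  case False
  have "hh x = (hh x*abs (inverse x)^2)*x^2" using False by (simp add: power2_abs power_inverse)
  also have "... <= G*x^2" using G[of 2 x] False that by (intro mult_right_mono) auto
  finally show ?thesis .
 qed (simp add: hh_def)
 have p6: "hh x*abs (TT x) <= (c*G)*abs x" if "abs x <= 1" for x
 proof (cases "x = 0")
  case False
  have "hh x*abs (TT x) <= (\<Sum>j=1..2*m. abs (2*real j*\<tau> j)*(G*abs x))"
  proof -
   have "hh x*abs (TT x) <= hh x*(\<Sum>j=1..2*m. abs (2*real j*\<tau> j*inverse x^(j + 1)))" unfolding TT_def by (intro mult_left_mono sum_abs hh_nonneg)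
   also have "... = (\<Sum>j=1..2*m. abs (2*real j*\<tau> j)*(hh x*abs (inverse x)^(j + 2)*abs x))"
    unfolding sum_distrib_left using False by (intro sum.cong) (auto simp: abs_mult power_abs power_add field_simps)
   also have "... <= (\<Sum>j=1..2*m. abs (2*real j*\<tau> j)*(G*abs x))"
    by (intro sum_mono mult_left_mono mult_right_mono G) (use that False in auto)
   finally show ?thesis .
  qed
  also have "... = (c*G)*abs x" unfolding c_def by (simp add: sum_distrib_right mult.assoc)
  finally show ?thesis .
 qed (simp add: TT_0)
 have p7: "hh x*abs (TT x)*abs x <= (c*(H*2^(2*m + 2)))*wt 0 x" for x
 proof (cases "x = 0")
  case False
  have "hh x*abs (TT x)*abs x <= hh x*(\<Sum>j=1..2*m. abs (2*real j*\<tau> j*inverse x^(j + 1)))*abs x" unfolding TT_def by (intro mult_left_mono mult_right_mono sum_abs hh_nonneg) simp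
  also have "... = (\<Sum>j=1..2*m. abs (2*real j*\<tau> j)*(hh x*abs (inverse x)^(j - 1 + 1)))"
   unfolding sum_distrib_left sum_distrib_right using False by (intro sum.cong) (auto simp: abs_mult power_abs field_simps)
  also have "... <= (\<Sum>j=1..2*m. abs (2*real j*\<tau> j)*((H*2^(2*m + 2))*wt 0 x))"
  proof (intro sum_mono mult_left_mono)
   fix j assume "j \<in> {1..2*m}"
   hence "hh x*abs (inverse x)^(j - 1 + 1) <= (H*2^(2*m + 2))*wt (j - 1) x" by (intro p3) auto
   also have "... <= (H*2^(2*m + 2))*wt 0 x" using H1 by (intro mult_left_mono wt_antimono) auto
   finally show "hh x*abs (inverse x)^(j - 1 + 1) <= (H*2^(2*m + 2))*wt 0 x" .
  qed simp
  also have "... = (c*(H*2^(2*m + 2)))*wt 0 x" unfolding c_def by (simp add: sum_distrib_right mult.assoc)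
  finally show ?thesis .
 qed (use H1 b0 less_imp_le[OF wt_pos] in simp)
 have p8: "abs (TT x)*abs x^(2*m + 2) <= c*abs x" if "abs x <= 1" for x
 proof (cases "x = 0")
  case False
  have "abs (TT x)*abs x^(2*m + 2) <= (\<Sum>j=1..2*m. abs (2*real j*\<tau> j*inverse x^(j + 1)))*abs x^(2*m + 2)" unfolding TT_def by (intro mult_right_mono sum_abs) simp
  also have "... <= (\<Sum>j=1..2*m. abs (2*real j*\<tau> j)*abs x)"
   unfolding sum_distrib_right
  proof (rule sum_mono)
   fix j assume j: "j \<in> {1..2*m}"
   have "abs (inverse x)^(j + 1)*abs x^(2*m + 2) = (abs (inverse x)^(j + 1)*abs x^(j + 1))*abs x^(2*m + 1 - j)"
    using j by (simp add: power_add[symmetric] mult.assoc del: power_Suc)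
   also have "abs (inverse x)^(j + 1)*abs x^(j + 1) = 1" unfolding power_mult_distrib[symmetric] using False by simp
   also have "1*abs x^(2*m + 1 - j) <= abs x^1" unfolding mult_1_left using j that by (intro power_decreasing) auto
   finally have "abs (inverse x)^(j + 1)*abs x^(2*m + 2) <= abs x" by simp
   thus "abs (2*real j*\<tau> j*inverse x^(j + 1))*abs x^(2*m + 2) <= abs (2*real j*\<tau> j)*abs x"
    unfolding abs_mult[of _ "inverse x^(j + 1)"] power_abs mult.assoc[of _ "abs (inverse x)^(j + 1)"] by (intro mult_left_mono) auto
  qed
  also have "... = c*abs x" unfolding c_def by (simp add: sum_distrib_right)
  finally show ?thesis .
 qed (simp add: TT_0)
 define B where "B = (2*(1 + H) + 4*b*H) + H + H*2^(2*m + 2) + G + c + c*G + c*(H*2^(2*m + 2))"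
 have nn: "0 <= 2*(1 + H) + 4*b*H" "0 <= H" "0 <= H*2^(2*m + 2)" "0 <= c*G" "0 <= c*(H*2^(2*m + 2))" using H1 b0 G0 by auto
 have le: "(2*(1 + H) + 4*b*H) <= B" "H <= B" "H*2^(2*m + 2) <= B" "G <= B" "c <= B" "c*G <= B" "c*(H*2^(2*m + 2)) <= B"
  unfolding B_def using nn b0 G0 by linarith+
 have w: "0 <= wt k x" for k x by (rule less_imp_le[OF wt_pos])
 show ?thesis unfolding hh_bound_def
 proof (intro exI[of _ B] conjI allI impI)
  show "B > 0" using le(2) H1 by linarith
  show "abs (hh x - 1) <= B*wt 0 x" for x by (rule order_trans[OF p1 mult_right_mono[OF le(1) w]])
  show "hh x <= B" for x using hH[of x] le(2) by linarith
  show "hh x*abs (inverse x)^(k + 1) <= B*wt k x" if "k <= 2*m + 1" for x k by (rule order_trans[OF p3[OF that] mult_right_mono[OF le(3) w]])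
  show "hh x <= B*x^2" if "abs x <= 1" for x by (rule order_trans[OF p4[OF that] mult_right_mono[OF le(4)]]) simp
  show "abs (TT x) <= B*(inverse x)^2" if "1 <= abs x" for x by (rule order_trans[OF TT1[OF that] mult_right_mono[OF le(5)]]) simp
  show "hh x*abs (TT x) <= B*abs x" if "abs x <= 1" for x by (rule order_trans[OF p6[OF that] mult_right_mono[OF le(6)]]) simp
  show "hh x*abs (TT x)*abs x <= B*wt 0 x" for x by (rule order_trans[OF p7 mult_right_mono[OF le(7) w]])
  show "abs (TT x)*abs x^(2*m + 2) <= B*abs x" if "abs x <= 1" for x by (rule order_trans[OF p8[OF that] mult_right_mono[OF le(5)]]) simp
 qed
qed

definition BB :: real where "BB = (SOME B. hh_bound B)"

lemma BB:
 "BB > 0" "abs (hh x - 1) <= BB*wt 0 x" "hh x <= BB" "k <= 2*m + 1 ==> hh x*abs (inverse x)^(k + 1) <= BB*wt k x"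
 "abs x <= 1 ==> hh x <= BB*x^2" "abs x >= 1 ==> abs (TT x) <= BB*(inverse x)^2"
 "abs x <= 1 ==> hh x*abs (TT x) <= BB*abs x" "hh x*abs (TT x)*abs x <= BB*wt 0 x"
 "abs x <= 1 ==> abs (TT x)*abs x^(2*m + 2) <= BB*abs x"
 using someI_ex[OF hh_bounds, folded BB_def] unfolding hh_bound_def by blast+

lemma hh_deriv: "DERIV hh x :> hh x*TT x"
proof (cases "x = 0")
 case True
 have "((%x. (hh x - hh 0)/(x - 0)) \<longlongrightarrow> 0) (at 0)"
 proof (rule tendsto_linear_bound)
  fix x :: real assume "x ~= 0" "abs (x - 0) < 1"
  hence "hh x/abs x <= (BB*x^2)/abs x" using BB(5)[of x] by (auto intro!: divide_right_mono)
  thus "abs ((hh x - hh 0)/(x - 0) - 0) <= BB*abs (x - 0)" using \<open>x \<noteq> 0\<close> hh_nonneg[of x] by (simp add: hh_def[of 0] power2_eq_square abs_mult[symmetric] field_simps)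
 qed
 thus ?thesis using True by (simp add: has_field_derivative_iff TT_0)
qed (rule hh_deriv_nonzero)

lemma hh_deriv_cont: "continuous_on UNIV (%x. hh x*TT x)"
proof (rule continuous_at_imp_continuous_on, rule ballI)
 fix x :: real
 show "isCont (%x. hh x*TT x) x"
 proof (cases "x = 0")
  case True
  have "((%x. hh x*TT x) \<longlongrightarrow> 0) (at 0)"
   by (rule tendsto_linear_bound[of _ _ _ BB]) (use BB(7) hh_nonneg in \<open>auto simp: abs_mult\<close>)
  thus ?thesis using True by (simp add: isCont_def TT_0)
 next
  case False
  have "isCont TT x" unfolding TT_def[abs_def] using False by (intro continuous_intros) auto
  moreover have "isCont hh x" by (rule DERIV_isCont[OF hh_deriv])
  ultimately show ?thesis by (intro continuous_intros)
 qed
qed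

text \<open>The contact of order \<open>2 * m + 2\<close> with \<open>1\<close> at the origin keeps \<open>(1 + sg X x) / x ^ (i + 1)\<close> continuous for \<open>i \<le> 2 * m\<close>.\<close>

definition cut :: "real => real => real" where "cut X x = (max 0 (1 - (x/X)^(2*m + 2)))^2"
definition cut' :: "real => real => real" where
 "cut' X x = - 2*max 0 (1 - (x/X)^(2*m + 2))*(real (2*m + 2)*(x/X)^(2*m + 1)/X)"

text \<open>The square in \<open>cut\<close> makes it continuously differentiable at the ends of its
  support.\<close>

lemma max0_sq_deriv: "DERIV (%y. (max 0 y)^2) y :> 2*max 0 y" for y :: real
proof -
 consider "y > 0" | "y < 0" | "y = 0" by linarith
 thus ?thesis
 proof cases
  case 1
  have "DERIV (%y. y^2) y :> 2*y" by (auto intro!: derivative_eq_intros)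
  moreover have "eventually (%y. y^2 = (max 0 y)^2) (nhds y)"
   using eventually_nhds_in_open[of "{0<..}" y] 1 by (auto elim!: eventually_mono)
  ultimately show ?thesis using DERIV_cong_ev[of y y "%y. y^2" "%y. (max 0 y)^2" "2*y" "2*max 0 y"] 1 by simp
 next
  case 2
  have "DERIV (%y. 0) y :> 0" by simp
  moreover have "eventually (%y. 0 = (max 0 y)^2) (nhds y)"
   using eventually_nhds_in_open[of "{..<0}" y] 2 by (auto elim!: eventually_mono)
  ultimately show ?thesis using DERIV_cong_ev[of y y "%y. 0" "%y. (max 0 y)^2" 0 "2*max 0 y"] 2 by simp
 next
  case 3
  have "((%x::real. ((max 0 x)^2 - (max 0 0)^2)/(x - 0)) \<longlongrightarrow> 0) (at 0)"
   by (rule tendsto_linear_bound[of _ _ _ 1]) (auto simp: max_def power2_eq_square)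
  thus ?thesis using 3 by (simp add: has_field_derivative_iff)
 qed
qed

lemma cut_deriv:
 assumes "X > 0"
 shows "DERIV (cut X) x :> cut' X x"
proof -
 have "DERIV (%x. 1 - (x/X)^(2*m + 2)) x :> - (real (2*m + 2)*(x/X)^(2*m + 1)/X)"
  by (rule derivative_eq_intros refl | use assms in force)+
 from DERIV_chain2[OF max0_sq_deriv this] show ?thesis unfolding cut_def[abs_def] cut'_def by (simp add: mult_ac)
qed

lemma cut'_cont: "X > 0 ==> continuous_on UNIV (cut' X)"
 unfolding cut'_def[abs_def] by (intro continuous_intros) auto

lemma cut_range: "0 <= cut X x" "cut X x <= 1"
proof -
 have "0 <= (x/X)^(2*(m + 1))" by (simp only: power_mult zero_le_power zero_le_power2)
 hence "abs (max 0 (1 - (x/X)^(2*m + 2))) <= 1" by (simp add: max_def)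
 thus "cut X x <= 1" unfolding cut_def by (simp only: abs_square_le_1)
qed (simp add: cut_def)

lemma cut_outside:
 assumes "X > 0" "X <= abs x"
 shows "cut X x = 0" "cut' X x = 0"
proof -
 have "1 <= abs (x/X)" using assms by simp
 hence "1 <= abs (x/X)^(2*m + 2)" by (rule one_le_power)
 also have "... = (x/X)^(2*m + 2)" by (rule power_even_abs) simp
 finally show "cut X x = 0" "cut' X x = 0" by (simp_all add: cut_def cut'_def)
qed

text \<open>Inside the support \<open>abs x/X \<le> 1\<close>, so the contact of order
  \<open>2*m + 2\<close> may be spent in any smaller order \<open>j\<close>, according to the pole
  that has to be compensated.\<close>

lemma cut_near:
 assumes "X > 0" "j <= 2*m + 2"
 shows "1 - cut X x <= 2*(abs x/X)^j"
proof (cases "X <= abs x")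
 case True
 hence "1 <= (abs x/X)^j" using assms by (intro one_le_power) simp
 thus ?thesis using cut_outside(1)[OF assms(1) True] by simp
next
 case False
 define z where "z = abs x/X"
 have z: "0 <= z" "z <= 1" using False assms by (auto simp: z_def)
 have "(x/X)^(2*m + 2) = abs (x/X)^(2*m + 2)" by (rule power_even_abs[symmetric]) simp
 hence e: "(x/X)^(2*m + 2) = z^(2*m + 2)" using assms by (simp add: z_def)
 define y where "y = z^(2*m + 2)"
 have y: "0 <= y" "y <= 1" using z unfolding y_def by (auto intro: power_le_one simp del: power_Suc add_2_eq_Suc')
 have "1 - cut X x = 1 - (1 - y)^2" unfolding cut_def e y_def[symmetric] using y by simp
 also have "... <= 2*y" by (simp add: power2_eq_square algebra_simps)
 also have "y <= z^j" unfolding y_def using z assms by (intro power_decreasing) auto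
 finally show ?thesis by (simp add: z_def)
qed

lemma cut'_bound:
 assumes "X > 0"
 shows "abs (cut' X x) <= 2*real (2*m + 2)/X"
proof (cases "X <= abs x")
 case True
 thus ?thesis using cut_outside[OF assms True] assms by simp
next
 case False
 have "0 <= (x/X)^(2*(m + 1))" by (simp only: power_mult zero_le_power zero_le_power2)
 hence 1: "abs (2*max 0 (1 - (x/X)^(2*m + 2))) <= 2" by (simp add: max_def)
 have "abs (x/X) <= 1" using False assms by simp
 hence "abs (x/X)^(2*m + 1) <= 1" by (intro power_le_one) auto
 hence 2: "abs (real (2*m + 2)*(x/X)^(2*m + 1)/X) <= real (2*m + 2)*1/X"
  using assms unfolding abs_divide abs_mult power_abs[of "x/X"] by (intro frac_le mult_mono) auto
 have "abs (cut' X x) = abs (2*max 0 (1 - (x/X)^(2*m + 2)))*abs (real (2*m + 2)*(x/X)^(2*m + 1)/X)"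
  unfolding cut'_def by (simp only: abs_mult abs_minus_cancel mult_minus_left)
 also have "... <= 2*(real (2*m + 2)*1/X)" by (intro mult_mono 1 2) auto
 finally show ?thesis by simp
qed

section \<open>The cut-off of \<open>hh - 1\<close>\<close>

definition sg :: "real => real => real" where "sg X x = cut X x*(hh x - 1)"
definition sg' :: "real => real => real" where "sg' X x = cut' X x*(hh x - 1) + cut X x*(hh x*TT x)"

text \<open>An upper bound of \<open>1 - hh\<close> outside \<open>(- e, e)\<close>. It does not
  depend on the radius of the cut-off, which makes coercivity uniform.\<close>

definition th :: "real => real" where "th e = 1 - exp (- 2*(\<Sum>j=1..2*m. abs (\<tau> j)*inverse e^j))"

lemma th_range:
 assumes "e > 0"
 shows "0 <= th e" "th e < 1"
proof -
 have "0 <= (\<Sum>j=1..2*m. abs (\<tau> j)*inverse e^j)" using assms(1) by (intro sum_nonneg) auto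
 thus "0 <= th e" "th e < 1" unfolding th_def by auto
qed

lemma sg_gap:
 assumes "e > 0" "e <= abs x"
 shows "- sg X x <= th e"
proof -
 note t = th_range[OF assms(1)]
 have "hT x <= abs (hT x)" by simp
 also have "... <= (\<Sum>j=1..2*m. abs (\<tau> j)*inverse e^j)"
  unfolding hT_def
 proof (rule sum_abs_le)
  fix j
  have "abs (inverse x)^j <= inverse e^j" using assms unfolding abs_inverse by (intro power_mono le_imp_inverse_le) auto
  thus "abs (\<tau> j*inverse x^j) <= abs (\<tau> j)*inverse e^j" by (simp only: abs_mult power_abs) (rule mult_left_mono; simp)
 qed
 finally have "1 - hh x <= th e" using assms by (auto simp: hh_def th_def)
 have "- sg X x = cut X x*(1 - hh x)" by (simp add: sg_def algebra_simps)
 also have "... <= cut X x*th e" using \<open>1 - hh x \<le> th e\<close> cut_range by (intro mult_left_mono)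
 also have "... <= 1*th e" using cut_range t by (intro mult_right_mono)
 finally show "- sg X x <= th e" by simp
qed

lemma one_plus_sg: "1 + sg X x = (1 - cut X x) + cut X x*hh x" by (simp add: sg_def algebra_simps)

lemma one_plus_sg_nonneg: "0 <= 1 + sg X x" unfolding one_plus_sg using cut_range[of X x] hh_nonneg[of x] by simp

lemma sg_bound: "abs (sg X x) <= BB*wt 0 x"
proof -
 have "abs (sg X x) <= 1*abs (hh x - 1)" unfolding sg_def abs_mult using cut_range[of X x] by (intro mult_right_mono) auto
 thus ?thesis using BB(2)[of x] by simp
qed

lemma dressing_sg: "X > 0 ==> dressing X (sg X) (sg' X)"
proof
 assume X: "X > 0"
 thus "X > 0" .
 show "DERIV (sg X) x :> sg' X x" for x
  unfolding sg_def[abs_def] sg'_def by (auto intro!: derivative_eq_intros cut_deriv[OF X] hh_deriv)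
 have c: "continuous_on UNIV hh" "continuous_on UNIV (cut X)"
  by (auto intro!: continuous_at_imp_continuous_on DERIV_isCont[OF hh_deriv] DERIV_isCont[OF cut_deriv[OF X]])
 show "continuous_on UNIV (sg' X)" unfolding sg'_def[abs_def] by (intro continuous_intros c cut'_cont X hh_deriv_cont)
 show "sg X x = 0" if "X <= abs x" for x using cut_outside[OF X that] by (simp add: sg_def)
 show "- sg X x <= 1" for x using one_plus_sg_nonneg[of X x] by linarith
 show "\<exists>p\<ge>0. p < 1 \<and> (\<forall>x. e <= abs x --> - sg X x <= p)" if "e > 0" for e
  using sg_gap[OF that] th_range[OF that] by blast
qed

end

section \<open>The weight \<open>hh\<close> compared with superpositions of exponentials\<close>

lemma lw_recurrence: "exp x = (real k + 1)*lw k x + x*lw (k + 1) x" "exp x - 1 = x*lw 0 x"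
proof -
 have d: "((%\<tau>. \<tau>^(k + 1)*exp (\<tau>*x)) has_real_derivative (real k + 1)*(\<tau>^k*exp (\<tau>*x)) + x*(\<tau>^(k + 1)*exp (\<tau>*x))) (at \<tau> within {0..1})" for \<tau> k
 proof -
  have "((%\<tau>. exp (\<tau>*x)) has_real_derivative x*exp (\<tau>*x)) (at \<tau> within {0..1})" by (auto intro!: derivative_eq_intros)
  from DERIV_mult[OF DERIV_power[OF DERIV_ident, of "k + 1" \<tau> "{0..1}"] this] show ?thesis by (simp add: algebra_simps)
 qed
 have i: "(%\<tau>. \<tau>^k*exp (\<tau>*x)) integrable_on {0..1}" for k by (intro integrable_continuous_real continuous_intros)
 have A: "((%\<tau>. (real k + 1)*(\<tau>^k*exp (\<tau>*x)) + x*(\<tau>^(k + 1)*exp (\<tau>*x))) has_integral (1^(k + 1)*exp (1*x) - 0^(k + 1)*exp (0*x))) {0..1}"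
  by (rule fundamental_theorem_of_calculus) (use d in \<open>auto simp: has_real_derivative_iff_has_vector_derivative[symmetric]\<close>)
 have B: "((%\<tau>. (real k + 1)*(\<tau>^k*exp (\<tau>*x)) + x*(\<tau>^(k + 1)*exp (\<tau>*x))) has_integral ((real k + 1)*lw k x + x*lw (k + 1) x)) {0..1}"
  unfolding lw_eq by (intro has_integral_add has_integral_mult_right integrable_integral i)
 show "exp x = (real k + 1)*lw k x + x*lw (k + 1) x" using has_integral_unique[OF A B] by simp
 have A: "((%\<tau>. x*exp (\<tau>*x)) has_integral (exp (1*x) - exp (0*x))) {0..1}"
  by (rule fundamental_theorem_of_calculus) (auto intro!: derivative_eq_intros simp: has_real_derivative_iff_has_vector_derivative[symmetric])
 have B: "((%\<tau>. x*exp (\<tau>*x)) has_integral (x*lw 0 x)) {0..1}"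
  unfolding lw_eq using integrable_integral[OF i[of 0]] by (intro has_integral_mult_right) simp
 show "exp x - 1 = x*lw 0 x" using has_integral_unique[OF A B] by simp
qed

lemma lw_nonneg: "0 <= lw i x"
 unfolding lw_eq by (rule HK_nonneg) (auto intro!: integrable_continuous_real continuous_intros)

text \<open>For \<open>x \<ge> 0\<close> this is Chebyshev's inequality for the increasing functions \<open>\<tau> - 1/2\<close> and \<open>\<tau> ^ i * exp (\<tau> * x)\<close>.\<close>

lemma lw_Suc_ge:
 assumes "-1 <= x"
 shows "lw i x <= 2*exp 1*(real i + 2)*2^(i + 2)*lw (i + 1) x"
proof (cases "x >= 0")
 case True
 have c: "(%\<tau>. \<tau>^k*exp (\<tau>*x)) integrable_on {0..1}" for k by (intro integrable_continuous_real continuous_intros)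
 have h: "((%\<tau>::real. \<tau> - 1/2) has_integral 0) {0..1}"
 proof -
  have "((%\<tau>::real. \<tau> - 1/2) has_integral ((1^2/2 - 1/2) - (0^2/2 - 0/2))) {0..1}"
   by (rule fundamental_theorem_of_calculus) (auto intro!: derivative_eq_intros simp: has_real_derivative_iff_has_vector_derivative[symmetric])
  thus ?thesis by simp
 qed
 have "0 <= lw (i + 1) x - 1/2*lw i x - (1/2)^i*exp (x/2)*0"
 proof (rule has_integral_nonneg)
  show "((%\<tau>. \<tau>^(i + 1)*exp (\<tau>*x) - 1/2*(\<tau>^i*exp (\<tau>*x)) - (1/2)^i*exp (x/2)*(\<tau> - 1/2)) has_integral (lw (i + 1) x - 1/2*lw i x - (1/2)^i*exp (x/2)*0)) {0..1}"
   unfolding lw_eq by (intro has_integral_diff has_integral_mult_right integrable_integral c h)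
  fix \<tau> :: real assume \<tau>: "\<tau> \<in> {0..1}"
  have "0 <= (\<tau> - 1/2)*(\<tau>^i*exp (\<tau>*x) - (1/2)^i*exp (x/2))"
  proof (cases "\<tau> >= 1/2")
   case t: True
   have "(1/2)^i*exp (x/2) <= \<tau>^i*exp (\<tau>*x)"
    using t True mult_right_mono[OF t True] by (intro mult_mono power_mono) auto
   thus ?thesis using t by (intro mult_nonneg_nonneg) auto
  next
   case f: False
   have "\<tau>^i*exp (\<tau>*x) <= (1/2)^i*exp (x/2)"
    using f \<tau> True mult_right_mono[of \<tau> "1/2" x] by (intro mult_mono power_mono) auto
   thus ?thesis using f by (intro mult_nonpos_nonpos) auto
  qed
  thus "0 <= \<tau>^(i + 1)*exp (\<tau>*x) - 1/2*(\<tau>^i*exp (\<tau>*x)) - (1/2)^i*exp (x/2)*(\<tau> - 1/2)"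
   by (simp add: algebra_simps)
 qed
 hence "lw i x <= 2*lw (i + 1) x" by simp
 also have "... = (2*1*1*1)*lw (i + 1) x" by simp
 also have "... <= (2*exp 1*(real i + 2)*2^(i + 2))*lw (i + 1) x"
  by (intro mult_right_mono mult_mono one_le_power lw_nonneg) auto
 finally show ?thesis .
next
 case False
 have "lw i x <= integral {0..1} (%\<tau>::real. 1)"
  unfolding lw_eq
 proof (rule integral_le)
  fix \<tau> :: real assume \<tau>: "\<tau> \<in> {0..1}"
  have "\<tau>^i*exp (\<tau>*x) <= 1*1" using \<tau> False by (intro mult_mono power_le_one) (auto simp: mult_nonneg_nonpos)
  thus "\<tau>^i*exp (\<tau>*x) <= 1" by simp
 qed (intro integrable_continuous_real continuous_intros)+
 hence "lw i x <= 1*1" by simp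
 also have "... <= 2*(2^(i + 1 + 1)*wt (i + 1) x)"
 proof -
  have "(1 - x)^(i + 1 + 1) <= 2^(i + 1 + 1)" using False assms by (intro power_mono) auto
  moreover have "0 < (1 - x)^(i + 1 + 1)" using False by (intro zero_less_power) simp
  ultimately have "1 <= 2^(i + 1 + 1)/(1 - x)^(i + 1 + 1)" by (simp only: le_divide_eq_1_pos)
  hence "1 <= 2^(i + 1 + 1)*wt (i + 1) x" using False by (simp add: wt_def)
  thus ?thesis by linarith
 qed
 also have "... <= 2*(2^(i + 1 + 1)*(exp 1*(real (i + 1) + 1)*lw (i + 1) x))" by (intro mult_left_mono wt_le_lw) auto
 also have "... = 2*exp 1*(real i + 2)*2^(i + 2)*lw (i + 1) x" by (simp add: mult_ac)
 finally show ?thesis .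
qed

context tau_data
begin

text \<open>For \<open>x\<close> tending to minus infinity, \<open>lw i x\<close> behaves like
  \<open>fact i/(- x)^(i + 1)\<close>, and the factorial is 1 for \<open>i \<le> 1\<close>. There
  the error is of the next order, because \<open>hh - 1\<close> and the exponential remainders are
  small; for \<open>x \<ge> -1\<close> all terms are dominated separately.\<close>

lemma hh_lw_compare:
 assumes i: "i <= 1"
 shows "\<exists>C\<ge>0. \<forall>x. abs ((-1)^(i + 1)*hh x*inverse x^(i + 1) - lw i x) <= C*lw (i + 1) x"
proof -
 define K where "K = exp 1*(real (i + 1) + 1)"
 define C1 where "C1 = BB*(2^(i + 2)*K) + 2*exp 1*(real i + 2)*2^(i + 2)"
 define C2 where "C2 = (2^(i + 2)*BB + 2*27*8)*K"
 have wl: "wt (i + 1) x <= K*lw (i + 1) x" for x unfolding K_def by (rule wt_le_lw)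
 have K0: "K >= 0" by (simp add: K_def)
 have 1: "abs ((-1)^(i + 1)*hh x*inverse x^(i + 1) - lw i x) <= C1*lw (i + 1) x" if x: "x >= -1" for x
 proof -
  have "abs ((-1)^(i + 1)*hh x*inverse x^(i + 1)) = hh x*abs (inverse x)^(i + 1)"
   using hh_nonneg[of x] by (simp add: abs_mult power_abs)
  also have "... <= BB*wt i x" using i m by (intro BB(4)) auto
  also have "... <= BB*1" using BB(1) wt_le_1 by (intro mult_left_mono) auto
  also have "... <= BB*(2^(i + 2)*wt (i + 1) x)"
  proof (intro mult_left_mono)
   show "1 <= 2^(i + 2)*wt (i + 1) x"
   proof (cases "x <= 0")
    case True
    thus ?thesis using wt_lower[of x "i+1"] x by simp
   next
    case False
    have "(1::real) <= 2^(i + 2)" by (rule one_le_power) simp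
    thus ?thesis using False by (simp add: wt_def)
   qed
  qed (use BB(1) in auto)
  also have "... <= BB*(2^(i + 2)*(K*lw (i + 1) x))" using BB(1) by (intro mult_left_mono wl) auto
  finally have "abs ((-1)^(i + 1)*hh x*inverse x^(i + 1)) <= BB*(2^(i + 2)*K)*lw (i + 1) x" by (simp only: mult.assoc)
  moreover have "abs (lw i x) <= 2*exp 1*(real i + 2)*2^(i + 2)*lw (i + 1) x" using lw_Suc_ge[OF x, of i] lw_nonneg[of i x] by simp
  ultimately show ?thesis unfolding C1_def distrib_right by linarith
 qed
 have 2: "abs ((-1)^(i + 1)*hh x*inverse x^(i + 1) - lw i x) <= C2*lw (i + 1) x" if x: "x <= -1" for x
 proof -
  have y: "abs x >= 1" "x ~= 0" "abs (inverse x) <= 1" using x by (auto simp: field_simps)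
  \<comment> \<open>A cube suffices: the target weight \<open>wt (i + 1)\<close> decays like the
    power \<open>i + 2\<close>, which is at most 3.\<close>
  have ex: "exp x <= 27*abs (inverse x)^3"
  proof -
   have "(- x/3)^3 <= (1 + - x/real 3)^3" using x by (intro power_mono) auto
   also have "... <= exp (- x)" using x by (intro exp_ge_one_plus_x_over_n_power_n) auto
   finally have "exp x*(- x/3)^3 <= exp x*exp (- x)" by (intro mult_left_mono) auto
   hence "exp x*abs x^3 <= 27" using x by (simp add: exp_minus power_divide)
   hence "(exp x*abs x^3)*abs (inverse x)^3 <= 27*abs (inverse x)^3" by (intro mult_right_mono) auto
   moreover have "abs x^3*abs (inverse x)^3 = 1" unfolding power_mult_distrib[symmetric] using y by simp
   ultimately show ?thesis by (simp add: mult.assoc)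
  qed
  have rem: "\<exists>r. lw i x = (-1)^(i + 1)*inverse x^(i + 1) + exp x*r \<and> abs r <= 2"
  proof (cases "i = 0")
   case True
   have "lw 0 x = (exp x - 1)*inverse x" using lw_recurrence(2)[of x] y by (simp add: field_simps)
   thus ?thesis using True y by (intro exI[of _ "inverse x"]) (simp add: algebra_simps)
  next
   case False
   hence i1: "i = 1" using i by simp
   have l0: "lw 0 x = (exp x - 1)*inverse x" using lw_recurrence(2)[of x] y by (simp add: field_simps)
   have "lw 1 x = (exp x - lw 0 x)*inverse x" using lw_recurrence(1)[of x 0] y by (simp add: field_simps)
   also have "... = (inverse x)^2 + exp x*(inverse x - (inverse x)^2)" unfolding l0 by (simp add: algebra_simps power2_eq_square)
   finally have "lw 1 x = (inverse x)^2 + exp x*(inverse x - (inverse x)^2)" .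
   moreover have "(inverse x)^2 <= 1" using y(3) by (simp only: abs_square_le_1)
   hence "abs (inverse x - (inverse x)^2) <= 2" using y(3) zero_le_power2[of "inverse x"] by linarith
   ultimately show ?thesis unfolding i1 by (intro exI[of _ "inverse x - (inverse x)^2"]) (simp add: power2_eq_square)
  qed
  then obtain r where r: "lw i x = (-1)^(i + 1)*inverse x^(i + 1) + exp x*r" "abs r <= 2" by blast
  have w0: "wt i x*wt 0 x = wt (i + 1) x" by (simp add: wt_mult)
  have "(-1)^(i + 1)*hh x*inverse x^(i + 1) - lw i x = (-1)^(i + 1)*((hh x - 1)*inverse x^(i + 1)) - exp x*r"
   unfolding r(1) by (simp add: algebra_simps)
  also have "abs ... <= abs ((-1)^(i + 1)*((hh x - 1)*inverse x^(i + 1))) + abs (exp x*r)" by (rule abs_triangle_ineq4)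
  finally have "abs ((-1)^(i + 1)*hh x*inverse x^(i + 1) - lw i x) <= abs (hh x - 1)*abs (inverse x)^(i + 1) + exp x*abs r"
   by (simp add: abs_mult power_abs)
  also have "abs (hh x - 1)*abs (inverse x)^(i + 1) <= (BB*wt 0 x)*(2^(i + 1)*wt i x)"
   using BB(1) less_imp_le[OF wt_pos] by (intro mult_mono BB(2) inverse_power_wt y) auto
  also have "... = (2^(i + 1)*BB)*wt (i + 1) x" unfolding w0[symmetric] by (simp only: mult_ac)
  also have "... <= (2^(i + 2)*BB)*wt (i + 1) x" using BB(1) less_imp_le[OF wt_pos] by (intro mult_right_mono) auto
  also have "exp x*abs r <= (27*abs (inverse x)^3)*2" using ex r(2) by (intro mult_mono) auto
  also have "... <= (27*(8*wt (i + 1) x))*2"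
  proof -
   have "abs (inverse x)^(2 + 1) <= 2^(2 + 1)*wt 2 x" by (rule inverse_power_wt[OF y(1)])
   also have "... <= 2^(2 + 1)*wt (i + 1) x" using i by (intro mult_left_mono wt_antimono) auto
   finally show ?thesis by simp
  qed
  finally have "abs ((-1)^(i + 1)*hh x*inverse x^(i + 1) - lw i x) <= (2^(i + 2)*BB + 2*27*8)*wt (i + 1) x"
   by (simp add: algebra_simps)
  also have "... <= (2^(i + 2)*BB + 2*27*8)*(K*lw (i + 1) x)" using BB(1) by (intro mult_left_mono wl) auto
  finally show ?thesis by (simp only: C2_def mult.assoc)
 qed
 have C: "C1 >= 0" "C2 >= 0" using K0 BB(1) by (auto simp: C1_def C2_def)
 show ?thesis
 proof (intro exI[of _ "C1 + C2"] conjI allI)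
  fix x
  have "0 <= C1*lw (i + 1) x" "0 <= C2*lw (i + 1) x" using C lw_nonneg by (auto intro: mult_nonneg_nonneg)
  thus "abs ((-1)^(i + 1)*hh x*inverse x^(i + 1) - lw i x) <= (C1 + C2)*lw (i + 1) x"
   using 1[of x] 2[of x] unfolding distrib_right by linarith
 qed (use C in simp)
qed

definition EE :: real where "EE = 2*2^(2*m + 2) + BB"

lemma EE_pos: "EE > 0" using BB(1) by (simp add: EE_def add_pos_pos)

text \<open>Near 0 the pole is compensated twice: in \<open>1 - cut\<close> by the order of contact,
  in \<open>cut*hh\<close> by flatness. With \<open>i \<le> 2*m\<close> one power of
  \<open>x\<close> is left over, which gives continuity at 0.\<close>

lemma one_plus_sg_weight:
 assumes X: "X >= 1" and i: "i <= 2*m"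
 shows "(1 + sg X x)*abs (inverse x)^(i + 1) <= EE*wt i x"
  "abs x <= 1 ==> (1 + sg X x)*abs (inverse x)^(i + 1) <= (2 + BB)*abs x"
proof -
 have w: "wt i x >= 0" by (rule less_imp_le[OF wt_pos])
 have pw: "(2::real)^(i + 1) <= 2^(2*m + 2)" using i by (intro power_increasing) auto
 have near: "1 - cut X x <= 2*abs x^j" if "j <= 2*m + 2" for j
 proof -
  have "abs x/X <= abs x/1" using X by (intro divide_left_mono) auto
  hence "(abs x/X)^j <= abs x^j" using X by (intro power_mono) auto
  thus ?thesis using cut_near[of X j x] X that by linarith
 qed
 have xy: "abs x^j*abs (inverse x)^j <= 1" for j unfolding power_mult_distrib[symmetric] by (cases "x = 0"; simp; cases j; simp)
 have a: "(1 - cut X x)*abs (inverse x)^(i + 1) <= 2*2^(2*m + 2)*wt i x"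
 proof (cases "abs x >= 1")
  case True
  have "(1 - cut X x)*abs (inverse x)^(i + 1) <= 1*(2^(i + 1)*wt i x)"
   using cut_range[of X x] inverse_power_wt[OF True, of i] by (intro mult_mono) auto
  also have "... <= 2*2^(2*m + 2)*wt i x" using mult_right_mono[OF pw w] mult_nonneg_nonneg[OF _ w, of "2^(2*m + 2)"] by simp
  finally show ?thesis .
 next
  case False
  have "(1 - cut X x)*abs (inverse x)^(i + 1) <= (2*abs x^(i + 1))*abs (inverse x)^(i + 1)"
   using i by (intro mult_right_mono near) auto
  also have "... <= 2*1" unfolding mult.assoc by (intro mult_left_mono xy) auto
  also have "... <= 2*(2^(i + 1)*wt i x)" using wt_lower[of x i] False by (intro mult_left_mono) auto
  also have "... <= 2*(2^(2*m + 2)*wt i x)" using pw w by (intro mult_left_mono mult_right_mono) auto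
  finally show ?thesis by (simp only: mult.assoc)
 qed
 have ch: "cut X x*z <= z" if "z >= 0" for z using cut_range(2)[of X x] that mult_right_mono[of "cut X x" 1 z] by simp
 have b: "cut X x*hh x*abs (inverse x)^(i + 1) <= hh x*abs (inverse x)^(i + 1)"
  using ch[of "hh x*abs (inverse x)^(i + 1)"] hh_nonneg[of x] by (simp add: mult.assoc)
 show "(1 + sg X x)*abs (inverse x)^(i + 1) <= EE*wt i x"
  unfolding one_plus_sg distrib_right EE_def using a b BB(4)[of i x] i by linarith
 assume x: "abs x <= 1"
 have "(1 - cut X x)*abs (inverse x)^(i + 1) <= (2*abs x^(i + 2))*abs (inverse x)^(i + 1)"
  using i by (intro mult_right_mono near) auto
 also have "... = 2*abs x*(abs x^(i + 1)*abs (inverse x)^(i + 1))" by (simp add: mult_ac)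
 also have "... <= 2*abs x*1" by (intro mult_left_mono xy) auto
 finally have 1: "(1 - cut X x)*abs (inverse x)^(i + 1) <= 2*abs x" by simp
 have "hh x*abs (inverse x)^(i + 1) <= BB*abs x"
 proof (cases "x = 0")
  case False
  have "hh x*abs (inverse x)^(i + 1) = (hh x*abs (inverse x)^(i + 1 + 1))*abs x" using False by simp
  also have "... <= (BB*wt (i + 1) x)*abs x" using i by (intro mult_right_mono BB(4)) auto
  also have "... <= (BB*1)*abs x" using BB(1) by (intro mult_right_mono mult_left_mono wt_le_1) auto
  finally show ?thesis by simp
 qed simp
 thus "(1 + sg X x)*abs (inverse x)^(i + 1) <= (2 + BB)*abs x" unfolding one_plus_sg distrib_right using 1 b by linarith
qed

end

text \<open>The factor \<open>exp (t x)\<close> regularises the completeness relation. Multiplication by \<open>x\<close> lowers the index of the weights \<open>wf\<close>;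
 the value \<open>inverse 0 = 0\<close> does no harm because \<open>1 + sg X\<close> vanishes at \<open>0\<close>.\<close>

locale approximant = tau_data +
 fixes X t Y :: real
 assumes X1: "X >= 1" and t: "0 < t" "t <= 1/X" and Y: "X <= Y"
begin

sublocale dressing X "sg X" "sg' X" by (rule dressing_sg) (use X1 in simp)

definition wf :: "nat => real => real" where "wf i x = - 2*(1 + sg X x)*exp (t*x)*inverse x^(i + 1)"

lemma tX: "x <= X ==> t*x <= 1"
proof -
 assume "x <= X"
 hence "t*x <= t*X" using t by (intro mult_left_mono) auto
 also have "... <= 1/X*X" using t X1 by (intro mult_right_mono) auto
 finally show ?thesis using X1 by simp
qed

lemma wf_abs: "x <= X ==> abs (wf i x) <= 2*exp 1*((1 + sg X x)*abs (inverse x)^(i + 1))"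
proof -
 assume "x <= X"
 hence e: "exp (t*x) <= exp 1" using tX[of x] by simp
 have "abs (wf i x) = 2*exp (t*x)*((1 + sg X x)*abs (inverse x)^(i + 1))"
  using one_plus_sg_nonneg[of X x] by (simp add: wf_def abs_mult power_abs)
 also have "... <= 2*exp 1*((1 + sg X x)*abs (inverse x)^(i + 1))"
  using e one_plus_sg_nonneg[of X x] by (intro mult_right_mono mult_left_mono) auto
 finally show ?thesis .
qed

lemma wf_bound: "i <= 2*m ==> x <= X ==> abs (wf i x) <= (2*exp 1*EE)*wt i x"
 by (rule order_trans[OF wf_abs]) (use mult_left_mono[OF one_plus_sg_weight(1)[OF X1, of i x], of "2*exp 1"] in \<open>simp_all add: mult.assoc\<close>)

lemma wf_cont:
 assumes i: "i <= 2*m"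
 shows "continuous_on S (wf i)"
proof (rule continuous_on_subset[OF continuous_at_imp_continuous_on subset_UNIV], rule ballI)
 fix x :: real
 show "isCont (wf i) x"
 proof (cases "x = 0")
  case True
  have "(wf i \<longlongrightarrow> 0) (at 0)"
  proof (rule tendsto_linear_bound)
   fix x :: real assume x: "abs (x - 0) < 1"
   have "abs (wf i x) <= 2*exp 1*((2 + BB)*abs x)"
    by (intro order_trans[OF wf_abs] mult_left_mono one_plus_sg_weight(2)[OF X1 i]) (use x X1 in auto)
   thus "abs (wf i x - 0) <= 2*exp 1*(2 + BB)*abs (x - 0)" by (simp add: mult.assoc)
  qed
  thus ?thesis using True by (simp add: isCont_def wf_def)
 next
  case False
  have "isCont (sg X) x" by (rule DERIV_isCont[OF \<sigma>_deriv])
  thus ?thesis unfolding wf_def[abs_def] using False by (intro continuous_intros) auto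
 qed
qed

lemma sg_0: "1 + sg X 0 = 0" by (simp add: sg_def cut_def hh_def)

lemma wf_shift: "x*wf (Suc i) x = wf i x" "x*wf 0 x = - 2*((1 + sg X x)*exp (t*x))"
proof -
 show "x*wf (Suc i) x = wf i x" by (cases "x = 0"; simp add: wf_def)
 show "x*wf 0 x = - 2*((1 + sg X x)*exp (t*x))"
 proof (cases "x = 0")
  case True
  thus ?thesis by (simp only: sg_0 mult_zero_left mult_zero_right)
 qed (simp add: wf_def field_simps)
qed

definition CC :: real where "CC = (5*exp 1 + 4*real m + 4)*BB"

text \<open>The trace formula contains \<sigma>', whereas the moments produce
  \<open>1 + \<sigma>\<close> times the regularising factor and the logarithmic derivative of
  \<open>hh\<close>. The discrepancy has three sources: the cut-off differs from 1, the exponential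
  differs from 1, and the cut-off has a derivative. Each is of order \<open>1/X\<close> relative to
  \<open>wt 0\<close>.\<close>

lemma trace_bracket:
 assumes x: "x <= X"
 shows "abs ((1 + sg X x)*exp (t*x)*TT x - sg' X x) <= CC/X*wt 0 x"
proof -
 have Xp: "X > 0" using X1 by simp
 have w: "wt 0 x > 0" by (rule wt_pos)
 have e1: "exp (t*x) <= exp 1" using tX[OF x] by simp
 have "abs (exp (t*x) - 1) <= abs (t*x)*exp 1"
  by (rule order_trans[OF abs_exp_minus_1_le mult_left_mono]) (use tX[OF x] in auto)
 also have "... <= (1/X*abs x)*exp 1" using t unfolding abs_mult by (intro mult_right_mono) auto
 finally have et: "abs (exp (t*x) - 1) <= (1/X*abs x)*exp 1" .
 have ch: "cut X x*z <= z" if "z >= 0" for z using cut_range(2)[of X x] that mult_right_mono[of "cut X x" 1 z] by simp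
 have T2: "abs (cut X x*(hh x*TT x)*(exp (t*x) - 1)) <= exp 1*BB/X*wt 0 x"
 proof -
  have "abs (cut X x*(hh x*TT x)*(exp (t*x) - 1)) = cut X x*(hh x*abs (TT x)*abs (exp (t*x) - 1))"
   using cut_range(1)[of X x] hh_nonneg[of x] by (simp add: abs_mult)
  also have "... <= hh x*abs (TT x)*abs (exp (t*x) - 1)" by (rule ch) (simp add: hh_nonneg)
  also have "... <= hh x*abs (TT x)*((1/X*abs x)*exp 1)" using et hh_nonneg[of x] by (intro mult_left_mono) auto
  also have "... = (exp 1/X)*(hh x*abs (TT x)*abs x)" by simp
  also have "... <= (exp 1/X)*(BB*wt 0 x)" using Xp by (intro mult_left_mono BB(8)) auto
  finally show ?thesis by simp
 qed
 have T3: "abs (cut' X x*(hh x - 1)) <= (4*real m + 4)*BB/X*wt 0 x"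
 proof -
  have "abs (cut' X x*(hh x - 1)) <= (2*real (2*m + 2)/X)*(BB*wt 0 x)" unfolding abs_mult using Xp by (intro mult_mono cut'_bound BB(2)) auto
  thus ?thesis by (simp add: add.commute mult.assoc)
 qed
 have T1a: "(1 - cut X x)*abs (TT x) <= 4*BB/X*wt 0 x"
 proof (cases "abs x >= 1")
  case True
  have "(1 - cut X x)*abs (TT x) <= (2*(abs x/X)^1)*(BB*(inverse x)^2)"
   using cut_range[of X x] Xp by (intro mult_mono cut_near BB(6) True) auto
  also have "... = 2*BB/X*abs (inverse x)^(0 + 1)" using True by (auto simp: power2_eq_square abs_if field_simps)
  also have "... <= 2*BB/X*(2^(0 + 1)*wt 0 x)" using Xp BB(1) by (intro mult_left_mono inverse_power_wt True) auto
  finally show ?thesis by simp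
 next
  case False
  have "(1 - cut X x)*abs (TT x) <= (2*(abs x/X)^(2*m + 2))*abs (TT x)" using Xp by (intro mult_right_mono cut_near) auto
  also have "(abs x/X)^(2*m + 2) <= abs x^(2*m + 2)/X"
  proof -
   have "X^1 <= X^(2*m + 2)" using X1 by (intro power_increasing) auto
   thus ?thesis unfolding power_divide using Xp by (intro divide_left_mono) auto
  qed
  also have "(2*(abs x^(2*m + 2)/X))*abs (TT x) = 2/X*(abs (TT x)*abs x^(2*m + 2))" by simp
  also have "... <= 2/X*(BB*abs x)" using False Xp by (intro mult_left_mono BB(9)) auto
  also have "... <= 2/X*(BB*(2^(0 + 1)*wt 0 x))" using wt_lower[of x 0] False Xp BB(1) by (intro mult_left_mono) auto
  finally show ?thesis by (simp add: mult_right_mono)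
 qed
 have T1: "abs ((1 - cut X x)*TT x*exp (t*x)) <= (4*BB/X*wt 0 x)*exp 1"
 proof -
  have "abs ((1 - cut X x)*TT x*exp (t*x)) = ((1 - cut X x)*abs (TT x))*exp (t*x)" using cut_range[of X x] by (simp add: abs_mult)
  also have "... <= (4*BB/X*wt 0 x)*exp 1" by (intro mult_mono[OF T1a e1]) (use w BB(1) Xp in auto)
  finally show ?thesis .
 qed
 have "(1 + sg X x)*exp (t*x)*TT x - sg' X x = (1 - cut X x)*TT x*exp (t*x) + cut X x*(hh x*TT x)*(exp (t*x) - 1) - cut' X x*(hh x - 1)"
  unfolding one_plus_sg sg'_def by (simp add: algebra_simps)
 hence "abs ((1 + sg X x)*exp (t*x)*TT x - sg' X x) <= (4*BB/X*wt 0 x)*exp 1 + exp 1*BB/X*wt 0 x + (4*real m + 4)*BB/X*wt 0 x"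
  using T1 T2 T3 by linarith
 also have "... = CC/X*wt 0 x" using Xp by (simp add: CC_def field_simps)
 finally show ?thesis .
qed

end

section \<open>Uniform estimates\<close>

lemma Om_antimono: "i <= j ==> Om j s <= Om i s"
 unfolding Om_def by (intro integral_mono Om_integrable mult_left_mono wt_antimono) auto

context dressing
begin

lemma mom_sup:
 assumes w: "continuous_on {a..b} w" and E: "\<And>x. x \<in> {a..b} ==> abs (w x) <= E*wt i x" "E >= 0"
 shows "abs (mom a b w s) <= E*(Om i s + 2 * sqrt (Om (2*i + 1) s*BQ s) + BQ s)"
proof -
 have "norm (integral {a..b} (%x. (airy (s + x))^2*w x)) <= integral {a..b} (%x. (airy (s + x))^2*abs (w x))"
  by (rule integral_norm_bound_integral) (auto simp: abs_mult intro!: integrable_continuous_real continuous_intros w)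
 hence "abs (integral {a..b} (%x. (airy (s + x))^2*w x)) <= E*Om i s"
  using airy_wt_interval[OF w E, of s] by simp
 moreover have "abs (mom a b w s - integral {a..b} (%x. (airy (s + x))^2*w x)) <= E*(2 * sqrt (Om (2*i + 1) s*BQ s) + BQ s)"
  by (rule mom_bounds[OF w E NQ_weight_le(1)[OF w E]])
 ultimately show ?thesis unfolding distrib_left by linarith
qed

end

section \<open>Asymptotics of the limiting Airy moments\<close>

context tau_data
begin

definition qb :: "real => real" where "qb s1 = (2/(1 - th (airy_eps s1)))^2*BB^2"

lemma qb_nonneg: "0 <= qb s1" by (simp add: qb_def)

text \<open>The moment with the full weight and the Airy function in place of \<open>Q\<close>: the
  limit of the main term when the cut-off is removed.\<close>

definition Lw :: "nat => real => real" where "Lw i s = (LINT x|lborel. (airy (s + x))^2*(- 2*hh x*inverse x^(i + 1)))"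
text \<open>Leading terms at infinity. Index 0 determines the value of the first integrals, index 1
  the asymptotics of \<open>b 1\<close>; for larger indices the leading term is already within the
  error allowed by \<open>tgt_exp\<close>.\<close>

definition tgt :: "nat => real => real" where
 "tgt i s = (if i = 0 then s powr (- (1/2)) else if i = 1 then - (1/2) * s powr (- (3/2)) else 0)"
definition tgt_exp :: "nat => real" where "tgt_exp i = (if i = 0 then 3/2 else 5/2)"

lemma hh_measurable [measurable]: "hh \<in> borel_measurable borel"
 by (intro borel_measurable_continuous_onI continuous_at_imp_continuous_on ballI DERIV_isCont[OF hh_deriv])

lemma Lw_integrable: "i <= 2*m ==> integrable lborel (%x. (airy (s + x))^2*(- 2*hh x*inverse x^(i + 1)))"
 and Lw_le: "i <= 2*m ==> abs (Lw i s) <= 2*BB*Om i s"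
proof -
 assume i: "i <= 2*m"
 have b: "abs ((airy (s + x))^2*(- 2*hh x*inverse x^(i + 1))) <= 2*BB*((airy (s + x))^2*wt i x)" for x
 proof -
  have "abs ((airy (s + x))^2*(- 2*hh x*inverse x^(i + 1))) = 2*(airy (s + x))^2*(hh x*abs (inverse x)^(i + 1))"
   using hh_nonneg[of x] by (simp add: abs_mult power_abs)
  also have "... <= 2*(airy (s + x))^2*(BB*wt i x)" using i by (intro mult_left_mono BB(4)) auto
  finally show ?thesis by (simp add: mult_ac)
 qed
 have g: "integrable lborel (%x. 2*BB*((airy (s + x))^2*wt i x))" using Om_integrable by simp
 show f: "integrable lborel (%x. (airy (s + x))^2*(- 2*hh x*inverse x^(i + 1)))"
  by (rule Bochner_bound[OF g _ AE_I2]) (measurable, use order_trans[OF b abs_ge_self] in simp)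
 have "abs (Lw i s) <= (LINT x|lborel. 2*BB*((airy (s + x))^2*wt i x))"
  unfolding Lw_def by (rule integral_abs_bound_integral[OF f g b])
 thus "abs (Lw i s) <= 2*BB*Om i s" by (simp add: Om_def)
qed

text \<open>For \<open>i \<le> 1\<close> the weight is exchanged for \<open>lw i\<close>, whose
  moment \<open>Rl i\<close> has an explicit expansion; the error is a moment of index
  \<open>i + 1\<close>. For \<open>i \<ge> 2\<close> the size of the moment is sufficient.\<close>

lemma Lw_asymp:
 assumes i: "i <= 2*m"
 shows "\<exists>C\<ge>0. \<forall>s\<ge>1. abs (Lw i s - tgt i s) <= C * s powr (- tgt_exp i)"
proof (cases "i <= 1")
 case True
 obtain C where C: "C >= 0" "\<And>x. abs ((-1)^(i + 1)*hh x*inverse x^(i + 1) - lw i x) <= C*lw (i + 1) x"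
  using hh_lw_compare[OF True] by blast
 obtain R where R: "R > 0" "\<And>s. s >= 1 ==> Rl (i + 1) s <= R * s powr (- (real (i + 1) + 1/2))"
  using Rl_decay[of "i + 1"] by blast
 have G: "Gamma (real i + 3/2) > 0" by (intro Gamma_real_pos; simp)
 have tg: "2*(-1)^i*(Gamma (real i + 1/2)/(2 * sqrt pi) * s powr (- (real i + 1/2))) = tgt i s" for s
 proof (cases "i = 0")
  case True
  thus ?thesis by (simp add: tgt_def Gamma_one_half_real)
 next
  case False
  hence "i = 1" using \<open>i \<le> 1\<close> by simp
  have "(1/2::real) \<notin> \<int>\<^sub>\<le>\<^sub>0" by (auto dest: nonpos_Ints_nonpos)
  hence G32: "Gamma (3/2 :: real) = sqrt pi/2" using Gamma_plus1[of "1/2::real"] by (simp add: Gamma_one_half_real)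
  show ?thesis using \<open>i = 1\<close> by (simp add: tgt_def G32)
 qed
 have te: "real (i + 1) + 1/2 = tgt_exp i" "real i + 3/2 = tgt_exp i" using True by (cases i; simp add: tgt_exp_def)+
 have "abs (Lw i s - tgt i s) <= (2*C*R + 2*(3*Gamma (real i + 3/2))) * s powr (- tgt_exp i)" if s: "s >= 1" for s
 proof -
  have sg: "(-1)^i*((-1)^(i + 1)*z) = - (z::real)" for z by (cases "even i") auto
  have l: "integrable lborel (%x. (airy (s + x))^2*lw i x)" "integrable lborel (%x. 2*(-1)^i*((airy (s + x))^2*lw i x))"
   using airy_lw(1) by simp_all
  have a1: "Lw i s - 2*(-1)^i*Rl i s = (LINT x|lborel. (airy (s + x))^2*(- 2*hh x*inverse x^(i + 1)) - 2*(-1)^i*((airy (s + x))^2*lw i x))"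
   using Lw_integrable[OF i] l by (simp add: Lw_def airy_lw(2))
  have a2: "abs (LINT x|lborel. (airy (s + x))^2*(- 2*hh x*inverse x^(i + 1)) - 2*(-1)^i*((airy (s + x))^2*lw i x))
   <= (LINT x|lborel. 2*C*((airy (s + x))^2*lw (i + 1) x))"
  proof (rule integral_abs_bound_integral)
   fix x
   have "(airy (s + x))^2*(- 2*hh x*inverse x^(i + 1)) - 2*(-1)^i*((airy (s + x))^2*lw i x)
    = (2*(airy (s + x))^2*(-1)^i)*((-1)^(i + 1)*hh x*inverse x^(i + 1) - lw i x)"
    by (cases "even i") (simp_all add: algebra_simps)
   also have "abs ... = (2*(airy (s + x))^2)*abs ((-1)^(i + 1)*hh x*inverse x^(i + 1) - lw i x)" unfolding abs_mult by (simp add: power_abs)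
   also have "... <= (2*(airy (s + x))^2)*(C*lw (i + 1) x)" by (intro mult_left_mono C(2)) auto
   finally show "abs ((airy (s + x))^2*(- 2*hh x*inverse x^(i + 1)) - 2*(-1)^i*((airy (s + x))^2*lw i x)) <= 2*C*((airy (s + x))^2*lw (i + 1) x)" by (simp only: mult_ac)
  next
   show "integrable lborel (%x. (airy (s + x))^2*(- 2*hh x*inverse x^(i + 1)) - 2*(-1)^i*((airy (s + x))^2*lw i x))"
    by (intro Bochner_diff Lw_integrable[OF i] l(2))
   show "integrable lborel (%x. 2*C*((airy (s + x))^2*lw (i + 1) x))" using airy_lw(1) by simp
  qed
  have a3: "(LINT x|lborel. 2*C*((airy (s + x))^2*lw (i + 1) x)) = 2*C*Rl (i + 1) s" by (simp only: integral_mult_right_zero airy_lw(2))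
  have 1: "abs (Lw i s - 2*(-1)^i*Rl i s) <= 2*C*Rl (i + 1) s" unfolding a1 using a2 unfolding a3 .
  have "2*C*Rl (i + 1) s <= 2*C*(R * s powr (- tgt_exp i))" using R(2)[OF s] C(1) unfolding te by (intro mult_left_mono) auto
  hence 2: "abs (Lw i s - 2*(-1)^i*Rl i s) <= 2*C*R * s powr (- tgt_exp i)" using 1 by (simp add: mult.assoc)
  have "abs (2*(-1)^i*Rl i s - tgt i s) = abs (2*(-1)^i*(Rl i s - Gamma (real i + 1/2)/(2 * sqrt pi) * s powr (- (real i + 1/2))))"
   unfolding tg[symmetric] by (simp add: right_diff_distrib)
  also have "... = 2*abs (Rl i s - Gamma (real i + 1/2)/(2 * sqrt pi) * s powr (- (real i + 1/2)))" by (simp add: abs_mult power_abs)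
  also have "... <= 2*(3*Gamma (real i + 3/2) * s powr (- tgt_exp i))" using Rl_asymp[of s i] s unfolding te by (intro mult_left_mono) auto
  finally show ?thesis using 2 unfolding distrib_right by linarith
 qed
 moreover have "0 <= 2*C*R + 2*(3*Gamma (real i + 3/2))" using C R G by simp
 ultimately show ?thesis by blast
next
 case False
 obtain C where C: "C > 0" "\<And>s. s >= 1 ==> Om i s <= C * s powr (- (real i + 1/2))" using Om_decay[of i] by blast
 have "abs (Lw i s - tgt i s) <= (2*BB*C) * s powr (- tgt_exp i)" if s: "s >= 1" for s
 proof -
  have "abs (Lw i s - tgt i s) <= 2*BB*Om i s" using Lw_le[OF i] False by (simp add: tgt_def)
  also have "... <= 2*BB*(C * s powr (- (real i + 1/2)))" using BB(1) by (intro mult_left_mono C(2)[OF s]) auto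
  also have "... <= 2*BB*(C * s powr (- tgt_exp i))" using s BB(1) C(1) False by (intro mult_left_mono powr_mono) (auto simp: tgt_exp_def)
  finally show ?thesis by (simp add: mult.assoc)
 qed
 moreover have "0 <= 2*BB*C" using C BB(1) by simp
 ultimately show ?thesis by blast
qed

end

section \<open>Moments of the approximants\<close>

context approximant
begin

lemma BQ_qb: "s1 <= s ==> BQ s <= qb s1*Om 1 s"
 using BQ_le[OF _ sg_gap[OF airy_eps(1)] th_range[OF airy_eps(1)] sg_bound less_imp_le[OF BB(1)], of s1 s s1] by (simp add: qb_def mult.assoc)

definition gA :: "nat => real => real" where "gA i = mom (-Y) X (wf i)"
definition hA :: "nat => real => real" where "hA i = mom1 (-Y) X (wf i)"
definition JA :: "real => real" where "JA = mom (-Y) X (%x. (1 + sg X x)*exp (t*x))"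
text \<open>The regularised moment of index -1, freed from the constant that diverges as
  \<open>t\<close> tends to 0.\<close>

definition fA :: "real => real" where "fA s = - 2*JA s + 2*gauss_kernel t 0 0"
definition eA :: "real => real" where "eA s = u s - s - 2*(\<Sum>j=1..2*m. real j*\<tau> j*gA j s)"
text \<open>Fitted so that the derivative of \<open>hA\<close> is \<open>2*u*gA\<close> plus four
  times the preceding moment plus \<open>RA\<close>, while the derivative of \<open>RA\<close> is
  \<open>2*u*hA\<close>. For index 0 the constant compensates the one taken out in
  \<open>fA\<close>.\<close>

definition RA :: "nat => real => real" where
 "RA i s = mom2 (-Y) X (wf i) s - 2*mom (-Y) X (%x. x*wf i x) s - 4*(if i = 0 then 2*gauss_kernel t 0 0 else 0)"

lemma mom_cmult: "mom a b (%x. c*w x) s = c*mom a b w s"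
proof -
 have "mom a b (%x. c*w x) s = integral {a..b} (%x. c*((Q s x)^2*w x))"
  unfolding mom_def by (intro HK_cong) simp
 thus ?thesis by (simp add: mom_def)
qed

lemma mom_shift: "mom (-Y) X (%x. x*wf i x) s = (if i = 0 then fA s - 2*gauss_kernel t 0 0 else gA (i - 1) s)"
 by (cases i) (simp_all only: wf_shift mom_cmult fA_def JA_def gA_def, simp_all)

lemma approx_ode:
 assumes i: "i <= 2*m"
 shows "DERIV (gA i) s :> hA i s"
  "DERIV (hA i) s :> 2*u s*gA i s + 4*(if i = 0 then fA s else gA (i - 1) s) + RA i s"
  "DERIV (RA i) s :> 2*u s*hA i s"
proof -
 have c: "continuous_on {-Y..X} (wf i)" "continuous_on {-Y..X} (%x. x*wf i x)" using wf_cont[OF i] by (auto intro!: continuous_intros)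
 show "DERIV (gA i) s :> hA i s" unfolding gA_def hA_def by (rule mom_derivs[OF c(1)])
 have "mom2 (-Y) X (wf i) s + 2*(u s*mom (-Y) X (wf i) s + mom (-Y) X (%x. x*wf i x) s)
  = 2*u s*gA i s + 4*(if i = 0 then fA s else gA (i - 1) s) + RA i s"
  unfolding RA_def mom_shift gA_def by (simp add: algebra_simps)
 thus "DERIV (hA i) s :> 2*u s*gA i s + 4*(if i = 0 then fA s else gA (i - 1) s) + RA i s"
  unfolding hA_def using mom_derivs(2)[OF c(1), of s] by simp
 have "DERIV (RA i) s :> 2*(u s*mom1 (-Y) X (wf i) s + mom1 (-Y) X (%x. x*wf i x) s) - 2*mom1 (-Y) X (%x. x*wf i x) s - 0"
  unfolding RA_def[abs_def] by (intro DERIV_diff DERIV_cmult DERIV_const mom_derivs(3)[OF c(1)] mom_derivs(1)[OF c(2)])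
 thus "DERIV (RA i) s :> 2*u s*hA i s" by (simp add: hA_def mult.assoc)
qed

text \<open>The defect of the trace formula is itself a moment, namely of the bracket estimated in
  \<open>trace_bracket\<close>. The integral with \<sigma>' may be extended to \<open>- Y\<close>
  because \<sigma>' vanishes beyond \<open>- X\<close>.\<close>

lemma eA_eq: "eA s = 2*mom (-Y) X (%x. - (\<Sum>j=1..2*m. real j*\<tau> j*wf j x) - sg' X x) s"
proof -
 have c: "continuous_on {-Y..X} (%x. (Q s x)^2*wf j x)" if "j \<in> {1..2*m}" for j using that by (intro continuous_intros wf_cont) auto
 have c': "continuous_on S (%x. (Q s x)^2 * sg' X x)" for S
  by (rule continuous_on_subset[of UNIV]) (auto intro!: continuous_intros \<sigma>'_cont)
 have i: "(%x. real j*\<tau> j*((Q s x)^2*wf j x)) integrable_on {-Y..X}" if "j \<in> {1..2*m}" for j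
  by (intro integrable_continuous_real continuous_on_mult_left c that)
 have I': "integral {-X..X} (%x. sg' X x*(Q s x)^2) = integral {-Y..X} (%x. (Q s x)^2 * sg' X x)"
 proof -
  have "integral {-Y..-X} (%x. (Q s x)^2 * sg' X x) + integral {-X..X} (%x. (Q s x)^2 * sg' X x) = integral {-Y..X} (%x. (Q s x)^2 * sg' X x)"
   using Y X1 by (intro Henstock_Kurzweil_Integration.integral_combine integrable_continuous_real c') auto
  moreover have "integral {-Y..-X} (%x. (Q s x)^2 * sg' X x) = integral {-Y..-X} (%x. 0)"
   by (rule HK_cong) (use X1 in \<open>simp add: sg'_def cut_outside\<close>)
  ultimately show ?thesis by (simp add: mult.commute)
 qed
 have "mom (-Y) X (%x. - (\<Sum>j=1..2*m. real j*\<tau> j*wf j x) - sg' X x) s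
  = integral {-Y..X} (%x. - (\<Sum>j=1..2*m. real j*\<tau> j*((Q s x)^2*wf j x)) - (Q s x)^2 * sg' X x)"
  unfolding mom_def by (rule HK_cong) (simp add: right_diff_distrib sum_distrib_left mult_ac)
 also have "... = - (\<Sum>j=1..2*m. real j*\<tau> j*gA j s) - integral {-Y..X} (%x. (Q s x)^2 * sg' X x)"
 proof -
  have "integral {-Y..X} (%x. \<Sum>j=1..2*m. real j*\<tau> j*((Q s x)^2*wf j x)) = (\<Sum>j=1..2*m. real j*\<tau> j*gA j s)"
   using i by (subst Henstock_Kurzweil_Integration.integral_sum) (auto simp: gA_def mom_def)
  thus ?thesis using i integrable_continuous_real[OF c'[of "{-Y..X}"]]
   by (subst HK_diff) (auto intro!: integrable_neg integrable_sum)
 qed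
 finally show ?thesis unfolding eA_def u_trace I' by simp
qed

lemma eA_bound: "abs (eA s) <= 2*(CC/X*(Om 0 s + 2 * sqrt (Om 1 s*BQ s) + BQ s))"
proof -
 have w: "continuous_on {-Y..X} (%x. - (\<Sum>j=1..2*m. real j*\<tau> j*wf j x) - sg' X x)"
  by (intro continuous_intros continuous_on_subset[OF \<sigma>'_cont] wf_cont) auto
 have e: "- (\<Sum>j=1..2*m. real j*\<tau> j*wf j x) = (1 + sg X x)*exp (t*x)*TT x" for x
  unfolding TT_def sum_negf[symmetric] sum_distrib_left by (intro sum.cong) (simp_all add: wf_def algebra_simps)
 have "abs (mom (-Y) X (%x. - (\<Sum>j=1..2*m. real j*\<tau> j*wf j x) - sg' X x) s) <= CC/X*(Om 0 s + 2 * sqrt (Om (2*0 + 1) s*BQ s) + BQ s)"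
 proof (rule mom_sup[OF w])
  show "abs (- (\<Sum>j=1..2*m. real j*\<tau> j*wf j x) - sg' X x) <= CC/X*wt 0 x" if "x \<in> {-Y..X}" for x
   unfolding e by (rule trace_bracket) (use that in simp)
 qed (use X1 BB(1) in \<open>simp add: CC_def\<close>)
 thus ?thesis unfolding eA_eq by simp
qed

lemma gA_bound: "i <= 2*m ==> abs (gA i s) <= 2*exp 1*EE*(Om i s + 2 * sqrt (Om (2*i + 1) s*BQ s) + BQ s)"
 unfolding gA_def by (rule mom_sup) (use EE_pos wf_bound in \<open>auto intro!: wf_cont\<close>)

lemma gA_airy:
 assumes "i <= 2*m" "s >= 1"
 shows "abs (gA i s - integral {-Y..X} (%x. (airy (s + x))^2*wf i x))
  <= 2*exp 1*EE*(2 * sqrt (Om (2*i + 1) s*BQ s) + BQ s*(1/(1 + s/2)^(i + 1) + AB^2*exp (- s)*I1))"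
proof -
 have c: "continuous_on {-Y..X} (wf i)" by (rule wf_cont[OF assms(1)])
 have b: "abs (wf i x) <= 2*exp 1*EE*wt i x" if "x \<in> {-Y..X}" for x using that by (intro wf_bound assms) auto
 have E: "2*exp 1*EE >= 0" using EE_pos by simp
 show ?thesis unfolding gA_def by (rule mom_bounds[OF c b E NQ_weight_le(2)[OF c b E assms(2)]])
qed

end

context tau_data
begin

text \<open>Coercivity enters through \<open>qb (- S)\<close> and the Airy moments through their
  supremum for \<open>s \<ge> - S\<close>, so nothing depends on the approximant except the factor
  \<open>1/X\<close> in the defect.\<close>

lemma uniform_bounds:
 "\<exists>K\<ge>0. \<forall>X t Y s. approximant m \<tau> X t Y \<and> - S <= s --> dressing.BQ X (sg X) s <= K \<and>
  abs (approximant.eA m \<tau> X t Y s) <= K/X \<and> (\<forall>i\<le>2*m. abs (approximant.gA m \<tau> X t Y i s) <= K)"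
proof -
 obtain O0 where O: "O0 >= 0" "\<And>s. s >= - S ==> Om 0 s <= O0" using Om_bounded[of S 0] by blast
 define B where "B = qb (- S)*O0"
 define K0 where "K0 = O0 + 2 * sqrt (O0*B) + B"
 define C where "C = (5*exp 1 + 4*real m + 4)*BB"
 define K where "K = B + 2*C*K0 + 2*exp 1*EE*K0"
 have B0: "B >= 0" using O qb_nonneg by (simp add: B_def)
 have K00: "K0 >= 0" using O B0 by (simp add: K0_def)
 have C0: "C >= 0" using BB(1) by (simp add: C_def)
 have K: "B <= K" "2*C*K0 <= K" "2*exp 1*EE*K0 <= K" "K >= 0" using B0 K00 C0 EE_pos by (simp_all add: K_def)
 show ?thesis
 proof (intro exI[of _ K] conjI K(4) allI impI; (elim conjE)?)
  fix X t Y s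
  assume "approximant m \<tau> X t Y" and s: "- S <= s"
  then interpret approximant m \<tau> X t Y by simp
  have Os: "Om i s <= O0" for i using Om_antimono[of 0 i s] O(2)[OF s] by simp
  have "BQ s <= qb (- S)*Om 1 s" by (rule BQ_qb[OF s])
  also have "... <= B" unfolding B_def using Os qb_nonneg by (intro mult_left_mono)
  finally have BQ: "BQ s <= B" .
  thus "BQ s <= K" using K(1) by linarith
  have k: "Om i s + 2 * sqrt (Om j s*BQ s) + BQ s <= K0" for i j
   unfolding K0_def using Os BQ Om_nonneg BQ_nonneg B0 O(1) by (intro add_mono mult_left_mono real_sqrt_le_mono mult_mono) auto
  have Xp: "X > 0" using X1 by simp
  have "abs (eA s) <= 2*(CC/X*(Om 0 s + 2 * sqrt (Om 1 s*BQ s) + BQ s))" by (rule eA_bound)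
  also have "... <= 2*(CC/X*K0)" using C0 Xp by (intro mult_left_mono k) (auto simp: CC_def C_def)
  also have "... = 2*C*K0/X" by (simp add: CC_def C_def)
  also have "... <= K/X" using K(2) Xp by (intro divide_right_mono) auto
  finally show "abs (eA s) <= K/X" .
  fix i assume "i <= 2*m"
  hence "abs (gA i s) <= 2*exp 1*EE*(Om i s + 2 * sqrt (Om (2*i + 1) s*BQ s) + BQ s)" by (rule gA_bound)
  also have "... <= 2*exp 1*EE*K0" using EE_pos by (intro mult_left_mono k) auto
  finally show "abs (gA i s) <= K" using K(3) by linarith
 qed
qed

text \<open>The exponents: \<open>Om (2*i + 1)\<close> has order \<open>- (2*i + 3/2)\<close> and
  \<open>BQ\<close> order \<open>- 3/2\<close>, so the root of their product has order
  \<open>- (i + 3/2)\<close>; the quadratic term is \<open>BQ\<close> times a further factor of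
  order \<open>- i\<close>.\<close>

lemma uniform_decay:
 assumes i: "i <= 2*m"
 shows "\<exists>C\<ge>0. \<forall>X t Y s. approximant m \<tau> X t Y \<and> 1 <= s -->
  abs (approximant.gA m \<tau> X t Y i s - integral {-Y..X} (%x. (airy (s + x))^2*approximant.wf m \<tau> X t i x)) <= C * s powr (- (real i + 3/2))"
proof -
 obtain C1 where C1: "C1 > 0" "\<And>s. s >= 1 ==> Om 1 s <= C1 * s powr (- (real 1 + 1/2))" using Om_decay[of 1] by blast
 obtain C2 where C2: "C2 > 0" "\<And>s. s >= 1 ==> Om (2*i + 1) s <= C2 * s powr (- (real (2*i + 1) + 1/2))" using Om_decay[of "2*i + 1"] by blast
 define q where "q = qb 1*C1"
 have q0: "q >= 0" using C1 qb_nonneg by (simp add: q_def)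
 define D where "D = 2^(i + 1) + AB^2*(real (i + 1))^(i + 1)*abs I1"
 have D0: "D >= 0" by (simp add: D_def)
 define C where "C = 2*exp 1*EE*(2 * sqrt (C2*q) + q*D)"
 have "abs (approximant.gA m \<tau> X t Y i s - integral {-Y..X} (%x. (airy (s + x))^2*approximant.wf m \<tau> X t i x)) <= C * s powr (- (real i + 3/2))"
  if "approximant m \<tau> X t Y" and s: "1 <= s" for X t Y s
 proof -
  interpret approximant m \<tau> X t Y by fact
  let ?p = "s powr (- (real i + 3/2))"
  have "BQ s <= qb 1*Om 1 s" by (rule BQ_qb[OF s])
  also have "... <= qb 1*(C1 * s powr (- (real 1 + 1/2)))" using C1(2)[OF s] qb_nonneg by (intro mult_left_mono)
  finally have BQ: "BQ s <= q * s powr (- (3/2))" by (simp add: q_def mult.assoc)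
  have "Om (2*i + 1) s*BQ s <= (C2 * s powr (- (real (2*i + 1) + 1/2)))*(q * s powr (- (3/2)))"
   using C2(2)[OF s] BQ Om_nonneg BQ_nonneg C2(1) by (intro mult_mono) auto
  also have "... = (C2*q)*(s powr (- (real (2*i + 1) + 1/2)) * s powr (- (3/2)))" by (simp only: mult_ac)
  also have "s powr (- (real (2*i + 1) + 1/2)) * s powr (- (3/2)) = ?p*?p" unfolding powr_add[symmetric] by (simp add: algebra_simps)
  finally have "sqrt (Om (2*i + 1) s*BQ s) <= sqrt ((C2*q)*(?p*?p))" by simp
  also have "... = sqrt (C2*q)*?p" by (simp add: real_sqrt_mult)
  finally have 1: "sqrt (Om (2*i + 1) s*BQ s) <= sqrt (C2*q)*?p" .
  have si: "1 / s^i = s powr (- real i)" using s by (simp add: powr_minus powr_realpow divide_inverse)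
  have sii: "1 / s^(i + 1) <= 1 / s^i" using s by (intro divide_left_mono power_increasing) auto
  have "(s/2)^(i + 1) <= (1 + s/2)^(i + 1)" using s by (intro power_mono) auto
  hence "1/(1 + s/2)^(i + 1) <= 1/(s/2)^(i + 1)" using s by (intro divide_left_mono) auto
  also have "... = 2^(i + 1)*(1 / s^(i + 1))" by (simp add: power_divide)
  also have "... <= 2^(i + 1)*(1 / s^i)" by (intro mult_left_mono sii) auto
  finally have a: "1/(1 + s/2)^(i + 1) <= 2^(i + 1)*(1 / s^i)" .
  have e: "exp (- s) <= (real (i + 1))^(i + 1)*(1 / s^i)"
  proof -
   have "(s/real (i + 1))^(i + 1) <= (1 + s/real (i + 1))^(i + 1)" using s by (intro power_mono) auto
   also have "... <= exp s" using s by (intro exp_ge_one_plus_x_over_n_power_n) auto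
   finally have "inverse (exp s) <= inverse ((s/real (i + 1))^(i + 1))" using s by (intro le_imp_inverse_le) auto
   also have "... = (real (i + 1))^(i + 1)*(1 / s^(i + 1))" by (simp only: power_divide inverse_divide) simp
   also have "... <= (real (i + 1))^(i + 1)*(1 / s^i)" by (intro mult_left_mono sii) auto
   finally show ?thesis by (simp add: exp_minus)
  qed
  have "AB^2*exp (- s)*I1 <= AB^2*((real (i + 1))^(i + 1)*(1 / s^i))*abs I1"
   using e s by (intro order_trans[OF mult_left_mono[OF abs_ge_self] mult_right_mono] mult_left_mono) auto
  hence "1/(1 + s/2)^(i + 1) + AB^2*exp (- s)*I1 <= D*(1 / s^i)"
   unfolding D_def distrib_right using a by (simp add: mult_ac)
  hence "BQ s*(1/(1 + s/2)^(i + 1) + AB^2*exp (- s)*I1) <= BQ s*(D*(1 / s^i))" using BQ_nonneg by (rule mult_left_mono)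
  also have "... <= (q * s powr (- (3/2)))*(D*(1 / s^i))" using BQ D0 s by (intro mult_right_mono) auto
  also have "... = q*D*?p" unfolding si using powr_add[of s "- (3/2)" "- real i"] by (simp add: mult_ac add.commute)
  finally have 2: "BQ s*(1/(1 + s/2)^(i + 1) + AB^2*exp (- s)*I1) <= q*D*?p" .
  have "abs (gA i s - integral {-Y..X} (%x. (airy (s + x))^2*wf i x))
   <= 2*exp 1*EE*(2 * sqrt (Om (2*i + 1) s*BQ s) + BQ s*(1/(1 + s/2)^(i + 1) + AB^2*exp (- s)*I1))" by (rule gA_airy[OF i s])
  also have "... <= 2*exp 1*EE*(2*(sqrt (C2*q)*?p) + q*D*?p)" using 1 2 EE_pos by (intro mult_left_mono add_mono) auto
  also have "... = C*?p" by (simp add: C_def algebra_simps)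
  finally show ?thesis .
 qed
 moreover have "C >= 0" using EE_pos C2(1) q0 D0 by (simp add: C_def)
 ultimately show ?thesis by blast
qed

lemma airy_limit:
 assumes A: "\<And>n. approximant m \<tau> (X n) (t n) (Y n)" and X: "filterlim X at_top sequentially" and i: "i <= 2*m"
 shows "(%n. integral {- Y n..X n} (%x. (airy (s + x))^2*approximant.wf m \<tau> (X n) (t n) i x)) \<longlonglongrightarrow> Lw i s"
proof -
 let ?w = "%n. approximant.wf m \<tau> (X n) (t n) i"
 have a: "X n >= 1" "0 < t n" "t n <= 1/X n" "X n <= Y n" for n
  using A[of n] unfolding approximant_def approximant_axioms_def by auto
 have t0: "t \<longlonglongrightarrow> 0"
 proof (rule Lim_null_comparison)
  show "eventually (%n. norm (t n) <= 1/X n) sequentially" using a by (auto simp: less_imp_le abs_of_pos)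
  show "(%n. 1/X n) \<longlonglongrightarrow> 0" by (intro real_tendsto_divide_at_top[OF tendsto_const X])
 qed
 have wc: "continuous_on S (?w n)" for S n by (rule approximant.wf_cont[OF A i])
 have [measurable]: "?w n \<in> borel_measurable borel" for n by (intro borel_measurable_continuous_onI wc)
 have e: "integral {- Y n..X n} (%x. (airy (s + x))^2*?w n x) = (LINT x|lborel. indicator {- Y n..X n} x*((airy (s + x))^2*?w n x))" for n
  by (subst integral_eq_lborel) (auto intro!: continuous_intros wc simp: LINT_def)
 show ?thesis unfolding e Lw_def
 proof (rule integral_dominated_convergence[where w = "%x. 2*exp 1*EE*((airy (s + x))^2*wt i x)"])
  show "(%x. (airy (s + x))^2*(- 2*hh x*inverse x^(i + 1))) \<in> borel_measurable lborel" by measurable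
  show "(%x. indicator {- Y n..X n} x*((airy (s + x))^2*?w n x)) \<in> borel_measurable lborel" for n by measurable
  show "integrable lborel (%x. 2*exp 1*EE*((airy (s + x))^2*wt i x))" using Om_integrable by simp
  show "AE x in lborel. norm (indicator {- Y n..X n} x*((airy (s + x))^2*?w n x)) <= 2*exp 1*EE*((airy (s + x))^2*wt i x)" for n
  proof (rule AE_I2)
   fix x
   show "norm (indicator {- Y n..X n} x*((airy (s + x))^2*?w n x)) <= 2*exp 1*EE*((airy (s + x))^2*wt i x)"
   proof (cases "x \<in> {- Y n..X n}")
    case True
    hence "abs (?w n x) <= 2*exp 1*EE*wt i x" using approximant.wf_bound[OF A i, of x] by simp
    from mult_left_mono[OF this, of "(airy (s + x))^2"] show ?thesis using True by (simp add: abs_mult mult_ac)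
   next
    case False
    thus ?thesis using EE_pos less_imp_le[OF wt_pos] by simp
   qed
  qed
  show "AE x in lborel. (%n. indicator {- Y n..X n} x*((airy (s + x))^2*?w n x)) \<longlonglongrightarrow> (airy (s + x))^2*(- 2*hh x*inverse x^(i + 1))"
  proof (rule AE_I2)
   fix x :: real
   have "(%n. cut (X n) x) \<longlonglongrightarrow> 1"
   proof (rule real_tendsto_sandwich)
    show "eventually (%n. 1 - 2*(abs x/X n) <= cut (X n) x) sequentially"
    proof (rule always_eventually, rule allI)
     fix n show "1 - 2*(abs x/X n) <= cut (X n) x" using cut_near[of "X n" 1 x] a(1)[of n] by simp
    qed
    show "eventually (%n. cut (X n) x <= 1) sequentially" using cut_range by simp
    have "(%n. 1 - 2*(abs x/X n)) \<longlonglongrightarrow> 1 - 2*0" by (intro tendsto_intros real_tendsto_divide_at_top[OF tendsto_const X])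
    thus "(%n. 1 - 2*(abs x/X n)) \<longlonglongrightarrow> 1" by simp
   qed simp
   hence "(%n. - 2*(1 + sg (X n) x)*exp (t n*x)*inverse x^(i + 1)) \<longlonglongrightarrow> - 2*(1 + 1*(hh x - 1))*exp (0*x)*inverse x^(i + 1)"
    unfolding sg_def by (intro tendsto_intros t0)
   hence w: "(%n. ?w n x) \<longlonglongrightarrow> - 2*hh x*inverse x^(i + 1)"
    unfolding approximant.wf_def[OF A] by simp
   have "(%n. (airy (s + x))^2*?w n x) \<longlonglongrightarrow> (airy (s + x))^2*(- 2*hh x*inverse x^(i + 1))" by (intro tendsto_intros w)
   moreover have "eventually (%n. (airy (s + x))^2*?w n x = indicator {- Y n..X n} x*((airy (s + x))^2*?w n x)) sequentially"
   proof (rule eventually_mono)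
    show "eventually (%n. abs x <= X n) sequentially" using X by (simp add: filterlim_at_top)
    fix n assume "abs x <= X n"
    hence "x \<in> {- Y n..X n}" using a(4)[of n] by auto
    thus "(airy (s + x))^2*?w n x = indicator {- Y n..X n} x*((airy (s + x))^2*?w n x)" by simp
   qed
   ultimately show "(%n. indicator {- Y n..X n} x*((airy (s + x))^2*?w n x)) \<longlonglongrightarrow> (airy (s + x))^2*(- 2*hh x*inverse x^(i + 1))"
    by (rule Lim_transform_eventually)
  qed
 qed
qed

end

text \<open>All that the limit process needs: approximate differential equations, locally uniform
  bounds of the values, and decay. The Airy function and the integral operators no longer
  appear.\<close>

locale approximating = tau_data +
 fixes g h R :: "nat => nat => real => real" and u e f :: "nat => real => real"
 assumes dg: "\<And>n i s. i <= 2*m ==> DERIV (g n i) s :> h n i s"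
  and dh: "\<And>n i s. i <= 2*m ==> DERIV (h n i) s :> 2*u n s*g n i s + 4*(if i = 0 then f n s else g n (i - 1) s) + R n i s"
  and dR: "\<And>n i s. i <= 2*m ==> DERIV (R n i) s :> 2*u n s*h n i s"
  and u_eq: "\<And>n s. u n s = s + 2*(\<Sum>j=1..2*m. real j*\<tau> j*g n j s) + e n s"
  and bd: "\<And>S. \<exists>K\<ge>0. \<forall>n. \<forall>s\<ge>-S. abs (e n s) <= K/real (n + 1) \<and> (\<forall>i\<le>2*m. abs (g n i s) <= K)"
  and f_small: "\<And>n s. s \<in> {- real n..real n} ==> abs (f n s) <= 4/real (n + 1)"
  and dec: "\<And>i. i <= 2*m ==> \<exists>C\<ge>0. \<forall>s\<ge>1. \<forall>q>0. eventually (%n. abs (g n i s - tgt i s) <= C * s powr (- tgt_exp i) + q) sequentially"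

context tau_data
begin

text \<open>The bound of \<open>BQ\<close> does not depend on the cut-off, so the radius can be
  chosen after it, large enough to beat the constant in the tail estimate of
  \<open>J_almost_constant\<close>; only then are \<open>t\<close> and \<open>Y\<close>
  chosen.\<close>

lemma approximants: "\<exists>g h R u e f. approximating m \<tau> g h R u e f"
proof -
 have "\<exists>X t Y. approximant m \<tau> X t Y \<and> X >= real n + 1 \<and> (\<forall>s\<in>{- real n..real n}. abs (approximant.fA m \<tau> X t Y s) <= 4/real (n + 1))" for n
 proof -
  obtain B0 where B0: "B0 >= 0" "\<And>X t Y s. approximant m \<tau> X t Y ==> - real n <= s ==> dressing.BQ X (sg X) s <= B0"
   using uniform_bounds[of "real n"] by blast
  define c where "c = 2*AB^2*(1 + B0)*exp (2*real n)*dressing.I2"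
  have "((%X. c*exp (- (X/2))) \<longlongrightarrow> c*0) at_top"
  proof (intro tendsto_mult tendsto_const filterlim_compose[OF exp_at_bot])
   have "filterlim (%X::real. X*(1/2)) at_top at_top"
    using filterlim_tendsto_pos_mult_at_top[OF tendsto_const[of "1/2::real"] _ filterlim_ident] by (simp add: mult.commute)
   thus "filterlim (%X::real. - (X/2)) at_bot at_top" by (simp add: filterlim_uminus_at_top)
  qed
  hence "eventually (%X. c*exp (- (X/2)) < 1/real (n + 1)) at_top"
   by (intro order_tendstoD(2)) auto
  hence "eventually (%X. c*exp (- (X/2)) < 1/real (n + 1) \<and> X >= real n + 1) at_top"
   using eventually_ge_at_top by (rule eventually_conj)
  then obtain X where X: "c*exp (- (X/2)) < 1/real (n + 1)" "X >= real n + 1"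
   using eventually_happens'[OF trivial_limit_at_top_linorder] by blast
  have X1: "X >= 1" "1/X > 0" using X(2) by auto
  interpret d: dressing X "sg X" "sg' X" by (rule dressing_sg) (use X1 in simp)
  have bq: "d.BQ s <= B0" if "s \<in> {- real n..real n}" for s
  proof (rule B0(2))
   \<comment> \<open>\<open>BQ\<close> involves neither \<open>t\<close> nor \<open>Y\<close>, so
     any admissible values give access to the uniform bound.\<close>
   show "approximant m \<tau> X (1/X) X" using X1 by unfold_locales auto
  qed (use that in auto)
  obtain t Y where t: "0 < t" "t < 1/X" and Y: "X <= Y"
   and J: "\<And>s. s \<in> {- real n..real n} ==> abs (d.mom (-Y) X (%x. (1 + sg X x)*exp (t*x)) s - gauss_kernel t 0 0)
    <= 1/real (n + 1) + 2*AB^2*(1 + B0)*exp (2*real n)*exp (- X/2)*dressing.I2"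
   using d.J_almost_constant[of "real n" "1/real (n + 1)" B0 "1/X"] bq X1 by auto
  interpret approximant m \<tau> X t Y using X1 t Y by unfold_locales auto
  have "abs (fA s) <= 4/real (n + 1)" if "s \<in> {- real n..real n}" for s
  proof -
   have "abs (fA s) = 2*abs (d.mom (-Y) X (%x. (1 + sg X x)*exp (t*x)) s - gauss_kernel t 0 0)" 
   proof -
    have "abs (- 2*a + 2*b) = 2*abs (a - b)" for a b :: real by (simp add: abs_if)
    thus ?thesis unfolding fA_def JA_def .
   qed
   also have "... <= 2*(1/real (n + 1) + c*exp (- (X/2)))" using J[OF that] by (simp add: c_def mult_ac)
   also have "... <= 4/real (n + 1)" using X(1) by simp
   finally show ?thesis .
  qed
  thus ?thesis using X(2) approximant_axioms by blast
 qed
 then obtain X t Y where A: "\<And>n. approximant m \<tau> (X n) (t n) (Y n)" and X: "\<And>n. X n >= real n + 1"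
  and f: "\<And>n s. s \<in> {- real n..real n} ==> abs (approximant.fA m \<tau> (X n) (t n) (Y n) s) <= 4/real (n + 1)"
  by metis
 have Xlim: "filterlim X at_top sequentially"
  by (rule filterlim_at_top_mono[OF filterlim_real_sequentially]) (use X in \<open>auto intro!: always_eventually order_trans[OF _ X]\<close>)
 have "approximating m \<tau> (%n. approximant.gA m \<tau> (X n) (t n) (Y n)) (%n. approximant.hA m \<tau> (X n) (t n) (Y n))
  (%n. approximant.RA m \<tau> (X n) (t n) (Y n)) (%n. dressing.u (X n) (sg (X n)))
  (%n. approximant.eA m \<tau> (X n) (t n) (Y n)) (%n. approximant.fA m \<tau> (X n) (t n) (Y n))"
 proof
  show "dressing.u (X n) (sg (X n)) s = s + 2*(\<Sum>j=1..2*m. real j*\<tau> j*approximant.gA m \<tau> (X n) (t n) (Y n) j s) + approximant.eA m \<tau> (X n) (t n) (Y n) s" for n s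
   unfolding approximant.eA_def[OF A] by simp
  show "\<exists>K\<ge>0. \<forall>n. \<forall>s\<ge>-S. abs (approximant.eA m \<tau> (X n) (t n) (Y n) s) <= K/real (n + 1) \<and> (\<forall>i\<le>2*m. abs (approximant.gA m \<tau> (X n) (t n) (Y n) i s) <= K)" for S
  proof -
   obtain K where K: "K >= 0" "\<And>n s. - S <= s ==> abs (approximant.eA m \<tau> (X n) (t n) (Y n) s) <= K/X n"
    "\<And>n s i. - S <= s ==> i <= 2*m ==> abs (approximant.gA m \<tau> (X n) (t n) (Y n) i s) <= K"
    using uniform_bounds[of S] A by blast
   have "K/X n <= K/real (n + 1)" for n using K(1) X[of n] by (intro divide_left_mono) auto
   thus ?thesis using K by (meson order_trans)
  qed
  show "\<exists>C\<ge>0. \<forall>s\<ge>1. \<forall>q>0. eventually (%n. abs (approximant.gA m \<tau> (X n) (t n) (Y n) i s - tgt i s) <= C * s powr (- tgt_exp i) + q) sequentially" if i: "i <= 2*m" for i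
  proof -
   obtain C1 where C1: "C1 >= 0" "\<And>s. s >= 1 ==> abs (Lw i s - tgt i s) <= C1 * s powr (- tgt_exp i)" using Lw_asymp[OF i] by blast
   obtain C2 where C2: "C2 >= 0" "\<And>n s. 1 <= s ==> abs (approximant.gA m \<tau> (X n) (t n) (Y n) i s - integral {- Y n..X n} (%x. (airy (s + x))^2*approximant.wf m \<tau> (X n) (t n) i x)) <= C2 * s powr (- (real i + 3/2))"
    using uniform_decay[OF i] A by blast
   have "eventually (%n. abs (approximant.gA m \<tau> (X n) (t n) (Y n) i s - tgt i s) <= (C1 + C2) * s powr (- tgt_exp i) + q) sequentially" if s: "s >= 1" and q: "q > 0" for s q
   proof -
    have "s powr (- (real i + 3/2)) <= s powr (- tgt_exp i)" using s by (intro powr_mono) (auto simp: tgt_exp_def)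
    hence c2: "C2 * s powr (- (real i + 3/2)) <= C2 * s powr (- tgt_exp i)" using C2(1) by (rule mult_left_mono)
    have "eventually (%n. dist (integral {- Y n..X n} (%x. (airy (s + x))^2*approximant.wf m \<tau> (X n) (t n) i x)) (Lw i s) < q) sequentially"
     by (rule tendstoD[OF airy_limit[OF A Xlim i] q])
    thus ?thesis
    proof (rule eventually_mono)
     fix n assume "dist (integral {- Y n..X n} (%x. (airy (s + x))^2*approximant.wf m \<tau> (X n) (t n) i x)) (Lw i s) < q"
     thus "abs (approximant.gA m \<tau> (X n) (t n) (Y n) i s - tgt i s) <= (C1 + C2) * s powr (- tgt_exp i) + q"
      using C2(2)[OF s, of n] C1(2)[OF s] c2 unfolding dist_real_def distrib_right by linarith
    qed
   qed
   thus ?thesis using C1(1) C2(1) by (intro exI[of _ "C1 + C2"]) auto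
  qed
 qed (rule approximant.approx_ode[OF A] f; assumption)+
 thus ?thesis by blast
qed

end

section \<open>Removal of the cut-off\<close>

lemma abs_diff_le_deriv:
 fixes f :: "real => real"
 assumes "\<And>x. x \<in> {a..b} ==> DERIV f x :> f' x" "\<And>x. x \<in> {a..b} ==> abs (f' x) <= B"
  and "x \<in> {a..b}" "y \<in> {a..b}"
 shows "abs (f x - f y) <= B*abs (x - y)"
 using field_differentiable_bound[of "{a..b}" f f' B x y] assms by (auto intro: has_field_derivative_at_within)

text \<open>Interpolation of \<open>h = g'\<close> and \<open>h'\<close> from the oscillation of \<open>g\<close>, where the derivative of \<open>R\<close> is only known
 to be controlled by \<open>h\<close> itself: on a short interval the resulting bound can be absorbed.\<close>

lemma derivative_interpolation:
 fixes g h R p q :: "real => real"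
 assumes j: "j > 0" and g: "\<And>x. x \<in> {a..a+j} ==> DERIV g x :> h x"
  and h: "\<And>x. x \<in> {a..a+j} ==> DERIV h x :> p x + R x"
  and R: "\<And>x. x \<in> {a..a+j} ==> DERIV R x :> q x"
  and G: "\<And>x. x \<in> {a..a+j} ==> abs (g x - g0) <= G"
  and P: "\<And>x. x \<in> {a..a+j} ==> abs (p x - p0) <= P"
  and U: "\<And>x. x \<in> {a..a+j} ==> abs (q x) <= U*abs (h x)" "U >= 0" "4*U*j^2 <= 1"
  and x: "x \<in> {a..a+j}"
 shows "abs (h x) <= 84*G/j + 4*P*j"
  "abs (p x + R x) <= 36*G/j^2 + 2*(P + U*j*(84*G/j + 4*P*j))"
proof -
 let ?J = "{a..a+j}"
 have "continuous_on ?J (%x. abs (h x))"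
  using h by (intro continuous_intros continuous_at_imp_continuous_on ballI DERIV_isCont)
 then obtain x0 where x0: "x0 \<in> ?J" "\<And>x. x \<in> ?J ==> abs (h x) <= abs (h x0)"
  using continuous_attains_sup[of ?J "%x. abs (h x)"] j by auto
 define M where "M = abs (h x0)"
 define K where "K = P + U*M*j"
 \<comment> \<open>A reference value for the derivative of \<open>h\<close>. Its deviation from it
   is at most \<open>K\<close>: the oscillation of \<open>p\<close> plus that of \<open>R\<close>,
   the latter bounded through the still unknown maximum \<open>M\<close> of
   \<open>h\<close>.\<close>
 define c where "c = p0 + R a"
 have M: "abs (h x) <= M" if "x \<in> ?J" for x using x0(2)[OF that] by (simp add: M_def)
 have c: "abs (p x + R x - c) <= K" if "x \<in> ?J" for x
 proof -
  have "abs (R x - R a) <= U*M*abs (x - a)"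
  proof (rule abs_diff_le_deriv[of a "a+j" R q])
   show "abs (q y) <= U*M" if "y \<in> ?J" for y using U(1)[OF that] mult_left_mono[OF M[OF that] U(2)] by linarith
  qed (use R that j in auto)
  also have "... <= U*M*j" using that U(2) by (intro mult_left_mono) (auto simp: M_def)
  finally show ?thesis using P[OF that] unfolding K_def c_def by linarith
 qed
 have mv: "\<exists>w. a + l < w \<and> w < a + l + j/3 \<and> abs (h w) <= 6*G/j" if l: "0 <= l" "l <= 2*j/3" for l
 proof -
  have "\<exists>w. a + l < w \<and> w < a + l + j/3 \<and> g (a + l + j/3) - g (a + l) = (a + l + j/3 - (a + l))*h w"
   by (rule MVT2) (use j l in \<open>auto intro!: g\<close>)
  then obtain w where w: "a + l < w" "w < a + l + j/3" "g (a + l + j/3) - g (a + l) = j/3*h w" by auto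
  have "abs (g (a + l + j/3) - g (a + l)) <= 2*G" using G[of "a + l + j/3"] G[of "a + l"] j l by force
  hence "j/3*abs (h w) <= 2*G" unfolding w(3) using j by (simp add: abs_mult)
  hence "abs (h w) <= 6*G/j" using j by (simp add: field_simps)
  thus ?thesis using w by blast
 qed
 \<comment> \<open>Points in the outer thirds where \<open>h\<close> is of size \<open>G/j\<close>.
   Their distance is at least \<open>j/3\<close>, so a further mean value yields a point where the
   derivative of \<open>h\<close> is of size \<open>G/j^2\<close>.\<close>
 obtain w1 where w1: "a < w1" "w1 < a + j/3" "abs (h w1) <= 6*G/j" using mv[of 0] j by auto
 obtain w2 where w2: "a + 2*j/3 < w2" "w2 < a + j" "abs (h w2) <= 6*G/j" using mv[of "2*j/3"] j by auto
 have "\<exists>z. w1 < z \<and> z < w2 \<and> h w2 - h w1 = (w2 - w1)*(p z + R z)"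
  by (rule MVT2) (use j w1 w2 in \<open>auto intro!: h\<close>)
 then obtain z where z: "w1 < z" "z < w2" "h w2 - h w1 = (w2 - w1)*(p z + R z)" by blast
 have zJ: "z \<in> ?J" using z w1 w2 by auto
 have d: "w2 - w1 >= j/3" using w1 w2 by simp
 have "j/3*abs (p z + R z) <= (w2 - w1)*abs (p z + R z)" using d by (rule mult_right_mono) simp
 also have "... = abs (h w2 - h w1)" using d j unfolding z(3) by (simp add: abs_mult)
 also have "... <= 12*G/j" using w1(3) w2(3) by simp
 finally have "abs (p z + R z) <= 36*G/j^2" using j by (simp add: field_simps power2_eq_square)
 hence h': "abs (p x + R x) <= 36*G/j^2 + 2*K" if "x \<in> ?J" for x
  using c[OF zJ] c[OF that] by linarith
 have hx: "abs (h x) <= 42*G/j + 2*K*j" if xJ: "x \<in> ?J" for x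
 proof -
  have "abs (h x - h w1) <= (36*G/j^2 + 2*K)*abs (x - w1)"
   by (rule abs_diff_le_deriv[of a "a+j" h "%x. p x + R x"]) (use h h' xJ w1 j in auto)
  also have "... <= (36*G/j^2 + 2*K)*j"
   using h'[OF xJ] xJ w1 j by (intro mult_left_mono) (auto intro: order_trans[OF abs_ge_zero])
  also have "... = 36*G/j + 2*K*j" using j by (simp add: field_simps power2_eq_square)
  finally show ?thesis using w1(3) by simp
 qed
 have "M <= 42*G/j + 2*K*j" unfolding M_def by (rule hx[OF x0(1)])
 also have "... = 42*G/j + 2*P*j + (4*U*j^2)*(M/2)" by (simp add: K_def power2_eq_square algebra_simps)
 also have "(4*U*j^2)*(M/2) <= 1*(M/2)" using U(3) by (rule mult_right_mono) (simp add: M_def)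
 finally have Mb: "M <= 84*G/j + 4*P*j" by simp
 thus "abs (h x) <= 84*G/j + 4*P*j" using M[OF x] by linarith
 have "K <= P + U*j*(84*G/j + 4*P*j)"
  using mult_left_mono[OF Mb, of "U*j"] U(2) j unfolding K_def by (simp add: mult_ac)
 from order_trans[OF h'[OF x] add_left_mono[OF mult_left_mono[OF this zero_le_numeral]]]
 show "abs (p x + R x) <= 36*G/j^2 + 2*(P + U*j*(84*G/j + 4*P*j))" .
qed

text \<open>Arzela-Ascoli for a countable family at once: a diagonal subsequence converges at all
  rational points, and the Lipschitz bounds carry the convergence over to the real points.\<close>

lemma Lipschitz_subsequence:
 fixes y :: "nat => 'k::countable => real => real"
 assumes B: "\<And>S. S >= 0 ==> \<exists>B\<ge>0. \<exists>N. \<forall>n\<ge>N. \<forall>k. \<forall>s\<in>{-S..S}. abs (y n k s) <= B \<and> (\<forall>s'\<in>{-S..S}. abs (y n k s - y n k s') <= B*abs (s - s'))"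
 obtains q Y where "strict_mono (q :: nat => nat)" "\<And>k s. (%n. y (q n) k s) \<longlonglongrightarrow> Y k s" "\<And>k. continuous_on UNIV (Y k)"
proof -
 obtain B N where BN: "\<And>S. S >= 0 ==> B S >= 0" "\<And>S n k s. S >= 0 ==> n >= N S ==> s \<in> {-S..S} ==> abs (y n k s) <= B S"
  "\<And>S n k s s'. S >= 0 ==> n >= N S ==> s \<in> {-S..S} ==> s' \<in> {-S..S} ==> abs (y n k s - y n k s') <= B S*abs (s - s')"
  using B by metis
 \<comment> \<open>Since the bounds hold only from an index depending on the interval, earlier terms
   are replaced by 0; the division provides the common bound 1 for the diagonal selection.\<close>
 define F where "F = (%n (k, r :: rat). let s = of_rat r :: real in if n >= N (abs s) then y n k s/(B (abs s) + 1) else 0)"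
 have nF: "norm (F n z) <= 1" for n z
 proof (cases z)
  case (Pair k r)
  define s where "s = (of_rat r :: real)"
  have F: "F n z = (if n >= N (abs s) then y n k s/(B (abs s) + 1) else 0)" by (simp add: F_def Pair Let_def s_def)
  have B0: "B (abs s) >= 0" by (rule BN(1)) simp
  have "abs (y n k s) <= B (abs s)" if "n >= N (abs s)" by (rule BN(2)[OF abs_ge_zero that]) auto
  thus ?thesis unfolding F using B0 by (auto simp: abs_of_nonneg divide_le_eq)
 qed
 have "\<exists>q. strict_mono q \<and> (\<forall>z. \<exists>l. (%n. F (q n) z) \<longlonglongrightarrow> l)"
  by (rule function_convergent_subsequence[of "UNIV :: ('k \<times> rat) set" F 1]) (simp, rule nF, blast)
 then obtain q where q: "strict_mono q" "\<And>z. \<exists>l. (%n. F (q n) z) \<longlonglongrightarrow> l" by blast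
 have ge: "q n >= n" for n using q(1) by (rule strict_mono_imp_increasing)
 have rat: "convergent (%n. y (q n) k (of_rat r))" for k r
 proof -
  let ?s = "of_rat r :: real"
  obtain l where "(%n. F (q n) (k, r)) \<longlonglongrightarrow> l" using q(2) by blast
  hence "(%n. (B (abs ?s) + 1)*F (q n) (k, r)) \<longlonglongrightarrow> (B (abs ?s) + 1)*l" by (intro tendsto_intros)
  moreover have "eventually (%n. (B (abs ?s) + 1)*F (q n) (k, r) = y (q n) k ?s) sequentially"
   using eventually_ge_at_top[of "N (abs ?s)"]
  proof eventually_elim
   case (elim n)
   thus ?case using ge[of n] BN(1)[of "abs ?s"] by (simp add: F_def Let_def)
  qed
  ultimately show ?thesis unfolding convergent_def by (blast intro: Lim_transform_eventually)
 qed
 have conv: "convergent (%n. y (q n) k s)" for k s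
  unfolding Cauchy_convergent_iff[symmetric]
 proof (rule metric_CauchyI)
  fix e :: real assume e: "e > 0"
  define S where "S = abs s + 1"
  have S: "S >= 0" by (simp add: S_def)
  define p where "p = min 1 (e/3/(B S + 1))"
  have p: "p > 0" "p <= 1" "p <= e/3/(B S + 1)" using e BN(1)[OF S] by (auto simp: p_def)
  obtain r where r: "s < of_rat r" "of_rat r < s + p" using of_rat_dense[of s "s + p"] p by auto
  let ?r = "of_rat r :: real"
  have rS: "?r \<in> {-S..S}" "s \<in> {-S..S}" "abs (s - ?r) <= p" using r p by (auto simp: S_def)
  have "B S*abs (s - ?r) <= (B S + 1)*(e/3/(B S + 1))" using rS(3) p(3) BN(1)[OF S] by (intro mult_mono) auto
  also have "... = e/3"
  proof -
   have c: "c*(e/3/c) = e/3" if "c > 0" for c using that by simp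
   show ?thesis by (rule c) (use BN(1)[OF S] in simp)
  qed
  finally have Bs: "B S*abs (s - ?r) <= e/3" .
  have "Cauchy (%n. y (q n) k ?r)" using rat by (simp add: Cauchy_convergent_iff)
  then obtain M where M: "\<And>i j. i >= M ==> j >= M ==> dist (y (q i) k ?r) (y (q j) k ?r) < e/3"
   using metric_CauchyD[of _ "e/3"] e by (metis divide_pos_pos zero_less_numeral)
  show "\<exists>M. \<forall>i\<ge>M. \<forall>j\<ge>M. dist (y (q i) k s) (y (q j) k s) < e"
  proof (intro exI[of _ "max M (N S)"] allI impI)
   fix i j assume ij: "max M (N S) <= i" "max M (N S) <= j"
   have "q i >= N S" "q j >= N S" using ij ge[of i] ge[of j] by auto
   hence "abs (y (q i) k s - y (q i) k ?r) <= e/3" "abs (y (q j) k s - y (q j) k ?r) <= e/3"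
    using BN(3)[OF S _ rS(2,1)] Bs by (meson order_trans)+
   moreover have "abs (y (q i) k ?r - y (q j) k ?r) < e/3" using M[of i j] ij by (simp add: dist_real_def)
   ultimately show "dist (y (q i) k s) (y (q j) k s) < e" unfolding dist_real_def by linarith
  qed
 qed
 define Y where "Y = (%k s. lim (%n. y (q n) k s))"
 have Y: "(%n. y (q n) k s) \<longlonglongrightarrow> Y k s" for k s using conv by (simp add: Y_def convergent_LIMSEQ_iff)
 have "isCont (Y k) s" for k s
 proof -
  define S where "S = abs s + 1"
  have S: "S >= 0" by (simp add: S_def)
  have L: "abs (Y k x - Y k s) <= B S*abs (x - s)" if "x \<in> {-S..S}" for x
  proof (rule LIMSEQ_le_const2)
   show "(%n. abs (y (q n) k x - y (q n) k s)) \<longlonglongrightarrow> abs (Y k x - Y k s)" by (intro tendsto_intros Y)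
   show "\<exists>M. \<forall>n\<ge>M. abs (y (q n) k x - y (q n) k s) <= B S*abs (x - s)"
   proof (intro exI[of _ "N S"] allI impI)
    fix n assume "N S <= n"
    hence "N S <= q n" using ge[of n] by simp
    thus "abs (y (q n) k x - y (q n) k s) <= B S*abs (x - s)" by (rule BN(3)[OF S _ that]) (auto simp: S_def)
   qed
  qed
  have "(Y k \<longlongrightarrow> Y k s) (at s)"
   by (rule tendsto_linear_bound, rule L) (auto simp: S_def)
  thus ?thesis by (simp add: isCont_def)
 qed
 hence "continuous_on UNIV (Y k)" for k by (intro continuous_at_imp_continuous_on) auto
 with q(1) Y show thesis by (rule that)
qed

text \<open>The integrated relation passes to the limit by dominated convergence, and continuity of
  \<open>D\<close> allows differentiating it again.\<close>

lemma pointwise_limit_derivative: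
 fixes y d :: "nat => real => real"
 assumes y: "\<And>n s. DERIV (y n) s :> d n s"
  and Y: "\<And>s. (%n. y n s) \<longlonglongrightarrow> Y s" and D: "\<And>s. (%n. d n s) \<longlonglongrightarrow> D s"
  and B: "\<And>S. S >= 0 ==> \<exists>B N. \<forall>n\<ge>N. \<forall>s\<in>{-S..S}. abs (d n s) <= B" and Dc: "continuous_on UNIV D"
 shows "DERIV Y s :> D s"
proof -
 define S where "S = abs s + 1"
 have S: "S >= 0" by (simp add: S_def)
 obtain B N where BN: "\<And>n x. n >= N ==> x \<in> {-S..S} ==> abs (d n x) <= B" using B[OF S] by blast
 have I: "Y x - Y (-S) = integral {-S..x} D" if x: "x \<in> {-S..S}" for x
 proof (rule LIMSEQ_unique)
  have hi: "(d n has_integral (y n x - y n (-S))) {-S..x}" for n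
   using x y by (intro fundamental_theorem_of_calculus) (auto intro: has_field_derivative_at_within simp: has_real_derivative_iff_has_vector_derivative[symmetric])
  show "(%n. y (n + N) x - y (n + N) (-S)) \<longlonglongrightarrow> Y x - Y (-S)" by (intro tendsto_diff LIMSEQ_ignore_initial_segment Y)
  have "(%n. integral {-S..x} (d (n + N))) \<longlonglongrightarrow> integral {-S..x} D"
  proof (rule dominated_convergence(2)[of "%n. d (n + N)" _ "%_. B"])
   show "d (n + N) integrable_on {-S..x}" for n using hi by (rule has_integral_integrable)
   show "norm (d (n + N) z) <= B" if "z \<in> {-S..x}" for n z using BN[of "n + N" z] that x by simp
   show "(%n. d (n + N) z) \<longlonglongrightarrow> D z" for z by (intro LIMSEQ_ignore_initial_segment D)
  qed (intro integrable_continuous_real continuous_intros)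
  thus "(%n. y (n + N) x - y (n + N) (-S)) \<longlonglongrightarrow> integral {-S..x} D" unfolding integral_unique[OF hi] .
 qed
 have sS: "s \<in> {-S<..<S}" by (auto simp: S_def)
 have "((%x. integral {-S..x} D) has_real_derivative D s) (at s within {-S..S})"
  using sS by (intro integral_has_real_derivative continuous_on_subset[OF Dc]) auto
 hence "DERIV (%x. integral {-S..x} D) s :> D s"
  using at_within_Icc_at[of "-S" s S] sS by auto
 hence d: "DERIV (%x. Y (-S) + integral {-S..x} D) s :> D s" by (auto intro!: derivative_eq_intros)
 have ev: "eventually (%x. Y (-S) + integral {-S..x} D = Y x) (nhds s)"
  using eventually_nhds_in_open[OF open_greaterThanLessThan sS]
 proof eventually_elim
  case (elim x)
  thus ?case using I[of x] by simp
 qed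
 show ?thesis using d DERIV_cong_ev[OF refl ev refl] by (rule iffD1[rotated])
qed

section \<open>The limit system\<close>

definition (in tau_data) usum :: "(nat => real => real) => real => real" where
 "usum g s = s + 2*(\<Sum>j=1..2*m. real j*\<tau> j*g j s)"

locale PXXXIV_solution = tau_data +
 fixes g h R :: "nat => real => real"
 assumes g_deriv: "\<And>i s. i <= 2*m ==> DERIV (g i) s :> h i s"
  and h_deriv: "\<And>i s. i <= 2*m ==> DERIV (h i) s :> 2*usum g s*g i s + 4*(if i = 0 then 0 else g (i - 1) s) + R i s"
  and R_deriv: "\<And>i s. i <= 2*m ==> DERIV (R i) s :> 2*usum g s*h i s"
  and decay: "\<And>i. i <= 2*m ==> \<exists>C\<ge>0. \<forall>s\<ge>1. abs (g i s - tgt i s) <= C * s powr (- tgt_exp i)"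

lemma (in approximating) limit_system: "\<exists>g h R. PXXXIV_solution m \<tau> g h R"
proof -
 define p where "p = (%n i s. 2*u n s*g n i s + 4*(if i = 0 then f n s else g n (i - 1) s))"
 have bounds: "\<exists>B\<ge>0. \<exists>N. \<forall>n\<ge>N. \<forall>i\<le>2*m. \<forall>s\<in>{-S..S}. abs (g n i s) <= B \<and> abs (h n i s) <= B \<and> abs (R n i s) <= B \<and> abs (p n i s + R n i s) <= B \<and> abs (2*u n s*h n i s) <= B"
  if S: "S >= 0" for S
 proof -
  obtain K where K: "K >= 0" "\<And>n s. s >= - S ==> abs (e n s) <= K/real (n + 1)" "\<And>n s i. s >= - S ==> i <= 2*m ==> abs (g n i s) <= K"
   using bd[of S] by blast
  define U where "U = S + 1 + 2*(\<Sum>j=1..2*m. abs (real j*\<tau> j)*K) + K"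
  have U0: "U >= 0" unfolding U_def using S K(1) by (intro add_nonneg_nonneg mult_nonneg_nonneg sum_nonneg) auto
  have uU: "abs (u n s) <= U" if s: "s \<in> {-S..S+1}" for n s
  proof -
   have "abs (\<Sum>j=1..2*m. real j*\<tau> j*g n j s) <= (\<Sum>j=1..2*m. abs (real j*\<tau> j)*K)"
   proof (rule sum_abs_le)
    fix j assume "j \<in> {1..2*m}"
    hence "abs (g n j s) <= K" using s by (intro K(3)) auto
    thus "abs (real j*\<tau> j*g n j s) <= abs (real j*\<tau> j)*K" unfolding abs_mult[of _ "g n j s"] by (rule mult_left_mono) simp
   qed
   moreover have "abs (e n s) <= K"
   proof -
    have "K/real (n + 1) <= K/1" using K(1) by (intro divide_left_mono) auto
    thus ?thesis using K(2)[of s n] s by simp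
   qed
   moreover have "abs s <= S + 1" using s S by auto
   ultimately show ?thesis unfolding u_eq U_def by linarith
  qed
  define P where "P = 2*U*K + 4*(K + 4)"
  have P0: "P >= 0" using U0 K(1) by (simp add: P_def)
  define N where "N = nat \<lceil>S + 1\<rceil>"
  have pP: "abs (p n i s) <= P" if "n >= N" "i <= 2*m" "s \<in> {-S..S+1}" for n i s
  proof -
   have 1: "abs (2*u n s*g n i s) <= 2*U*K"
    unfolding abs_mult using uU[OF that(3)] K(3)[of s i n] that U0 by (intro mult_mono) auto
   have nS: "real n >= S + 1" using that(1) unfolding N_def by linarith
   have "abs (f n s) <= 4/real (n + 1)" using nS that(3) by (intro f_small) auto
   also have "... <= 4/1" by (intro divide_left_mono) auto
   finally have 2: "abs (f n s) <= 4" by simp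
   have "abs (g n (i - 1) s) <= K" using that by (intro K(3)) auto
   hence 3: "abs (if i = 0 then f n s else g n (i - 1) s) <= K + 4" using 2 K(1) by simp
   have "abs (a + 4*b) <= A + 4*(K + 4)" if "abs a <= A" "abs b <= K + 4" for a b A :: real using that by (auto simp: abs_le_iff)
   from this[OF 1 3] show ?thesis unfolding p_def P_def .
  qed
  \<comment> \<open>A length for which the absorption condition of
    \<open>derivative_interpolation\<close> holds with the coefficient \<open>2*U\<close>; being at
    most 1, it keeps the short intervals inside \<open>{-S..S+1}\<close>.\<close>
  define w where "w = 1/(2*(1 + 2*U))"
  have w: "w > 0" "w <= 1" using U0 by (auto simp: w_def field_simps)
  have Uw: "4*(2*U)*w^2 <= 1"
  proof -
   have "4*(2*U) <= (2*(1 + 2*U))^2" using U0 by (simp add: power2_eq_square algebra_simps)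
   moreover have "0 < (2*(1 + 2*U))^2" using U0 by simp
   ultimately have "4*(2*U)/(2*(1 + 2*U))^2 <= 1" by (simp only: divide_le_eq_1_pos)
   thus ?thesis by (simp only: w_def power_divide power_one times_divide_eq_right mult_1_right)
  qed
  define H where "H = 84*K/w + 4*P*w"
  define H' where "H' = 36*K/w^2 + 2*(P + 2*U*w*H)"
  have H0: "H >= 0" "H' >= 0" using K(1) P0 U0 w by (auto simp: H_def H'_def)
  define B where "B = K + H + (H' + P) + 2*U*H"
  have B: "K <= B" "H <= B" "H' + P <= B" "H' <= B" "2*U*H <= B" "B >= 0" using K(1) H0 U0 P0 by (auto simp: B_def)
  show ?thesis
  proof (intro exI[of _ B] exI[of _ N] conjI B(6) allI ballI impI)
   fix n i s assume n: "N <= n" and i: "i <= 2*m" and s: "s \<in> {-S..S}"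
   have sub: "x \<in> {-S..S+1}" if "x \<in> {s..s+w}" for x using that s w by auto
   have c4: "abs (g n i x - 0) <= K" and c5: "abs (p n i x - 0) <= P" and c6: "abs (2*u n x*h n i x) <= 2*U*abs (h n i x)" if "x \<in> {s..s+w}" for x
   proof -
    show "abs (g n i x - 0) <= K" using K(3)[of x i n] sub[OF that] i by simp
    show "abs (p n i x - 0) <= P" using pP[OF n i sub[OF that]] by simp
    show "abs (2*u n x*h n i x) <= 2*U*abs (h n i x)" unfolding abs_mult using uU[OF sub[OF that], of n] by (intro mult_right_mono) auto
   qed
   have dh': "DERIV (h n i) x :> p n i x + R n i x" for x unfolding p_def by (rule dh[OF i])
   have U2: "2*U >= 0" and sJ: "s \<in> {s..s+w}" using U0 w by auto
   note hH = derivative_interpolation[OF w(1) dg[OF i] dh' dR[OF i] c4 c5 c6 U2 Uw sJ]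
   have sS: "s \<in> {-S..S+1}" using s by auto
   show "abs (g n i s) <= B" using K(3)[of s i n] s i B(1) by simp
   show hB: "abs (h n i s) <= B" using hH(1) B(2) unfolding H_def by linarith
   have 1: "abs (p n i s + R n i s) <= H'" using hH(2) unfolding H'_def H_def by simp
   thus "abs (p n i s + R n i s) <= B" using B(4) by linarith
   show "abs (R n i s) <= B" using 1 pP[OF n i sS] B(3) by linarith
   have "abs (2*u n s*h n i s) <= 2*U*H" unfolding abs_mult using uU[OF sS, of n] hH(1) U0 by (intro mult_mono) (auto simp: H_def)
   thus "abs (2*u n s*h n i s) <= B" using B(5) by linarith
  qed
 qed
 define y where "y = (%n (k :: nat, i :: nat) s. if i <= 2*m then (if k = 0 then g n i s else if k = 1 then h n i s else R n i s) else 0)"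
 define d where "d = (%n (k :: nat, i :: nat) s. if i <= 2*m then (if k = 0 then h n i s else if k = 1 then p n i s + R n i s else 2*u n s*h n i s) else 0)"
 have yd: "DERIV (y n z) s :> d n z s" for n z s
 proof -
  obtain k i where z: "z = (k, i)" by (cases z)
  show ?thesis using dg[of i n s] dh[of i n s] dR[of i n s] unfolding z
   by (cases "i <= 2*m"; cases "k = 0"; cases "k = 1") (simp_all add: y_def d_def p_def)
 qed
 have yb: "\<exists>B\<ge>0. \<exists>N. \<forall>n\<ge>N. \<forall>z. \<forall>s\<in>{-S..S}. abs (y n z s) <= B \<and> abs (d n z s) <= B" if S: "S >= 0" for S
 proof -
  obtain B N where BN: "B >= 0" "\<And>n i s. n >= N ==> i <= 2*m ==> s \<in> {-S..S} ==> abs (g n i s) <= B \<and> abs (h n i s) <= B \<and> abs (R n i s) <= B \<and> abs (p n i s + R n i s) <= B \<and> abs (2*u n s*h n i s) <= B"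
   using bounds[OF S] by blast
  show ?thesis
  proof (intro exI[of _ B] exI[of _ N] conjI BN(1) allI ballI impI)
   fix n z s assume n: "N <= n" and s: "s \<in> {-S..S}"
   show "abs (y n z s) <= B" using BN(1) BN(2)[OF n _ s, of "snd z"] by (cases z) (auto simp: y_def)
   show "abs (d n z s) <= B" using BN(1) BN(2)[OF n _ s, of "snd z"] by (cases z) (auto simp: d_def)
  qed
 qed
 obtain l Y where l: "strict_mono (l :: nat => nat)" and Y: "\<And>z s. (%n. y (l n) z s) \<longlonglongrightarrow> Y z s" and Yc: "\<And>z. continuous_on UNIV (Y z)"
 proof (rule Lipschitz_subsequence)
  fix S :: real assume S: "S >= 0"
  obtain B N where BN: "B >= 0" "\<And>n z s. n >= N ==> s \<in> {-S..S} ==> abs (y n z s) <= B \<and> abs (d n z s) <= B" using yb[OF S] by blast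
  have "abs (y n z s - y n z s') <= B*abs (s - s')" if "n >= N" "s \<in> {-S..S}" "s' \<in> {-S..S}" for n z s s'
   by (rule abs_diff_le_deriv[of "-S" S, OF yd _ that(2,3)]) (use BN(2)[OF that(1)] in auto)
  thus "\<exists>B\<ge>0. \<exists>N. \<forall>n\<ge>N. \<forall>z. \<forall>s\<in>{-S..S}. abs (y n z s) <= B \<and> (\<forall>s'\<in>{-S..S}. abs (y n z s - y n z s') <= B*abs (s - s'))"
   using BN by blast
 qed blast
 have ge: "l n >= n" for n using l by (rule strict_mono_imp_increasing)
 define g0 h0 R0 where "g0 = (%i. Y (0, i))" and "h0 = (%i. Y (1, i))" and "R0 = (%i. Y (2, i))"
 have lg: "(%n. g (l n) i s) \<longlonglongrightarrow> g0 i s" and lh: "(%n. h (l n) i s) \<longlonglongrightarrow> h0 i s" and lR: "(%n. R (l n) i s) \<longlonglongrightarrow> R0 i s" if "i <= 2*m" for i s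
  using Y[of "(0, i)" s] Y[of "(1, i)" s] Y[of "(2, i)" s] that by (simp_all add: y_def g0_def h0_def R0_def)
 have inv: "(%n. c/real (l n + 1)) \<longlonglongrightarrow> 0" for c :: real
 proof (rule real_tendsto_divide_at_top[OF tendsto_const])
  have "filterlim (%n. real n) at_top sequentially" by (rule filterlim_real_sequentially)
  thus "filterlim (%n. real (l n + 1)) at_top sequentially"
  proof (rule filterlim_at_top_mono, intro always_eventually allI)
   fix n show "real n <= real (l n + 1)" using ge[of n] by simp
  qed
 qed
 have le: "(%n. e (l n) s) \<longlonglongrightarrow> 0" for s
 proof -
  obtain K where K: "K >= 0" "\<And>n. abs (e n s) <= K/real (n + 1)"
   using bd[of "- s"] by auto
  show ?thesis by (rule Lim_null_comparison[OF always_eventually inv[of K]]) (use K(2) in simp)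
 qed
 have lf: "(%n. f (l n) s) \<longlonglongrightarrow> 0" for s
 proof (rule Lim_null_comparison[OF _ inv[of 4]])
  show "eventually (%n. norm (f (l n) s) <= 4/real (l n + 1)) sequentially"
   using eventually_ge_at_top[of "nat \<lceil>\<bar>s\<bar>\<rceil>"]
  proof eventually_elim
   case (elim n)
   hence "abs s <= real (l n)" using ge[of n] by linarith
   hence "s \<in> {- real (l n)..real (l n)}" by (auto simp: abs_le_iff)
   from f_small[OF this] show ?case by simp
  qed
 qed
 have lu: "(%n. u (l n) s) \<longlonglongrightarrow> usum g0 s" for s
 proof -
  have "(%n. s + 2*(\<Sum>j=1..2*m. real j*\<tau> j*g (l n) j s) + e (l n) s) \<longlonglongrightarrow> s + 2*(\<Sum>j=1..2*m. real j*\<tau> j*g0 j s) + 0"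
   by (intro tendsto_intros lg le) auto
  thus ?thesis by (simp add: u_eq usum_def)
 qed
 have gc: "continuous_on UNIV (g0 i)" "continuous_on UNIV (h0 i)" "continuous_on UNIV (R0 i)" for i by (simp_all add: g0_def h0_def R0_def Yc)
 have uc: "continuous_on UNIV (usum g0)" unfolding usum_def[abs_def] by (intro continuous_intros gc)
 have db: "\<exists>B N. \<forall>n\<ge>N. \<forall>s\<in>{-S..S}. abs (d (l n) z s) <= B" if "S >= 0" for S z
  using yb[OF that] ge by (meson le_trans)
 have "PXXXIV_solution m \<tau> g0 h0 R0"
 proof
  fix i s assume i: "i <= 2*m"
  show "DERIV (g0 i) s :> h0 i s"
  proof (rule pointwise_limit_derivative)
   show "DERIV (g (l n) i) s :> h (l n) i s" for n s by (rule dg[OF i])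
   show "\<exists>B N. \<forall>n\<ge>N. \<forall>s\<in>{-S..S}. abs (h (l n) i s) <= B" if "S >= 0" for S using db[OF that, of "(0, i)"] i by (simp add: d_def)
  qed (use lg[OF i] lh[OF i] gc in auto)
  have l1: "(%n. if i = 0 then f (l n) s else g (l n) (i - 1) s) \<longlonglongrightarrow> (if i = 0 then 0 else g0 (i - 1) s)" for s
   using lf lg[of "i - 1"] i by auto
  show "DERIV (h0 i) s :> 2*usum g0 s*g0 i s + 4*(if i = 0 then 0 else g0 (i - 1) s) + R0 i s"
  proof (rule pointwise_limit_derivative)
   show "DERIV (h (l n) i) s :> p (l n) i s + R (l n) i s" for n s using dh[OF i] by (simp add: p_def)
   show "\<exists>B N. \<forall>n\<ge>N. \<forall>s\<in>{-S..S}. abs (p (l n) i s + R (l n) i s) <= B" if "S >= 0" for S using db[OF that, of "(1, i)"] i by (simp add: d_def)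
   show "(%n. p (l n) i s + R (l n) i s) \<longlonglongrightarrow> 2*usum g0 s*g0 i s + 4*(if i = 0 then 0 else g0 (i - 1) s) + R0 i s" for s
    unfolding p_def by (intro tendsto_add tendsto_mult tendsto_const lu lg[OF i] lR[OF i] l1)
   show "continuous_on UNIV (%s. 2*usum g0 s*g0 i s + 4*(if i = 0 then 0 else g0 (i - 1) s) + R0 i s)"
    by (cases "i = 0") (auto intro!: continuous_intros gc uc)
  qed (use lh[OF i] in auto)
  show "DERIV (R0 i) s :> 2*usum g0 s*h0 i s"
  proof (rule pointwise_limit_derivative)
   show "DERIV (R (l n) i) s :> 2*u (l n) s*h (l n) i s" for n s by (rule dR[OF i])
   show "\<exists>B N. \<forall>n\<ge>N. \<forall>s\<in>{-S..S}. abs (2*u (l n) s*h (l n) i s) <= B" if "S >= 0" for S using db[OF that, of "(2, i)"] i by (simp add: d_def)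
   show "(%n. 2*u (l n) s*h (l n) i s) \<longlonglongrightarrow> 2*usum g0 s*h0 i s" for s by (intro tendsto_intros lu lh[OF i])
   show "continuous_on UNIV (%s. 2*usum g0 s*h0 i s)" by (intro continuous_intros gc uc)
  qed (use lR[OF i] in auto)
 next
  fix i assume i: "i <= 2*m"
  obtain C where C: "C >= 0" "\<And>s q. s >= 1 ==> q > 0 ==> eventually (%n. abs (g n i s - tgt i s) <= C * s powr (- tgt_exp i) + q) sequentially"
   using dec[OF i] by blast
  have "abs (g0 i s - tgt i s) <= C * s powr (- tgt_exp i)" if s: "s >= 1" for s
  proof (rule field_le_epsilon)
   fix q :: real assume "q > 0"
   from C(2)[OF s this] have "eventually (%n. abs (g (l n) i s - tgt i s) <= C * s powr (- tgt_exp i) + q) sequentially"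
    using filterlim_subseq[OF l] by (rule eventually_compose_filterlim)
   moreover have "(%n. abs (g (l n) i s - tgt i s)) \<longlonglongrightarrow> abs (g0 i s - tgt i s)" by (intro tendsto_intros lg[OF i])
   ultimately show "abs (g0 i s - tgt i s) <= C * s powr (- tgt_exp i) + q"
    by (intro tendsto_upperbound[of _ _ sequentially]) auto
  qed
  thus "\<exists>C\<ge>0. \<forall>s\<ge>1. abs (g0 i s - tgt i s) <= C * s powr (- tgt_exp i)" using C(1) by blast
 qed
 thus ?thesis by blast
qed

section \<open>First integrals and the coupled system\<close>

definition conv :: "(nat => real => real) => (nat => real => real) => nat => real => real" where
 "conv A B i s = (\<Sum>a=0..i. A a s*B (i - a) s)"

definition lshift :: "(nat => real => real) => nat => real => real" where
 "lshift A i s = (if i = 0 then 0 else A (i - 1) s)"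

text \<open>The generating series in \<lambda> at a fixed \<open>s\<close>. It turns identities
  between convolutions into ring identities, with \<open>lshift\<close> as multiplication by
  \<lambda>.\<close>

definition ser :: "(nat => real => real) => real => real fps" where "ser A s = Abs_fps (%i. A i s)"

lemma conv_ser: "conv A B i s = fps_nth (ser A s * ser B s) i"
 by (simp add: conv_def ser_def fps_mult_nth)

lemma ser_lshift: "ser (lshift A) s = fps_X * ser A s"
 by (rule fps_ext) (simp add: ser_def lshift_def)

lemma conv_deriv:
 assumes "\<And>a. a <= i ==> DERIV (A a) s :> A' a s" "\<And>a. a <= i ==> DERIV (B a) s :> B' a s"
 shows "DERIV (conv A B i) s :> conv A' B i s + conv A B' i s"
proof -
 have "DERIV (conv A B i) s :> (\<Sum>a=0..i. A' a s*B (i - a) s + B' (i - a) s*A a s)"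
  unfolding conv_def[abs_def] by (intro DERIV_sum DERIV_mult assms) auto
 thus ?thesis by (simp add: conv_def sum.distrib mult.commute)
qed

section \<open>First integrals of the limit system\<close>

context PXXXIV_solution
begin

abbreviation u :: "real => real" where "u \<equiv> usum g"

definition u' :: "real => real" where "u' s = 1 + 2*(\<Sum>j=1..2*m. real j*\<tau> j*h j s)"
definition pp :: "nat => real => real" where "pp i s = 2*u s*g i s + 4*lshift g i s"
text \<open>The second derivative of \<open>g i\<close>, kept as a sum of an explicit part and
  \<open>R i\<close>, as required by \<open>derivative_interpolation\<close>.\<close>

definition k :: "nat => real => real" where "k i s = pp i s + R i s"
definition k' :: "nat => real => real" where "k' i s = 4*u s*h i s + 2*u' s*g i s + 4*lshift h i s"

lemma u_deriv: "DERIV u s :> u' s"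
 unfolding usum_def[abs_def] u'_def by (intro DERIV_add DERIV_cmult DERIV_sum DERIV_ident g_deriv) auto

lemma h_deriv_k: "i <= 2*m ==> DERIV (h i) s :> k i s"
 using h_deriv[of i s] by (simp add: k_def pp_def lshift_def)

lemma shift_deriv: "i <= 2*m ==> DERIV (lshift g i) s :> lshift h i s"
 using g_deriv[of "i - 1" s] by (cases "i = 0") (auto simp: lshift_def[abs_def])

lemma k_deriv:
 assumes i: "i <= 2*m" shows "DERIV (k i) s :> k' i s"
proof -
 have "DERIV (k i) s :> ((2*u' s)*g i s + h i s*(2*u s)) + 4*lshift h i s + 2*u s*h i s"
  unfolding k_def[abs_def] pp_def by (intro DERIV_add DERIV_mult DERIV_cmult u_deriv g_deriv R_deriv shift_deriv i)
 thus ?thesis by (simp add: k'_def algebra_simps)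
qed

definition Q2 :: "nat => real => real" where
 "Q2 i s = 2*conv g k i s - conv h h i s - 4*u s*conv g g i s - 4*conv (lshift g) g i s"

lemma Q2_deriv:
 assumes i: "i <= 2*m"
 shows "DERIV (Q2 i) s :> 0"
proof -
 let ?c = "fps_const (u s)" let ?d = "fps_const (u' s)" let ?G = "ser g s" let ?H = "ser h s" let ?K = "ser k s"
 have "DERIV (Q2 i) s :> 2*(conv h k i s + conv g k' i s) - (conv k h i s + conv h k i s)
   - ((4*u' s)*conv g g i s + (conv h g i s + conv g h i s)*(4*u s)) - 4*(conv (lshift h) g i s + conv (lshift g) h i s)"
  unfolding Q2_def[abs_def]
  by (intro DERIV_diff DERIV_cmult DERIV_mult u_deriv conv_deriv g_deriv h_deriv_k k_deriv shift_deriv) (use i in auto)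
 moreover have "2*(conv h k i s + conv g k' i s) - (conv k h i s + conv h k i s)
   - ((4*u' s)*conv g g i s + (conv h g i s + conv g h i s)*(4*u s)) - 4*(conv (lshift h) g i s + conv (lshift g) h i s) = 0" (is "?L = 0")
 proof -
  let ?XG = "ser (lshift g) s" let ?XH = "ser (lshift h) s"
  have K': "ser k' s = 4*?c*?H + 2*?d*?G + 4*?XH"
   by (rule fps_ext) (simp add: ser_def k'_def numeral_fps_const mult.assoc)
  have X: "?XG*?H = ?XH*?G" by (simp add: ser_lshift mult_ac)
  have "?L = fps_nth (2*(?H*?K + ?G * ser k' s) - (?K*?H + ?H*?K) - (4*?d*(?G*?G) + 4*?c*(?H*?G + ?G*?H)) - 4*(?XH*?G + ?XG*?H)) i"
   by (simp add: conv_ser numeral_fps_const mult.assoc mult.commute[of ?H ?G] mult.commute[of ?H ?K])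
  also have "2*(?H*?K + ?G * ser k' s) - (?K*?H + ?H*?K) - (4*?d*(?G*?G) + 4*?c*(?H*?G + ?G*?H)) - 4*(?XH*?G + ?XG*?H) = 0"
   unfolding K' X by (simp add: algebra_simps)
  finally show ?thesis by simp
 qed
 ultimately show ?thesis by simp
qed

lemma Q2_const: "i <= 2*m ==> Q2 i s = Q2 i s'"
 using DERIV_isconst_all[of "Q2 i" s s'] Q2_deriv by blast

lemma decay_sqrt:
 obtains C where "C >= 1" "\<And>i s. i <= 2*m ==> s >= 1 ==> abs (g i s - (if i = 0 then 1 / sqrt s else 0)) <= C / sqrt s^3"
proof -
 have "\<exists>C\<ge>0. \<forall>s\<ge>1. abs (g i s - (if i = 0 then 1 / sqrt s else 0)) <= C / sqrt s^3" if i: "i <= 2*m" for i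
 proof -
  obtain C where C: "C >= 0" "\<And>s. s >= 1 ==> abs (g i s - tgt i s) <= C * s powr (- tgt_exp i)" using decay[OF i] by blast
  have "abs (g i s - (if i = 0 then 1 / sqrt s else 0)) <= (C + 1) / sqrt s^3" if s: "s >= 1" for s
  proof -
   have 3: "s powr (- (3/2)) = 1 / sqrt s^3"
   proof -
    have "s powr (3/2) = (s powr (1/2)) powr real 3" by (simp add: powr_powr)
    also have "... = sqrt s^3" using s by (subst powr_realpow) (auto simp: powr_half_sqrt)
    finally show ?thesis using powr_minus_divide[of s "3/2"] by simp
   qed
   have "s powr (- tgt_exp i) <= s powr (- (3/2))" using s by (intro powr_mono) (auto simp: tgt_exp_def)
   hence 1: "C * s powr (- tgt_exp i) <= C / sqrt s^3" using mult_left_mono[OF _ C(1)] unfolding 3 by fastforce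
   have 2: "abs (tgt i s - (if i = 0 then 1 / sqrt s else 0)) <= 1 / sqrt s^3"
   proof -
    have "s powr (- (1/2)) = 1 / sqrt s" using s powr_minus_divide[of s "1/2"] by (simp add: powr_half_sqrt)
    moreover define z where "z = 1 / sqrt s^3"
    moreover have "0 <= z" using s by (simp add: z_def)
    ultimately show ?thesis unfolding tgt_def 3 z_def[symmetric] by simp
   qed
   show ?thesis using C(2)[OF s] 1 2 unfolding add_divide_distrib by linarith
  qed
  thus ?thesis using C(1) by (intro exI[of _ "C + 1"]) auto
 qed
 then obtain C where C: "\<And>i. i <= 2*m ==> C i >= 0" "\<And>i s. i <= 2*m ==> s >= 1 ==> abs (g i s - (if i = 0 then 1 / sqrt s else 0)) <= C i / sqrt s^3"
  by metis
 define D where "D = 1 + (\<Sum>i\<le>2*m. C i)"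
 have D: "C i <= D" if "i <= 2*m" for i using member_le_sum[of i "{..2*m}" C] C(1) that unfolding D_def by force
 show thesis
 proof (rule that[of D])
  show "D >= 1" unfolding D_def using C(1) by (auto intro!: sum_nonneg)
  fix i :: nat and s :: real assume i: "i <= 2*m" and s: "s >= 1"
  have "C i / sqrt s^3 <= D / sqrt s^3" using D[OF i] s by (intro divide_right_mono) auto
  thus "abs (g i s - (if i = 0 then 1 / sqrt s else 0)) <= D / sqrt s^3" using C(2)[OF i s] by linarith
 qed
qed

text \<open>Interpolation on intervals of length of order \<open>1 / sqrt s\<close>, the natural
  scale of a Schroedinger equation whose potential grows like \<open>s\<close>. There
  \<open>g i\<close> varies by at most a multiple of \<open>1 / sqrt s^3\<close>, so its first
  derivative is of order \<open>1 / s\<close> and its second of order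
  \<open>1 / sqrt s\<close>.\<close>

lemma derivative_decay:
 "\<exists>B\<ge>0. \<forall>i\<le>2*m. \<forall>s\<ge>1. abs (h i s) <= B / sqrt s \<and> abs (k i s) <= B / sqrt s \<and> abs (u s - s) <= B"
proof -
 obtain C where C1: "C >= 1" and C: "\<And>i s. i <= 2*m ==> s >= 1 ==> abs (g i s - (if i = 0 then 1 / sqrt s else 0)) <= C / sqrt s^3"
  by (rule decay_sqrt) (rule that; assumption)
 define V where "V = 1 + 2*(\<Sum>j=1..2*m. abs (real j*\<tau> j)*C)"
 have V1: "V >= 1" unfolding V_def using C1 by (auto intro!: sum_nonneg mult_nonneg_nonneg)
 have g1: "abs (g j x) <= C" if "j \<in> {1..2*m}" "x >= 1" for j x
 proof -
  have "abs (g j x) <= C / sqrt x^3" using C[of j x] that by simp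
  also have "... <= C/1" using that C1 by (intro divide_left_mono one_le_power) auto
  finally show ?thesis by simp
 qed
 have uV: "abs (u x - x) <= V" if "x >= 1" for x
 proof -
  have "abs (\<Sum>j=1..2*m. real j*\<tau> j*g j x) <= (\<Sum>j=1..2*m. abs (real j*\<tau> j)*C)"
  proof (rule sum_abs_le)
   fix j assume "j \<in> {1..2*m}"
   thus "abs (real j*\<tau> j*g j x) <= abs (real j*\<tau> j)*C" unfolding abs_mult[of _ "g j x"] by (rule mult_left_mono[OF g1[OF _ that]]) simp
  qed
  thus ?thesis unfolding usum_def V_def by linarith
 qed
 define W where "W = 2 + V"
 define G where "G = C + 1"
 define P where "P = 2*W*G + 2*(2*V + 1) + 4*(C + 2)"
 \<comment> \<open>On intervals of length \<open>1/(c * sqrt s)\<close> and with the coefficient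
   \<open>2 * W * s\<close>, the absorption condition reads \<open>8*W/c^2 \<le> 1\<close>.\<close>
 define c where "c = 8*W"
 define H where "H = 84*G*c + 4*P"
 define K where "K = 36*G*c^2 + 2*(P + 2*W*H)"
 have pos: "W >= 1" "G >= 0" "P >= 0" "c >= 1" "H >= 0" "K >= 0"
  using V1 C1 by (auto simp: W_def G_def P_def c_def H_def K_def)
 have main: "abs (h i s) <= H / sqrt s \<and> abs (k i s) <= K / sqrt s" if i: "i <= 2*m" and s: "s >= 1" for i s
 proof -
  define r where "r = sqrt s"
  have r: "r >= 1" and rs: "r^2 = s" using s by (auto simp: r_def)
  define p where "p = 1/(c*r)"
  have cr: "c*r >= 1" using mult_mono[OF pos(4) r] pos(4) by simp
  have p: "p > 0" "p <= 1" using cr by (auto simp: p_def)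
  have xJ: "s <= x" "x <= s + 1" "1 <= x" if "x \<in> {s..s+p}" for x using that p s by auto
  let ?t = "%j. if j = 0 then 1/r else (0::real)"
  have G: "abs (g j x - ?t j) <= G/r^3" if "x \<in> {s..s+p}" "j <= 2*m" for x j
  proof -
   note x = xJ[OF that(1)]
   have rx: "r <= sqrt x" "sqrt x >= 1" using x by (auto simp: r_def)
   have "C / sqrt x^3 <= C/r^3" using rx r C1 by (intro divide_left_mono power_mono) auto
   hence 1: "abs (g j x - (if j = 0 then 1 / sqrt x else 0)) <= C/r^3" using C[OF that(2) x(3)] by linarith
   have "abs (1 / sqrt x - 1/r) <= 1/r^3"
   proof -
    have "(sqrt x - r)*(sqrt x + r) = x - s" using x s by (simp add: r_def algebra_simps)
    moreover have sr: "sqrt x + r > 0" using rx r by linarith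
    ultimately have f: "sqrt x - r = (x - s)/(sqrt x + r)" by (simp only: eq_divide_eq) simp
    have "1/r - 1 / sqrt x = (sqrt x - r)/(r * sqrt x)" using rx r by (simp add: field_simps)
    also have "... = (x - s)/(sqrt x + r)/(r * sqrt x)" by (simp only: f)
    also have "... <= (1/r)/(r*r)"
     using x rx r by (intro frac_le mult_mono) auto
    finally have "1/r - 1 / sqrt x <= 1/r^3" by (simp add: power3_eq_cube)
    moreover have "1 / sqrt x <= 1/r" using rx r by (intro divide_left_mono) auto
    ultimately show ?thesis by linarith
   qed
   thus ?thesis using 1 unfolding G_def add_divide_distrib by (cases "j = 0") auto
  qed
  have ub: "abs (u x) <= W*r^2" if "x \<in> {s..s+p}" for x
  proof -
   note x = xJ[OF that]
   have "abs (u x) <= s + 1 + V" using uV[OF x(3)] x s by linarith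
   also have "... <= W * s" using s V1 mult_left_mono[of 1 s V] unfolding W_def distrib_right by linarith
   finally show ?thesis by (simp add: rs)
  qed
  have uo: "abs (u x - u s) <= 2*V + 1" if "x \<in> {s..s+p}" for x
   using uV[of x] uV[OF s] xJ[OF that] by linarith
  have r3: "G/r^3 <= G/r" using pos r self_le_power[of r 3] by (intro divide_left_mono) auto
  have Pb: "abs (pp i x - 2*u s*?t i) <= P/r" if x: "x \<in> {s..s+p}" for x
  proof -
   have "abs (2*u x*(g i x - ?t i)) <= 2*(W*r^2)*(G/r^3)"
    unfolding abs_mult by (intro mult_mono) (use ub[OF x] G[OF x i] r pos in auto)
   also have "... = 2*W*G/r" using r by (simp add: power2_eq_square power3_eq_cube)
   finally have a: "abs (2*u x*(g i x - ?t i)) <= 2*W*G/r" .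
   have "abs (2*(u x - u s)*?t i) <= 2*(2*V + 1)*(1/r)"
    unfolding abs_mult using uo[OF x] r V1 by (intro mult_mono) auto
   hence b: "abs (2*(u x - u s)*?t i) <= 2*(2*V + 1)/r" by simp
   have "abs (lshift g i x) <= (C + 2)/r"
   proof (cases "i = 0")
    case False
    have "abs (g (i - 1) x - ?t (i - 1)) <= G/r^3" by (rule G[OF x]) (use i in simp)
    moreover have "abs (?t (i - 1)) <= 1/r" using r by simp
    ultimately have "abs (g (i - 1) x) <= G/r + 1/r" using r3 by linarith
    thus ?thesis using False by (simp add: lshift_def G_def add_divide_distrib[symmetric] add.commute)
   qed (use C1 r in \<open>simp add: lshift_def\<close>)
   hence d: "abs (4*lshift g i x) <= 4*((C + 2)/r)" by (simp only: abs_mult)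
   have "pp i x - 2*u s*?t i = 2*u x*(g i x - ?t i) + 2*(u x - u s)*?t i + 4*lshift g i x"
    unfolding pp_def by (simp add: algebra_simps)
   hence "abs (pp i x - 2*u s*?t i) = abs (2*u x*(g i x - ?t i) + 2*(u x - u s)*?t i + 4*lshift g i x)" by (simp only:)
   also have "... <= 2*W*G/r + 2*(2*V + 1)/r + 4*((C + 2)/r)"
    by (rule order_trans[OF abs_triangle_ineq add_mono[OF order_trans[OF abs_triangle_ineq add_mono[OF a b]] d]])
   also have "... = P/r" by (simp add: P_def add_divide_distrib)
   finally show ?thesis .
  qed
  have qb': "abs (2*u x*h i x) <= (2*W*r^2)*abs (h i x)" if "x \<in> {s..s+p}" for x
   unfolding abs_mult using ub[OF that] by (intro mult_right_mono) auto
  have U0: "0 <= 2*W*r^2" using pos by simp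
  have Up: "4*(2*W*r^2)*p^2 <= 1"
  proof -
   have "4*(2*W*r^2)*p^2 = c/c^2" using r by (simp add: p_def c_def power_divide power_mult_distrib)
   also have "... <= 1" using pos(4) by (simp add: power2_eq_square)
   finally show ?thesis .
  qed
  have hk: "DERIV (h i) x :> pp i x + R i x" for x using h_deriv_k[OF i] by (simp add: k_def)
  have sJ: "s \<in> {s..s+p}" using p by simp
  define Z where "Z = 84*(G/r^3)/p + 4*(P/r)*p"
  have Gi: "abs (g i x - ?t i) <= G/r^3" if "x \<in> {s..s+p}" for x by (rule G[OF that i])
  have D: "abs (h i s) <= Z" "abs (pp i s + R i s) <= 36*(G/r^3)/p^2 + 2*(P/r + 2*W*r^2*p*Z)"
   unfolding Z_def by (rule derivative_interpolation[OF p(1) g_deriv[OF i] hk R_deriv[OF i] Gi Pb qb' U0 Up sJ]; assumption)+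
  have "Z = 84*G*c/r^2 + 4*P/r^2/c"
   using r pos by (simp add: Z_def p_def power2_eq_square power3_eq_cube mult_ac)
  also have "4*P/r^2/c <= 4*P/r^2/1" using pos r by (intro divide_left_mono) auto
  finally have Hb: "Z <= H/r^2" by (simp add: H_def add_divide_distrib)
  have "H/r^2 <= H/r" using pos r self_le_power[of r 2] by (intro divide_left_mono) auto
  hence h: "abs (h i s) <= H/r" using D(1) Hb by linarith
  have "2*W*r^2*p*Z <= 2*W*r^2*p*(H/r^2)"
   using Hb pos p by (intro mult_left_mono) auto
  also have "... = 2*W*H/r/c" using r pos by (simp add: p_def power2_eq_square mult_ac)
  also have "... <= 2*W*H/r/1" using pos r by (intro divide_left_mono) auto
  finally have a: "2*W*r^2*p*Z <= 2*W*H/r" by simp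
  have b: "36*(G/r^3)/p^2 = 36*G*c^2/r" using r pos by (simp add: p_def power_divide power2_eq_square power3_eq_cube mult_ac)
  have "abs (pp i s + R i s) <= 36*G*c^2/r + 2*(P/r + 2*W*H/r)"
   by (rule order_trans[OF D(2)]) (unfold b, intro add_left_mono mult_left_mono a, simp)
  also have "... = K/r" by (simp add: K_def add_divide_distrib)
  finally show ?thesis using h by (simp add: k_def r_def)
 qed
 show ?thesis
 proof (intro exI[of _ "V + H + K"] conjI allI impI)
  show "0 <= V + H + K" using pos V1 by simp
  fix i s assume i: "i <= 2*m" and s: "(1::real) <= s"
  have "H / sqrt s <= (V + H + K) / sqrt s" "K / sqrt s <= (V + H + K) / sqrt s" using pos V1 s by (intro divide_right_mono; simp)+
  thus "abs (h i s) <= (V + H + K) / sqrt s" "abs (k i s) <= (V + H + K) / sqrt s" using main[OF i s] by linarith+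
  show "abs (u s - s) <= V + H + K" using uV[OF s] pos by linarith
 qed
qed

text \<open>Being constant in \<open>s\<close>, the quantity equals its limit at infinity. Every
  product tends to 0 except \<open>- 4 * u s * g 0 s * g 0 s\<close>, where \<open>u s / s\<close>
  and \<open>sqrt s * g 0 s\<close> tend to 1.\<close>

lemma Q2_value:
 assumes i: "i <= 2*m"
 shows "Q2 i s = (if i = 0 then -4 else 0)"
proof -
 obtain B where B: "B >= 0" "\<And>i s. i <= 2*m ==> s >= 1 ==> abs (h i s) <= B / sqrt s \<and> abs (k i s) <= B / sqrt s \<and> abs (u s - s) <= B"
  using derivative_decay by blast
 obtain C where C: "C >= 1" "\<And>i s. i <= 2*m ==> s >= 1 ==> abs (g i s - (if i = 0 then 1 / sqrt s else 0)) <= C / sqrt s^3"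
  by (rule decay_sqrt) (rule that; assumption)
 have sq: "filterlim sqrt at_top at_top" by (rule sqrt_at_top)
 have inv: "((%s. c / sqrt s) \<longlongrightarrow> 0) at_top" for c by (rule real_tendsto_divide_at_top[OF tendsto_const sq])
 have hl: "(h j \<longlongrightarrow> 0) at_top" and kl: "(k j \<longlongrightarrow> 0) at_top" if "j <= 2*m" for j
  using B(2)[OF that] by (auto intro!: Lim_null_comparison[OF _ inv[of B]] eventually_mono[OF eventually_ge_at_top[of 1]])
 have rl: "((%s. sqrt s*g j s) \<longlongrightarrow> (if j = 0 then 1 else 0)) at_top" if j: "j <= 2*m" for j
 proof -
  have "((%s. sqrt s*(g j s - (if j = 0 then 1 / sqrt s else 0))) \<longlongrightarrow> 0) at_top"
  proof (rule Lim_null_comparison[OF _ inv[of C]])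
   show "eventually (%s. norm (sqrt s*(g j s - (if j = 0 then 1 / sqrt s else 0))) <= C / sqrt s) at_top"
    using eventually_ge_at_top[of "1::real"]
   proof eventually_elim
    case (elim s)
    have "norm (sqrt s*(g j s - (if j = 0 then 1 / sqrt s else 0))) <= sqrt s*(C / sqrt s^3)"
     using C(2)[OF j elim] elim unfolding real_norm_def abs_mult by (intro mult_mono) auto
    also have "... = C / s" using elim by (simp add: power3_eq_cube)
    also have "... <= C / sqrt s"
    proof -
     have "sqrt s*1 <= sqrt s * sqrt s" using elim by (intro mult_left_mono) auto
     thus ?thesis using elim C(1) by (intro divide_left_mono) auto
    qed
    finally show ?case .
   qed
  qed
  hence "((%s. sqrt s*(g j s - (if j = 0 then 1 / sqrt s else 0)) + (if j = 0 then 1 else 0)) \<longlongrightarrow> 0 + (if j = 0 then 1 else 0)) at_top"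
   by (intro tendsto_intros)
  thus ?thesis unfolding add_0_left
  proof (rule Lim_transform_eventually)
   show "eventually (%s. sqrt s*(g j s - (if j = 0 then 1 / sqrt s else 0)) + (if j = 0 then 1 else 0) = sqrt s*g j s) at_top"
    using eventually_gt_at_top[of "0::real"] by eventually_elim (auto simp: right_diff_distrib)
  qed
 qed
 have gl: "(g j \<longlongrightarrow> 0) at_top" if j: "j <= 2*m" for j
 proof -
  have "((%s. 1 / sqrt s*(sqrt s*g j s)) \<longlongrightarrow> 0*(if j = 0 then 1 else 0)) at_top" by (intro tendsto_mult inv rl j)
  hence "((%s. 1 / sqrt s*(sqrt s*g j s)) \<longlongrightarrow> 0) at_top" by simp
  thus ?thesis
  proof (rule Lim_transform_eventually)
   show "eventually (%s. 1 / sqrt s*(sqrt s*g j s) = g j s) at_top"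
    using eventually_gt_at_top[of "0::real"] by eventually_elim auto
  qed
 qed
 have sl: "(lshift g j \<longlongrightarrow> 0) at_top" if j: "j <= 2*m" for j
  using gl[of "j - 1"] j by (cases "j = 0") (auto simp: lshift_def[abs_def])
 have ul: "((%s. u s / s) \<longlongrightarrow> 1) at_top"
 proof -
  have "((%s. (u s - s) / s) \<longlongrightarrow> 0) at_top"
  proof (rule Lim_null_comparison)
   show "eventually (%s. norm ((u s - s) / s) <= B / s) at_top"
    using eventually_ge_at_top[of "1::real"]
   proof eventually_elim
    case (elim s)
    thus ?case using B(2)[of 0 s] by (simp add: divide_right_mono)
   qed
   show "((%s. B / s) \<longlongrightarrow> 0) at_top" by (rule real_tendsto_divide_at_top[OF tendsto_const filterlim_ident])
  qed
  hence "((%s. (u s - s) / s + 1) \<longlongrightarrow> 0 + 1) at_top" by (intro tendsto_intros)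
  hence "((%s. (u s - s) / s + 1) \<longlongrightarrow> 1) at_top" by simp
  thus ?thesis
  proof (rule Lim_transform_eventually)
   show "eventually (%s. (u s - s) / s + 1 = u s / s) at_top"
    using eventually_gt_at_top[of "0::real"] by eventually_elim (simp add: field_simps)
  qed
 qed
 have cl: "(conv A A' i \<longlongrightarrow> (\<Sum>a=0..i. L a*L' (i - a))) at_top"
  if "\<And>a. a <= 2*m ==> (A a \<longlongrightarrow> L a) at_top" "\<And>a. a <= 2*m ==> (A' a \<longlongrightarrow> L' a) at_top" for A A' L L'
  unfolding conv_def[abs_def] using i by (intro tendsto_sum tendsto_mult that) auto
 \<comment> \<open>The growth of \<open>u\<close> is shared out: dividing it by \<open>s\<close> and
   multiplying each factor of the convolution by \<open>sqrt s\<close> leaves a product of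
   convergent factors.\<close>
 define Z where "Z = (%j (s::real). sqrt s*g j s)"
 have "((%s. 2*conv g k i s - conv h h i s - 4*(u s / s)*conv Z Z i s - 4*conv (lshift g) g i s) \<longlongrightarrow>
  2*(\<Sum>a=0..i. 0*0) - (\<Sum>a=0..i. 0*0) - 4*1*(\<Sum>a=0..i. (if a = 0 then 1 else 0)*(if i - a = 0 then 1 else 0)) - 4*(\<Sum>a=0..i. 0*0)) at_top"
  by (intro tendsto_diff tendsto_mult tendsto_const ul cl gl hl kl sl) (use rl in \<open>auto simp: Z_def\<close>)
 moreover have "eventually (%s. 2*conv g k i s - conv h h i s - 4*(u s / s)*conv Z Z i s - 4*conv (lshift g) g i s = Q2 i 0) at_top"
  using eventually_gt_at_top[of "0::real"]
 proof eventually_elim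
  case (elim s)
  have "conv Z Z i s = s*conv g g i s" unfolding conv_def sum_distrib_left Z_def using elim
   by (intro sum.cong) (auto simp: algebra_simps)
  hence "2*conv g k i s - conv h h i s - 4*(u s / s)*conv Z Z i s - 4*conv (lshift g) g i s = Q2 i s" using elim by (simp add: Q2_def)
  thus ?case using Q2_const[OF i] by simp
 qed
 ultimately have "((%s. Q2 i 0) \<longlongrightarrow>
  2*(\<Sum>a=0..i. 0*0) - (\<Sum>a=0..i. 0*0) - 4*1*(\<Sum>a=0..i. (if a = 0 then 1 else 0)*(if i - a = 0 then 1 else 0)) - 4*(\<Sum>a=0..i. 0*0)) (at_top :: real filter)"
  by (rule Lim_transform_eventually)
 hence "Q2 i 0 = - 4*(\<Sum>a=0..i. (if a = 0 then 1 else 0)*(if i - a = 0 then 1 else 0))"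
  by (subst (asm) tendsto_const_iff) auto
 also have "(\<Sum>a=0..i. (if a = 0 then 1 else 0)*(if i - a = 0 then 1 else 0)) = (\<Sum>a=0..i. if a = 0 then (if i = 0 then 1 else 0) else (0::real))"
  by (intro sum.cong) auto
 also have "... = (if i = 0 then 1 else 0)" by simp
 finally show ?thesis using Q2_const[OF i, of s 0] by simp
qed


text \<open>Coefficients of the polynomial multiplier. They are chosen so that the coefficient of
  order \<open>2*m\<close> of the product with \<open>g\<close> is half of \<open>u s - s\<close>,
  and so that the square of the polynomial has the numbers \<open>tau_tilde\<close> as
  coefficients.\<close>

definition tc :: "nat => real" where "tc j = real (2*m - j)*\<tau> (2*m - j)"

abbreviation dressed :: "(nat => real => real) => nat => real => real" where "dressed \<equiv> conv (%a s. tc a)"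

text \<open>The coefficient of order \<open>2*m + 1 - l\<close> of the multiplied series. Reversing
  the order turns multiplication by \<lambda> into the step from \<open>b l\<close> to
  \<open>b (l + 1)\<close>, and the convention above \<open>2*m + 1\<close> matches the missing
  constant term of the shifted series.\<close>

definition b :: "nat => real => real" where "b l s = (if l > 2*m + 1 then 0 else dressed g (2*m + 1 - l) s)"

lemma dressed_deriv:
 assumes "\<And>a. a <= i ==> DERIV (B a) s :> B' a s"
 shows "DERIV (dressed B i) s :> dressed B' i s"
 using conv_deriv[of i "%a s. tc a" "%a s. 0" s B B'] assms by (simp add: conv_def)

lemma b_derivs:
 assumes l: "1 <= l" "l <= 2*m + 1"
 shows "deriv (b l) s = dressed h (2*m + 1 - l) s" "deriv (deriv (b l)) s = dressed k (2*m + 1 - l) s"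
proof -
 have b: "b l = dressed g (2*m + 1 - l)" using l by (auto simp: b_def fun_eq_iff)
 have "deriv (b l) s = dressed h (2*m + 1 - l) s" for s
  unfolding b by (intro DERIV_imp_deriv dressed_deriv g_deriv) (use l in auto)
 hence d: "deriv (b l) = dressed h (2*m + 1 - l)" by (rule ext)
 thus "deriv (b l) s = dressed h (2*m + 1 - l) s" by simp
 show "deriv (deriv (b l)) s = dressed k (2*m + 1 - l) s"
  unfolding d by (intro DERIV_imp_deriv dressed_deriv h_deriv_k) (use l in auto)
qed

lemma b_1: "b 1 s = (\<Sum>j=1..2*m. real j*\<tau> j*g j s)"
proof -
 have "b 1 s = (\<Sum>a=0..2*m. real (2*m - a)*\<tau> (2*m - a)*g (2*m - a) s)" by (simp add: b_def conv_def tc_def)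
 also have "... = (\<Sum>j=0..2*m. real j*\<tau> j*g j s)"
  by (rule sum.reindex_bij_witness[of _ "%j. 2*m - j" "%j. 2*m - j"]) auto
 also have "... = (\<Sum>j=1..2*m. real j*\<tau> j*g j s)" by (simp add: sum.atLeast_Suc_atMost[of 0])
 finally show ?thesis .
qed

lemma reindex_system:
 assumes p: "2*m + 2 <= p" "p <= 4*m + 2"
 shows "(\<Sum>l = p - 2*m - 1..2*m + 1. F l (p - l)) = (\<Sum>i=0..4*m + 2 - p. F (2*m + 1 - i) (2*m + 1 - (4*m + 2 - p - i)) :: real)"
 by (rule sum.reindex_bij_witness[of _ "%i. 2*m + 1 - i" "%l. 2*m + 1 - l"]) (use p in \<open>auto intro!: arg_cong2[of _ _ _ _ F]\<close>)

text \<open>The first integral is quadratic in \<open>g\<close> and the multiplier does not depend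
  on \<open>s\<close>, so the expression is multiplied by the square of the multiplier. Up to order
  \<open>2*m\<close> the first integral is the constant series -4.\<close>

lemma dressed_system:
 assumes q: "q <= 2*m"
 shows "2*conv (dressed k) (dressed g) q s - conv (dressed h) (dressed h) q s - 4*u s*conv (dressed g) (dressed g) q s
  - 4*conv (lshift (dressed g)) (dressed g) q s = - 4*(\<Sum>a=0..q. tc a*tc (q - a))"
proof -
 let ?c = "fps_const (u s)" let ?G = "ser g s" let ?H = "ser h s" let ?K = "ser k s" let ?T = "ser (%a s. tc a) s"
 have d: "ser (dressed A) s = ?T * ser A s" for A by (rule fps_ext) (simp add: ser_def conv_ser)
 let ?Q = "2*(?G*?K) - ?H*?H - 4*?c*(?G*?G) - 4*(fps_X*?G*?G)"
 have Q: "fps_nth ?Q j = (if j = 0 then - 4 else 0)" if "j <= 2*m" for j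
 proof -
  have "fps_nth ?Q j = Q2 j s"
   unfolding Q2_def conv_ser ser_lshift by (simp add: numeral_fps_const mult.assoc del: fps_X_mult_nth fps_X_mult_right_nth)
  thus ?thesis using Q2_value[OF that] by simp
 qed
 have "2*conv (dressed k) (dressed g) q s - conv (dressed h) (dressed h) q s - 4*u s*conv (dressed g) (dressed g) q s
  - 4*conv (lshift (dressed g)) (dressed g) q s
  = fps_nth (2*(?T*?K*(?T*?G)) - ?T*?H*(?T*?H) - 4*?c*(?T*?G*(?T*?G)) - 4*(fps_X*(?T*?G)*(?T*?G))) q"
  unfolding conv_ser ser_lshift d by (simp add: numeral_fps_const mult.assoc del: fps_X_mult_nth fps_X_mult_right_nth)
 also have "2*(?T*?K*(?T*?G)) - ?T*?H*(?T*?H) - 4*?c*(?T*?G*(?T*?G)) - 4*(fps_X*(?T*?G)*(?T*?G)) = (?T*?T)*?Q"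
  by (simp add: algebra_simps)
 also have "fps_nth ((?T*?T)*?Q) q = (\<Sum>a=0..q. fps_nth (?T*?T) a*(if q - a = 0 then - 4 else 0))"
  unfolding fps_mult_nth[of "?T*?T"] using q by (intro sum.cong refl arg_cong2[of _ _ _ _ "(*)"] Q) auto
 also have "... = (\<Sum>a=0..q. if a = q then - 4*fps_nth (?T*?T) q else 0)" by (intro sum.cong) auto
 also have "... = - 4*fps_nth (?T*?T) q" by simp
 also have "fps_nth (?T*?T) q = (\<Sum>a=0..q. tc a*tc (q - a))" by (simp add: fps_mult_nth ser_def)
 finally show ?thesis .
qed

lemma coupled: "coupled_PXXXIV m \<tau> b"
 unfolding coupled_PXXXIV_def
proof (intro conjI allI impI ballI)
 show "b l s = 0" if "l > 2*m + 1" for l s using that by (simp add: b_def)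
 fix p s assume "p \<in> {2*m + 2..4*m + 2}"
 hence p: "2*m + 2 <= p" "p <= 4*m + 2" by auto
 \<comment> \<open>The equation with index \<open>p\<close> is the coefficient of order
   \<open>q\<close>; the range of \<open>p\<close> corresponds to the orders up to
   \<open>2*m\<close>, in which the first integral is known.\<close>
 define q where "q = 4*m + 2 - p"
 have q: "q <= 2*m" using p by (simp add: q_def)
 let ?n = "2*m + 1"
 have us: "2*b 1 s + s = u s" unfolding b_1 usum_def by simp
 have tt: "tau_tilde m \<tau> p = (\<Sum>a=0..q. tc a*tc (q - a))"
  unfolding tau_tilde_def reindex_system[OF p, of "%l l'. real (l - 1)*real (p - l - 1)*\<tau> (l - 1)*\<tau> (p - l - 1)"] q_def[symmetric]
 proof (rule sum.cong)
  fix a assume "a \<in> {0..q}"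
  hence "?n - a - 1 = 2*m - a" "p - (?n - a) - 1 = 2*m - (q - a)" using p unfolding q_def by auto
  thus "real (?n - a - 1)*real (p - (?n - a) - 1)*\<tau> (?n - a - 1)*\<tau> (p - (?n - a) - 1) = tc a*tc (q - a)"
   by (simp only: tc_def mult_ac)
 qed simp
 have "(\<Sum>l = p - 2*m - 1..2*m + 1. b (p - l) s*deriv (deriv (b l)) s - 1/2*deriv (b l) s*deriv (b (p - l)) s
   - 2*(2*b 1 s + s)*b (p - l) s*b l s - 2*b (p - l) s*b (l + 1) s)
  = (\<Sum>i=0..q. dressed g (q - i) s*dressed k i s - 1/2*dressed h i s*dressed h (q - i) s
   - 2*u s*dressed g (q - i) s*dressed g i s - 2*dressed g (q - i) s*lshift (dressed g) i s)"
  unfolding us reindex_system[OF p, of "%l l'. b l' s*deriv (deriv (b l)) s - 1/2*deriv (b l) s*deriv (b l') s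
   - 2*u s*b l' s*b l s - 2*b l' s*b (l + 1) s"] q_def[symmetric]
 proof (rule sum.cong)
  fix i assume i: "i \<in> {0..q}"
  have e: "?n - (?n - i) = i" "?n - (?n - (q - i)) = q - i" using i q by auto
  have l: "1 <= ?n - i" "?n - i <= ?n" "1 <= ?n - (q - i)" "?n - (q - i) <= ?n" using i q by auto
  have "b (?n - i) s = dressed g i s" "b (?n - (q - i)) s = dressed g (q - i) s" using l e by (auto simp: b_def)
  moreover have "b (?n - i + 1) s = lshift (dressed g) i s"
  proof (cases "i = 0")
   case False
   have "?n - (?n - i + 1) = i - 1" "\<not> ?n - i + 1 > ?n" using i q False by auto
   thus ?thesis using False by (simp add: b_def lshift_def)
  qed (simp add: b_def lshift_def)
  ultimately show "b (?n - (q - i)) s*deriv (deriv (b (?n - i))) s - 1/2*deriv (b (?n - i)) s*deriv (b (?n - (q - i))) s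
   - 2*u s*b (?n - (q - i)) s*b (?n - i) s - 2*b (?n - (q - i)) s*b (?n - i + 1) s
   = dressed g (q - i) s*dressed k i s - 1/2*dressed h i s*dressed h (q - i) s
   - 2*u s*dressed g (q - i) s*dressed g i s - 2*dressed g (q - i) s*lshift (dressed g) i s"
   by (simp only: b_derivs[OF l(1,2)] b_derivs[OF l(3,4)] e)
 qed simp
 also have "... = 1/2*(2*conv (dressed k) (dressed g) q s - conv (dressed h) (dressed h) q s - 4*u s*conv (dressed g) (dressed g) q s
  - 4*conv (lshift (dressed g)) (dressed g) q s)"
  unfolding conv_def[of "dressed k"] conv_def[of "dressed h"] conv_def[of "dressed g"] conv_def[of "lshift (dressed g)"]
   sum_distrib_left sum_subtractf[symmetric]
  by (intro sum.cong) (simp_all add: algebra_simps)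
 also have "... = - 2*tau_tilde m \<tau> p" unfolding dressed_system[OF q] tt by simp
 finally show "(\<Sum>l = p - 2*m - 1..2*m + 1. b (p - l) s*deriv (deriv (b l)) s - 1/2*deriv (b l) s*deriv (b (p - l)) s
   - 2*(2*b 1 s + s)*b (p - l) s*b l s - 2*b (p - l) s*b (l + 1) s) + 2*tau_tilde m \<tau> p = 0" by simp
qed

lemma b_1_asymp: "(%s. b 1 s - (- \<tau> 1/(2 * s powr (3/2)))) \<in> O[at_top](%s. s powr (- 5/2))"
proof -
 have "\<forall>j\<in>{1..2*m}. \<exists>C\<ge>0. \<forall>s\<ge>1. abs (g j s - tgt j s) <= C * s powr (- 5/2)"
 proof
  fix j assume j: "j \<in> {1..2*m}"
  hence te: "tgt_exp j = 5/2" by (simp add: tgt_exp_def)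
  show "\<exists>C\<ge>0. \<forall>s\<ge>1. abs (g j s - tgt j s) <= C * s powr (- 5/2)" using decay[of j] j by (simp add: te)
 qed
 then obtain C where C: "\<And>j s. j \<in> {1..2*m} ==> s >= 1 ==> abs (g j s - tgt j s) <= C j * s powr (- 5/2)"
  by metis
 have e: "b 1 s - (- \<tau> 1/(2 * s powr (3/2))) = (\<Sum>j=1..2*m. real j*\<tau> j*(g j s - tgt j s))" for s
 proof -
  have "(\<Sum>j=1..2*m. real j*\<tau> j*tgt j s) = (\<Sum>j=1..2*m. if j = 1 then \<tau> 1*tgt 1 s else 0)"
   by (intro sum.cong) (auto simp: tgt_def)
  also have "... = \<tau> 1*tgt 1 s" using m by simp
  also have "... = - \<tau> 1/(2 * s powr (3/2))" using powr_minus_divide[of s "3/2"] by (simp add: tgt_def)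
  finally show ?thesis unfolding b_1 right_diff_distrib sum_subtractf by simp
 qed
 show ?thesis
  unfolding e
 proof (rule bigoI[of _ "\<Sum>j=1..2*m. abs (real j*\<tau> j)*C j"])
  show "eventually (%s. norm (\<Sum>j=1..2*m. real j*\<tau> j*(g j s - tgt j s)) <= (\<Sum>j=1..2*m. abs (real j*\<tau> j)*C j)*norm (s powr (- 5/2))) at_top"
   using eventually_ge_at_top[of "1::real"]
  proof eventually_elim
   case (elim s)
   have "abs (\<Sum>j=1..2*m. real j*\<tau> j*(g j s - tgt j s)) <= (\<Sum>j=1..2*m. abs (real j*\<tau> j)*(C j * s powr (- 5/2)))"
    by (rule sum_abs_le) (unfold abs_mult[of _ "g _ s - tgt _ s"], rule mult_left_mono[OF C[OF _ elim]], auto)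
   thus ?case by (simp add: sum_distrib_right mult.assoc)
  qed
 qed
qed

end

section \<open>Real analyticity\<close>

lemma DERIV_sum_list:
 fixes f :: "'t => real => real"
 assumes "\<And>t. t \<in> set xs ==> DERIV (f t) s :> f' t"
 shows "DERIV (%s. \<Sum>t\<leftarrow>xs. f t s) s :> (\<Sum>t\<leftarrow>xs. f' t)"
 using assms by (induction xs) (auto intro!: derivative_eq_intros)

lemma abs_sum_list_le:
 fixes f :: "'t => real"
 assumes "\<And>t. t \<in> set xs ==> abs (f t) <= g t"
 shows "abs (\<Sum>t\<leftarrow>xs. f t) <= (\<Sum>t\<leftarrow>xs. g t)"
 using assms
proof (induction xs)
 case (Cons x xs)
 have "abs (f x) <= g x" "abs (\<Sum>t\<leftarrow>xs. f t) <= (\<Sum>t\<leftarrow>xs. g t)" using Cons by auto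
 thus ?case unfolding list.map sum_list.Cons by (intro order_trans[OF abs_triangle_ineq] add_mono)
qed simp

lemma Cauchy_product_Leibniz:
 fixes x y :: "nat => real"
 shows "(\<Sum>j=0..n. real (Suc j)*x (Suc j)*y (n - j) + real (Suc (n - j))*y (Suc (n - j))*x j)
  = real (Suc n)*(\<Sum>j=0..Suc n. x j*y (Suc n - j))"
proof -
 have "(\<Sum>j=0..n. real (Suc j)*x (Suc j)*y (n - j) + real (Suc (n - j))*y (Suc (n - j))*x j)
  = fps_nth (Abs_fps x*fps_deriv (Abs_fps y) + fps_deriv (Abs_fps x)*Abs_fps y) n"
  unfolding fps_add_nth fps_mult_nth sum.distrib[symmetric] by (intro sum.cong) (simp_all add: mult_ac)
 also have "... = fps_nth (fps_deriv (Abs_fps x*Abs_fps y)) n" by (simp only: fps_deriv_mult)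
 also have "... = real (Suc n)*(\<Sum>j=0..Suc n. x j*y (Suc n - j))" by (simp only: fps_deriv_nth fps_mult_nth fps_nth_Abs_fps Suc_eq_plus1)
 finally show ?thesis .
qed

section \<open>Taylor series of solutions of quadratic systems\<close>

context
 fixes Y :: "'k => real => real" and T :: "'k => (real \<times> 'k \<times> 'k) list"
begin

text \<open>Taylor coefficients at \<open>s\<close> of the component \<open>a\<close>, by comparison
  of coefficients in a system whose right-hand sides are sums of constants times products of two
  components; \<open>T a\<close> lists the constants with the two indices.\<close>

fun tayl :: "nat => 'k => real => real" where
 "tayl 0 a s = Y a s"
| "tayl (Suc n) a s = (\<Sum>t\<leftarrow>T a. fst t*(\<Sum>j=0..n. tayl j (fst (snd t)) s*tayl (n - j) (snd (snd t)) s))/real (Suc n)"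

lemma tayl_deriv:
 assumes ode: "\<And>a s. DERIV (Y a) s :> (\<Sum>t\<leftarrow>T a. fst t*(Y (fst (snd t)) s*Y (snd (snd t)) s))"
 shows "DERIV (tayl n a) s :> real (Suc n)*tayl (Suc n) a s"
proof (induction n arbitrary: a rule: less_induct)
 case (less n)
 show ?case
 proof (cases n)
  case 0
  thus ?thesis using ode[of a s] by simp
 next
  case (Suc n')
  have "((%s. \<Sum>j=0..n'. tayl j b s*tayl (n' - j) c s) has_real_derivative
    real (Suc n')*(\<Sum>j=0..Suc n'. tayl j b s*tayl (Suc n' - j) c s)) (at s)" for b c
   unfolding Cauchy_product_Leibniz[of "%j. tayl j b s" "%j. tayl j c s" n', symmetric]
   by (intro DERIV_sum DERIV_mult less.IH) (use Suc in auto)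
  hence "(tayl n a has_real_derivative
    (\<Sum>t\<leftarrow>T a. fst t*(real (Suc n')*(\<Sum>j=0..Suc n'. tayl j (fst (snd t)) s*tayl (Suc n' - j) (snd (snd t)) s)))/real (Suc n')) (at s)"
   unfolding Suc tayl.simps(2)[abs_def] by (intro DERIV_cdivide DERIV_sum_list DERIV_cmult)
  moreover have "(\<Sum>t\<leftarrow>T a. fst t*(real (Suc n')*(\<Sum>j=0..Suc n'. tayl j (fst (snd t)) s*tayl (Suc n' - j) (snd (snd t)) s)))/real (Suc n')
   = (\<Sum>t\<leftarrow>T a. fst t*(\<Sum>j=0..Suc n'. tayl j (fst (snd t)) s*tayl (Suc n' - j) (snd (snd t)) s))"
   by (simp add: mult.left_commute[of _ "real (Suc n')"] sum_list_const_mult del: of_nat_Suc sum.cl_ivl_Suc tayl.simps)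
  ultimately show ?thesis unfolding Suc tayl.simps(2)[of "Suc n'" a s] by (simp del: of_nat_Suc tayl.simps sum.cl_ivl_Suc)
 qed
qed

text \<open>The geometric majorant reproduces itself under the recursion: each of the
  \<open>n + 1\<close> terms of the Cauchy product has the same bound, and their number cancels the
  division by \<open>n + 1\<close>.\<close>

lemma tayl_bound:
 assumes M: "\<And>a. abs (Y a s) <= M" and q: "\<And>a. (\<Sum>t\<leftarrow>T a. abs (fst t)) <= q" and "M >= 0"
 shows "abs (tayl n a s) <= M*(q*M)^n"
proof (induction n arbitrary: a rule: less_induct)
 case (less n)
 show ?case
 proof (cases n)
  case 0 thus ?thesis using M by simp
 next
  case (Suc n')
  have q0: "q >= 0" using order_trans[OF sum_list_nonneg q[of a]] by fastforce
  have b: "abs (\<Sum>j=0..n'. tayl j b s*tayl (n' - j) c s) <= real (Suc n')*(M*M*(q*M)^n')" for b c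
  proof -
   have "abs (\<Sum>j=0..n'. tayl j b s*tayl (n' - j) c s) <= (\<Sum>j=0..n'. M*M*(q*M)^n')"
   proof (rule sum_abs_le)
    fix j assume j: "j \<in> {0..n'}"
    have "abs (tayl j b s*tayl (n' - j) c s) <= (M*(q*M)^j)*(M*(q*M)^(n' - j))"
     unfolding abs_mult using j Suc \<open>M \<ge> 0\<close> q0 by (intro mult_mono less.IH) auto
    also have "... = M*M*(q*M)^n'" using j by (simp add: power_add[symmetric] mult_ac)
    finally show "abs (tayl j b s*tayl (n' - j) c s) <= M*M*(q*M)^n'" .
   qed
   thus ?thesis by simp
  qed
  have "abs (\<Sum>t\<leftarrow>T a. fst t*(\<Sum>j=0..n'. tayl j (fst (snd t)) s*tayl (n' - j) (snd (snd t)) s)) <= (\<Sum>t\<leftarrow>T a. abs (fst t)*(real (Suc n')*(M*M*(q*M)^n')))"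
   by (rule abs_sum_list_le) (unfold abs_mult, intro mult_left_mono b, simp)
  also have "... = (\<Sum>t\<leftarrow>T a. abs (fst t))*(real (Suc n')*(M*M*(q*M)^n'))" by (rule sum_list_mult_const)
  also have "... <= q*(real (Suc n')*(M*M*(q*M)^n'))" using q[of a] \<open>M \<ge> 0\<close> q0 by (intro mult_right_mono) auto
  finally have "abs (\<Sum>t\<leftarrow>T a. fst t*(\<Sum>j=0..n'. tayl j (fst (snd t)) s*tayl (n' - j) (snd (snd t)) s))/real (Suc n') <= q*(real (Suc n')*(M*M*(q*M)^n'))/real (Suc n')"
   by (intro divide_right_mono) auto
  also have "... = M*(q*M)^n" by (simp add: Suc mult_ac del: of_nat_Suc)
  finally show ?thesis by (simp add: Suc del: of_nat_Suc)
 qed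
qed

text \<open>The Lagrange remainder of order \<open>N\<close> is a Taylor coefficient at an
  intermediate point times \<open>x^N\<close>. Since the system is finite, the components have a
  common bound on a slightly larger interval, and the radius is uniform in the centre.\<close>

lemma tayl_sums:
 assumes ode: "\<And>a s. DERIV (Y a) s :> (\<Sum>t\<leftarrow>T a. fst t*(Y (fst (snd t)) s*Y (snd (snd t)) s))"
  and I: "finite I" "\<And>a s. a \<notin> I ==> T a = [] \<and> Y a s = 0"
 shows "\<exists>r>0. \<forall>s\<in>{-S..S}. \<forall>x. abs x < r --> (%n. tayl n a s*x^n) sums Y a (s + x)"
proof -
 have "\<exists>B. \<forall>s\<in>{-S-1..S+1}. abs (Y a s) <= B" for a
  using continuous_on_bounded_ex[of "-S-1" "S+1" "Y a"] ode by (meson DERIV_isCont continuous_at_imp_continuous_on)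
 then obtain B where B: "\<And>a s. s \<in> {-S-1..S+1} ==> abs (Y a s) <= B a" by metis
 define M where "M = (\<Sum>a\<in>I. abs (B a))"
 define q where "q = (\<Sum>a\<in>I. \<Sum>t\<leftarrow>T a. abs (fst t))"
 have n0: "0 <= (\<Sum>t\<leftarrow>T a. abs (fst t))" for a by (rule sum_list_nonneg) auto
 have M0: "M >= 0" and q0: "q >= 0" unfolding M_def q_def using n0 by (auto intro: sum_nonneg)
 have M: "abs (Y a s) <= M" if "s \<in> {-S-1..S+1}" for a s
 proof (cases "a \<in> I")
  case True
  have "abs (B a) <= M" unfolding M_def using True I(1) by (intro member_le_sum) auto
  thus ?thesis using B[OF that, of a] by linarith
 qed (use I(2)[of a s] M0 in simp)
 have q: "(\<Sum>t\<leftarrow>T a. abs (fst t)) <= q" for a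
 proof (cases "a \<in> I")
  case True
  thus ?thesis unfolding q_def using I(1) n0 by (intro member_le_sum) auto
 qed (use I(2)[of a 0] q0 in simp)
 \<comment> \<open>Ensures \<open>q*M*r \<le> 1/2\<close>, so that the remainders decrease
   geometrically, and \<open>r \<le> 1\<close>, so that intermediate points stay in
   \<open>{-S-1..S+1}\<close>.\<close>
 define r where "r = 1/(2*(q*M + 1))"
 have qM: "q*M >= 0" using q0 M0 by simp
 have r: "r > 0" "r <= 1" "q*M*r <= 1/2" using qM by (auto simp: r_def field_simps)
 have "(%n. tayl n a s*x^n) sums Y a (s + x)" if s: "s \<in> {-S..S}" and x: "abs x < r" for s x
 proof (cases "x = 0")
  case True
  thus ?thesis using sums_0[of "%_. 0"] powser_sums_zero[of "%n. tayl n a s"] by simp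
 next
  case False
  have rem: "abs (Y a (s + x) - (\<Sum>n<N. tayl n a s*x^n)) <= M*(1/2)^N" if N: "N > 0" for N
  proof -
   have d: "\<forall>m t. m < N \<and> min s (s + x) <= t \<and> t <= max s (s + x) --> DERIV (%s. fact m*tayl m a s) t :> fact (Suc m)*tayl (Suc m) a t"
    using DERIV_cmult[OF tayl_deriv[OF ode]] by (simp add: mult_ac)
   have "\<exists>t. (if s + x < s then s + x < t \<and> t < s else s < t \<and> t < s + x) \<and>
    Y a (s + x) = (\<Sum>m<N. (fact m*tayl m a s)/fact m*(s + x - s)^m) + (fact N*tayl N a t)/fact N*(s + x - s)^N"
    by (rule Taylor[of N "%m s. fact m*tayl m a s" "Y a" "min s (s + x)" "max s (s + x)" s "s + x", OF N _ d]) (use False in auto)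
   then obtain t where t: "if s + x < s then s + x < t \<and> t < s else s < t \<and> t < s + x"
    and e: "Y a (s + x) = (\<Sum>m<N. tayl m a s*x^m) + tayl N a t*x^N" by auto
   have tS: "t \<in> {-S-1..S+1}" using t s x r by (auto split: if_splits)
   have "abs (tayl N a t*x^N) <= (M*(q*M)^N)*r^N"
    unfolding abs_mult power_abs by (intro mult_mono tayl_bound M[OF tS] q M0 power_mono) (use x qM M0 r in auto)
   also have "... = M*(q*M*r)^N" by (simp add: power_mult_distrib)
   also have "... <= M*(1/2)^N" using r qM M0 by (intro mult_left_mono power_mono) auto
   finally show ?thesis using e by simp
  qed
  have "(%N. Y a (s + x) - (\<Sum>n<N. tayl n a s*x^n)) \<longlonglongrightarrow> 0"
  proof (rule Lim_null_comparison)
   show "eventually (%N. norm (Y a (s + x) - (\<Sum>n<N. tayl n a s*x^n)) <= M*(1/2)^N) sequentially"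
    using eventually_gt_at_top[of 0] by eventually_elim (use rem in auto)
   have "(%N. M*(1/2)^N) \<longlonglongrightarrow> M*0" by (intro tendsto_intros LIMSEQ_power_zero) auto
   thus "(%N. M*(1/2)^N) \<longlonglongrightarrow> 0" by simp
  qed
  hence "(%N. Y a (s + x) - (Y a (s + x) - (\<Sum>n<N. tayl n a s*x^n))) \<longlonglongrightarrow> Y a (s + x) - 0" by (intro tendsto_intros)
  thus ?thesis by (simp add: sums_def)
 qed
 thus ?thesis using r(1) by blast
qed

end

text \<open>The local complex extensions, one power series at each real centre, agree on overlaps by the identity theorem;
 the global extension uses at \<open>z\<close> the series centred at \<open>Re z\<close>.\<close>

lemma pole_free_of_power_series:
 assumes c: "\<And>S. \<exists>r>0. \<forall>s\<in>{-S..S}. \<forall>x. abs x < r --> (%n. c n s*x^n) sums f (s + x)"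
 shows "pole_free_on_reals f"
proof -
 define G where "G = (%s z. \<Sum>n. complex_of_real (c n s)*(z - of_real s)^n)"
 define F where "F = (%z. G (Re z) z)"
 have G: "G s holomorphic_on ball (of_real s) r" "\<And>y. abs (y - s) < r ==> G s (of_real y) = of_real (f y)"
  if r: "\<And>x. abs x < r ==> (%n. c n s*x^n) sums f (s + x)" for s r
 proof -
  show "G s holomorphic_on ball (of_real s) r"
  proof (rule power_series_holomorphic)
   fix w assume "w \<in> ball (complex_of_real s) r"
   hence w: "norm (w - of_real s) < r" by (simp add: dist_norm norm_minus_commute)
   obtain p where p: "norm (w - of_real s) < p" "p < r" using dense[OF w] by blast
   have "0 < p" using p(1) norm_ge_zero[of "w - of_real s"] by linarith
   hence "(%n. c n s*p^n) sums f (s + p)" using p(2) by (intro r) simp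
   hence "summable (%n. complex_of_real (c n s*p^n))" by (intro summable_of_real sums_summable)
   hence "summable (%n. complex_of_real (c n s)*(of_real p)^n)" by simp
   hence "summable (%n. complex_of_real (c n s)*(w - of_real s)^n)"
    by (rule powser_inside) (use p \<open>0 < p\<close> in simp)
   thus "(%n. complex_of_real (c n s)*(w - of_real s)^n) sums G s w" unfolding G_def by (rule summable_sums)
  qed
  fix y assume "abs (y - s) < r"
  hence "(%n. complex_of_real (c n s*(y - s)^n)) sums of_real (f (s + (y - s)))" by (intro sums_of_real r)
  thus "G s (of_real y) = of_real (f y)" unfolding G_def by (simp add: sums_iff)
 qed
 \<comment> \<open>The series converge on radius \<open>2*p0\<close>, while the ball has radius
   \<open>p0\<close>: it then lies in the disc of every real centre closer than \<open>p0\<close> to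
   \<open>s0\<close>. The bound \<open>p0 \<le> 1\<close> keeps such centres in the interval on
   which the radius is uniform.\<close>
 have "F holomorphic_on ball (of_real s0) p \<and> F (of_real s0) = of_real (f s0)" if "p = p0" "p0 > 0 \<and> (\<forall>s\<in>{-(abs s0+1)..abs s0+1}. \<forall>x. abs x < 2*p0 --> (%n. c n s*x^n) sums f (s + x)) \<and> p0 <= 1" for s0 p p0
 proof
  have p: "p > 0" "p <= 1" and r: "\<And>s x. s \<in> {-(abs s0+1)..abs s0+1} ==> abs x < 2*p ==> (%n. c n s*x^n) sums f (s + x)" using that by auto
  have s0: "s0 \<in> {-(abs s0+1)..abs s0+1}" by auto
  show "F (of_real s0) = of_real (f s0)" unfolding F_def using G(2)[of "2*p" s0 s0, OF r[OF s0]] p by simp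
  have h0: "G s0 holomorphic_on ball (of_real s0) p"
   by (rule holomorphic_on_subset[OF G(1)[OF r[OF s0]]]) (use p in \<open>auto simp: subset_ball\<close>)
  have "G s0 z = F z" if z: "z \<in> ball (of_real s0) p" for z
  proof -
   define x where "x = Re z"
   have "abs (x - s0) <= norm (z - of_real s0)" using abs_Re_le_cmod[of "z - of_real s0"] by (simp add: x_def)
   hence xs: "abs (x - s0) < p" using z by (simp add: dist_norm norm_minus_commute)
   have xI: "x \<in> {-(abs s0+1)..abs s0+1}" using xs p(2) by auto
   have sub: "ball (of_real s0) p \<subseteq> ball (complex_of_real x) (2*p)"
   proof
    fix w assume "w \<in> ball (complex_of_real s0) p"
    moreover have "dist (complex_of_real x) (of_real s0) < p" using xs by (simp add: dist_norm flip: of_real_diff)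
    ultimately show "w \<in> ball (complex_of_real x) (2*p)" using dist_triangle[of "complex_of_real x" w "of_real s0"] by simp
   qed
   have hx: "G x holomorphic_on ball (of_real s0) p" by (rule holomorphic_on_subset[OF G(1)[OF r[OF xI]] sub])
   have "G s0 z - G x z = 0"
   proof (rule analytic_continuation[of "%z. G s0 z - G x z" "ball (of_real s0) p" "complex_of_real ` {s0..<s0 + p}" "of_real s0"])
    show "(%z. G s0 z - G x z) holomorphic_on ball (of_real s0) p" by (intro holomorphic_intros h0 hx)
    show "complex_of_real ` {s0..<s0 + p} \<subseteq> ball (of_real s0) p" by (auto simp: dist_norm simp flip: of_real_diff)
    show "complex_of_real s0 islimpt complex_of_real ` {s0..<s0 + p}"
     unfolding islimpt_approachable
    proof (intro allI impI)
     fix e :: real assume e: "e > 0"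
     let ?y = "s0 + min e p/2"
     show "\<exists>x'\<in>complex_of_real ` {s0..<s0 + p}. x' ~= of_real s0 \<and> dist x' (of_real s0) < e"
     proof (intro bexI[of _ "complex_of_real ?y"] conjI)
      show "complex_of_real ?y ~= of_real s0" using e p by auto
      have "dist (complex_of_real ?y) (of_real s0) = abs (?y - s0)" by (simp only: dist_of_real dist_real_def)
      thus "dist (complex_of_real ?y) (of_real s0) < e" using e p by auto
      show "complex_of_real ?y \<in> complex_of_real ` {s0..<s0 + p}" using e p by (intro imageI) auto
     qed
    qed
    fix w assume "w \<in> complex_of_real ` {s0..<s0 + p}"
    then obtain y where y: "w = of_real y" "s0 <= y" "y < s0 + p" by auto
    have "G s0 w = of_real (f y)" "G x w = of_real (f y)"
     unfolding y(1) using y xs p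
     by (auto intro!: G(2)[of "2*p" s0, OF r[OF s0]] G(2)[of "2*p" x, OF r[OF xI]])
    thus "G s0 w - G x w = 0" by simp
   qed (use z p in auto)
   thus ?thesis by (simp add: F_def x_def)
  qed
  thus "F holomorphic_on ball (of_real s0) p" using h0 by (rule holomorphic_transform[rotated])
 qed
 moreover have "\<exists>p. p > 0 \<and> (\<forall>s\<in>{-(abs s0+1)..abs s0+1}. \<forall>x. abs x < 2*p --> (%n. c n s*x^n) sums f (s + x)) \<and> p <= 1" for s0
 proof -
  obtain r where r: "r > 0" "\<forall>s\<in>{-(abs s0+1)..abs s0+1}. \<forall>x. abs x < r --> (%n. c n s*x^n) sums f (s + x)" using c[of "abs s0+1"] by blast
  thus ?thesis by (intro exI[of _ "min r 2/2"]) auto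
 qed
 ultimately have "\<exists>p>0. F holomorphic_on ball (of_real s0) p \<and> F (of_real s0) = of_real (f s0)" for s0 by blast
 thus ?thesis unfolding pole_free_on_reals_def analytic_on_def
  by (intro exI[of _ F]) (metis Reals_cases)
qed

lemma pole_free_linear_combination:
 assumes "\<And>a. a \<in> A ==> pole_free_on_reals (f a)"
 shows "pole_free_on_reals (%s. \<Sum>a\<in>A. t a*f a s)"
proof -
 obtain F where F: "\<And>a. a \<in> A ==> F a analytic_on \<real>" "\<And>a s. a \<in> A ==> F a (of_real s) = of_real (f a s)"
  using assms unfolding pole_free_on_reals_def by metis
 show ?thesis unfolding pole_free_on_reals_def
  by (intro exI[of _ "%z. \<Sum>a\<in>A. of_real (t a)*F a z"] conjI analytic_on_sum analytic_on_mult analytic_on_const F) (simp_all add: F)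
qed

section \<open>Pole-freeness of the solution\<close>

context PXXXIV_solution
begin

text \<open>The functions \<open>g i\<close>, \<open>h i\<close>, \<open>R i\<close>, \<open>s\<close> and \<open>1\<close> form a quadratic system; \<open>TY\<close> lists the monomials of its right-hand sides.\<close>

definition YY :: "nat \<times> nat => real => real" where
 "YY a s = (if snd a > 2*m then 0 else
  if fst a = 0 then g (snd a) s else if fst a = 1 then h (snd a) s else if fst a = 2 then R (snd a) s else
  if fst a = 3 then s else if fst a = 4 then 1 else 0)"

definition TY :: "nat \<times> nat => (real \<times> (nat \<times> nat) \<times> (nat \<times> nat)) list" where
 "TY a = (let i = snd a; S = (3, 0); E = (4, 0) in if i > 2*m then [] else
  if fst a = 0 then [(1, (1, i), E)] else
  if fst a = 1 then [(2, S, (0, i)), (if i = 0 then 0 else 4, (0, i - 1), E), (1, (2, i), E)]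
   @ map (%j. (4*real j*\<tau> j, (0, j), (0, i))) [1..<2*m + 1] else
  if fst a = 2 then (2, S, (1, i)) # map (%j. (4*real j*\<tau> j, (0, j), (1, i))) [1..<2*m + 1] else
  if fst a = 3 then [(1, E, E)] else [])"

lemma YY_ode: "DERIV (YY a) s :> (\<Sum>t\<leftarrow>TY a. fst t*(YY (fst (snd t)) s*YY (snd (snd t)) s))"
proof -
 obtain c i where a: "a = (c, i)" by (cases a)
 have us: "(\<Sum>j\<leftarrow>[1..<2*m+1]. 4*real j*\<tau> j*(YY (0, j) s*z)) = (2*u s - 2 * s)*z" for z
 proof -
  have "(\<Sum>j\<leftarrow>[1..<2*m+1]. 4*real j*\<tau> j*(YY (0, j) s*z)) = (\<Sum>j=1..2*m. 4*real j*\<tau> j*(YY (0, j) s*z))"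
   unfolding sum_list_distinct_conv_sum_set[OF distinct_upt] by (rule sum.cong) auto
  also have "... = (\<Sum>j=1..2*m. 4*(real j*\<tau> j*g j s)*z)" by (rule sum.cong) (auto simp: YY_def)
  also have "... = (2*u s - 2 * s)*z" by (simp add: usum_def sum_distrib_right sum_distrib_left mult_ac)
  finally show ?thesis .
 qed
 have Y: "j <= 2*m ==> YY (0, j) s = g j s" "j <= 2*m ==> YY (Suc 0, j) s = h j s" "j <= 2*m ==> YY (2, j) s = R j s"
  "YY (3, 0) s = s" "YY (4, 0) s = 1" for j by (simp_all add: YY_def)
 show ?thesis
 proof (cases "i <= 2*m")
  case i: True
  consider "c = 0" | "c = 1" | "c = 2" | "c = 3" | "c = 4" | "c > 4" by linarith
  thus ?thesis
  proof cases
   case 1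
   hence "YY a = g i" using i a by (auto simp: YY_def fun_eq_iff)
   thus ?thesis using g_deriv[OF i, of s] 1 i a by (simp add: TY_def Let_def Y)
  next
   case 2
   hence "YY a = h i" using i a by (auto simp: YY_def fun_eq_iff)
   moreover have "(\<Sum>t\<leftarrow>TY a. fst t*(YY (fst (snd t)) s*YY (snd (snd t)) s))
    = 2*(s*g i s) + (if i = 0 then 0 else 4*g (i - 1) s) + R i s + (\<Sum>j\<leftarrow>[1..<2*m+1]. 4*real j*\<tau> j*(YY (0, j) s*g i s))"
    using 2 i a by (simp add: TY_def Let_def Y o_def del: upt_Suc)
   ultimately show ?thesis unfolding us using h_deriv[OF i, of s] by (simp add: algebra_simps split: if_splits)
  next
   case 3
   hence "YY a = R i" using i a by (auto simp: YY_def fun_eq_iff)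
   moreover have "(\<Sum>t\<leftarrow>TY a. fst t*(YY (fst (snd t)) s*YY (snd (snd t)) s))
    = 2*(s*h i s) + (\<Sum>j\<leftarrow>[1..<2*m+1]. 4*real j*\<tau> j*(YY (0, j) s*h i s))"
    using 3 i a by (simp add: TY_def Let_def Y o_def del: upt_Suc)
   ultimately show ?thesis unfolding us using R_deriv[OF i, of s] by (simp add: algebra_simps)
  next
   case 4
   hence "YY a = (%s. s)" using i a by (auto simp: YY_def fun_eq_iff)
   thus ?thesis using 4 i a by (simp add: TY_def Let_def Y)
  next
   case 5
   hence "YY a = (%s. 1)" using i a by (auto simp: YY_def fun_eq_iff)
   thus ?thesis using 5 i a by (simp add: TY_def)
  next
   case 6
   hence "YY a = (%s. 0)" using a by (auto simp: YY_def fun_eq_iff)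
   thus ?thesis using 6 i a by (simp add: TY_def)
  qed
 next
  case False
  hence "YY a = (%s. 0)" using a by (auto simp: YY_def fun_eq_iff)
  thus ?thesis using False a by (simp add: TY_def)
 qed
qed

lemma g_pole_free: "i <= 2*m ==> pole_free_on_reals (g i)"
proof -
 assume i: "i <= 2*m"
 have "pole_free_on_reals (YY (0, i))"
 proof (rule pole_free_of_power_series[OF tayl_sums[OF YY_ode]])
  show "finite ({..4::nat} \<times> {..2*m})" by simp
  show "TY a = [] \<and> YY a s = 0" if "a \<notin> {..4} \<times> {..2*m}" for a s
   using that by (cases a) (auto simp: TY_def YY_def)
 qed
 moreover have "YY (0, i) = g i" using i by (auto simp: YY_def fun_eq_iff)
 ultimately show ?thesis by simp
qed

lemma b_pole_free:
 assumes "l \<in> {1..2*m + 1}"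
 shows "pole_free_on_reals (b l)"
proof -
 have "b l = (%s. \<Sum>a=0..2*m + 1 - l. tc a*g (2*m + 1 - l - a) s)"
  using assms by (auto simp: b_def conv_def fun_eq_iff)
 thus ?thesis using assms by (simp only:) (intro pole_free_linear_combination g_pole_free, auto)
qed

end

theorem theorem2p1:
  fixes m :: nat and \<tau> :: "nat \<Rightarrow> real"
  assumes "m \<ge> 1"
    and "\<tau> (2 * m) > 0"
  shows "\<exists>b :: nat \<Rightarrow> real \<Rightarrow> real.
           (\<forall>k \<in> {1..2 * m + 1}. pole_free_on_reals (b k)) \<and>
           coupled_PXXXIV m \<tau> b \<and>
           (\<lambda>s. b 1 s - (- \<tau> 1 / (2 * s powr (3 / 2)))) \<in> O[at_top](\<lambda>s. s powr (- 5 / 2))"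
proof -
  interpret tau_data m \<tau> using assms by unfold_locales
  obtain g h R where "PXXXIV_solution m \<tau> g h R" using approximants approximating.limit_system by blast
  then interpret PXXXIV_solution m \<tau> g h R .
  show ?thesis using b_pole_free coupled b_1_asymp by blast
qed

end
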